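(* Let $(\mathbb B,\|\cdot\|_{\mathbb B})$ be a real separable 2-smooth Banach space with a Schauder basis. Let $(X_i)_{i\in\mathbb Z}$ be an ergodic stationary sequence of centered $\mathbb B$-valued random variables, adapted to a non-decreasing and stationary filtration $(\mathcal F_i)_{i\in\mathbb Z}$, and such that $\mathbb E(\|X_0\|_{\mathbb B}^2)<\infty$. Set $S_n=\sum_{k=1}^n X_k$ and assume that the sequence $$\big(\|X_0\|_{\mathbb B}\,\mathbb E(S_n\mid\mathcal F_0)\big)_{n\ge 1}\quad\text{converges in } \mathbb L^1_{\mathbb B}.$$ Then $\big(\tfrac1{\sqrt n}S_n\big)_{n\ge1}$ converges in distribution (in $\mathbb B$) to $G$, where $G$ is a Gaussian $\mathbb B$-valued random variable whose covariance operator is given by $$K_G(x^*,y^* )=\sum_{k\in\mathbb Z}\operatorname{cov}\big(x^*(X_0),y^*(X_k)\big)\qquad\text{for any }x^*,y^*\in\mathbb B^*.$$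
   Context: All random variables are defined on a probability space $(\Omega,\mathcal F,\mathbb P)$. 2-smooth: let $\psi_2(x)=\|x\|_{\mathbb B}^2$. The separable Banach space $\mathbb B$ is called 2-smooth if there exists $d>0$ such that for all $x,u\in\mathbb B$: (i) if $x\neq0$, $D^2\psi_2(x)(u,u)\le d^2\|u\|_{\mathbb B}^2$; (ii) $|D\psi_2(x)(u)-D\psi_2(0)(u)|\le d^2\|x\|_{\mathbb B}\|u\|_{\mathbb B}$, where $D\psi_2(x)$, $D^2\psi_2(x)$ are the first and second order Fréchet derivatives of $\psi_2$ at $x$ (assumed to exist wherever they appear). Schauder basis: a family $\{x_n:n\in\mathbb N\}\subset\mathbb B$ such that every $x\in\mathbb B$ is the norm limit of a unique series $\sum_{n\ge 0} a_nx_n$ with $a_n=a_n(x)\in\mathbb R$. $\mathbb L^1_{\mathbb B}$ is the space of (Bochner) integrable $\mathbb B$-valued random variables $Z$ with norm $\mathbb E\|Z\|_{\mathbb B}$; conditional expectations are Bochner conditional expectations. $\mathbb B^*$ is the topological dual of $\mathbb B$. "Stationary sequence adapted to a stationary filtration" has the usual meaning: there is a bijective bimeasurable measure-preserving map $T:\Omega\to\Omega$ with $X_i=X_0\circ T^i$ and $\mathcal F_i=T^{-i}(\mathcal F_0)$, with $X_0$ being $\mathcal F_0$-measurable; non-decreasing means $\mathcal F_i\subset\mathcal F_{i+1}$. "Ergodic" means that the shift-invariant $\sigma$-field of the sequence $(X_i)_{i\in\mathbb Z}$ is trivial. Gaussian random variables here are centered, with covariance operator $K_G(x^*,y^* )=\operatorname{cov}(x^*(G),y^*(G))$.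 *)

theory Defs
  imports "HOL-Probability.Probability"
begin

section \<open>Geometry of the Banach space\<close>

text \<open>Frechet derivatives are unique, so the derivatives can be given as existential
  witnesses. The second derivative is that of the map \<open>D1\<close> into the dual space, hence takes
  values in the bounded linear maps from \<open>'b\<close> to the dual.\<close>

definition two_smooth :: "'b::real_normed_vector itself \<Rightarrow> bool" where
  "two_smooth (T :: 'b itself) \<longleftrightarrow>
     (\<exists>d>0. \<exists>(D1 :: 'b \<Rightarrow> 'b \<Rightarrow>\<^sub>L real) (D2 :: 'b \<Rightarrow> 'b \<Rightarrow>\<^sub>L ('b \<Rightarrow>\<^sub>L real)).
        (\<forall>x. ((\<lambda>y. (norm y)\<^sup>2) has_derivative blinfun_apply (D1 x)) (at x)) \<and>
        (\<forall>x. x \<noteq> 0 \<longrightarrow> (D1 has_derivative blinfun_apply (D2 x)) (at x)) \<and>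
        (\<forall>x u. x \<noteq> 0 \<longrightarrow> blinfun_apply (blinfun_apply (D2 x) u) u \<le> d\<^sup>2 * (norm u)\<^sup>2) \<and>
        (\<forall>x u. \<bar>blinfun_apply (D1 x) u - blinfun_apply (D1 0) u\<bar> \<le> d\<^sup>2 * norm x * norm u))"

definition schauder_basis :: "(nat \<Rightarrow> 'b::real_normed_vector) \<Rightarrow> bool" where
  "schauder_basis e \<longleftrightarrow> (\<forall>x. \<exists>!a :: nat \<Rightarrow> real. (\<lambda>n. a n *\<^sub>R e n) sums x)"

section \<open>Stationary processes and filtrations\<close>

definition bimeasurable_mp :: "'a measure \<Rightarrow> ('a \<Rightarrow> 'a) \<Rightarrow> bool" where
  "bimeasurable_mp M T \<longleftrightarrow>
     bij_betw T (space M) (space M) \<and> T \<in> measurable M M \<and>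
     inv_into (space M) T \<in> measurable M M \<and> distr M M T = M"

definition int_iterate :: "'a measure \<Rightarrow> ('a \<Rightarrow> 'a) \<Rightarrow> int \<Rightarrow> 'a \<Rightarrow> 'a" where
  "int_iterate M T i =
     (if 0 \<le> i then T ^^ nat i else inv_into (space M) T ^^ nat (- i))"

definition stationary_process ::
  "'a measure \<Rightarrow> ('a \<Rightarrow> 'a) \<Rightarrow> (int \<Rightarrow> 'a \<Rightarrow> 'b) \<Rightarrow> bool" where
  "stationary_process M T X \<longleftrightarrow>
     (\<forall>i. \<forall>\<omega>\<in>space M. X i \<omega> = X 0 (int_iterate M T i \<omega>))"

definition stationary_filtration ::
  "'a measure \<Rightarrow> ('a \<Rightarrow> 'a) \<Rightarrow> (int \<Rightarrow> 'a measure) \<Rightarrow> bool" where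
  "stationary_filtration M T F \<longleftrightarrow>
     (\<forall>i. subalgebra M (F i)) \<and>
     (\<forall>i. sets (F i) = {int_iterate M T i -` A \<inter> space M | A. A \<in> sets (F 0)}) \<and>
     (\<forall>i. sets (F i) \<subseteq> sets (F (i + 1)))"

text \<open>The shift-invariant sigma-field of the sequence consists of the events
  \<open>{(X\<^sub>i)\<^sub>i \<in> B}\<close>, where \<open>B\<close> is a shift-invariant set in the product sigma-field.\<close>

definition ergodic_process :: "'a measure \<Rightarrow> (int \<Rightarrow> 'a \<Rightarrow> 'b::topological_space) \<Rightarrow> bool" where
  "ergodic_process M X \<longleftrightarrow>
     (\<forall>B \<in> sets (\<Pi>\<^sub>M i\<in>(UNIV :: int set). (borel :: 'b measure)).
        (\<lambda>x i. x (i + 1)) -` B = B \<longrightarrow>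
        measure M {\<omega> \<in> space M. (\<lambda>i. X i \<omega>) \<in> B} \<in> {0, 1})"

definition partial_sum :: "(int \<Rightarrow> 'a \<Rightarrow> 'b::real_normed_vector) \<Rightarrow> nat \<Rightarrow> 'a \<Rightarrow> 'b" where
  "partial_sum X n \<omega> = (\<Sum>k=1..n. X (int k) \<omega>)"

section \<open>Bochner conditional expectation and convergence in \<open>L\<^sup>1\<close>\<close>

definition is_bochner_cond_exp ::
  "'a measure \<Rightarrow> 'a measure \<Rightarrow> ('a \<Rightarrow> 'b::{banach, second_countable_topology}) \<Rightarrow> ('a \<Rightarrow> 'b) \<Rightarrow> bool" where
  "is_bochner_cond_exp M F f g \<longleftrightarrow>
     g \<in> borel_measurable F \<and> integrable M g \<and>
     (\<forall>A\<in>sets F. set_lebesgue_integral M A g = set_lebesgue_integral M A f)"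

text \<open>For integrable \<open>f\<close> on a probability space and a sub-sigma-field \<open>F\<close>, a version exists and is
  almost surely unique; the choice below picks one version.\<close>

definition bochner_cond_exp ::
  "'a measure \<Rightarrow> 'a measure \<Rightarrow> ('a \<Rightarrow> 'b::{banach, second_countable_topology}) \<Rightarrow> 'a \<Rightarrow> 'b" where
  "bochner_cond_exp M F f = (SOME g. is_bochner_cond_exp M F f g)"

definition converges_in_L1 ::
  "'a measure \<Rightarrow> (nat \<Rightarrow> 'a \<Rightarrow> 'b::{banach, second_countable_topology}) \<Rightarrow> bool" where
  "converges_in_L1 M Y \<longleftrightarrow>
     (\<forall>n. integrable M (Y n)) \<and>
     (\<exists>Z. integrable M Z \<and> (\<lambda>n. \<integral>\<omega>. norm (Y n \<omega> - Z \<omega>) \<partial>M) \<longlonglongrightarrow> 0)"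

section \<open>Covariances, Gaussian variables and convergence in distribution\<close>

definition covariance :: "'a measure \<Rightarrow> ('a \<Rightarrow> real) \<Rightarrow> ('a \<Rightarrow> real) \<Rightarrow> real" where
  "covariance M U V =
     (\<integral>\<omega>. (U \<omega> - (\<integral>\<omega>'. U \<omega>' \<partial>M)) * (V \<omega> - (\<integral>\<omega>'. V \<omega>' \<partial>M)) \<partial>M)"

definition cov_operator ::
  "'a measure \<Rightarrow> ('a \<Rightarrow> 'b::real_normed_vector) \<Rightarrow> ('b \<Rightarrow>\<^sub>L real) \<Rightarrow> ('b \<Rightarrow>\<^sub>L real) \<Rightarrow> real" where
  "cov_operator M G x y =
     covariance M (\<lambda>\<omega>. blinfun_apply x (G \<omega>)) (\<lambda>\<omega>. blinfun_apply y (G \<omega>))"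

text \<open>Point masses at 0 count as (degenerate) centered normal laws; \<open>normal_density\<close> does not
  cover them.\<close>

definition centered_gaussian :: "'a measure \<Rightarrow> ('a \<Rightarrow> 'b::real_normed_vector) \<Rightarrow> bool" where
  "centered_gaussian M G \<longleftrightarrow>
     G \<in> borel_measurable M \<and>
     (\<forall>x :: 'b \<Rightarrow>\<^sub>L real.
        (AE \<omega> in M. blinfun_apply x (G \<omega>) = 0) \<or>
        (\<exists>\<sigma>>0. distributed M lborel (\<lambda>\<omega>. blinfun_apply x (G \<omega>))
                  (\<lambda>t. ennreal (normal_density 0 \<sigma> t))))"

text \<open>The limit may live on a different probability space.\<close>

definition converges_in_distribution ::
  "'a measure \<Rightarrow> (nat \<Rightarrow> 'a \<Rightarrow> 'b::topological_space) \<Rightarrow> 'c measure \<Rightarrow> ('c \<Rightarrow> 'b) \<Rightarrow> bool" where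
  "converges_in_distribution M Y N G \<longleftrightarrow>
     (\<forall>n. Y n \<in> borel_measurable M) \<and> G \<in> borel_measurable N \<and>
     (\<forall>f :: 'b \<Rightarrow> real. continuous_on UNIV f \<and> bounded (range f) \<longrightarrow>
        (\<lambda>n. \<integral>\<omega>. f (Y n \<omega>) \<partial>M) \<longlonglongrightarrow> (\<integral>\<omega>. f (G \<omega>) \<partial>N))"

text \<open>A series over the integers, with both one-sided series required to converge (possibly only
  conditionally); this is stronger than convergence of the symmetric partial sums.\<close>

definition int_sums :: "(int \<Rightarrow> real) \<Rightarrow> real \<Rightarrow> bool" where
  "int_sums c s \<longleftrightarrow>
     (\<exists>a b. (\<lambda>n. c (int n)) sums a \<and> (\<lambda>n. c (- int (Suc n))) sums b \<and> s = a + b)"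

end

theory Submission
  imports Defs
begin

text \<open>Write \<open>S\<^sub>n\<close> for the partial sums. Functions \<open>\<Phi>(S\<^sub>k)\<close> are expanded by summation by parts: the sum of
  \<open>\<Phi>(S\<^sub>k\<^sub>-\<^sub>1) X\<^sub>k\<close> over \<open>k \<le> n\<close> is the sum of \<open>(\<Phi>(S\<^sub>l) - \<Phi>(S\<^sub>l\<^sub>-\<^sub>1)) (S\<^sub>n - S\<^sub>l)\<close>. Stationarity moves the \<open>l\<close>-th term
  back to time 0, where the increment of a Lipschitz \<open>\<Phi>\<close> is \<open>F 0\<close>-measurable and at most a multiple
  of \<open>norm (X 0)\<close>; the term is then controlled by the L1 norm of \<open>norm (X 0)\<close> times the conditional
  expectation of \<open>S\<^sub>n\<^sub>-\<^sub>l\<close>.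

  With \<open>\<Phi>\<close> the derivative of the squared norm, composed with the remainder projections of the
  Schauder basis, this bounds the second moments of the normalised remainders, uniformly in \<open>n\<close> and
  arbitrarily small because an L1-convergent sequence is relatively compact. With \<open>\<Phi>\<close> a character,
  it gives for \<open>a\<^sub>K\<close>, the characteristic function at time \<open>K\<close> of the sums normalised by the square
  root of \<open>n\<close>, the equation \<open>a\<^sub>K = 1 - (\<kappa>/n) (a\<^sub>0 + \<dots> + a\<^sub>K\<^sub>-\<^sub>1) + o(1)\<close> uniformly in \<open>K \<le> n\<close>, once the
  products \<open>X\<^sub>l X\<^sub>l\<^sub>+\<^sub>j\<close> have been averaged by the mean ergodic theorem; hence \<open>a\<^sub>n\<close> tends to \<open>exp (- \<kappa>)\<close>.

  The limit is the sum of the series with jointly Gaussian coordinates of the prescribed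
  covariance; the series is Cauchy in L1 because of the uniform smallness of the remainders.\<close>

section \<open>Schauder bases\<close>

text \<open>The hypothesis controls the conditional expectation of \<open>S n\<close> only after
  multiplication by \<open>norm (X 0)\<close>. Every estimate must therefore produce that factor;
  the increment of a Lipschitz function along the partial sums is such a factor, and this is why
  everything runs on summation by parts. Two-smoothness serves to make the derivative of the squared
  norm Lipschitz. The Schauder basis supplies uniformly bounded finite-rank maps that tend pointwise
  to the identity: small remainders take the place of tightness, and the limit is built by hand
  instead of being extracted by compactness of measures.

  In the expansion of the characteristic function the linear and the quadratic Taylor term
  contribute at the same order \<open>1/n\<close>. Summation by parts turns the linear one into
  products of one variable with the near future, which are the covariances at positive lags, so
  \<open>\<kappa>\<close> is half the sum over all integer lags. The estimates give only conditional
  convergence of that series; a fixed number \<open>m\<close> of lags is compared with the limit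
  through the Cauchy property in L1.\<close>

lemma schauder_basis_coefficients_bounded:
  fixes e :: "nat \<Rightarrow> 'b::banach"
  assumes basis: "schauder_basis e"
  obtains u :: "nat \<Rightarrow> 'b \<Rightarrow>\<^sub>L real" and C :: real
  where "C > 0" "\<And>x. (\<lambda>n. u n x *\<^sub>R e n) sums x"
    "\<And>N x. norm (\<Sum>i<N. u i x *\<^sub>R e i) \<le> C * norm x"
proof -
  define a where "a x = (THE a. (\<lambda>n. a n *\<^sub>R e n) sums x)" for x
  have ex1: "\<exists>!a. (\<lambda>n. a n *\<^sub>R e n) sums x" for x
    using basis unfolding schauder_basis_def by blast
  have a_sums: "(\<lambda>n. a x n *\<^sub>R e n) sums x" for x
    unfolding a_def by (rule theI'[OF ex1])
  have a_uniq: "a x = b" if "(\<lambda>n. b n *\<^sub>R e n) sums x" for x b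
    using ex1[of x] a_sums[of x] that by blast
  have a_add: "a (x + y) i = a x i + a y i" for x y i
    using a_uniq[of "\<lambda>i. a x i + a y i" "x + y"] sums_add[OF a_sums[of x] a_sums[of y]]
    by (simp add: scaleR_add_left)
  have a_scale: "a (c *\<^sub>R x) i = c * a x i" for x c i
    using a_uniq[of "\<lambda>i. c * a x i" "c *\<^sub>R x"] sums_scaleR_right[OF a_sums[of x], of c]
    by simp
  have a_0: "a 0 i = 0" for i using a_scale[of 0 0 i] by simp
  have a_diff: "a (x - y) i = a x i - a y i" for x y i
    using a_add[of "x - y" y i] by simp
  have e_nz: "e n \<noteq> 0" for n
  proof
    assume "e n = 0"
    then have "(\<lambda>i. (if i = n then 1 else 0) *\<^sub>R e i) sums 0"
      by (intro sums_0) auto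
    from a_uniq[OF this] have "a 0 n = 1" by simp
    then show False by (simp add: a_0)
  qed
  define P where "P N x = (\<Sum>i<N. a x i *\<^sub>R e i)" for N x
  have P_lim: "(\<lambda>N. P N x) \<longlonglongrightarrow> x" for x
    using a_sums[of x] unfolding sums_def P_def .
  have P_diff: "P N (x - y) = P N x - P N y" for N x y
    by (simp add: P_def a_diff scaleR_diff_left sum_subtractf)
  have P_scale: "P N (c *\<^sub>R x) = c *\<^sub>R P N x" for N x c
    by (simp add: P_def a_scale scaleR_sum_right)
  \<comment> \<open>This is Banach's theorem that the partial sum maps of a Schauder basis are
    uniformly bounded. No \<open>P N\<close> is known to be continuous yet, so the sets
    \<open>A m\<close> need not be closed; Baire category is applied to their closures, and the
    density obtained is upgraded to an exact bound by successive approximation, as in the open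
    mapping theorem.\<close>
  define A where "A m = {x. \<forall>N. norm (P N x) \<le> real m}" for m :: nat
  have cover: "\<exists>m. x \<in> A m" for x
  proof -
    have "Bseq (\<lambda>N. P N x)" using P_lim[of x] convergentI convergent_imp_Bseq by blast
    then obtain K where "\<And>N. norm (P N x) \<le> K" unfolding Bseq_def by blast
    moreover obtain m :: nat where "K \<le> real m" using real_arch_simple by blast
    ultimately have "x \<in> A m" unfolding A_def by (auto intro: order_trans)
    then show ?thesis ..
  qed
  have "\<exists>m. interior (closure (A m)) \<noteq> {}"
  proof (rule ccontr)
    assume H: "\<not> ?thesis"
    have "euclidean interior_of \<Union>(range (\<lambda>m. closure (A m))) = {}"
      by (rule Baire_category_alt) (use H in \<open>auto simp: completely_metrizable_space_euclidean\<close>)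
    moreover have "\<Union>(range (\<lambda>m. closure (A m))) = UNIV"
      using cover closure_subset by fastforce
    ultimately show False by simp
  qed
  then obtain m x0 r where "r > 0" and ball: "ball x0 r \<subseteq> closure (A m)"
    by (metis ex_in_conv mem_interior)
  \<comment> \<open>Half the difference of approximants to \<open>x0 + y\<close> and
    \<open>x0 - y\<close> approximates \<open>y\<close>, which moves the ball from \<open>x0\<close>
    to the origin; \<open>A m\<close> is convex and symmetric, so this point stays inside.\<close>
  have approx: "\<exists>b\<in>A m. norm (b - y) < \<delta>" if "norm y < r" "\<delta> > 0" for y \<delta>
  proof -
    have "x0 + y \<in> closure (A m)" "x0 - y \<in> closure (A m)"
      using ball that by (auto simp: dist_norm subset_iff)
    then obtain p q where pq: "p \<in> A m" "q \<in> A m" "dist p (x0 + y) < \<delta>" "dist q (x0 - y) < \<delta>"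
      using \<open>\<delta> > 0\<close> unfolding closure_approachable by blast
    define b where "b = (1/2) *\<^sub>R (p - q)"
    have "norm (P N b) \<le> real m" for N
    proof -
      have "norm (P N b) = (1/2) * norm (P N p - P N q)"
        by (simp add: b_def P_scale P_diff)
      also have "\<dots> \<le> (1/2) * (norm (P N p) + norm (P N q))"
        using norm_triangle_ineq4[of "P N p" "P N q"] by simp
      also have "\<dots> \<le> (1/2) * (real m + real m)"
        using pq unfolding A_def by (intro mult_left_mono add_mono) auto
      finally show ?thesis by simp
    qed
    then have "b \<in> A m" unfolding A_def by simp
    have "b - y = (1/2) *\<^sub>R ((p - (x0 + y)) - (q - (x0 - y)))"
      unfolding b_def by (simp add: algebra_simps)
        (metis scaleR_half_double scaleR_right_distrib)
    then have "norm (b - y) \<le> (1/2) * (norm (p - (x0 + y)) + norm (q - (x0 - y)))"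
      using norm_triangle_ineq4[of "p - (x0 + y)" "q - (x0 - y)"] by simp
    also have "\<dots> < \<delta>" using pq by (simp add: dist_norm)
    finally show ?thesis using \<open>b \<in> A m\<close> by blast
  qed
  \<comment> \<open>For \<open>y \<noteq> 0\<close> the factor \<open>s = 2 * norm y / r\<close>
    puts \<open>y / s\<close> at norm \<open>r / 2\<close>, inside the ball; an error
    \<open>r / 4\<close> scales back to \<open>norm y / 2\<close>, and the bound \<open>m\<close> to
    at most \<open>c * norm y\<close>. The summand 1 keeps \<open>c\<close> positive.\<close>
  define c where "c = 2 * (real m + 1) / r"
  have "c > 0" using \<open>r > 0\<close> by (simp add: c_def)
  have "\<exists>b. norm (y - b) \<le> norm y / 2 \<and> (\<forall>N. norm (P N b) \<le> c * norm y)" for y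
  proof (cases "y = 0")
    case True
    then show ?thesis by (intro exI[of _ 0]) (simp add: P_def a_0)
  next
    case False
    define s where "s = 2 * norm y / r"
    have "s > 0" using False \<open>r > 0\<close> by (simp add: s_def)
    have "norm ((1/s) *\<^sub>R y) < r" using False \<open>r > 0\<close> \<open>s > 0\<close> by (simp add: s_def field_simps)
    from approx[OF this, of "r / 4"] \<open>r > 0\<close>
    obtain b where b: "b \<in> A m" "norm (b - (1/s) *\<^sub>R y) < r / 4" by auto
    have "s *\<^sub>R b - y = s *\<^sub>R (b - (1/s) *\<^sub>R y)" using \<open>s > 0\<close> by (simp add: scaleR_diff_right)
    then have "norm (s *\<^sub>R b - y) = s * norm (b - (1/s) *\<^sub>R y)" using \<open>s > 0\<close> by simp
    also have "\<dots> \<le> s * (r / 4)" using b \<open>s > 0\<close> by (intro mult_left_mono) auto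
    also have "\<dots> = norm y / 2" using \<open>r > 0\<close> by (simp add: s_def)
    finally have 1: "norm (y - s *\<^sub>R b) \<le> norm y / 2" by (simp add: norm_minus_commute)
    have "norm (P N (s *\<^sub>R b)) \<le> c * norm y" for N
    proof -
      have "norm (P N (s *\<^sub>R b)) = s * norm (P N b)" using \<open>s > 0\<close> by (simp add: P_scale)
      also have "\<dots> \<le> s * (real m + 1)" using b \<open>s > 0\<close> unfolding A_def by (intro mult_left_mono) (auto intro: order_trans)
      also have "\<dots> = c * norm y" by (simp add: s_def c_def)
      finally show ?thesis .
    qed
    with 1 show ?thesis by blast
  qed
  then obtain f where f1: "\<And>y. norm (y - f y) \<le> norm y / 2"
    and f2: "\<And>y N. norm (P N (f y)) \<le> c * norm y" by metis
  have key: "norm (P N x) \<le> 2 * c * norm x" for N x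
  proof -
    \<comment> \<open>Residuals of the successive approximation: they halve at every stage, so
      \<open>x\<close> is the sum of the \<open>f (y k)\<close>, and the partial sums of these
      pieces are bounded by a geometric series of total \<open>2 * c * norm x\<close>.\<close>
    define y where "y = rec_nat x (\<lambda>_ z. z - f z)"
    have y0: "y 0 = x" and yS: "y (Suc k) = y k - f (y k)" for k by (simp_all add: y_def)
    have y_norm: "norm (y k) \<le> norm x * (1/2) ^ k" for k
    proof (induction k)
      case (Suc k)
      have "norm (y (Suc k)) \<le> norm (y k) / 2" using f1[of "y k"] by (simp add: yS)
      then show ?case using Suc by simp
    qed (simp add: y0)
    have sum_f: "(\<Sum>k<n. f (y k)) = x - y n" for n
      by (induction n) (auto simp: y0 yS)
    have "y \<longlonglongrightarrow> 0"
    proof (rule Lim_null_comparison)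
      show "\<forall>\<^sub>F k in sequentially. norm (y k) \<le> norm x * (1/2) ^ k" using y_norm by simp
      have "(\<lambda>k. norm x * (1/2) ^ k) \<longlonglongrightarrow> norm x * 0"
        by (intro tendsto_mult tendsto_const LIMSEQ_power_zero) simp
      then show "(\<lambda>k. norm x * (1/2) ^ k) \<longlonglongrightarrow> 0" by simp
    qed
    then have "(\<lambda>n. x - y n) \<longlonglongrightarrow> x - 0" by (intro tendsto_diff tendsto_const)
    then have f_sums: "(\<lambda>k. f (y k)) sums x" unfolding sums_def by (simp add: sum_f)
    define g where "g k = c * norm x * (1/2) ^ k" for k :: nat
    have g_sums: "g sums (2 * c * norm x)"
      unfolding g_def using sums_mult[OF geometric_sums[of "1/2 :: real"], of "c * norm x"]
      by (simp add: mult_ac)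
    have g_bound: "norm (P N (f (y k))) \<le> g k" for N k
      using order_trans[OF f2[of N "y k"] mult_left_mono[OF y_norm[of k], of c]] \<open>c > 0\<close>
      unfolding g_def by (simp add: mult.assoc)
    have g_summable: "summable g" using g_sums by (rule sums_summable)
    have Pf_summable: "summable (\<lambda>k. P N (f (y k)))" for N
      by (rule summable_comparison_test'[OF g_summable, of 0]) (use g_bound in auto)
    define p where "p N = (\<Sum>k. P N (f (y k)))" for N
    \<comment> \<open>Candidate coefficients, added up piece by piece. Uniqueness of the expansion
      identifies them with \<open>a x\<close> once their series is shown to converge to
      \<open>x\<close>; in this way continuity of the coefficients is not presupposed.\<close>
    define b where "b i = (\<Sum>k. a (f (y k)) i)" for i
    have a_summable: "summable (\<lambda>k. a (f (y k)) i)" for i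
    proof (rule summable_comparison_test')
      show "summable (\<lambda>k. 2 * g k / norm (e i))"
        using g_summable by (intro summable_divide summable_mult)
      fix k :: nat
      have "a (f (y k)) i *\<^sub>R e i = P (Suc i) (f (y k)) - P i (f (y k))" by (simp add: P_def)
      then have "\<bar>a (f (y k)) i\<bar> * norm (e i) = norm (P (Suc i) (f (y k)) - P i (f (y k)))"
        by (metis norm_scaleR)
      also have "\<dots> \<le> g k + g k"
        using norm_triangle_ineq4 g_bound add_mono order_trans by meson
      finally show "norm (a (f (y k)) i) \<le> 2 * g k / norm (e i)"
        using e_nz[of i] by (simp add: field_simps)
    qed
    have p_eq: "p N = (\<Sum>i<N. b i *\<^sub>R e i)" for N
    proof -
      have "p N = (\<Sum>k. \<Sum>i<N. a (f (y k)) i *\<^sub>R e i)" by (simp add: p_def P_def)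
      also have "\<dots> = (\<Sum>i<N. \<Sum>k. a (f (y k)) i *\<^sub>R e i)"
        by (rule suminf_sum) (intro summable_scaleR_left a_summable)
      also have "\<dots> = (\<Sum>i<N. b i *\<^sub>R e i)"
        unfolding b_def using a_summable by (simp add: suminf_scaleR_left)
      finally show ?thesis .
    qed
    have f_le: "norm (f (y k)) \<le> g k" for k
      by (rule LIMSEQ_le_const2[OF tendsto_norm[OF P_lim]]) (use g_bound in auto)
    have d_le: "norm (P N (f (y k)) - f (y k)) \<le> 2 * g k" for N k
      using norm_triangle_ineq4[of "P N (f (y k))" "f (y k)"] g_bound[of N k] f_le[of k] by linarith
    have d_summable: "summable (\<lambda>k. norm (P N (f (y k)) - f (y k)))" for N
      by (rule summable_comparison_test'[OF summable_mult[OF g_summable, of 2], of 0])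
        (use d_le in auto)
    \<comment> \<open>Each piece is the limit of its own partial sums; the summable bound
      \<open>2 * g k\<close> permits exchanging this limit with the sum over the pieces.\<close>
    have "(\<lambda>N. \<Sum>k. norm (P N (f (y k)) - f (y k))) \<longlonglongrightarrow> (\<Sum>k::nat. 0)"
    proof (rule tannerys_theorem[THEN conjunct2, THEN conjunct2])
      show "(\<lambda>N. norm (P N (f (y k)) - f (y k))) \<longlonglongrightarrow> 0" for k
        using P_lim[of "f (y k)"] LIM_zero tendsto_norm_zero by blast
      show "\<forall>\<^sub>F (k, N) in sequentially \<times>\<^sub>F sequentially.
          norm (norm (P N (f (y k)) - f (y k))) \<le> 2 * g k"
        using d_le by (intro always_eventually) auto
      show "summable (\<lambda>k. 2 * g k)" by (intro summable_mult g_summable)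
    qed simp
    then have lim0: "(\<lambda>N. \<Sum>k. norm (P N (f (y k)) - f (y k))) \<longlonglongrightarrow> 0" by simp
    have "norm (p N - x) \<le> (\<Sum>k. norm (P N (f (y k)) - f (y k)))" for N
    proof -
      have "p N - x = (\<Sum>k. P N (f (y k)) - f (y k))"
        unfolding p_def using suminf_diff[OF Pf_summable sums_summable[OF f_sums]] f_sums
        by (simp add: sums_iff)
      then show ?thesis using summable_norm[OF d_summable] by simp
    qed
    then have "p \<longlonglongrightarrow> x"
      by (intro LIM_zero_cancel[of p x] Lim_null_comparison[OF _ lim0]) auto
    then have "(\<lambda>i. b i *\<^sub>R e i) sums x" unfolding sums_def p_eq .
    then have "a x = b" by (rule a_uniq)
    then have "P N x = p N" unfolding P_def p_eq by simp
    also have "norm (p N) \<le> (\<Sum>k. g k)"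
      unfolding p_def using g_bound g_summable by (intro norm_suminf_le) auto
    also have "\<dots> = 2 * c * norm x" using g_sums by (simp add: sums_iff)
    finally show ?thesis .
  qed
  have bl: "bounded_linear (\<lambda>x. a x i)" for i
  proof (rule bounded_linear_intro)
    fix x
    have "a x i *\<^sub>R e i = P (Suc i) x - P i x" by (simp add: P_def)
    then have "\<bar>a x i\<bar> * norm (e i) = norm (P (Suc i) x - P i x)" by (metis norm_scaleR)
    also have "\<dots> \<le> 2 * c * norm x + 2 * c * norm x"
      using norm_triangle_ineq4 key add_mono order_trans by meson
    finally show "norm (a x i) \<le> norm x * (4 * c / norm (e i))"
      using e_nz[of i] by (simp add: field_simps)
  qed (simp_all add: a_add a_scale)
  define u where "u i = Blinfun (\<lambda>x. a x i)" for i
  have u: "u i x = a x i" for i x unfolding u_def using bl by (simp add: bounded_linear_Blinfun_apply)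
  show ?thesis
  proof (rule that[of "2 * c" u])
    show "2 * c > 0" using \<open>c > 0\<close> by simp
    show "(\<lambda>n. u n x *\<^sub>R e n) sums x" for x using a_sums u by simp
    show "norm (\<Sum>i<N. u i x *\<^sub>R e i) \<le> 2 * c * norm x" for N x
      using key[of N x] by (simp add: P_def u)
  qed
qed

section \<open>Two-smooth spaces\<close>

text \<open>Convexity places the squared norm above its tangents along lines, the lower counterpart
  of the bound that comes from smoothness.\<close>

lemma norm_sq_convex_line:
  fixes x v :: "'b::real_normed_vector"
  shows "convex_on UNIV (\<lambda>s::real. (norm (x + s *\<^sub>R v))\<^sup>2)"
proof (rule convex_onI)
  fix t a b :: real assume t: "0 < t" "t < 1"
  let ?p = "norm (x + a *\<^sub>R v)" and ?q = "norm (x + b *\<^sub>R v)"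
  have "x + ((1 - t) *\<^sub>R a + t *\<^sub>R b) *\<^sub>R v = (1 - t) *\<^sub>R (x + a *\<^sub>R v) + t *\<^sub>R (x + b *\<^sub>R v)"
    by (simp add: algebra_simps)
  then have "norm (x + ((1 - t) *\<^sub>R a + t *\<^sub>R b) *\<^sub>R v) \<le> (1 - t) * ?p + t * ?q"
    using norm_triangle_ineq[of "(1 - t) *\<^sub>R (x + a *\<^sub>R v)" "t *\<^sub>R (x + b *\<^sub>R v)"] t by simp
  then have "(norm (x + ((1 - t) *\<^sub>R a + t *\<^sub>R b) *\<^sub>R v))\<^sup>2 \<le> ((1 - t) * ?p + t * ?q)\<^sup>2"
    by (intro power_mono) auto
  also have "\<dots> = (1 - t) * ?p\<^sup>2 + t * ?q\<^sup>2 - t * (1 - t) * (?p - ?q)\<^sup>2"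
    by (simp add: power2_eq_square algebra_simps)
  also have "\<dots> \<le> (1 - t) * ?p\<^sup>2 + t * ?q\<^sup>2" using t by simp
  finally show "(norm (x + ((1 - t) *\<^sub>R a + t *\<^sub>R b) *\<^sub>R v))\<^sup>2 \<le> (1 - t) * ?p\<^sup>2 + t * ?q\<^sup>2" .
qed (rule convex_UNIV)

text \<open>Convexity of the squared norm and the one-sided second-order bound together make the
  first derivative Lipschitz, so that symmetry of the second derivative is never needed.\<close>

lemma two_smoothE:
  assumes "two_smooth TYPE('b::real_normed_vector)"
  obtains D :: "'b::real_normed_vector \<Rightarrow> 'b \<Rightarrow>\<^sub>L real" and C :: real
  where "C > 0" "D 0 = 0"
    "\<And>x u. (norm (x + u))\<^sup>2 \<le> (norm x)\<^sup>2 + D x u + C * (norm u)\<^sup>2"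
    "\<And>x y. norm (D x - D y) \<le> 2 * C * norm (x - y)"
proof -
  obtain d and D :: "'b \<Rightarrow> 'b \<Rightarrow>\<^sub>L real" and D2 :: "'b \<Rightarrow> 'b \<Rightarrow>\<^sub>L ('b \<Rightarrow>\<^sub>L real)"
    where "d > 0"
      and "\<forall>x. ((\<lambda>y. (norm y)\<^sup>2) has_derivative blinfun_apply (D x)) (at x)"
      and "\<forall>x. x \<noteq> 0 \<longrightarrow> (D has_derivative blinfun_apply (D2 x)) (at x)"
      and "\<forall>x u. x \<noteq> 0 \<longrightarrow> D2 x u u \<le> d\<^sup>2 * (norm u)\<^sup>2"
      and "\<forall>x u. \<bar>D x u - D 0 u\<bar> \<le> d\<^sup>2 * norm x * norm u"
    using assms unfolding two_smooth_def by (elim exE conjE) (rule that)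
  then have D: "((\<lambda>y. (norm y)\<^sup>2) has_derivative blinfun_apply (D x)) (at x)"
    and D2: "x \<noteq> 0 \<Longrightarrow> (D has_derivative blinfun_apply (D2 x)) (at x)"
    and bd2: "x \<noteq> 0 \<Longrightarrow> D2 x u u \<le> d\<^sup>2 * (norm u)\<^sup>2"
    and bd1: "\<bar>D x u - D 0 u\<bar> \<le> d\<^sup>2 * norm x * norm u" for x u
    by auto
  define q where "q = d\<^sup>2"
  have "q > 0" using \<open>d > 0\<close> by (simp add: q_def)
  have "blinfun_apply (D 0) = (\<lambda>h. 0)"
    by (rule has_derivative_local_min[OF D]) simp
  then have D0: "D 0 = 0" by (simp add: blinfun_eqI)
  have line: "((\<lambda>s. (norm (x + s *\<^sub>R u))\<^sup>2) has_real_derivative D (x + s *\<^sub>R u) u) (at s)" for x u :: 'b and s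
  proof -
    have "((\<lambda>s. x + s *\<^sub>R u) has_derivative (\<lambda>h. h *\<^sub>R u)) (at s)"
      by (auto intro!: derivative_eq_intros)
    from diff_chain_at[OF this D[of "x + s *\<^sub>R u"]]
    show ?thesis
      by (simp add: has_field_derivative_def o_def blinfun.scaleR_right mult_commute_abs)
  qed
  have line2: "((\<lambda>s. D (x + s *\<^sub>R u) u) has_real_derivative D2 (x + s *\<^sub>R u) u u) (at s)"
    if "x + s *\<^sub>R u \<noteq> 0" for x u :: 'b and s
  proof -
    have "((\<lambda>s. x + s *\<^sub>R u) has_derivative (\<lambda>h. h *\<^sub>R u)) (at s)"
      by (auto intro!: derivative_eq_intros)
    from diff_chain_at[OF this D2[OF that]]
    have "((\<lambda>s. D (x + s *\<^sub>R u)) has_derivative (\<lambda>h. h *\<^sub>R D2 (x + s *\<^sub>R u) u)) (at s)"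
      by (simp add: o_def blinfun.scaleR_right)
    then have "((\<lambda>s. D (x + s *\<^sub>R u) u) has_derivative (\<lambda>h. (h *\<^sub>R D2 (x + s *\<^sub>R u) u) u)) (at s)"
      by (rule bounded_linear.has_derivative[OF bounded_linear_apply_blinfun])
    then show ?thesis
      by (simp add: has_field_derivative_def blinfun.scaleR_left mult_commute_abs)
  qed
  have upper: "(norm (x + u))\<^sup>2 \<le> (norm x)\<^sup>2 + D x u + 2 * q * (norm u)\<^sup>2" for x u
  proof -
    have "\<exists>\<xi>::real. 0 < \<xi> \<and> \<xi> < 1 \<and> (norm (x + 1 *\<^sub>R u))\<^sup>2 - (norm (x + 0 *\<^sub>R u))\<^sup>2 = (1 - 0) * D (x + \<xi> *\<^sub>R u) u"
      by (rule MVT2) (use line in auto)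
    then obtain \<xi> :: real where \<xi>: "0 < \<xi>" "\<xi> < 1" "(norm (x + u))\<^sup>2 = (norm x)\<^sup>2 + D (x + \<xi> *\<^sub>R u) u"
      by auto
    have "D (x + \<xi> *\<^sub>R u) u - D x u \<le> 2 * q * (norm u)\<^sup>2"
    \<comment> \<open>The second derivative is available away from the origin only. If the segment
      passes through the origin, both \<open>x\<close> and \<open>x + \<xi> u\<close> are multiples
      of \<open>u\<close> of norm at most \<open>norm u\<close>, and \<open>bd1\<close> applied at
      each of them gives twice \<open>q * (norm u)^2\<close>.\<close>
    proof (cases "\<exists>s0. 0 \<le> s0 \<and> s0 \<le> 1 \<and> x + s0 *\<^sub>R u = 0")
      case True
      then obtain s0 where s0: "0 \<le> s0" "s0 \<le> 1" "x + s0 *\<^sub>R u = 0" by blast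
      then have x: "x = - s0 *\<^sub>R u" by (simp add: eq_neg_iff_add_eq_0)
      have "norm x \<le> norm u" using s0 by (simp add: x mult_left_le_one_le)
      moreover have "x + \<xi> *\<^sub>R u = (\<xi> - s0) *\<^sub>R u" by (simp add: x scaleR_diff_left)
      then have "norm (x + \<xi> *\<^sub>R u) = \<bar>\<xi> - s0\<bar> * norm u" by simp
      then have "norm (x + \<xi> *\<^sub>R u) \<le> norm u"
        using s0 \<xi> by (simp add: mult_left_le_one_le)
      ultimately have "q * norm (x + \<xi> *\<^sub>R u) * norm u \<le> q * norm u * norm u"
        "q * norm x * norm u \<le> q * norm u * norm u"
        using \<open>q > 0\<close> by (auto intro!: mult_right_mono mult_left_mono)
      with bd1[of "x + \<xi> *\<^sub>R u" u] bd1[of x u] show ?thesis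
        by (simp add: D0 q_def power2_eq_square[of "norm u"])
    next
      case False
      have "\<exists>\<eta>::real. 0 < \<eta> \<and> \<eta> < \<xi> \<and> D (x + \<xi> *\<^sub>R u) u - D (x + 0 *\<^sub>R u) u = (\<xi> - 0) * D2 (x + \<eta> *\<^sub>R u) u u"
        by (rule MVT2) (use line2 False \<xi> in auto)
      then obtain \<eta> :: real where \<eta>: "0 < \<eta>" "\<eta> < \<xi>" "D (x + \<xi> *\<^sub>R u) u - D x u = \<xi> * D2 (x + \<eta> *\<^sub>R u) u u"
        by auto
      have "x + \<eta> *\<^sub>R u \<noteq> 0" using False \<eta> \<xi> by auto
      from bd2[OF this, of u] have "\<xi> * D2 (x + \<eta> *\<^sub>R u) u u \<le> \<xi> * (q * (norm u)\<^sup>2)"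
        using \<xi> by (intro mult_left_mono) (auto simp: q_def)
      also have "\<dots> \<le> 1 * (q * (norm u)\<^sup>2)" using \<xi> \<open>q > 0\<close> by (intro mult_right_mono) auto
      also have "\<dots> \<le> 2 * q * (norm u)\<^sup>2" using \<open>q > 0\<close> by simp
      finally show ?thesis using \<eta> by simp
    qed
    with \<xi> show ?thesis by linarith
  qed
  have lower: "(norm (x + u))\<^sup>2 \<ge> (norm x)\<^sup>2 + D x u" for x u
    using convex_on_imp_above_tangent[OF norm_sq_convex_line[of x u] connected_UNIV, of 0 1 "D x u"]
      line[of x u 0] by simp
  \<comment> \<open>The value at \<open>y + v\<close> is compared from two sides: from below by the
    tangent at \<open>x\<close>, from above by the expansion at \<open>y\<close>, with
    \<open>y\<close> itself expanded at \<open>x\<close>.\<close>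
  have three: "(D x - D y) v \<le> 2 * q * ((norm (y - x))\<^sup>2 + (norm v)\<^sup>2)" for x y v
    using lower[of x "y + v - x"] upper[of y v] upper[of x "y - x"]
    by (simp add: blinfun.bilinear_simps algebra_simps)
  have lip: "(D x - D y) w \<le> 4 * q * norm (x - y) * norm w" for x y w
  proof (cases "x = y \<or> w = 0")
    case False
    \<comment> \<open>Rescaling \<open>w\<close> to length \<open>norm (x - y)\<close> balances the
      two squares in \<open>three\<close>; homogeneity then gives a linear bound.\<close>
    define r where "r = norm (x - y)"
    have r: "r > 0" "norm w > 0" using False by (auto simp: r_def)
    have "(D x - D y) ((r / norm w) *\<^sub>R w) \<le> 2 * q * (r\<^sup>2 + r\<^sup>2)"
      using three[of x y "(r / norm w) *\<^sub>R w"] r by (simp add: r_def norm_minus_commute)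
    then have "(r / norm w) * (D x - D y) w \<le> 4 * q * r * r"
      by (simp add: blinfun.scaleR_right power2_eq_square)
    then have "r * ((D x - D y) w) \<le> r * (4 * q * r * norm w)"
      using r by (simp add: field_simps)
    then show ?thesis using r by (simp add: r_def)
  qed auto
  show ?thesis
  proof (rule that[of "2 * q" D])
    show "norm (D x - D y) \<le> 2 * (2 * q) * norm (x - y)" for x y
    proof (rule norm_blinfun_bound)
      show "norm ((D x - D y) w) \<le> 2 * (2 * q) * norm (x - y) * norm w" for w
        using lip[of x y w] lip[of x y "- w"] by (simp add: blinfun.minus_right)
    qed (use \<open>q > 0\<close> in simp)
  qed (use \<open>q > 0\<close> D0 upper in auto)
qed

section \<open>Bochner conditional expectation\<close>

lemma AE_summable_if_summable_integral_norm:
  fixes f :: "nat \<Rightarrow> 'a \<Rightarrow> 'b::{banach, second_countable_topology}"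
  assumes int: "\<And>i. integrable M (f i)" and sum: "summable (\<lambda>i. \<integral>x. norm (f i x) \<partial>M)"
  shows "AE x in M. summable (\<lambda>i. norm (f i x))"
proof -
  have [measurable]: "f i \<in> borel_measurable M" for i using int by auto
  have "(\<integral>\<^sup>+ x. (\<Sum>i. ennreal (norm (f i x))) \<partial>M) = (\<Sum>i. \<integral>\<^sup>+ x. norm (f i x) \<partial>M)"
    by (rule nn_integral_suminf) auto
  also have "\<dots> = (\<Sum>i. ennreal (\<integral>x. norm (f i x) \<partial>M))"
    by (intro arg_cong[where f=suminf] ext nn_integral_eq_integral integrable_norm int) auto
  also have "\<dots> < \<infinity>"
    by (simp add: sum ennreal_suminf_neq_top less_top[symmetric] integral_nonneg_AE)
  finally have "AE x in M. (\<Sum>i. ennreal (norm (f i x))) \<noteq> \<infinity>"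
    by (intro nn_integral_noteq_infinite) auto
  then show ?thesis
    by eventually_elim (auto intro: summable_suminf_not_top)
qed

lemma measurable_pairing:
  fixes \<Phi> :: "'b::second_countable_topology \<Rightarrow> 'c::second_countable_topology \<Rightarrow> 'd::topological_space"
  assumes "continuous_on UNIV (\<lambda>(w, b). \<Phi> w b)"
    and "U \<in> borel_measurable M" "h \<in> borel_measurable M"
  shows "(\<lambda>\<omega>. \<Phi> (U \<omega>) (h \<omega>)) \<in> borel_measurable M"
proof -
  have "(\<lambda>\<omega>. (U \<omega>, h \<omega>)) \<in> borel_measurable M" using assms(2,3) by (rule borel_measurable_Pair)
  from measurable_compose[OF this borel_measurable_continuous_onI[OF assms(1)]] show ?thesis by simp
qed

lemma simple_function_indicator_sum:
  fixes s :: "'a \<Rightarrow> 'c" and h :: "'c \<Rightarrow> 'd::real_vector"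
  assumes "simple_function M s" "\<omega> \<in> space M"
  shows "(\<Sum>y\<in>s ` space M. indicator (s -` {y} \<inter> space M) \<omega> *\<^sub>R h y) = h (s \<omega>)"
proof -
  have fin: "finite (s ` space M)" using assms(1) by (rule simple_functionD)
  have "(\<Sum>y\<in>s ` space M. indicator (s -` {y} \<inter> space M) \<omega> *\<^sub>R h y) =
      (\<Sum>y\<in>s ` space M. if y = s \<omega> then h y else 0)"
    using assms(2) by (intro sum.cong) (auto simp: indicator_def)
  then show ?thesis using fin assms(2) by (simp add: sum.delta)
qed

context finite_measure_subalgebra
begin

interpretation sigma_finite_subalgebra M F
  by (intro finite_measure_subalgebra_is_sigma_finite) unfold_locales

lemma space_F: "space F = space M"
  using subalg by (simp add: subalgebra_def)

lemma sets_F: "A \<in> sets F \<Longrightarrow> A \<in> sets M"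
  using subalg by (auto simp: subalgebra_def)

lemma F_measurableD: "f \<in> measurable F N \<Longrightarrow> f \<in> measurable M N"
  using measurable_from_subalg[OF subalg] by blast

text \<open>The coefficients are the real conditional expectations of the indicators of the level
  sets; these are nonnegative and keep their integrals, which yields the L1 contraction. The
  contraction is what allows the passage to limits of simple functions.\<close>

lemma is_bochner_cond_exp_simple:
  fixes s :: "'a \<Rightarrow> 'b::{banach, second_countable_topology}"
  assumes s: "simple_function M s"
  shows "\<exists>g. is_bochner_cond_exp M F s g \<and> (\<integral>\<omega>. norm (g \<omega>) \<partial>M) \<le> (\<integral>\<omega>. norm (s \<omega>) \<partial>M)"
proof -
  define A where "A y = s -` {y} \<inter> space M" for y
  define r where "r y = real_cond_exp M F (indicator (A y))" for y
  define g where "g \<omega> = (\<Sum>y\<in>s ` space M. r y \<omega> *\<^sub>R y)" for \<omega>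
  have A[measurable]: "A y \<in> sets M" for y
    unfolding A_def using simple_functionD(2)[OF s] by blast
  have fin: "finite (s ` space M)" using s by (rule simple_functionD)
  have indI: "integrable M (indicator (A y) :: 'a \<Rightarrow> real)" for y
    by (simp add: emeasure_eq_measure)
  have r_int: "integrable M (r y)" "(\<integral>\<omega>. r y \<omega> \<partial>M) = measure M (A y)" for y
    unfolding r_def using real_cond_exp_int[OF indI[of y]] by auto
  have [measurable]: "r y \<in> borel_measurable F" "r y \<in> borel_measurable M" for y
    unfolding r_def by auto
  have r_pos: "AE \<omega> in M. r y \<omega> \<ge> 0" for y
    unfolding r_def by (rule real_cond_exp_pos) auto
  have s_eq: "s \<omega> = (\<Sum>y\<in>s ` space M. indicator (A y) \<omega> *\<^sub>R y)" if "\<omega> \<in> space M" for \<omega>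
    using simple_function_indicator_sum[OF s that, of "\<lambda>y. y"] by (simp add: A_def)
  have ns_eq: "norm (s \<omega>) = (\<Sum>y\<in>s ` space M. indicator (A y) \<omega> * norm y)" if "\<omega> \<in> space M" for \<omega>
    using simple_function_indicator_sum[OF s that, of norm] by (simp add: A_def)
  have g_int: "integrable M g"
    unfolding g_def using r_int by (intro Bochner_Integration.integrable_sum integrable_scaleR_left) auto
  have "is_bochner_cond_exp M F s g"
    unfolding is_bochner_cond_exp_def
  proof (intro conjI ballI)
    show "g \<in> borel_measurable F" unfolding g_def by measurable
    show "integrable M g" by (rule g_int)
    fix B assume B: "B \<in> sets F"
    then have [measurable]: "B \<in> sets M" by (rule sets_F)
    have "set_lebesgue_integral M B g = (\<integral>\<omega>. (\<Sum>y\<in>s ` space M. (indicator B \<omega> * r y \<omega>) *\<^sub>R y) \<partial>M)"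
      unfolding set_lebesgue_integral_def g_def by (simp add: scaleR_sum_right)
    also have "\<dots> = (\<Sum>y\<in>s ` space M. (\<integral>\<omega>. indicator B \<omega> * r y \<omega> \<partial>M) *\<^sub>R y)"
      using integrable_mult_indicator[OF \<open>B \<in> sets M\<close> r_int(1)]
      by (subst Bochner_Integration.integral_sum) auto
    also have "\<dots> = (\<Sum>y\<in>s ` space M. (\<integral>\<omega>. indicator B \<omega> * indicator (A y) \<omega> \<partial>M) *\<^sub>R y)"
      using real_cond_exp_intA[OF indI B] unfolding set_lebesgue_integral_def r_def by simp
    also have "\<dots> = (\<integral>\<omega>. (\<Sum>y\<in>s ` space M. (indicator B \<omega> * indicator (A y) \<omega>) *\<^sub>R y) \<partial>M)"
      using integrable_mult_indicator[OF \<open>B \<in> sets M\<close> indI]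
      by (subst Bochner_Integration.integral_sum) auto
    also have "\<dots> = set_lebesgue_integral M B s"
      unfolding set_lebesgue_integral_def
    proof (rule Bochner_Integration.integral_cong[OF refl])
      fix \<omega> assume "\<omega> \<in> space M"
      show "(\<Sum>y\<in>s ` space M. (indicator B \<omega> * indicator (A y) \<omega>) *\<^sub>R y) = indicator B \<omega> *\<^sub>R s \<omega>"
        by (subst s_eq[OF \<open>\<omega> \<in> space M\<close>]) (simp add: scaleR_sum_right)
    qed
    finally show "set_lebesgue_integral M B g = set_lebesgue_integral M B s" .
  qed
  moreover have "(\<integral>\<omega>. norm (g \<omega>) \<partial>M) \<le> (\<integral>\<omega>. (\<Sum>y\<in>s ` space M. r y \<omega> * norm y) \<partial>M)"
  proof (rule integral_mono_AE)
    show "integrable M (\<lambda>\<omega>. norm (g \<omega>))" using g_int by auto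
    show "integrable M (\<lambda>\<omega>. \<Sum>y\<in>s ` space M. r y \<omega> * norm y)" using r_int by auto
    have "AE \<omega> in M. \<forall>y\<in>s ` space M. r y \<omega> \<ge> 0"
      using r_pos fin by (subst AE_finite_all) auto
    then show "AE \<omega> in M. norm (g \<omega>) \<le> (\<Sum>y\<in>s ` space M. r y \<omega> * norm y)"
    proof eventually_elim
      case (elim \<omega>)
      then show ?case unfolding g_def by (intro order_trans[OF norm_sum] sum_mono) auto
    qed
  qed
  moreover have "\<dots> = (\<integral>\<omega>. norm (s \<omega>) \<partial>M)"
  proof -
    have "(\<integral>\<omega>. (\<Sum>y\<in>s ` space M. r y \<omega> * norm y) \<partial>M) = (\<Sum>y\<in>s ` space M. measure M (A y) * norm y)"
      using r_int by (subst Bochner_Integration.integral_sum) auto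
    also have "\<dots> = (\<integral>\<omega>. (\<Sum>y\<in>s ` space M. indicator (A y) \<omega> * norm y) \<partial>M)"
      using indI by (subst Bochner_Integration.integral_sum) auto
    also have "\<dots> = (\<integral>\<omega>. norm (s \<omega>) \<partial>M)"
      by (intro Bochner_Integration.integral_cong refl) (simp add: ns_eq)
    finally show ?thesis .
  qed
  ultimately show ?thesis by auto
qed

text \<open>Simple functions approximating \<open>f\<close> at a geometric rate are conditioned
  increment by increment; the L1 contraction makes the resulting series absolutely summable almost
  everywhere, so a version is given by an explicit series.\<close>

lemma ex_bochner_cond_exp:
  fixes f :: "'a \<Rightarrow> 'b::{banach, second_countable_topology}"
  assumes f: "integrable M f"
  shows "\<exists>g. is_bochner_cond_exp M F f g"
proof -
  have f_meas[measurable]: "f \<in> borel_measurable M" using f by auto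
  obtain s where "\<forall>i. simple_function M (s i)" "\<forall>\<omega>\<in>space M. (\<lambda>i. s i \<omega>) \<longlonglongrightarrow> f \<omega>"
    "\<forall>i. \<forall>\<omega>\<in>space M. dist (s i \<omega>) 0 \<le> 2 * dist (f \<omega>) 0"
    using borel_measurable_implies_sequence_metric[OF f_meas, of 0] by (elim exE conjE) (rule that)
  then have s: "simple_function M (s i)" and s_lim: "\<omega> \<in> space M \<Longrightarrow> (\<lambda>i. s i \<omega>) \<longlonglongrightarrow> f \<omega>"
    and s_bd: "\<omega> \<in> space M \<Longrightarrow> norm (s i \<omega>) \<le> 2 * norm (f \<omega>)" for i \<omega>
    by auto
  have s_meas[measurable]: "s i \<in> borel_measurable M" for i
    using s by (rule borel_measurable_simple_function)
  have "(\<lambda>i. \<integral>\<omega>. norm (s i \<omega> - f \<omega>) \<partial>M) \<longlonglongrightarrow> (\<integral>\<omega>. 0 \<partial>M)"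
  proof (rule integral_dominated_convergence)
    show "integrable M (\<lambda>\<omega>. 3 * norm (f \<omega>))" using f by auto
    show "AE \<omega> in M. (\<lambda>i. norm (s i \<omega> - f \<omega>)) \<longlonglongrightarrow> 0"
      using s_lim by (intro AE_I2 tendsto_norm_zero LIM_zero)
    show "AE \<omega> in M. norm (norm (s i \<omega> - f \<omega>)) \<le> 3 * norm (f \<omega>)" for i
    proof (rule AE_I2)
      fix \<omega> assume "\<omega> \<in> space M"
      from s_bd[OF this, of i] norm_triangle_ineq4[of "s i \<omega>" "f \<omega>"]
      show "norm (norm (s i \<omega> - f \<omega>)) \<le> 3 * norm (f \<omega>)" by simp
    qed
  qed auto
  then have lim0: "(\<lambda>i. \<integral>\<omega>. norm (s i \<omega> - f \<omega>) \<partial>M) \<longlonglongrightarrow> 0" by simp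
  have "\<exists>i. (\<integral>\<omega>. norm (s i \<omega> - f \<omega>) \<partial>M) < (1/2) ^ k" for k :: nat
  proof -
    have "(0::real) < (1/2) ^ k" by simp
    from order_tendstoD(2)[OF lim0 this] show ?thesis
      unfolding eventually_sequentially by blast
  qed
  then obtain r where r: "\<And>k::nat. (\<integral>\<omega>. norm (s (r k) \<omega> - f \<omega>) \<partial>M) < (1/2) ^ k" by metis
  \<comment> \<open>Starting the sequence at 0 makes \<open>t n\<close> the sum of its first
    \<open>n\<close> increments.\<close>
  define t where "t k = (case k of 0 \<Rightarrow> \<lambda>_. 0 | Suc j \<Rightarrow> s (r j))" for k
  have t: "simple_function M (t k)" for k unfolding t_def using s by (cases k) auto
  have t_meas[measurable]: "t k \<in> borel_measurable M" for k
    using t by (rule borel_measurable_simple_function)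
  have t_int: "integrable M (t k)" for k
  proof (rule Bochner_Integration.integrable_bound[OF _ t_meas])
    show "integrable M (\<lambda>\<omega>. 2 * norm (f \<omega>))" using f by auto
    show "AE \<omega> in M. norm (t k \<omega>) \<le> norm (2 * norm (f \<omega>))"
      using s_bd by (cases k) (auto simp: t_def)
  qed
  define \<delta> where "\<delta> k = (\<integral>\<omega>. norm (t k \<omega> - f \<omega>) \<partial>M)" for k
  have \<delta>_summable: "summable \<delta>"
  proof (subst summable_Suc_iff[symmetric], rule summable_comparison_test')
    show "summable (\<lambda>k. (1/2::real) ^ k)" by (simp add: summable_geometric)
    show "norm (\<delta> (Suc k)) \<le> (1/2) ^ k" for k
      using r[of k] by (simp add: \<delta>_def t_def integral_nonneg_AE)
  qed
  define d where "d k \<omega> = t (Suc k) \<omega> - t k \<omega>" for k \<omega>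
  have d_int: "integrable M (d k)" for k unfolding d_def using t_int by auto
  have "simple_function M (d k)" for k unfolding d_def using t by auto
  from is_bochner_cond_exp_simple[OF this]
  obtain g where g: "\<And>k. is_bochner_cond_exp M F (d k) (g k)"
    and g_bd: "\<And>k. (\<integral>\<omega>. norm (g k \<omega>) \<partial>M) \<le> (\<integral>\<omega>. norm (d k \<omega>) \<partial>M)" by metis
  have d_bd: "(\<integral>\<omega>. norm (d k \<omega>) \<partial>M) \<le> \<delta> (Suc k) + \<delta> k" for k
  proof -
    have "(\<integral>\<omega>. norm (d k \<omega>) \<partial>M) \<le> (\<integral>\<omega>. norm (t (Suc k) \<omega> - f \<omega>) + norm (t k \<omega> - f \<omega>) \<partial>M)"
    proof (rule integral_mono)
      show "norm (d k \<omega>) \<le> norm (t (Suc k) \<omega> - f \<omega>) + norm (t k \<omega> - f \<omega>)" for \<omega>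
        unfolding d_def using norm_triangle_ineq4[of "t (Suc k) \<omega> - f \<omega>" "t k \<omega> - f \<omega>"] by simp
    qed (use t_int f d_int in auto)
    then show ?thesis using t_int f by (simp add: \<delta>_def)
  qed
  have g_int: "integrable M (g k)" and g_meas[measurable]: "g k \<in> borel_measurable F"
    and g_set: "A \<in> sets F \<Longrightarrow> set_lebesgue_integral M A (g k) = set_lebesgue_integral M A (d k)" for k A
    using g unfolding is_bochner_cond_exp_def by auto
  have g_sum: "summable (\<lambda>k. \<integral>\<omega>. norm (g k \<omega>) \<partial>M)"
  proof (rule summable_comparison_test')
    show "summable (\<lambda>k. \<delta> (Suc k) + \<delta> k)"
      using \<delta>_summable by (intro summable_add) (simp add: summable_Suc_iff)
    show "norm (\<integral>\<omega>. norm (g k \<omega>) \<partial>M) \<le> \<delta> (Suc k) + \<delta> k" for k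
      using g_bd[of k] d_bd[of k] by (simp add: integral_nonneg_AE)
  qed
  note g_AE = AE_summable_if_summable_integral_norm[OF g_int g_sum]
  \<comment> \<open>Where the series diverges, the default value of the infinite sum is taken; this
    keeps \<open>G\<close> measurable for \<open>F\<close> everywhere.\<close>
  define G where "G \<omega> = (\<Sum>k. g k \<omega>)" for \<omega>
  have "is_bochner_cond_exp M F f G"
    unfolding is_bochner_cond_exp_def
  proof (intro conjI ballI)
    show "G \<in> borel_measurable F" unfolding G_def by measurable
    show "integrable M G" unfolding G_def by (rule integrable_suminf[OF g_int g_AE g_sum])
    fix A assume A: "A \<in> sets F"
    then have [measurable]: "A \<in> sets M" by (rule sets_F)
    have iA: "integrable M (\<lambda>\<omega>. indicator A \<omega> *\<^sub>R h \<omega>)" if "integrable M h" for h :: "'a \<Rightarrow> 'b"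
      using integrable_mult_indicator[OF \<open>A \<in> sets M\<close> that] .
    have sumA: "summable (\<lambda>k. \<integral>\<omega>. norm (indicator A \<omega> *\<^sub>R g k \<omega>) \<partial>M)"
    proof (rule summable_comparison_test'[OF g_sum])
      show "norm (\<integral>\<omega>. norm (indicator A \<omega> *\<^sub>R g k \<omega>) \<partial>M) \<le> (\<integral>\<omega>. norm (g k \<omega>) \<partial>M)" for k
        using integral_mono[OF integrable_norm[OF iA[OF g_int[of k]]] integrable_norm[OF g_int[of k]]]
        by (auto simp: integral_nonneg_AE indicator_def)
    qed
    have "(\<lambda>k. \<integral>\<omega>. indicator A \<omega> *\<^sub>R g k \<omega> \<partial>M) sums (\<integral>\<omega>. (\<Sum>k. indicator A \<omega> *\<^sub>R g k \<omega>) \<partial>M)"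
      by (rule sums_integral[OF iA[OF g_int] AE_summable_if_summable_integral_norm[OF iA[OF g_int] sumA] sumA])
    also have "(\<integral>\<omega>. (\<Sum>k. indicator A \<omega> *\<^sub>R g k \<omega>) \<partial>M) = set_lebesgue_integral M A G"
      unfolding set_lebesgue_integral_def G_def
      by (intro Bochner_Integration.integral_cong refl) (auto simp: indicator_def)
    finally have "(\<lambda>n. \<Sum>k<n. set_lebesgue_integral M A (d k)) \<longlonglongrightarrow> set_lebesgue_integral M A G"
      using g_set[OF A] unfolding sums_def set_lebesgue_integral_def by simp
    moreover have "(\<Sum>k<n. set_lebesgue_integral M A (d k)) = set_lebesgue_integral M A (t n)" for n
    proof (induction n)
      case 0 then show ?case by (simp add: t_def set_lebesgue_integral_def)
    next
      case (Suc n)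
      have "set_lebesgue_integral M A (d n) = set_lebesgue_integral M A (t (Suc n)) - set_lebesgue_integral M A (t n)"
        unfolding d_def set_lebesgue_integral_def
        using iA[OF t_int] by (simp add: scaleR_diff_right)
      with Suc show ?case by simp
    qed
    ultimately have 1: "(\<lambda>n. set_lebesgue_integral M A (t n)) \<longlonglongrightarrow> set_lebesgue_integral M A G" by simp
    have "(\<lambda>n. set_lebesgue_integral M A (t n)) \<longlonglongrightarrow> set_lebesgue_integral M A f"
    proof (rule LIM_zero_cancel, rule Lim_null_comparison)
      show "\<delta> \<longlonglongrightarrow> 0" using \<delta>_summable by (rule summable_LIMSEQ_zero)
      show "\<forall>\<^sub>F n in sequentially. norm (set_lebesgue_integral M A (t n) - set_lebesgue_integral M A f) \<le> \<delta> n"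
      proof (rule always_eventually, rule allI)
        fix n
        have "set_lebesgue_integral M A (t n) - set_lebesgue_integral M A f = (\<integral>\<omega>. indicator A \<omega> *\<^sub>R (t n \<omega> - f \<omega>) \<partial>M)"
          unfolding set_lebesgue_integral_def using iA[OF t_int] iA[OF f] by (simp add: scaleR_diff_right)
        also have "norm \<dots> \<le> (\<integral>\<omega>. norm (indicator A \<omega> *\<^sub>R (t n \<omega> - f \<omega>)) \<partial>M)"
          by (rule integral_norm_bound)
        also have "\<dots> \<le> \<delta> n"
          unfolding \<delta>_def
          using integral_mono[OF integrable_norm[OF iA[of "\<lambda>\<omega>. t n \<omega> - f \<omega>"]]
              integrable_norm[of M "\<lambda>\<omega>. t n \<omega> - f \<omega>"]] t_int f
          by (auto simp: indicator_def)
        finally show "norm (set_lebesgue_integral M A (t n) - set_lebesgue_integral M A f) \<le> \<delta> n" .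
      qed
    qed
    with 1 show "set_lebesgue_integral M A G = set_lebesgue_integral M A f" by (rule LIMSEQ_unique)
  qed
  then show ?thesis by blast
qed

lemma bochner_cond_exp:
  assumes "integrable M f"
  shows "is_bochner_cond_exp M F f (bochner_cond_exp M F f)"
  unfolding bochner_cond_exp_def using ex_bochner_cond_exp[OF assms] by (rule someI_ex)

text \<open>For simple \<open>W\<close> each value \<open>w\<close> contributes the image under
  \<open>\<Phi> w\<close> of an integral over a set of \<open>F\<close>; a bounded \<open>W\<close>
  follows by continuity and dominated convergence. Linearity is asked of the second argument only,
  because derivatives of the squared norm and characters of partial sums enter through the first
  one.\<close>

lemma bochner_cond_exp_pairing:
  fixes f g :: "'a \<Rightarrow> 'b::{banach, second_countable_topology}"
    and W :: "'a \<Rightarrow> 'c::{real_normed_vector, second_countable_topology}"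
    and \<Phi> :: "'c \<Rightarrow> 'b \<Rightarrow> 'd::{banach, second_countable_topology}"
  assumes g: "is_bochner_cond_exp M F f g" and f: "integrable M f"
    and W[measurable]: "W \<in> borel_measurable F" and W_bd: "\<And>\<omega>. \<omega> \<in> space M \<Longrightarrow> norm (W \<omega>) \<le> K"
    and lin: "\<And>w. bounded_linear (\<Phi> w)"
    and cont: "continuous_on UNIV (\<lambda>(w, b). \<Phi> w b)"
    and bd: "\<And>w b. norm (\<Phi> w b) \<le> C * norm w * norm b" and "C \<ge> 0"
  shows "(\<integral>\<omega>. \<Phi> (W \<omega>) (f \<omega>) \<partial>M) = (\<integral>\<omega>. \<Phi> (W \<omega>) (g \<omega>) \<partial>M)"
proof -
  have g_int: "integrable M g" and g_set: "\<And>A. A \<in> sets F \<Longrightarrow> set_lebesgue_integral M A g = set_lebesgue_integral M A f"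
    using g unfolding is_bochner_cond_exp_def by auto
  obtain s where "\<forall>i. simple_function F (s i)" "\<forall>\<omega>\<in>space F. (\<lambda>i. s i \<omega>) \<longlonglongrightarrow> W \<omega>"
    "\<forall>i. \<forall>\<omega>\<in>space F. dist (s i \<omega>) 0 \<le> 2 * dist (W \<omega>) 0"
    using borel_measurable_implies_sequence_metric[OF W, of 0] by (elim exE conjE) (rule that)
  then have s: "simple_function F (s i)" and s_lim: "\<omega> \<in> space M \<Longrightarrow> (\<lambda>i. s i \<omega>) \<longlonglongrightarrow> W \<omega>"
    and s_bd: "\<omega> \<in> space M \<Longrightarrow> norm (s i \<omega>) \<le> 2 * norm (W \<omega>)" for i \<omega>
    by (auto simp: space_F)
  have s_meas: "s i \<in> borel_measurable M" for i
    using borel_measurable_simple_function[OF s] by (rule F_measurableD)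
  have W_meas: "W \<in> borel_measurable M" using W by (rule F_measurableD)
  have \<Phi>_meas: "(\<lambda>\<omega>. \<Phi> (V \<omega>) (h \<omega>)) \<in> borel_measurable M"
    if "V \<in> borel_measurable M" "h \<in> borel_measurable M" for V h
    by (rule measurable_pairing[OF cont that])
  have lim: "(\<lambda>i. \<integral>\<omega>. \<Phi> (s i \<omega>) (h \<omega>) \<partial>M) \<longlonglongrightarrow> (\<integral>\<omega>. \<Phi> (W \<omega>) (h \<omega>) \<partial>M)"
    if h: "integrable M h" for h
  proof (rule integral_dominated_convergence)
    have [measurable]: "h \<in> borel_measurable M" using h by auto
    show "(\<lambda>\<omega>. \<Phi> (W \<omega>) (h \<omega>)) \<in> borel_measurable M" "(\<lambda>\<omega>. \<Phi> (s i \<omega>) (h \<omega>)) \<in> borel_measurable M" for i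
      using W_meas s_meas by (auto intro!: \<Phi>_meas)
    show "integrable M (\<lambda>\<omega>. C * (2 * K) * norm (h \<omega>))" using h by auto
    show "AE \<omega> in M. (\<lambda>i. \<Phi> (s i \<omega>) (h \<omega>)) \<longlonglongrightarrow> \<Phi> (W \<omega>) (h \<omega>)"
    proof (rule AE_I2)
      fix \<omega> assume "\<omega> \<in> space M"
      from tendsto_Pair[OF s_lim[OF this] tendsto_const[of "h \<omega>"]]
      have "(\<lambda>i. (\<lambda>(w, b). \<Phi> w b) (s i \<omega>, h \<omega>)) \<longlonglongrightarrow> (\<lambda>(w, b). \<Phi> w b) (W \<omega>, h \<omega>)"
        by (rule continuous_on_tendsto_compose[OF cont]) auto
      then show "(\<lambda>i. \<Phi> (s i \<omega>) (h \<omega>)) \<longlonglongrightarrow> \<Phi> (W \<omega>) (h \<omega>)" by simp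
    qed
    show "AE \<omega> in M. norm (\<Phi> (s i \<omega>) (h \<omega>)) \<le> C * (2 * K) * norm (h \<omega>)" for i
    proof (rule AE_I2)
      fix \<omega> assume \<omega>: "\<omega> \<in> space M"
      have "norm (s i \<omega>) \<le> 2 * K" using s_bd[OF \<omega>, of i] W_bd[OF \<omega>] by simp
      then have "C * norm (s i \<omega>) * norm (h \<omega>) \<le> C * (2 * K) * norm (h \<omega>)"
        using \<open>C \<ge> 0\<close> by (intro mult_right_mono mult_left_mono) auto
      with bd[of "s i \<omega>" "h \<omega>"] show "norm (\<Phi> (s i \<omega>) (h \<omega>)) \<le> C * (2 * K) * norm (h \<omega>)" by linarith
    qed
  qed
  have eq: "(\<integral>\<omega>. \<Phi> (s i \<omega>) (f \<omega>) \<partial>M) = (\<integral>\<omega>. \<Phi> (s i \<omega>) (g \<omega>) \<partial>M)" for i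
  proof -
    define A where "A w = s i -` {w} \<inter> space M" for w
    have A: "A w \<in> sets F" for w
      using simple_functionD(2)[OF s[of i]] unfolding A_def by (simp flip: space_F)
    have "(\<integral>\<omega>. \<Phi> (s i \<omega>) (h \<omega>) \<partial>M) = (\<Sum>w\<in>s i ` space M. \<Phi> w (set_lebesgue_integral M (A w) h))"
      if h: "integrable M h" for h
    proof -
      have "(\<integral>\<omega>. \<Phi> (s i \<omega>) (h \<omega>) \<partial>M) = (\<integral>\<omega>. (\<Sum>w\<in>s i ` space M. \<Phi> w (indicator (A w) \<omega> *\<^sub>R h \<omega>)) \<partial>M)"
      proof (rule Bochner_Integration.integral_cong[OF refl])
        fix \<omega> assume \<omega>: "\<omega> \<in> space M"
        have "\<Phi> (s i \<omega>) (h \<omega>) = (\<Sum>w\<in>s i ` space F. indicator (s i -` {w} \<inter> space F) \<omega> *\<^sub>R \<Phi> w (h \<omega>))"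
          using simple_function_indicator_sum[OF s[of i], of \<omega> "\<lambda>w. \<Phi> w (h \<omega>)"] \<omega> by (simp add: space_F)
        then show "\<Phi> (s i \<omega>) (h \<omega>) = (\<Sum>w\<in>s i ` space M. \<Phi> w (indicator (A w) \<omega> *\<^sub>R h \<omega>))"
          by (simp add: space_F A_def linear_simps(5)[OF lin])
      qed
      also have "\<dots> = (\<Sum>w\<in>s i ` space M. \<Phi> w (set_lebesgue_integral M (A w) h))"
        unfolding set_lebesgue_integral_def
        using integrable_mult_indicator[OF sets_F[OF A] h]
        by (subst Bochner_Integration.integral_sum)
          (auto intro!: integrable_bounded_linear[OF lin] sum.cong integral_bounded_linear[OF lin])
      finally show ?thesis .
    qed
    from this[OF f] this[OF g_int] g_set[OF A] show ?thesis by simp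
  qed
  from LIMSEQ_unique[OF lim[OF f]] lim[OF g_int] show ?thesis by (simp add: eq)
qed

end

section \<open>Stationary adapted sequences\<close>

lemma integrable_mult_of_squares:
  fixes f g :: "'a \<Rightarrow> real"
  assumes [measurable]: "f \<in> borel_measurable M" "g \<in> borel_measurable M"
    and "integrable M (\<lambda>x. (f x)\<^sup>2)" "integrable M (\<lambda>x. (g x)\<^sup>2)"
  shows "integrable M (\<lambda>x. f x * g x)"
proof (rule Bochner_Integration.integrable_bound)
  show "integrable M (\<lambda>x. (f x)\<^sup>2 + (g x)\<^sup>2)" using assms by auto
  have "\<bar>a * b\<bar> \<le> \<bar>a\<^sup>2 + b\<^sup>2\<bar>" for a b :: real
  proof -
    have "2 * (\<bar>a\<bar> * \<bar>b\<bar>) \<le> a\<^sup>2 + b\<^sup>2"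
      using sum_squares_bound[of "\<bar>a\<bar>" "\<bar>b\<bar>"] by (simp add: mult.assoc)
    moreover have "0 \<le> \<bar>a\<bar> * \<bar>b\<bar>" by simp
    ultimately show ?thesis unfolding abs_mult by linarith
  qed
  then show "AE x in M. norm (f x * g x) \<le> norm ((f x)\<^sup>2 + (g x)\<^sup>2)" by simp
qed measurable

lemma integrable_norm_sq_add:
  fixes f g :: "'a \<Rightarrow> 'b::{real_normed_vector, second_countable_topology}"
  assumes [measurable]: "f \<in> borel_measurable M" "g \<in> borel_measurable M"
    and "integrable M (\<lambda>x. (norm (f x))\<^sup>2)" "integrable M (\<lambda>x. (norm (g x))\<^sup>2)"
  shows "integrable M (\<lambda>x. (norm (f x + g x))\<^sup>2)"
proof (rule Bochner_Integration.integrable_bound)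
  show "integrable M (\<lambda>x. 2 * (norm (f x))\<^sup>2 + 2 * (norm (g x))\<^sup>2)" using assms by auto
  have "(norm (a + b))\<^sup>2 \<le> 2 * (norm a)\<^sup>2 + 2 * (norm b)\<^sup>2" for a b :: 'b
  proof -
    have "(norm (a + b))\<^sup>2 \<le> (norm a + norm b)\<^sup>2" by (intro power_mono norm_triangle_ineq) auto
    also have "\<dots> \<le> 2 * (norm a)\<^sup>2 + 2 * (norm b)\<^sup>2"
      using sum_squares_bound[of "norm a" "norm b"] by (simp add: power2_sum)
    finally show ?thesis .
  qed
  then show "AE x in M. norm ((norm (f x + g x))\<^sup>2) \<le> norm (2 * (norm (f x))\<^sup>2 + 2 * (norm (g x))\<^sup>2)" by simp
qed measurable

lemma (in finite_measure) integrable_if_norm_sq_integrable: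
  fixes f :: "'a \<Rightarrow> 'b::{banach, second_countable_topology}"
  assumes [measurable]: "f \<in> borel_measurable M" and "integrable M (\<lambda>x. (norm (f x))\<^sup>2)"
  shows "integrable M f"
proof (rule Bochner_Integration.integrable_bound)
  show "integrable M (\<lambda>x. 1 + (norm (f x))\<^sup>2)" using assms by auto
  have "a \<le> 1 + a\<^sup>2" for a :: real
    using zero_le_power2[of "a - 1/2"] by (simp add: power2_eq_square algebra_simps)
  then show "AE x in M. norm (f x) \<le> norm (1 + (norm (f x))\<^sup>2)" by simp
qed measurable

text \<open>In the induction the new increment \<open>S (Suc n) - S n\<close> is added to every
  future sum; the increments of \<open>\<Phi>\<close> paired with it telescope to
  \<open>\<Phi> (S n)\<close> because \<open>\<Phi>\<close> vanishes at \<open>S 0\<close>, and the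
  new last term has an empty future.\<close>

lemma sum_by_parts_pairing:
  fixes \<Phi> :: "'b::real_normed_vector \<Rightarrow> 'b \<Rightarrow> 'd::real_normed_vector"
  assumes lin: "\<And>w. bounded_linear (\<Phi> w)" and zero: "\<And>b. \<Phi> (S 0) b = 0"
  shows "(\<Sum>k<n. \<Phi> (S k) (S (Suc k) - S k)) =
    (\<Sum>l<n. \<Phi> (S (Suc l)) (S n - S (Suc l)) - \<Phi> (S l) (S n - S (Suc l)))"
proof (induction n)
  case (Suc n)
  have telescope: "(\<Sum>l<n. \<Phi> (S (Suc l)) b - \<Phi> (S l) b) = \<Phi> (S n) b" for b
    by (subst sum_lessThan_telescope) (simp add: zero)
  have "(\<Sum>l<Suc n. \<Phi> (S (Suc l)) (S (Suc n) - S (Suc l)) - \<Phi> (S l) (S (Suc n) - S (Suc l)))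
    = (\<Sum>l<n. \<Phi> (S (Suc l)) (S (Suc n) - S (Suc l)) - \<Phi> (S l) (S (Suc n) - S (Suc l)))"
    using linear_simps(3)[OF lin] by simp
  also have "\<dots> = (\<Sum>l<n. (\<Phi> (S (Suc l)) (S n - S (Suc l)) - \<Phi> (S l) (S n - S (Suc l)))
      + (\<Phi> (S (Suc l)) (S (Suc n) - S n) - \<Phi> (S l) (S (Suc n) - S n)))"
    by (intro sum.cong refl) (simp add: linear_simps(2)[OF lin])
  also have "\<dots> = (\<Sum>k<Suc n. \<Phi> (S k) (S (Suc k) - S k))"
    by (simp add: sum.distrib telescope Suc)
  finally show ?case ..
qed simp

locale stationary_adapted = prob_space M
  for M :: "'a measure" +
  fixes T :: "'a \<Rightarrow> 'a"
    and X :: "int \<Rightarrow> 'a \<Rightarrow> 'b::{banach, second_countable_topology}"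
    and F :: "int \<Rightarrow> 'a measure"
  assumes shift: "bimeasurable_mp M T"
    and stat_X: "stationary_process M T X"
    and stat_F: "stationary_filtration M T F"
    and adapted: "X 0 \<in> borel_measurable (F 0)"
    and sq_int: "integrable M (\<lambda>\<omega>. (norm (X 0 \<omega>))\<^sup>2)"
begin

abbreviation S :: "nat \<Rightarrow> 'a \<Rightarrow> 'b" where "S \<equiv> partial_sum X"

sublocale F0: finite_measure_subalgebra M "F 0"
  using stat_F by unfold_locales (simp add: stationary_filtration_def)

lemma T_measurable[measurable]: "T \<in> measurable M M"
  using shift by (simp add: bimeasurable_mp_def)

lemma T_funpow_measurable[measurable]: "T ^^ l \<in> measurable M M"
  by (induction l) auto

lemma T_space: "\<omega> \<in> space M \<Longrightarrow> T \<omega> \<in> space M"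
  using measurable_space[OF T_measurable] .

lemma T_funpow_space: "\<omega> \<in> space M \<Longrightarrow> (T ^^ l) \<omega> \<in> space M"
  using measurable_space[OF T_funpow_measurable] .

lemma distr_T_funpow: "distr M M (T ^^ l) = M"
proof (induction l)
  case 0 then show ?case by (simp add: distr_id2)
next
  case (Suc l)
  have "distr M M (T ^^ Suc l) = distr (distr M M (T ^^ l)) M T"
    by (subst distr_distr) auto
  also have "\<dots> = M" using Suc shift by (simp add: bimeasurable_mp_def)
  finally show ?case .
qed

lemma integral_shift:
  fixes h :: "'a \<Rightarrow> 'c::{banach, second_countable_topology}"
  assumes "h \<in> borel_measurable M"
  shows "(\<integral>\<omega>. h ((T ^^ l) \<omega>) \<partial>M) = (\<integral>\<omega>. h \<omega> \<partial>M)"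
  using integral_distr[OF T_funpow_measurable, of h l] assms by (simp add: distr_T_funpow)

lemma integrable_shift:
  fixes h :: "'a \<Rightarrow> 'c::{banach, second_countable_topology}"
  assumes "h \<in> borel_measurable M"
  shows "integrable M (\<lambda>\<omega>. h ((T ^^ l) \<omega>)) \<longleftrightarrow> integrable M h"
  using integrable_distr_eq[OF T_funpow_measurable, of h l] assms by (simp add: distr_T_funpow)

lemma int_iterate_space:
  assumes "\<omega> \<in> space M"
  shows "int_iterate M T i \<omega> \<in> space M"
proof -
  have inv: "inv_into (space M) T \<in> measurable M M" using shift by (simp add: bimeasurable_mp_def)
  have "inv_into (space M) T ^^ k \<in> measurable M M" for k
  proof (induction k)
    case (Suc k)
    then show ?case unfolding funpow.simps using inv by (rule measurable_comp)
  qed auto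
  from measurable_space[OF this assms] T_funpow_space[OF assms] show ?thesis
    unfolding int_iterate_def by (cases "0 \<le> i") simp_all
qed

lemma int_iterate_T:
  assumes "\<omega> \<in> space M"
  shows "int_iterate M T (i + 1) \<omega> = int_iterate M T i (T \<omega>)"
proof (cases "0 \<le> i")
  case True
  then have "nat (i + 1) = Suc (nat i)" by simp
  with True show ?thesis by (simp add: int_iterate_def funpow_swap1)
next
  case False
  define k where "k = nat (- i - 1)"
  have k: "nat (- i) = Suc k" "nat (- (i + 1)) = k" using False by (auto simp: k_def)
  have "inv_into (space M) T (T \<omega>) = \<omega>"
    using shift assms by (auto simp: bimeasurable_mp_def bij_betw_def inv_into_f_f)
  then have 1: "int_iterate M T i (T \<omega>) = (inv_into (space M) T ^^ k) \<omega>"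
    using False k by (simp add: int_iterate_def funpow_swap1)
  show ?thesis
  \<comment> \<open>At \<open>i = -1\<close> the index \<open>i + 1\<close> is 0 and falls under the
    other branch of \<open>int_iterate\<close>.\<close>
  proof (cases "i = -1")
    case True
    then show ?thesis unfolding 1 by (simp add: int_iterate_def k_def)
  next
    case False
    with \<open>\<not> 0 \<le> i\<close> show ?thesis unfolding 1 using k by (simp add: int_iterate_def)
  qed
qed

lemma X_T: "\<omega> \<in> space M \<Longrightarrow> X i (T \<omega>) = X (i + 1) \<omega>"
  using stat_X T_space[of \<omega>] int_iterate_T[of \<omega> i] unfolding stationary_process_def by metis

lemma X_T_funpow: "\<omega> \<in> space M \<Longrightarrow> X i ((T ^^ l) \<omega>) = X (i + int l) \<omega>"
proof (induction l arbitrary: i)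
  case (Suc l)
  have "X i ((T ^^ Suc l) \<omega>) = X (i + 1) ((T ^^ l) \<omega>)"
    using X_T[OF T_funpow_space[OF Suc.prems]] by simp
  also have "\<dots> = X (i + 1 + int l) \<omega>" by (rule Suc.IH[OF Suc.prems])
  finally show ?case by (simp add: algebra_simps)
qed simp

lemma X_measurable_F: "X i \<in> borel_measurable (F i)"
proof (rule measurableI)
  fix B :: "'b set" assume B: "B \<in> sets borel"
  have sp: "space (F i) = space M" for i using stat_F by (auto simp: stationary_filtration_def subalgebra_def)
  have eqF: "sets (F i) = {int_iterate M T i -` A \<inter> space M | A. A \<in> sets (F 0)}"
    using stat_F unfolding stationary_filtration_def by (elim conjE) (rule spec)
  have A: "X 0 -` B \<inter> space M \<in> sets (F 0)" using measurable_sets[OF adapted B] by (simp add: sp)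
  have eq: "X i -` B \<inter> space M = int_iterate M T i -` (X 0 -` B \<inter> space M) \<inter> space M"
  proof (intro set_eqI)
    fix \<omega>
    show "\<omega> \<in> X i -` B \<inter> space M \<longleftrightarrow> \<omega> \<in> int_iterate M T i -` (X 0 -` B \<inter> space M) \<inter> space M"
    proof (cases "\<omega> \<in> space M")
      case True
      then have "X i \<omega> = X 0 (int_iterate M T i \<omega>)"
        using stat_X unfolding stationary_process_def by blast
      then show ?thesis using True int_iterate_space[OF True] by simp
    qed simp
  qed
  show "X i -` B \<inter> space (F i) \<in> sets (F i)"
    unfolding sp eqF mem_Collect_eq by (intro exI[of _ "X 0 -` B \<inter> space M"] conjI eq A)
qed simp

lemma sets_F_mono: "i \<le> j \<Longrightarrow> sets (F i) \<subseteq> sets (F j)"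
proof (induction j rule: int_ge_induct)
  case (step j)
  have "sets (F j) \<subseteq> sets (F (j + 1))"
    using stat_F unfolding stationary_filtration_def by (elim conjE) (rule spec)
  with step(2) show ?case by (rule order_trans)
qed simp

lemma X_measurable_F0: "i \<le> 0 \<Longrightarrow> X i \<in> borel_measurable (F 0)"
proof -
  assume "i \<le> 0"
  moreover have "space (F i) = space (F 0)"
    using stat_F by (auto simp: stationary_filtration_def subalgebra_def)
  ultimately have "subalgebra (F 0) (F i)" using sets_F_mono by (simp add: subalgebra_def)
  then show ?thesis using X_measurable_F[of i] by (rule measurable_from_subalg)
qed

lemma X_measurable[measurable]: "X i \<in> borel_measurable M"
proof -
  have "subalgebra M (F i)" using stat_F by (simp add: stationary_filtration_def)
  then show ?thesis using X_measurable_F[of i] by (rule measurable_from_subalg)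
qed

lemma S_measurable[measurable]: "S n \<in> borel_measurable M"
  unfolding partial_sum_def by measurable

lemma S_0: "S 0 \<omega> = 0" by (simp add: partial_sum_def)

lemma S_Suc: "S (Suc n) \<omega> = S n \<omega> + X (int (Suc n)) \<omega>"
  by (simp add: partial_sum_def)

lemma S_T_funpow: "\<omega> \<in> space M \<Longrightarrow> S n ((T ^^ l) \<omega>) = S (l + n) \<omega> - S l \<omega>"
proof (induction n)
  case (Suc n)
  have "X (int (Suc n)) ((T ^^ l) \<omega>) = X (int (Suc (l + n))) \<omega>"
    unfolding X_T_funpow[OF Suc.prems] by (simp add: algebra_simps)
  then show ?case unfolding S_Suc Suc.IH[OF Suc.prems] add_Suc_right by simp
qed (simp add: S_0)

text \<open>Only forward powers of \<open>T\<close> occur: a negative index is shifted up to 0, a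
  nonnegative one is reached from 0.\<close>

lemma X_law:
  fixes \<phi> :: "'b \<Rightarrow> 'c::{banach, second_countable_topology}"
  assumes [measurable]: "\<phi> \<in> borel_measurable borel"
  shows "(\<integral>\<omega>. \<phi> (X i \<omega>) \<partial>M) = (\<integral>\<omega>. \<phi> (X 0 \<omega>) \<partial>M)"
    and "integrable M (\<lambda>\<omega>. \<phi> (X i \<omega>)) \<longleftrightarrow> integrable M (\<lambda>\<omega>. \<phi> (X 0 \<omega>))"
proof -
  have "(\<integral>\<omega>. \<phi> (X i \<omega>) \<partial>M) = (\<integral>\<omega>. \<phi> (X (i + int l) \<omega>) \<partial>M) \<and>
      integrable M (\<lambda>\<omega>. \<phi> (X i \<omega>)) = integrable M (\<lambda>\<omega>. \<phi> (X (i + int l) \<omega>))" for i l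
  proof -
    have m: "(\<lambda>\<omega>. \<phi> (X i \<omega>)) \<in> borel_measurable M" by measurable
    have "(\<integral>\<omega>. \<phi> (X i ((T ^^ l) \<omega>)) \<partial>M) = (\<integral>\<omega>. \<phi> (X (i + int l) \<omega>) \<partial>M)"
      by (intro Bochner_Integration.integral_cong refl) (simp add: X_T_funpow)
    moreover have "integrable M (\<lambda>\<omega>. \<phi> (X i ((T ^^ l) \<omega>))) = integrable M (\<lambda>\<omega>. \<phi> (X (i + int l) \<omega>))"
      by (intro Bochner_Integration.integrable_cong refl) (simp add: X_T_funpow)
    ultimately show ?thesis using integral_shift[OF m, of l] integrable_shift[OF m, of l] by simp
  qed
  note * = this
  have both: "(\<integral>\<omega>. \<phi> (X i \<omega>) \<partial>M) = (\<integral>\<omega>. \<phi> (X 0 \<omega>) \<partial>M) \<and>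
    integrable M (\<lambda>\<omega>. \<phi> (X i \<omega>)) = integrable M (\<lambda>\<omega>. \<phi> (X 0 \<omega>))"
  proof (cases "0 \<le> i")
    case True
    then have "0 + int (nat i) = i" by simp
    from *[of 0 "nat i", unfolded this] show ?thesis by metis
  next
    case False
    then have "i + int (nat (- i)) = 0" by simp
    from *[of i "nat (- i)", unfolded this] show ?thesis .
  qed
  show "(\<integral>\<omega>. \<phi> (X i \<omega>) \<partial>M) = (\<integral>\<omega>. \<phi> (X 0 \<omega>) \<partial>M)"
    by (rule conjunct1[OF both])
  show "integrable M (\<lambda>\<omega>. \<phi> (X i \<omega>)) \<longleftrightarrow> integrable M (\<lambda>\<omega>. \<phi> (X 0 \<omega>))"
    by (rule conjunct2[OF both])
qed

lemma X_sq_integrable: "integrable M (\<lambda>\<omega>. (norm (X i \<omega>))\<^sup>2)"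
  using X_law(2)[of "\<lambda>x. (norm x)\<^sup>2" i] sq_int by simp

lemma X_integrable: "integrable M (X i)"
  by (rule integrable_if_norm_sq_integrable[OF X_measurable X_sq_integrable])

lemma S_sq_integrable: "integrable M (\<lambda>\<omega>. (norm (S n \<omega>))\<^sup>2)"
proof (induction n)
  case (Suc n)
  have "integrable M (\<lambda>\<omega>. (norm (S n \<omega> + X (int (Suc n)) \<omega>))\<^sup>2)"
    using S_measurable X_measurable Suc.IH X_sq_integrable by (rule integrable_norm_sq_add)
  then show ?case by (simp only: S_Suc)
next
  case 0
  show ?case by (simp only: S_0 norm_zero power2_eq_square mult_zero_left integrable_zero)
qed

lemma S_integrable: "integrable M (S n)"
  by (rule integrable_if_norm_sq_integrable[OF S_measurable S_sq_integrable])

text \<open>Shifting by \<open>T\<close> makes the increment of \<open>\<Phi>\<close> an \<open>F 0\<close>-measurable quantity of size at most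
  \<open>L * norm (X 0)\<close>, so \<open>f\<close> may be replaced by its conditional expectation.\<close>

lemma increment_pairing_bound:
  fixes \<Phi> :: "'b \<Rightarrow> 'b \<Rightarrow> 'd::{banach, second_countable_topology}"
    and R :: "'b \<Rightarrow> 'e::real_normed_vector"
  assumes g: "is_bochner_cond_exp M (F 0) f g" and f: "integrable M f"
    and f_sq: "integrable M (\<lambda>\<omega>. (norm (f \<omega>))\<^sup>2)"
    and g_int: "integrable M (\<lambda>\<omega>. norm (X 0 \<omega>) * norm (R (g \<omega>)))"
    and lin: "\<And>w. bounded_linear (\<Phi> w)" and cont: "continuous_on UNIV (\<lambda>(w, b). \<Phi> w b)"
    and zero: "\<And>b. \<Phi> 0 b = 0" and R: "bounded_linear R"
    and lip: "\<And>v w b. norm (\<Phi> v b - \<Phi> w b) \<le> L * norm (v - w) * norm (R b)"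
    and "L \<ge> 0"
  shows "norm (\<integral>\<omega>. \<Phi> (S (Suc l) \<omega>) (f ((T ^^ Suc l) \<omega>)) - \<Phi> (S l \<omega>) (f ((T ^^ Suc l) \<omega>)) \<partial>M)
    \<le> L * (\<integral>\<omega>. norm (X 0 \<omega>) * norm (R (g \<omega>)) \<partial>M)"
proof -
  obtain K where "K \<ge> 0" "\<forall>b. norm (R b) \<le> norm b * K"
    using bounded_linear.nonneg_bounded[OF R] by (elim exE conjE) (rule that)
  then have K: "K \<ge> 0" "norm (R b) \<le> norm b * K" for b by auto
  have [measurable]: "f \<in> borel_measurable M" using f by auto
  have g': "integrable M g" using g unfolding is_bochner_cond_exp_def by auto
  then have [measurable]: "g \<in> borel_measurable M" by auto
  have R_meas[measurable]: "R \<in> borel_measurable borel"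
    by (intro borel_measurable_continuous_onI linear_continuous_on R)
  have \<Phi>_meas: "(\<lambda>\<omega>. \<Phi> (V \<omega>) (h \<omega>)) \<in> borel_measurable M"
    if "V \<in> borel_measurable M" "h \<in> borel_measurable M" for V h
    by (rule measurable_pairing[OF cont that])
  have bd: "norm (\<Phi> w b) \<le> (L * K) * norm w * norm b" for w b
  proof -
    have "norm (\<Phi> w b) \<le> L * norm w * norm (R b)" using lip[of w b 0] by (simp add: zero)
    also have "\<dots> \<le> L * norm w * (norm b * K)" using K \<open>L \<ge> 0\<close> by (intro mult_left_mono) auto
    finally show ?thesis by (simp add: mult_ac)
  qed
  \<comment> \<open>\<open>V\<close> and \<open>W\<close> are \<open>S l\<close> and
    \<open>S (Suc l)\<close> moved back by \<open>Suc l\<close> steps: they involve the indices from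
    \<open>-l\<close> to 0 only, hence are \<open>F 0\<close>-measurable, and they differ by
    \<open>X 0\<close>.\<close>
  define V where "V \<omega> = (\<Sum>k=1..l. X (int k - int (Suc l)) \<omega>)" for \<omega>
  define W where "W \<omega> = V \<omega> + X 0 \<omega>" for \<omega>
  have V_F[measurable]: "V \<in> borel_measurable (F 0)"
    unfolding V_def by (intro borel_measurable_sum X_measurable_F0) auto
  have W_F[measurable]: "W \<in> borel_measurable (F 0)"
    unfolding W_def by (intro borel_measurable_add V_F X_measurable_F0) auto
  have [measurable]: "V \<in> borel_measurable M" "W \<in> borel_measurable M"
    using V_F W_F by (auto intro: F0.F_measurableD)
  have V_T: "V ((T ^^ Suc l) \<omega>) = S l \<omega>" if "\<omega> \<in> space M" for \<omega>
    unfolding V_def partial_sum_def by (simp only: X_T_funpow[OF that]) simp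
  have W_T: "W ((T ^^ Suc l) \<omega>) = S (Suc l) \<omega>" if "\<omega> \<in> space M" for \<omega>
    unfolding W_def V_T[OF that] X_T_funpow[OF that] S_Suc by simp
  define H where "H h \<omega> = \<Phi> (W \<omega>) (h \<omega>) - \<Phi> (V \<omega>) (h \<omega>)" for h \<omega>
  have H_meas[measurable]: "H h \<in> borel_measurable M" if "h \<in> borel_measurable M" for h
    unfolding H_def using that by (intro borel_measurable_diff \<Phi>_meas) auto
  have H_bd: "norm (H h \<omega>) \<le> L * norm (X 0 \<omega>) * norm (R (h \<omega>))" for h \<omega>
    using lip[of "W \<omega>" "h \<omega>" "V \<omega>"] by (simp add: H_def W_def)
  have eq1: "(\<integral>\<omega>. \<Phi> (S (Suc l) \<omega>) (f ((T ^^ Suc l) \<omega>)) - \<Phi> (S l \<omega>) (f ((T ^^ Suc l) \<omega>)) \<partial>M) = (\<integral>\<omega>. H f \<omega> \<partial>M)"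
  proof -
    have "(\<integral>\<omega>. \<Phi> (S (Suc l) \<omega>) (f ((T ^^ Suc l) \<omega>)) - \<Phi> (S l \<omega>) (f ((T ^^ Suc l) \<omega>)) \<partial>M) = (\<integral>\<omega>. H f ((T ^^ Suc l) \<omega>) \<partial>M)"
      by (intro Bochner_Integration.integral_cong refl) (simp add: H_def V_T W_T del: funpow.simps)
    also have "\<dots> = (\<integral>\<omega>. H f \<omega> \<partial>M)" by (rule integral_shift) measurable
    finally show ?thesis .
  qed
  \<comment> \<open>The pairing with a conditional expectation asks for bounded factors. Truncation
    to \<open>A n\<close>, a set of \<open>F 0\<close>, provides them; it is removed at the end on
    the side of \<open>f\<close>, where the second moments give a dominating function.\<close>
  define A where "A n = {\<omega> \<in> space M. norm (V \<omega>) \<le> real n \<and> norm (W \<omega>) \<le> real n}" for n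
  have A_F: "A n \<in> sets (F 0)" for n
  proof -
    have "A n = {\<omega> \<in> space (F 0). norm (V \<omega>) \<le> real n \<and> norm (W \<omega>) \<le> real n}"
      by (simp add: A_def F0.space_F)
    also have "\<dots> \<in> sets (F 0)" by measurable
    finally show ?thesis .
  qed
  have A_M[measurable]: "A n \<in> sets M" for n using A_F by (rule F0.sets_F)
  \<comment> \<open>Since \<open>\<Phi>\<close> vanishes at 0 in the first argument, an indicator
    passes through it although \<open>\<Phi>\<close> need not be linear there.\<close>
  have sc: "\<Phi> (indicator (A n) \<omega> *\<^sub>R w) b = indicator (A n) \<omega> *\<^sub>R \<Phi> w b" for n \<omega> w b
    by (simp add: indicator_def zero)
  have le_n: "norm (\<integral>\<omega>. indicator (A n) \<omega> *\<^sub>R H f \<omega> \<partial>M) \<le> L * (\<integral>\<omega>. norm (X 0 \<omega>) * norm (R (g \<omega>)) \<partial>M)" for n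
  proof -
    have pair: "(\<integral>\<omega>. indicator (A n) \<omega> *\<^sub>R \<Phi> (U \<omega>) (f \<omega>) \<partial>M) = (\<integral>\<omega>. indicator (A n) \<omega> *\<^sub>R \<Phi> (U \<omega>) (g \<omega>) \<partial>M)
      \<and> integrable M (\<lambda>\<omega>. indicator (A n) \<omega> *\<^sub>R \<Phi> (U \<omega>) (f \<omega>)) \<and> integrable M (\<lambda>\<omega>. indicator (A n) \<omega> *\<^sub>R \<Phi> (U \<omega>) (g \<omega>))"
      if U[measurable]: "U \<in> borel_measurable (F 0)" and Ub: "\<And>\<omega>. \<omega> \<in> A n \<Longrightarrow> norm (U \<omega>) \<le> real n" for U
    proof (intro conjI)
      have [measurable]: "U \<in> borel_measurable M" using U by (rule F0.F_measurableD)
      have UA: "(\<lambda>\<omega>. indicator (A n) \<omega> *\<^sub>R U \<omega>) \<in> borel_measurable (F 0)"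
        using A_F by (intro borel_measurable_scaleR borel_measurable_indicator U)
      have Ub': "norm (indicator (A n) \<omega> *\<^sub>R U \<omega>) \<le> real n" for \<omega>
        using Ub[of \<omega>] by (auto simp: indicator_def)
      show "(\<integral>\<omega>. indicator (A n) \<omega> *\<^sub>R \<Phi> (U \<omega>) (f \<omega>) \<partial>M) = (\<integral>\<omega>. indicator (A n) \<omega> *\<^sub>R \<Phi> (U \<omega>) (g \<omega>) \<partial>M)"
        using F0.bochner_cond_exp_pairing[OF g f UA Ub' lin cont bd] K \<open>L \<ge> 0\<close> by (simp add: sc)
      have int: "integrable M (\<lambda>\<omega>. indicator (A n) \<omega> *\<^sub>R \<Phi> (U \<omega>) (h \<omega>))" if h: "integrable M h" for h
      proof (rule Bochner_Integration.integrable_bound)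
        show "integrable M (\<lambda>\<omega>. (L * K) * real n * norm (h \<omega>))" using h by auto
        have [measurable]: "h \<in> borel_measurable M" using h by auto
        show "(\<lambda>\<omega>. indicator (A n) \<omega> *\<^sub>R \<Phi> (U \<omega>) (h \<omega>)) \<in> borel_measurable M"
          by (intro borel_measurable_scaleR borel_measurable_indicator A_M \<Phi>_meas) auto
        have "norm (\<Phi> (indicator (A n) \<omega> *\<^sub>R U \<omega>) (h \<omega>)) \<le> (L * K) * real n * norm (h \<omega>)" for \<omega>
          using bd[of "indicator (A n) \<omega> *\<^sub>R U \<omega>" "h \<omega>"] Ub'[of \<omega>] K \<open>L \<ge> 0\<close>
          by (elim order_trans) (intro mult_right_mono mult_left_mono, auto)
        then show "AE \<omega> in M. norm (indicator (A n) \<omega> *\<^sub>R \<Phi> (U \<omega>) (h \<omega>)) \<le> norm ((L * K) * real n * norm (h \<omega>))"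
          unfolding sc using K \<open>L \<ge> 0\<close> by (simp add: abs_mult)
      qed
      show "integrable M (\<lambda>\<omega>. indicator (A n) \<omega> *\<^sub>R \<Phi> (U \<omega>) (f \<omega>))" by (rule int[OF f])
      show "integrable M (\<lambda>\<omega>. indicator (A n) \<omega> *\<^sub>R \<Phi> (U \<omega>) (g \<omega>))" by (rule int[OF g'])
    qed
    have pW: "\<omega> \<in> A n \<Longrightarrow> norm (W \<omega>) \<le> real n" and pV: "\<omega> \<in> A n \<Longrightarrow> norm (V \<omega>) \<le> real n" for \<omega>
      by (auto simp: A_def)
    note pW = pair[OF W_F pW] and pV = pair[OF V_F pV]
    have "(\<integral>\<omega>. indicator (A n) \<omega> *\<^sub>R H f \<omega> \<partial>M) = (\<integral>\<omega>. indicator (A n) \<omega> *\<^sub>R H g \<omega> \<partial>M)"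
      using pW pV by (simp add: H_def scaleR_diff_right)
    also have "norm \<dots> \<le> (\<integral>\<omega>. norm (indicator (A n) \<omega> *\<^sub>R H g \<omega>) \<partial>M)" by (rule integral_norm_bound)
    also have "\<dots> \<le> (\<integral>\<omega>. L * (norm (X 0 \<omega>) * norm (R (g \<omega>))) \<partial>M)"
    proof (rule integral_mono)
      show "integrable M (\<lambda>\<omega>. norm (indicator (A n) \<omega> *\<^sub>R H g \<omega>))"
        unfolding H_def scaleR_diff_right using pW pV by (intro integrable_norm Bochner_Integration.integrable_diff) auto
      show "integrable M (\<lambda>\<omega>. L * (norm (X 0 \<omega>) * norm (R (g \<omega>))))" using g_int by simp
      show "norm (indicator (A n) \<omega> *\<^sub>R H g \<omega>) \<le> L * (norm (X 0 \<omega>) * norm (R (g \<omega>)))" for \<omega>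
        using H_bd[of g \<omega>] \<open>L \<ge> 0\<close> by (auto simp: indicator_def mult_ac)
    qed
    finally show ?thesis by simp
  qed
  have "(\<lambda>n. \<integral>\<omega>. indicator (A n) \<omega> *\<^sub>R H f \<omega> \<partial>M) \<longlonglongrightarrow> (\<integral>\<omega>. H f \<omega> \<partial>M)"
  proof (rule integral_dominated_convergence)
    have "integrable M (\<lambda>\<omega>. norm (X 0 \<omega>) * norm (f \<omega>))"
      by (rule integrable_mult_of_squares) (use sq_int f_sq in auto)
    then show "integrable M (\<lambda>\<omega>. L * K * (norm (X 0 \<omega>) * norm (f \<omega>)))" by simp
    show "AE \<omega> in M. norm (indicator (A n) \<omega> *\<^sub>R H f \<omega>) \<le> L * K * (norm (X 0 \<omega>) * norm (f \<omega>))" for n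
    proof (rule AE_I2)
      fix \<omega>
      have "norm (H f \<omega>) \<le> L * norm (X 0 \<omega>) * (norm (f \<omega>) * K)"
        using H_bd[of f \<omega>] K(2)[of "f \<omega>"] \<open>L \<ge> 0\<close> by (elim order_trans) (intro mult_left_mono, auto)
      then show "norm (indicator (A n) \<omega> *\<^sub>R H f \<omega>) \<le> L * K * (norm (X 0 \<omega>) * norm (f \<omega>))"
        using K(1) \<open>L \<ge> 0\<close> by (auto simp: indicator_def mult_ac)
    qed
    show "AE \<omega> in M. (\<lambda>n. indicator (A n) \<omega> *\<^sub>R H f \<omega>) \<longlonglongrightarrow> H f \<omega>"
    proof (rule AE_I2)
      fix \<omega> assume \<omega>: "\<omega> \<in> space M"
      obtain N :: nat where N: "max (norm (V \<omega>)) (norm (W \<omega>)) \<le> real N" using real_arch_simple by blast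
      have "\<forall>n\<ge>N. indicator (A n) \<omega> *\<^sub>R H f \<omega> = H f \<omega>"
        using N \<omega> by (auto simp: A_def indicator_def)
      then show "(\<lambda>n. indicator (A n) \<omega> *\<^sub>R H f \<omega>) \<longlonglongrightarrow> H f \<omega>"
        by (intro tendsto_eventually) (auto simp: eventually_sequentially)
    qed
  qed auto
  from tendsto_norm[OF this] have "norm (\<integral>\<omega>. H f \<omega> \<partial>M) \<le> L * (\<integral>\<omega>. norm (X 0 \<omega>) * norm (R (g \<omega>)) \<partial>M)"
    by (rule LIMSEQ_le_const2) (use le_n in auto)
  then show ?thesis by (simp only: eq1)
qed

end

lemma integrable_pairing:
  fixes \<Phi> :: "'b::{banach, second_countable_topology} \<Rightarrow> 'b \<Rightarrow> 'd::{banach, second_countable_topology}"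
  assumes cont: "continuous_on UNIV (\<lambda>(w, b). \<Phi> w b)"
    and bd: "\<And>w b. norm (\<Phi> w b) \<le> C * (norm w * norm b)"
    and U: "U \<in> borel_measurable M" "integrable M (\<lambda>\<omega>. (norm (U \<omega>))\<^sup>2)"
    and h: "h \<in> borel_measurable M" "integrable M (\<lambda>\<omega>. (norm (h \<omega>))\<^sup>2)"
  shows "integrable M (\<lambda>\<omega>. \<Phi> (U \<omega>) (h \<omega>))"
proof (rule Bochner_Integration.integrable_bound)
  have "integrable M (\<lambda>\<omega>. norm (U \<omega>) * norm (h \<omega>))"
    by (rule integrable_mult_of_squares) (use U h in auto)
  then show "integrable M (\<lambda>\<omega>. C * (norm (U \<omega>) * norm (h \<omega>)))" by simp
  show "(\<lambda>\<omega>. \<Phi> (U \<omega>) (h \<omega>)) \<in> borel_measurable M"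
    by (rule measurable_pairing[OF cont U(1) h(1)])
  show "AE \<omega> in M. norm (\<Phi> (U \<omega>) (h \<omega>)) \<le> norm (C * (norm (U \<omega>) * norm (h \<omega>)))"
    using bd by (auto intro: order_trans[OF _ abs_ge_self])
qed

section \<open>Second moments of partial sums under the L1 condition\<close>

locale projectively_summable = stationary_adapted M T X F
  for M :: "'a measure" and T and X :: "int \<Rightarrow> 'a \<Rightarrow> 'b::{banach, second_countable_topology}" and F +
  assumes conv: "converges_in_L1 M
      (\<lambda>n \<omega>. norm (X 0 \<omega>) *\<^sub>R bochner_cond_exp M (F 0) (partial_sum X (Suc n)) \<omega>)"
begin

abbreviation g :: "nat \<Rightarrow> 'a \<Rightarrow> 'b" where "g n \<equiv> bochner_cond_exp M (F 0) (S n)"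

lemma g_cond_exp: "is_bochner_cond_exp M (F 0) (S n) (g n)"
  by (rule F0.bochner_cond_exp[OF S_integrable])

lemma g_integrable: "integrable M (g n)"
  using g_cond_exp[of n] unfolding is_bochner_cond_exp_def by auto

lemma g_measurable[measurable]: "g n \<in> borel_measurable M"
  using g_integrable by auto

lemma Y_integrable: "n \<ge> 1 \<Longrightarrow> integrable M (\<lambda>\<omega>. norm (X 0 \<omega>) *\<^sub>R g n \<omega>)"
  using conv unfolding converges_in_L1_def by (cases n) auto

lemma Y_limit:
  obtains Z where "integrable M Z"
    "(\<lambda>n. \<integral>\<omega>. norm (norm (X 0 \<omega>) *\<^sub>R g n \<omega> - Z \<omega>) \<partial>M) \<longlonglongrightarrow> 0"
proof -
  obtain Z where "integrable M Z"
    "(\<lambda>n. \<integral>\<omega>. norm (norm (X 0 \<omega>) *\<^sub>R g (Suc n) \<omega> - Z \<omega>) \<partial>M) \<longlonglongrightarrow> 0"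
    using conv unfolding converges_in_L1_def by (elim conjE exE) (rule that)
  from this(1) LIMSEQ_imp_Suc[OF this(2)] show ?thesis by (rule that)
qed

lemma R_Y:
  assumes "bounded_linear R"
  shows "norm (X 0 \<omega>) * norm (R (g n \<omega>)) = norm (R (norm (X 0 \<omega>) *\<^sub>R g n \<omega>))"
  by (simp add: linear_simps(5)[OF assms])

lemma integrable_X0_R_g:
  fixes R :: "'b \<Rightarrow> 'c::{banach, second_countable_topology}"
  assumes R: "bounded_linear R" and "n \<ge> 1"
  shows "integrable M (\<lambda>\<omega>. norm (X 0 \<omega>) * norm (R (g n \<omega>)))"
  unfolding R_Y[OF R]
  by (intro integrable_norm integrable_bounded_linear[OF R] Y_integrable \<open>n \<ge> 1\<close>)

text \<open>One reference index \<open>m\<close> replaces the usual pair because \<open>m\<close>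
  later is the number of lags kept in the covariances. It is at least 1 since the hypothesis starts
  with \<open>S 1\<close>.\<close>

lemma Y_Cauchy:
  assumes "\<epsilon> > 0"
  shows "\<exists>m\<ge>1. \<forall>n\<ge>m. integrable M (\<lambda>\<omega>. norm (X 0 \<omega>) * norm (g n \<omega> - g m \<omega>)) \<and>
    (\<integral>\<omega>. norm (X 0 \<omega>) * norm (g n \<omega> - g m \<omega>) \<partial>M) \<le> \<epsilon>"
proof -
  obtain Z where Z: "integrable M Z"
    and lim: "(\<lambda>n. \<integral>\<omega>. norm (norm (X 0 \<omega>) *\<^sub>R g n \<omega> - Z \<omega>) \<partial>M) \<longlonglongrightarrow> 0"
    by (rule Y_limit)
  have "\<forall>\<^sub>F n in sequentially. (\<integral>\<omega>. norm (norm (X 0 \<omega>) *\<^sub>R g n \<omega> - Z \<omega>) \<partial>M) < \<epsilon> / 2"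
    by (rule order_tendstoD(2)[OF lim half_gt_zero[OF assms]])
  then obtain m0 where m0: "\<And>n. n \<ge> m0 \<Longrightarrow> (\<integral>\<omega>. norm (norm (X 0 \<omega>) *\<^sub>R g n \<omega> - Z \<omega>) \<partial>M) < \<epsilon> / 2"
    unfolding eventually_sequentially by blast
  define m where "m = max 1 m0"
  have eq: "norm (X 0 \<omega>) * norm (g n \<omega> - g m \<omega>) =
      norm ((norm (X 0 \<omega>) *\<^sub>R g n \<omega> - Z \<omega>) - (norm (X 0 \<omega>) *\<^sub>R g m \<omega> - Z \<omega>))" for n \<omega>
    by (simp flip: scaleR_diff_right)
  have int: "integrable M (\<lambda>\<omega>. norm (X 0 \<omega>) *\<^sub>R g n \<omega> - Z \<omega>)" if "n \<ge> m" for n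
    using Y_integrable[of n] Z that by (simp add: m_def)
  show ?thesis
  proof (intro exI[of _ m] conjI allI impI)
    show "m \<ge> 1" by (simp add: m_def)
    fix n assume n: "n \<ge> m"
    note i1 = integrable_norm[OF Bochner_Integration.integrable_diff[OF int[OF n] int[OF order_refl]]]
    note i2 = Bochner_Integration.integrable_add[OF integrable_norm[OF int[OF n]] integrable_norm[OF int[OF order_refl]]]
    show "integrable M (\<lambda>\<omega>. norm (X 0 \<omega>) * norm (g n \<omega> - g m \<omega>))"
      unfolding eq by (rule i1)
    have "(\<integral>\<omega>. norm (X 0 \<omega>) * norm (g n \<omega> - g m \<omega>) \<partial>M)
      \<le> (\<integral>\<omega>. norm (norm (X 0 \<omega>) *\<^sub>R g n \<omega> - Z \<omega>) + norm (norm (X 0 \<omega>) *\<^sub>R g m \<omega> - Z \<omega>) \<partial>M)"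
      unfolding eq by (rule integral_mono[OF i1 i2 norm_triangle_ineq4])
    also have "\<dots> = (\<integral>\<omega>. norm (norm (X 0 \<omega>) *\<^sub>R g n \<omega> - Z \<omega>) \<partial>M) + (\<integral>\<omega>. norm (norm (X 0 \<omega>) *\<^sub>R g m \<omega> - Z \<omega>) \<partial>M)"
      using int[OF n] int[of m] by (intro Bochner_Integration.integral_add integrable_norm) auto
    also have "\<dots> \<le> \<epsilon>" using m0[of n] m0[of m] n by (simp add: m_def)
    finally show "(\<integral>\<omega>. norm (X 0 \<omega>) * norm (g n \<omega> - g m \<omega>) \<partial>M) \<le> \<epsilon>" .
  qed
qed

lemma X0_g_bounded:
  obtains B where "B \<ge> 0" "\<And>n. n \<ge> 1 \<Longrightarrow> (\<integral>\<omega>. norm (X 0 \<omega>) * norm (g n \<omega>) \<partial>M) \<le> B"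
proof -
  obtain Z where Z: "integrable M Z"
    and lim: "(\<lambda>n. \<integral>\<omega>. norm (norm (X 0 \<omega>) *\<^sub>R g n \<omega> - Z \<omega>) \<partial>M) \<longlonglongrightarrow> 0"
    by (rule Y_limit)
  from convergent_imp_Bseq[OF convergentI[OF lim]] obtain K where K: "\<And>n. norm (\<integral>\<omega>. norm (norm (X 0 \<omega>) *\<^sub>R g n \<omega> - Z \<omega>) \<partial>M) \<le> K"
    unfolding Bseq_def by blast
  show ?thesis
  proof (rule that[of "\<bar>K\<bar> + (\<integral>\<omega>. norm (Z \<omega>) \<partial>M)"])
    show "0 \<le> \<bar>K\<bar> + (\<integral>\<omega>. norm (Z \<omega>) \<partial>M)" by (simp add: integral_nonneg_AE)
    fix n :: nat assume n: "n \<ge> 1"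
    note int = Y_integrable[OF n]
    have "(\<integral>\<omega>. norm (X 0 \<omega>) * norm (g n \<omega>) \<partial>M) \<le> (\<integral>\<omega>. norm (norm (X 0 \<omega>) *\<^sub>R g n \<omega> - Z \<omega>) + norm (Z \<omega>) \<partial>M)"
    proof (rule integral_mono)
      show "integrable M (\<lambda>\<omega>. norm (X 0 \<omega>) * norm (g n \<omega>))" using integrable_norm[OF int] by simp
      show "integrable M (\<lambda>\<omega>. norm (norm (X 0 \<omega>) *\<^sub>R g n \<omega> - Z \<omega>) + norm (Z \<omega>))" using int Z by auto
      show "norm (X 0 \<omega>) * norm (g n \<omega>) \<le> norm (norm (X 0 \<omega>) *\<^sub>R g n \<omega> - Z \<omega>) + norm (Z \<omega>)" for \<omega>
        using norm_triangle_ineq[of "norm (X 0 \<omega>) *\<^sub>R g n \<omega> - Z \<omega>" "Z \<omega>"] by simp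
    qed
    also have "\<dots> = (\<integral>\<omega>. norm (norm (X 0 \<omega>) *\<^sub>R g n \<omega> - Z \<omega>) \<partial>M) + (\<integral>\<omega>. norm (Z \<omega>) \<partial>M)"
      using int Z by (intro Bochner_Integration.integral_add) auto
    also have "\<dots> \<le> \<bar>K\<bar> + (\<integral>\<omega>. norm (Z \<omega>) \<partial>M)" using K[of n] by simp
    finally show "(\<integral>\<omega>. norm (X 0 \<omega>) * norm (g n \<omega>) \<partial>M) \<le> \<bar>K\<bar> + (\<integral>\<omega>. norm (Z \<omega>) \<partial>M)" .
  qed
qed

text \<open>Applying the smoothness inequality at every step leaves a sum of cross terms
  \<open>D (Q (S k)) (Q (X (k + 1)))\<close>, to which summation by parts applies. In the Lipschitz
  estimate \<open>Q\<close> is replaced by its bound \<open>K\<close> on the increment only and is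
  kept on the conditional expectation: the cross terms are small as soon as \<open>B\<close> is,
  even though \<open>K\<close> is not.\<close>

lemma norm_S_sq_bound:
  fixes Q :: "'b \<Rightarrow> 'b" and D :: "'b \<Rightarrow> 'b \<Rightarrow>\<^sub>L real"
  assumes D: "C > 0" "D 0 = 0"
    and upper: "\<And>x u. (norm (x + u))\<^sup>2 \<le> (norm x)\<^sup>2 + D x u + C * (norm u)\<^sup>2"
    and lip: "\<And>x y. norm (D x - D y) \<le> 2 * C * norm (x - y)"
    and Q: "bounded_linear Q" and K: "K \<ge> 0" "\<And>x. norm (Q x) \<le> K * norm x"
    and B: "\<And>n. n \<ge> 1 \<Longrightarrow> (\<integral>\<omega>. norm (X 0 \<omega>) * norm (Q (g n \<omega>)) \<partial>M) \<le> B" "B \<ge> 0"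
  shows "(\<integral>\<omega>. (norm (Q (S n \<omega>)))\<^sup>2 \<partial>M) \<le> real n * (C * (\<integral>\<omega>. (norm (Q (X 0 \<omega>)))\<^sup>2 \<partial>M) + 2 * C * K * B)"
proof -
  define \<Phi> where "\<Phi> w b = D (Q w) (Q b)" for w b
  interpret Q: bounded_linear Q by (rule Q)
  have [measurable]: "Q \<in> borel_measurable borel"
    by (intro borel_measurable_continuous_onI linear_continuous_on Q)
  have lin: "bounded_linear (\<Phi> w)" for w
    unfolding \<Phi>_def by (rule bounded_linear_compose[OF blinfun.bounded_linear_right Q])
  have zero: "\<Phi> 0 b = 0" for b by (simp add: \<Phi>_def Q.zero D)
  have D_cont: "continuous_on UNIV D"
  proof (rule continuous_onI)
    fix x :: 'b and e :: real assume "e > 0"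
    show "\<exists>d>0. \<forall>x'\<in>UNIV. dist x' x < d \<longrightarrow> dist (D x') (D x) \<le> e"
    proof (intro exI[of _ "e / (2 * C)"] conjI ballI impI)
      show "e / (2 * C) > 0" using \<open>e > 0\<close> D by simp
      fix x' assume "dist x' x < e / (2 * C)"
      then have "2 * C * norm (x' - x) < e" using D by (simp add: dist_norm field_simps)
      with lip[of x' x] show "dist (D x') (D x) \<le> e" by (simp add: dist_norm)
    qed
  qed
  have cont: "continuous_on UNIV (\<lambda>(w, b). \<Phi> w b)"
    unfolding \<Phi>_def case_prod_unfold
    by (intro blinfun.continuous_on continuous_on_compose2[OF D_cont] Q.continuous_on continuous_intros) auto
  have lip\<Phi>: "norm (\<Phi> v b - \<Phi> w b) \<le> (2 * C * K) * norm (v - w) * norm (Q b)" for v w b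
  proof -
    have "norm (\<Phi> v b - \<Phi> w b) = norm ((D (Q v) - D (Q w)) (Q b))" by (simp add: \<Phi>_def blinfun.diff_left)
    also have "\<dots> \<le> norm (D (Q v) - D (Q w)) * norm (Q b)" by (rule norm_blinfun)
    also have "\<dots> \<le> (2 * C * norm (Q v - Q w)) * norm (Q b)" by (intro mult_right_mono lip) auto
    also have "\<dots> \<le> (2 * C * (K * norm (v - w))) * norm (Q b)"
      using K(2)[of "v - w"] D by (intro mult_right_mono mult_left_mono) (auto simp: Q.diff)
    finally show ?thesis by (simp add: mult_ac)
  qed
  have bd: "norm (\<Phi> w b) \<le> (2 * C * K * K) * (norm w * norm b)" for w b
  proof -
    have "norm (\<Phi> w b) \<le> (2 * C * K) * norm w * norm (Q b)" using lip\<Phi>[of w b 0] by (simp add: zero)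
    also have "\<dots> \<le> (2 * C * K) * norm w * (K * norm b)" using K D by (intro mult_left_mono) auto
    finally show ?thesis by (simp add: mult_ac)
  qed
  have int_\<Phi>: "integrable M (\<lambda>\<omega>. \<Phi> (S k \<omega>) (h \<omega>))"
    if "h \<in> borel_measurable M" "integrable M (\<lambda>\<omega>. (norm (h \<omega>))\<^sup>2)" for k h
    using cont bd S_measurable S_sq_integrable that by (rule integrable_pairing)
  have Q_sq: "integrable M (\<lambda>\<omega>. (norm (Q (h \<omega>)))\<^sup>2)"
    if [measurable]: "h \<in> borel_measurable M" and "integrable M (\<lambda>\<omega>. (norm (h \<omega>))\<^sup>2)" for h
  proof (rule Bochner_Integration.integrable_bound)
    show "integrable M (\<lambda>\<omega>. K\<^sup>2 * (norm (h \<omega>))\<^sup>2)" using that by simp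
    have "(norm (Q b))\<^sup>2 \<le> K\<^sup>2 * (norm b)\<^sup>2" for b
      using power_mono[OF K(2)[of b], of 2] by (simp add: power_mult_distrib)
    then show "AE \<omega> in M. norm ((norm (Q (h \<omega>)))\<^sup>2) \<le> norm (K\<^sup>2 * (norm (h \<omega>))\<^sup>2)" by simp
  qed measurable
  have pw: "(norm (Q (S n \<omega>)))\<^sup>2 \<le> (\<Sum>k<n. \<Phi> (S k \<omega>) (X (int (Suc k)) \<omega>) + C * (norm (Q (X (int (Suc k)) \<omega>)))\<^sup>2)" for n \<omega>
  proof (induction n)
    case (Suc n)
    have "(norm (Q (S (Suc n) \<omega>)))\<^sup>2 \<le> (norm (Q (S n \<omega>)))\<^sup>2 + \<Phi> (S n \<omega>) (X (int (Suc n)) \<omega>) + C * (norm (Q (X (int (Suc n)) \<omega>)))\<^sup>2"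
      unfolding S_Suc Q.add \<Phi>_def by (rule upper)
    with Suc show ?case by simp
  qed (simp add: S_0 Q.zero)
  define q where "q = (\<integral>\<omega>. (norm (Q (X 0 \<omega>)))\<^sup>2 \<partial>M)"
  have q: "(\<integral>\<omega>. (norm (Q (X i \<omega>)))\<^sup>2 \<partial>M) = q" for i
    unfolding q_def by (rule X_law) measurable
  have int1: "integrable M (\<lambda>\<omega>. \<Phi> (S k \<omega>) (X i \<omega>))" for k i
    by (rule int_\<Phi>[OF X_measurable X_sq_integrable])
  have int2: "integrable M (\<lambda>\<omega>. (norm (Q (X i \<omega>)))\<^sup>2)" for i
    by (rule Q_sq[OF X_measurable X_sq_integrable])
  have "(\<integral>\<omega>. (norm (Q (S n \<omega>)))\<^sup>2 \<partial>M)
    \<le> (\<integral>\<omega>. (\<Sum>k<n. \<Phi> (S k \<omega>) (X (int (Suc k)) \<omega>) + C * (norm (Q (X (int (Suc k)) \<omega>)))\<^sup>2) \<partial>M)"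
    by (intro integral_mono pw Q_sq S_measurable S_sq_integrable Bochner_Integration.integrable_sum
        Bochner_Integration.integrable_add int1 integrable_mult_right int2)
  also have "\<dots> = (\<integral>\<omega>. (\<Sum>k<n. \<Phi> (S k \<omega>) (X (int (Suc k)) \<omega>)) + (\<Sum>k<n. C * (norm (Q (X (int (Suc k)) \<omega>)))\<^sup>2) \<partial>M)"
    by (simp only: sum.distrib)
  also have "\<dots> = (\<integral>\<omega>. (\<Sum>k<n. \<Phi> (S k \<omega>) (X (int (Suc k)) \<omega>)) \<partial>M) + (\<integral>\<omega>. (\<Sum>k<n. C * (norm (Q (X (int (Suc k)) \<omega>)))\<^sup>2) \<partial>M)"
    by (intro Bochner_Integration.integral_add Bochner_Integration.integrable_sum int1 integrable_mult_right int2)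
  also have "(\<integral>\<omega>. (\<Sum>k<n. C * (norm (Q (X (int (Suc k)) \<omega>)))\<^sup>2) \<partial>M) = real n * (C * q)"
    by (subst Bochner_Integration.integral_sum) (use int2 in \<open>auto simp: q simp del: of_nat_Suc\<close>)
  also have "(\<integral>\<omega>. (\<Sum>k<n. \<Phi> (S k \<omega>) (X (int (Suc k)) \<omega>)) \<partial>M) =
    (\<integral>\<omega>. (\<Sum>l<n. \<Phi> (S (Suc l) \<omega>) (S n \<omega> - S (Suc l) \<omega>) - \<Phi> (S l \<omega>) (S n \<omega> - S (Suc l) \<omega>)) \<partial>M)"
  proof (rule Bochner_Integration.integral_cong[OF refl])
    fix \<omega>
    have "\<Phi> (S 0 \<omega>) b = 0" for b by (simp add: S_0 zero)
    from sum_by_parts_pairing[of \<Phi> "\<lambda>k. S k \<omega>", OF lin this, of n]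
    show "(\<Sum>k<n. \<Phi> (S k \<omega>) (X (int (Suc k)) \<omega>)) =
      (\<Sum>l<n. \<Phi> (S (Suc l) \<omega>) (S n \<omega> - S (Suc l) \<omega>) - \<Phi> (S l \<omega>) (S n \<omega> - S (Suc l) \<omega>))"
      by (simp only: S_Suc add_diff_cancel_left')
  qed
  also have "\<dots> \<le> real n * (2 * C * K * B)"
  proof -
    have bl: "(\<integral>\<omega>. \<Phi> (S (Suc l) \<omega>) (S n \<omega> - S (Suc l) \<omega>) - \<Phi> (S l \<omega>) (S n \<omega> - S (Suc l) \<omega>) \<partial>M) \<le> 2 * C * K * B"
      if "l < n" for l
    \<comment> \<open>For \<open>n = Suc l\<close> the future sum is empty; the bound
      \<open>B\<close> starts at index 1 and does not speak about it.\<close>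
    proof (cases "n = Suc l")
      case True
      then show ?thesis using B(2) K D by (simp add: linear_simps(3)[OF lin])
    next
      case False
      define j where "j = n - Suc l"
      have j: "j \<ge> 1" "Suc l + j = n" using that False by (auto simp: j_def)
      have LK: "2 * C * K \<ge> 0" using K D by simp
      have "norm (\<integral>\<omega>. \<Phi> (S (Suc l) \<omega>) (S j ((T ^^ Suc l) \<omega>)) - \<Phi> (S l \<omega>) (S j ((T ^^ Suc l) \<omega>)) \<partial>M)
        \<le> (2 * C * K) * (\<integral>\<omega>. norm (X 0 \<omega>) * norm (Q (g j \<omega>)) \<partial>M)"
        by (rule increment_pairing_bound[OF g_cond_exp S_integrable S_sq_integrable
              integrable_X0_R_g[OF Q j(1)] lin cont zero Q lip\<Phi> LK])
      also have "\<dots> \<le> (2 * C * K) * B" using LK by (intro mult_left_mono B(1) j(1))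
      also have "(\<integral>\<omega>. \<Phi> (S (Suc l) \<omega>) (S j ((T ^^ Suc l) \<omega>)) - \<Phi> (S l \<omega>) (S j ((T ^^ Suc l) \<omega>)) \<partial>M) =
        (\<integral>\<omega>. \<Phi> (S (Suc l) \<omega>) (S n \<omega> - S (Suc l) \<omega>) - \<Phi> (S l \<omega>) (S n \<omega> - S (Suc l) \<omega>) \<partial>M)"
        by (intro Bochner_Integration.integral_cong refl) (simp only: S_T_funpow j(2))
      finally show ?thesis by (simp add: abs_le_iff)
    qed
    have d_meas: "(\<lambda>\<omega>. S n \<omega> - S (Suc l) \<omega>) \<in> borel_measurable M" for l by measurable
    have d_sq: "integrable M (\<lambda>\<omega>. (norm (S n \<omega> - S (Suc l) \<omega>))\<^sup>2)" for l
      using integrable_norm_sq_add[of "S n" M "\<lambda>\<omega>. - S (Suc l) \<omega>"] S_sq_integrable by simp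
    have "(\<integral>\<omega>. (\<Sum>l<n. \<Phi> (S (Suc l) \<omega>) (S n \<omega> - S (Suc l) \<omega>) - \<Phi> (S l \<omega>) (S n \<omega> - S (Suc l) \<omega>)) \<partial>M)
      = (\<Sum>l<n. \<integral>\<omega>. \<Phi> (S (Suc l) \<omega>) (S n \<omega> - S (Suc l) \<omega>) - \<Phi> (S l \<omega>) (S n \<omega> - S (Suc l) \<omega>) \<partial>M)"
      by (intro Bochner_Integration.integral_sum Bochner_Integration.integrable_diff int_\<Phi> d_meas d_sq)
    also have "\<dots> \<le> (\<Sum>l<n. 2 * C * K * B)" by (intro sum_mono bl) auto
    finally show ?thesis by simp
  qed
  finally show ?thesis unfolding q_def[symmetric] by (simp add: algebra_simps)
qed

lemma norm_S_sq_linear_growth: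
  assumes "two_smooth TYPE('b)"
  obtains B where "B \<ge> 0" "\<And>n. (\<integral>\<omega>. (norm (S n \<omega>))\<^sup>2 \<partial>M) \<le> real n * B"
proof -
  obtain D :: "'b \<Rightarrow> 'b \<Rightarrow>\<^sub>L real" and C where D: "C > 0" "D 0 = 0"
    "\<And>x u. (norm (x + u))\<^sup>2 \<le> (norm x)\<^sup>2 + D x u + C * (norm u)\<^sup>2"
    "\<And>x y. norm (D x - D y) \<le> 2 * C * norm (x - y)"
    using two_smoothE[OF assms] by metis
  obtain B where B: "B \<ge> 0" "\<And>n. n \<ge> 1 \<Longrightarrow> (\<integral>\<omega>. norm (X 0 \<omega>) * norm (g n \<omega>) \<partial>M) \<le> B"
    using X0_g_bounded by metis
  have "(\<integral>\<omega>. (norm (S n \<omega>))\<^sup>2 \<partial>M) \<le> real n * (C * (\<integral>\<omega>. (norm (X 0 \<omega>))\<^sup>2 \<partial>M) + 2 * C * 1 * B)" for n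
    by (rule norm_S_sq_bound[OF D bounded_linear_ident]) (use B in auto)
  then show ?thesis
    using B D by (intro that[of "C * (\<integral>\<omega>. (norm (X 0 \<omega>))\<^sup>2 \<partial>M) + 2 * C * 1 * B"]) (auto simp: integral_nonneg_AE)
qed

text \<open>For indices above \<open>m\<close> the weighted conditional expectation is near its L1
  limit \<open>Z\<close>, which leaves \<open>Z\<close> and finitely many further integrable
  functions; on each of them \<open>Q N\<close> tends to 0 in L1 by dominated convergence.\<close>

lemma norm_Q_S_sq_small:
  fixes Q :: "nat \<Rightarrow> 'b \<Rightarrow> 'b"
  assumes smooth: "two_smooth TYPE('b)"
    and Q: "\<And>N. bounded_linear (Q N)" and K: "K \<ge> 0" "\<And>N x. norm (Q N x) \<le> K * norm x"
    and Q_lim: "\<And>x. (\<lambda>N. Q N x) \<longlonglongrightarrow> 0" and "\<epsilon> > 0"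
  obtains N0 where "\<And>N n. N \<ge> N0 \<Longrightarrow> (\<integral>\<omega>. (norm (Q N (S n \<omega>)))\<^sup>2 \<partial>M) \<le> real n * \<epsilon>"
proof -
  obtain D :: "'b \<Rightarrow> 'b \<Rightarrow>\<^sub>L real" and C where D: "C > 0" "D 0 = 0"
    "\<And>x u. (norm (x + u))\<^sup>2 \<le> (norm x)\<^sup>2 + D x u + C * (norm u)\<^sup>2"
    "\<And>x y. norm (D x - D y) \<le> 2 * C * norm (x - y)"
    using two_smoothE[OF smooth] by metis
  have [measurable]: "Q N \<in> borel_measurable borel" for N
    by (intro borel_measurable_continuous_onI linear_continuous_on Q)
  have QL1: "(\<lambda>N. \<integral>\<omega>. norm (Q N (h \<omega>)) \<partial>M) \<longlonglongrightarrow> 0" if h: "integrable M h" for h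
  proof -
    have [measurable]: "h \<in> borel_measurable M" using h by auto
    have "(\<lambda>N. \<integral>\<omega>. norm (Q N (h \<omega>)) \<partial>M) \<longlonglongrightarrow> (\<integral>\<omega>. 0 \<partial>M)"
    proof (rule integral_dominated_convergence)
      show "integrable M (\<lambda>\<omega>. K * norm (h \<omega>))" using h by simp
      show "AE \<omega> in M. (\<lambda>N. norm (Q N (h \<omega>))) \<longlonglongrightarrow> 0"
        using Q_lim by (intro AE_I2 tendsto_norm_zero)
    qed (use K in auto)
    then show ?thesis by simp
  qed
  have QL2: "(\<lambda>N. \<integral>\<omega>. (norm (Q N (X 0 \<omega>)))\<^sup>2 \<partial>M) \<longlonglongrightarrow> 0"
  proof -
    have "(\<lambda>N. \<integral>\<omega>. (norm (Q N (X 0 \<omega>)))\<^sup>2 \<partial>M) \<longlonglongrightarrow> (\<integral>\<omega>. 0 \<partial>M)"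
    proof (rule integral_dominated_convergence)
      show "integrable M (\<lambda>\<omega>. K\<^sup>2 * (norm (X 0 \<omega>))\<^sup>2)" using sq_int by simp
      show "AE \<omega> in M. (\<lambda>N. (norm (Q N (X 0 \<omega>)))\<^sup>2) \<longlonglongrightarrow> 0"
      proof (rule AE_I2)
        fix \<omega>
        from tendsto_power[OF tendsto_norm_zero[OF Q_lim[of "X 0 \<omega>"]], of 2]
        show "(\<lambda>N. (norm (Q N (X 0 \<omega>)))\<^sup>2) \<longlonglongrightarrow> 0" by simp
      qed
      have "(norm (Q N b))\<^sup>2 \<le> K\<^sup>2 * (norm b)\<^sup>2" for b N
        using power_mono[OF K(2)[of N b], of 2] by (simp add: power_mult_distrib)
      then show "AE \<omega> in M. norm ((norm (Q N (X 0 \<omega>)))\<^sup>2) \<le> K\<^sup>2 * (norm (X 0 \<omega>))\<^sup>2" for N by simp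
    qed measurable
    then show ?thesis by simp
  qed
  \<comment> \<open>Chosen so that
    \<open>C * \<delta> + 2 * C * K * \<delta> \<le> \<epsilon>\<close>, the two summands coming
    from \<open>norm_S_sq_bound\<close>.\<close>
  define \<delta> where "\<delta> = \<epsilon> / (C + 2 * C * K + 1)"
  have \<delta>: "\<delta> > 0" using \<open>\<epsilon> > 0\<close> D(1) K(1) unfolding \<delta>_def
    by (intro divide_pos_pos add_nonneg_pos add_nonneg_nonneg mult_nonneg_nonneg) auto
  obtain Z where Z: "integrable M Z"
    and lim: "(\<lambda>n. \<integral>\<omega>. norm (norm (X 0 \<omega>) *\<^sub>R g n \<omega> - Z \<omega>) \<partial>M) \<longlonglongrightarrow> 0"
    by (rule Y_limit)
  \<comment> \<open>\<open>Q N\<close> enlarges the distance to \<open>Z\<close> by at most the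
    factor \<open>K\<close>, so that this distance contributes less than
    \<open>\<delta> / 2\<close>.\<close>
  have "\<delta> / (2 * (K + 1)) > 0" using \<delta> K(1) by simp
  from order_tendstoD(2)[OF lim this]
  obtain m where m: "\<And>n. n \<ge> m \<Longrightarrow> (\<integral>\<omega>. norm (norm (X 0 \<omega>) *\<^sub>R g n \<omega> - Z \<omega>) \<partial>M) < \<delta> / (2 * (K + 1))"
    unfolding eventually_sequentially by blast
  have "\<forall>\<^sub>F N in sequentially. \<forall>n\<in>{1..m}. (\<integral>\<omega>. norm (Q N (norm (X 0 \<omega>) *\<^sub>R g n \<omega>)) \<partial>M) < \<delta>"
    using \<delta> by (intro eventually_ball_finite ballI order_tendstoD(2)[OF QL1] Y_integrable) auto
  moreover have "\<forall>\<^sub>F N in sequentially. (\<integral>\<omega>. norm (Q N (Z \<omega>)) \<partial>M) < \<delta> / 2"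
    using \<delta> by (intro order_tendstoD(2)[OF QL1] Z) auto
  moreover have "\<forall>\<^sub>F N in sequentially. (\<integral>\<omega>. (norm (Q N (X 0 \<omega>)))\<^sup>2 \<partial>M) < \<delta>"
    using \<delta> by (intro order_tendstoD(2)[OF QL2])
  ultimately have "\<forall>\<^sub>F N in sequentially. (\<forall>n\<in>{1..m}. (\<integral>\<omega>. norm (Q N (norm (X 0 \<omega>) *\<^sub>R g n \<omega>)) \<partial>M) < \<delta>)
      \<and> (\<integral>\<omega>. norm (Q N (Z \<omega>)) \<partial>M) < \<delta> / 2 \<and> (\<integral>\<omega>. (norm (Q N (X 0 \<omega>)))\<^sup>2 \<partial>M) < \<delta>"
    by (intro eventually_conj)
  then obtain N0 where N0: "\<And>N n. N \<ge> N0 \<Longrightarrow> n \<in> {1..m} \<Longrightarrow> (\<integral>\<omega>. norm (Q N (norm (X 0 \<omega>) *\<^sub>R g n \<omega>)) \<partial>M) < \<delta>"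
    "\<And>N. N \<ge> N0 \<Longrightarrow> (\<integral>\<omega>. norm (Q N (Z \<omega>)) \<partial>M) < \<delta> / 2"
    "\<And>N. N \<ge> N0 \<Longrightarrow> (\<integral>\<omega>. (norm (Q N (X 0 \<omega>)))\<^sup>2 \<partial>M) < \<delta>"
    unfolding eventually_sequentially by blast
  have B: "(\<integral>\<omega>. norm (X 0 \<omega>) * norm (Q N (g n \<omega>)) \<partial>M) \<le> \<delta>" if N: "N \<ge> N0" and n: "n \<ge> 1" for N n
  proof (cases "n \<le> m")
    case True
    then show ?thesis using N0(1)[OF N, of n] n by (simp add: R_Y[OF Q])
  next
    case False
    note int = Y_integrable[OF n]
    have "(\<integral>\<omega>. norm (X 0 \<omega>) * norm (Q N (g n \<omega>)) \<partial>M)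
      \<le> (\<integral>\<omega>. K * norm (norm (X 0 \<omega>) *\<^sub>R g n \<omega> - Z \<omega>) + norm (Q N (Z \<omega>)) \<partial>M)"
    proof (rule integral_mono)
      show "integrable M (\<lambda>\<omega>. norm (X 0 \<omega>) * norm (Q N (g n \<omega>)))" by (rule integrable_X0_R_g[OF Q n])
      show "integrable M (\<lambda>\<omega>. K * norm (norm (X 0 \<omega>) *\<^sub>R g n \<omega> - Z \<omega>) + norm (Q N (Z \<omega>)))"
        using int Z integrable_bounded_linear[OF Q Z] by auto
      fix \<omega>
      let ?y = "norm (X 0 \<omega>) *\<^sub>R g n \<omega>"
      have "norm (Q N ?y) \<le> norm (Q N (?y - Z \<omega>)) + norm (Q N (Z \<omega>))"
        using norm_triangle_ineq[of "Q N (?y - Z \<omega>)" "Q N (Z \<omega>)"] by (simp add: linear_simps(2)[OF Q])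
      then show "norm (X 0 \<omega>) * norm (Q N (g n \<omega>)) \<le> K * norm (?y - Z \<omega>) + norm (Q N (Z \<omega>))"
        using K(2)[of N "?y - Z \<omega>"] unfolding R_Y[OF Q] by linarith
    qed
    also have "\<dots> = K * (\<integral>\<omega>. norm (norm (X 0 \<omega>) *\<^sub>R g n \<omega> - Z \<omega>) \<partial>M) + (\<integral>\<omega>. norm (Q N (Z \<omega>)) \<partial>M)"
      using int Z integrable_bounded_linear[OF Q Z] by (subst Bochner_Integration.integral_add) auto
    also have "\<dots> \<le> K * (\<delta> / (2 * (K + 1))) + \<delta> / 2"
      using m[of n] False N0(2)[OF N] K(1) by (intro add_mono mult_left_mono) auto
    also have "\<dots> \<le> \<delta>" using K(1) \<delta> by (simp add: field_simps)
    finally show ?thesis .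
  qed
  show ?thesis
  proof (rule that[of N0])
    fix N n assume N: "N \<ge> N0"
    have "(\<integral>\<omega>. (norm (Q N (S n \<omega>)))\<^sup>2 \<partial>M) \<le> real n * (C * (\<integral>\<omega>. (norm (Q N (X 0 \<omega>)))\<^sup>2 \<partial>M) + 2 * C * K * \<delta>)"
      by (rule norm_S_sq_bound[OF D Q K(1) K(2) B[OF N]]) (use \<delta> in auto)
    also have "\<dots> \<le> real n * (C * \<delta> + 2 * C * K * \<delta>)"
      using N0(3)[OF N] D(1) by (intro mult_left_mono add_right_mono) auto
    also have "\<dots> \<le> real n * ((C + 2 * C * K + 1) * \<delta>)"
      using \<delta> by (intro mult_left_mono) (auto simp: algebra_simps)
    also have "(C + 2 * C * K + 1) * \<delta> = \<epsilon>"
    proof -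
      have "C + 2 * C * K + 1 > 0" using D(1) K(1) by (intro add_nonneg_pos add_nonneg_nonneg mult_nonneg_nonneg) auto
      then show ?thesis by (simp add: \<delta>_def)
    qed
    finally show "(\<integral>\<omega>. (norm (Q N (S n \<omega>)))\<^sup>2 \<partial>M) \<le> real n * \<epsilon>" .
  qed
qed

end

section \<open>The mean ergodic theorem\<close>

text \<open>Ergodicity is stated for exactly invariant sets on a space that fills its type: the form
  in which the ergodicity of the process transfers to path space.\<close>

locale ergodic_map = prob_space M for M :: "'a measure" +
  fixes \<theta> :: "'a \<Rightarrow> 'a"
  assumes \<theta>_measurable[measurable]: "\<theta> \<in> measurable M M"
    and \<theta>_preserving: "distr M M \<theta> = M"
    and space_UNIV: "space M = UNIV"
    and ergodic: "\<And>B. B \<in> sets M \<Longrightarrow> \<theta> -` B = B \<Longrightarrow> measure M B \<in> {0, 1}"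
begin

text \<open>There are \<open>Suc n\<close> terms so that the denominator never vanishes.\<close>

definition avg :: "('a \<Rightarrow> real) \<Rightarrow> nat \<Rightarrow> 'a \<Rightarrow> real" where
  "avg f n x = (\<Sum>k<Suc n. f ((\<theta> ^^ k) x)) / real (Suc n)"

lemma \<theta>_funpow_measurable[measurable]: "\<theta> ^^ k \<in> measurable M M"
  by (induction k) auto

lemma distr_\<theta>_funpow: "distr M M (\<theta> ^^ k) = M"
proof (induction k)
  case 0 then show ?case by (simp add: distr_id2)
next
  case (Suc k)
  have "distr M M (\<theta> ^^ Suc k) = distr (distr M M (\<theta> ^^ k)) M \<theta>"
    by (subst distr_distr) auto
  also have "\<dots> = M" using Suc \<theta>_preserving by simp
  finally show ?case .
qed

lemma integral_\<theta>_funpow: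
  fixes f :: "'a \<Rightarrow> real"
  assumes "f \<in> borel_measurable M"
  shows "(\<integral>x. f ((\<theta> ^^ k) x) \<partial>M) = (\<integral>x. f x \<partial>M)"
    and "integrable M (\<lambda>x. f ((\<theta> ^^ k) x)) \<longleftrightarrow> integrable M f"
  using integral_distr[OF \<theta>_funpow_measurable, of f k] integrable_distr_eq[OF \<theta>_funpow_measurable, of f k] assms
  by (simp_all add: distr_\<theta>_funpow)

lemma avg_measurable[measurable]:
  assumes f: "f \<in> borel_measurable M"
  shows "avg f n \<in> borel_measurable M"
proof -
  have [measurable]: "(\<lambda>x. f ((\<theta> ^^ k) x)) \<in> borel_measurable M" for k
    using measurable_compose[OF \<theta>_funpow_measurable f] .
  show ?thesis unfolding avg_def[abs_def] by measurable
qed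

lemma integral_avg:
  assumes f: "integrable M f"
  shows "integrable M (avg f n)" "(\<integral>x. avg f n x \<partial>M) = (\<integral>x. f x \<partial>M)"
proof -
  have [measurable]: "f \<in> borel_measurable M" using f by auto
  have i: "integrable M (\<lambda>x. f ((\<theta> ^^ k) x))" for k using f integral_\<theta>_funpow(2)[of f k] by simp
  show "integrable M (avg f n)" unfolding avg_def using i by (intro integrable_divide Bochner_Integration.integrable_sum) auto
  have "(\<integral>x. avg f n x \<partial>M) = (\<Sum>k<Suc n. \<integral>x. f ((\<theta> ^^ k) x) \<partial>M) / real (Suc n)"
    unfolding avg_def by (subst integral_divide_zero, subst Bochner_Integration.integral_sum) (use i in auto)
  also have "\<dots> = (\<integral>x. f x \<partial>M)" by (simp only: integral_\<theta>_funpow(1)[OF \<open>f \<in> borel_measurable M\<close>]) simp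
  finally show "(\<integral>x. avg f n x \<partial>M) = (\<integral>x. f x \<partial>M)" .
qed

lemma avg_diff: "avg (\<lambda>x. f x - g x) n x = avg f n x - avg g n x"
  unfolding avg_def by (simp only: sum_subtractf diff_divide_distrib)

lemma avg_bounded:
  assumes "\<And>x. \<bar>f x\<bar> \<le> c"
  shows "\<bar>avg f n x\<bar> \<le> c"
proof -
  have "\<bar>\<Sum>k<Suc n. f ((\<theta> ^^ k) x)\<bar> \<le> (\<Sum>k<Suc n. c)"
    by (rule order_trans[OF sum_abs sum_mono]) (rule assms)
  then show ?thesis unfolding avg_def by (simp add: field_simps)
qed

lemma abs_avg_le: "\<bar>avg f n x\<bar> \<le> avg (\<lambda>x. \<bar>f x\<bar>) n x"
  unfolding avg_def abs_divide abs_of_nat by (rule divide_right_mono[OF sum_abs]) simp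

lemma avg_shift:
  assumes "\<And>x. \<bar>f x\<bar> \<le> c"
  shows "\<bar>avg f n ((\<theta> ^^ k) x) - avg f n x\<bar> \<le> real k * (2 * c / real (Suc n))"
proof (induction k)
  case (Suc k)
  have step: "\<bar>avg f n (\<theta> y) - avg f n y\<bar> \<le> 2 * c / real (Suc n)" for y
  proof -
    have "(\<Sum>k<Suc n. f ((\<theta> ^^ k) (\<theta> y))) - (\<Sum>k<Suc n. f ((\<theta> ^^ k) y)) = (\<Sum>k<Suc n. f ((\<theta> ^^ Suc k) y) - f ((\<theta> ^^ k) y))"
      by (simp only: sum_subtractf funpow_Suc_right o_apply)
    also have "\<dots> = f ((\<theta> ^^ Suc n) y) - f ((\<theta> ^^ 0) y)" by (rule sum_lessThan_telescope)
    finally have eq: "avg f n (\<theta> y) - avg f n y = (f ((\<theta> ^^ Suc n) y) - f ((\<theta> ^^ 0) y)) / real (Suc n)"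
      unfolding avg_def by (metis diff_divide_distrib)
    have "\<bar>f ((\<theta> ^^ Suc n) y) - f ((\<theta> ^^ 0) y)\<bar> \<le> 2 * c"
      using assms[of "(\<theta> ^^ Suc n) y"] assms[of "(\<theta> ^^ 0) y"] by linarith
    then show ?thesis unfolding eq abs_divide abs_of_nat by (rule divide_right_mono) simp
  qed
  from step[of "(\<theta> ^^ k) x"] Suc show ?case
    unfolding of_nat_Suc[of k] distrib_right mult_1_left funpow.simps o_apply by linarith
qed simp

text \<open>After exchanging the sums, an average of averages is a mean of shifted long averages,
  each within \<open>O (m / n)\<close> of the unshifted one.\<close>

lemma avg_avg:
  assumes c: "\<And>x. \<bar>f x\<bar> \<le> c"
  shows "\<bar>avg (avg f m) n x - avg f n x\<bar> \<le> real m * (2 * c / real (Suc n))"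
proof -
  have "c \<ge> 0" using c[of undefined] by linarith
  have "avg (avg f m) n x = (\<Sum>k<Suc m. avg f n ((\<theta> ^^ k) x)) / real (Suc m)"
  proof -
    have "(\<Sum>j<Suc n. \<Sum>k<Suc m. f ((\<theta> ^^ k) ((\<theta> ^^ j) x))) = (\<Sum>k<Suc m. \<Sum>j<Suc n. f ((\<theta> ^^ j) ((\<theta> ^^ k) x)))"
      by (subst sum.swap) (simp only: funpow_add[symmetric, unfolded o_def, THEN fun_cong] add.commute)
    then show ?thesis unfolding avg_def sum_divide_distrib[symmetric]
      by (simp only: divide_divide_eq_left mult.commute)
  qed
  then have "avg (avg f m) n x - avg f n x = (\<Sum>k<Suc m. avg f n ((\<theta> ^^ k) x) - avg f n x) / real (Suc m)"
    by (simp add: sum_subtractf diff_divide_distrib del: sum.lessThan_Suc)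
  also have "\<bar>\<dots>\<bar> \<le> (\<Sum>k<Suc m. real m * (2 * c / real (Suc n))) / real (Suc m)"
    unfolding abs_divide
  proof (intro frac_le order_trans[OF sum_abs sum_mono])
    fix k assume "k \<in> {..<Suc m}"
    then have "real k * (2 * c / real (Suc n)) \<le> real m * (2 * c / real (Suc n))"
      using \<open>c \<ge> 0\<close> by (intro mult_right_mono) auto
    with avg_shift[of f c n k x, OF c] show "\<bar>avg f n ((\<theta> ^^ k) x) - avg f n x\<bar> \<le> real m * (2 * c / real (Suc n))" by linarith
  qed (use \<open>c \<ge> 0\<close> in auto)
  finally show ?thesis by simp
qed

text \<open>Convexity of the square holds pointwise, and invariance of the measure removes the
  shifts under the integral.\<close>

lemma integral_avg_sq_le:
  assumes [measurable]: "g \<in> borel_measurable M" and c: "\<And>x. \<bar>g x\<bar> \<le> c"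
  shows "(\<integral>x. (avg g n x)\<^sup>2 \<partial>M) \<le> (\<integral>x. (g x)\<^sup>2 \<partial>M)"
proof -
  have bd: "\<bar>h x\<bar> \<le> c \<Longrightarrow> (h x)\<^sup>2 \<le> c\<^sup>2" for h :: "'a \<Rightarrow> real" and x
    using power_mono[of "\<bar>h x\<bar>" c 2] by simp
  have i: "integrable M (\<lambda>x. (h x)\<^sup>2)" if [measurable]: "h \<in> borel_measurable M" and "\<And>x. \<bar>h x\<bar> \<le> c" for h :: "'a \<Rightarrow> real"
    by (rule integrable_const_bound[of _ "c\<^sup>2"]) (use bd that(2) in auto)
  have "(\<integral>x. (avg g n x)\<^sup>2 \<partial>M) \<le> (\<integral>x. avg (\<lambda>x. (g x)\<^sup>2) n x \<partial>M)"
  proof (rule integral_mono)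
    show "integrable M (\<lambda>x. (avg g n x)\<^sup>2)" by (rule i) (auto intro: avg_bounded c)
    show "integrable M (\<lambda>x. avg (\<lambda>x. (g x)\<^sup>2) n x)" by (intro integral_avg i) (auto intro: c)
    fix x
    have "(\<Sum>k<Suc n. g ((\<theta> ^^ k) x))\<^sup>2 \<le> (\<Sum>k<Suc n. (g ((\<theta> ^^ k) x))\<^sup>2) * card {..<Suc n}"
      by (rule sum_squared_le_sum_of_squares)
    then have "(\<Sum>k<Suc n. g ((\<theta> ^^ k) x))\<^sup>2 / (real (Suc n))\<^sup>2 \<le> (\<Sum>k<Suc n. (g ((\<theta> ^^ k) x))\<^sup>2) * real (Suc n) / (real (Suc n))\<^sup>2"
      by (intro divide_right_mono) auto
    then show "(avg g n x)\<^sup>2 \<le> avg (\<lambda>x. (g x)\<^sup>2) n x"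
      unfolding avg_def power_divide by (simp add: power2_eq_square[of "real (Suc n)"] del: of_nat_Suc sum.lessThan_Suc)
  qed
  also have "\<dots> = (\<integral>x. (g x)\<^sup>2 \<partial>M)" by (intro integral_avg(2) i) (auto intro: c)
  finally show ?thesis .
qed

lemma integral_sq_perturb:
  fixes u v :: "'a \<Rightarrow> real"
  assumes [measurable]: "u \<in> borel_measurable M" "v \<in> borel_measurable M"
    and u: "\<And>x. \<bar>u x\<bar> \<le> c" and v: "\<And>x. \<bar>v x\<bar> \<le> c" and \<delta>: "\<And>x. \<bar>v x - u x\<bar> \<le> \<delta>"
  shows "(\<integral>x. (u x)\<^sup>2 \<partial>M) \<le> (\<integral>x. (v x)\<^sup>2 \<partial>M) + 2 * c * \<delta>"
proof -
  have bd: "\<bar>h x\<bar> \<le> c \<Longrightarrow> (h x)\<^sup>2 \<le> c\<^sup>2" for h :: "'a \<Rightarrow> real" and x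
    using power_mono[of "\<bar>h x\<bar>" c 2] by simp
  have i: "integrable M (\<lambda>x. (h x)\<^sup>2)" if [measurable]: "h \<in> borel_measurable M" and "\<And>x. \<bar>h x\<bar> \<le> c" for h :: "'a \<Rightarrow> real"
    by (rule integrable_const_bound[of _ "c\<^sup>2"]) (use bd that(2) in auto)
  have "(\<integral>x. (u x)\<^sup>2 \<partial>M) \<le> (\<integral>x. (v x)\<^sup>2 + 2 * c * \<delta> \<partial>M)"
  proof (rule integral_mono)
    show "integrable M (\<lambda>x. (u x)\<^sup>2)" by (rule i) (auto intro: u)
    show "integrable M (\<lambda>x. (v x)\<^sup>2 + 2 * c * \<delta>)" using i[of v] v by auto
    fix x
    have "(u x)\<^sup>2 - (v x)\<^sup>2 = (u x + v x) * (u x - v x)" by (simp add: power2_eq_square algebra_simps)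
    also have "\<dots> \<le> \<bar>u x + v x\<bar> * \<bar>u x - v x\<bar>" by (metis abs_ge_self abs_mult)
    also have "\<dots> \<le> (2 * c) * \<delta>" using u[of x] v[of x] \<delta>[of x] by (intro mult_mono) auto
    finally show "(u x)\<^sup>2 \<le> (v x)\<^sup>2 + 2 * c * \<delta>" by simp
  qed
  also have "\<dots> = (\<integral>x. (v x)\<^sup>2 \<partial>M) + 2 * c * \<delta>" using i[of v] v by (simp add: prob_space)
  finally show ?thesis .
qed

text \<open>The averages nearly minimise the \<open>L\<^sup>2\<close> norm among all convex combinations of the translates
  of \<open>f\<close>, so the parallelogram law makes them Cauchy.\<close>

lemma avg_Cauchy_bounded:
  assumes f[measurable]: "f \<in> borel_measurable M" and c: "\<And>x. \<bar>f x\<bar> \<le> c" and "\<epsilon> > 0"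
  shows "\<exists>N. \<forall>p\<ge>N. \<forall>q\<ge>N. (\<integral>x. \<bar>avg f p x - avg f q x\<bar> \<partial>M) < \<epsilon>"
proof -
  have c0: "c \<ge> 0" using c[of undefined] by linarith
  define I where "I n = (\<integral>x. (avg f n x)\<^sup>2 \<partial>M)" for n
  have I_pos: "I n \<ge> 0" for n unfolding I_def by (rule Bochner_Integration.integral_nonneg) auto
  define \<beta> where "\<beta> = Inf (range I)"
  have \<beta>_le: "\<beta> \<le> I n" for n
    unfolding \<beta>_def by (rule cInf_lower) (auto intro!: bdd_belowI[of _ 0] I_pos)
  have b: "\<bar>avg f n x\<bar> \<le> c" for n x by (rule avg_bounded[of f c, OF c])
  have bb: "\<bar>avg (avg f m) n x\<bar> \<le> c" for m n x by (rule avg_bounded[of "avg f m" c, OF b])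
  \<comment> \<open>The \<open>n\<close>-average of \<open>avg f m\<close> has L2 norm at most that
    of \<open>avg f m\<close> and lies within \<open>O (m / n)\<close> of \<open>avg f n\<close>;
    hence \<open>I\<close> tends to its infimum.\<close>
  have I_le: "I n \<le> I m + 2 * c * (real m * (2 * c / real (Suc n)))" for m n
  proof -
    have "I n \<le> (\<integral>x. (avg (avg f m) n x)\<^sup>2 \<partial>M) + 2 * c * (real m * (2 * c / real (Suc n)))"
      unfolding I_def by (rule integral_sq_perturb[where u="avg f n" and v="avg (avg f m) n", OF _ _ b bb avg_avg[of f c, OF c]]) measurable
    also have "(\<integral>x. (avg (avg f m) n x)\<^sup>2 \<partial>M) \<le> I m"
      unfolding I_def by (rule integral_avg_sq_le[OF _ b]) auto
    finally show ?thesis by simp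
  qed
  \<comment> \<open>The midpoint \<open>h\<close> is not itself one of the averages of
    \<open>f\<close>, but its long averages approach those of \<open>f\<close> and have L2 norm at
    most that of \<open>h\<close>, so \<open>\<beta>\<close> bounds its squared norm from below as
    well.\<close>
  have mid: "\<beta> \<le> (\<integral>x. ((avg f p x + avg f q x) / 2)\<^sup>2 \<partial>M)" for p q
  proof -
    have mid_le: "\<bar>(a + b) / 2 - z\<bar> \<le> P + Q" if "\<bar>a - z\<bar> \<le> P" "\<bar>b - z\<bar> \<le> Q" for a b z P Q :: real
      using that by (simp add: abs_le_iff field_simps)
    define h where "h x = (avg f p x + avg f q x) / 2" for x
    have [measurable]: "h \<in> borel_measurable M" unfolding h_def by measurable
    have hb: "\<bar>h x\<bar> \<le> c" for x using b[of p x] b[of q x] unfolding h_def by (simp add: abs_le_iff field_simps)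
    have h_avg: "avg h n x = (avg (avg f p) n x + avg (avg f q) n x) / 2" for n x
      unfolding h_def avg_def[of "\<lambda>x. (avg f p x + avg f q x) / 2"] avg_def[of "avg f p"] avg_def[of "avg f q"]
      by (simp only: sum_divide_distrib[symmetric] sum.distrib add_divide_distrib[symmetric] divide_divide_eq_left mult.commute)
    have "\<beta> \<le> (\<integral>x. (h x)\<^sup>2 \<partial>M) + 2 * c * ((real p + real q) * (2 * c / real (Suc n)))" for n
    proof -
      have "\<beta> \<le> I n" by (rule \<beta>_le)
      also have "I n \<le> (\<integral>x. (avg h n x)\<^sup>2 \<partial>M) + 2 * c * ((real p + real q) * (2 * c / real (Suc n)))"
        unfolding I_def
      proof (rule integral_sq_perturb)
        fix x
        show "\<bar>avg h n x - avg f n x\<bar> \<le> (real p + real q) * (2 * c / real (Suc n))"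
          unfolding h_avg distrib_right
          by (rule mid_le[OF avg_avg[of f c p n x, OF c] avg_avg[of f c q n x, OF c]])
      qed (auto intro: b avg_bounded hb)
      also have "(\<integral>x. (avg h n x)\<^sup>2 \<partial>M) \<le> (\<integral>x. (h x)\<^sup>2 \<partial>M)"
        by (rule integral_avg_sq_le[OF _ hb]) auto
      finally show ?thesis by simp
    qed
    moreover have "(\<lambda>n. (\<integral>x. (h x)\<^sup>2 \<partial>M) + 2 * c * ((real p + real q) * (2 * c / real (Suc n)))) \<longlonglongrightarrow> (\<integral>x. (h x)\<^sup>2 \<partial>M) + 2 * c * ((real p + real q) * 0)"
      by (intro tendsto_intros LIMSEQ_Suc lim_const_over_n)
    ultimately have "\<beta> \<le> (\<integral>x. (h x)\<^sup>2 \<partial>M) + 2 * c * ((real p + real q) * 0)"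
      by (intro LIMSEQ_le_const) auto
    then show ?thesis by (simp add: h_def)
  qed
  \<comment> \<open>The parallelogram law gives a squared L2 distance of at most
    \<open>4 * e = \<epsilon>^2 / 4\<close>; with
    \<open>\<bar>y\<bar> \<le> \<epsilon> / 4 + y^2 / \<epsilon>\<close> the L1 distance is at most
    \<open>\<epsilon> / 2\<close>.\<close>
  define e where "e = \<epsilon>\<^sup>2 / 16"
  have e: "e > 0" using \<open>\<epsilon> > 0\<close> by (simp add: e_def)
  obtain m where m: "I m < \<beta> + e"
  proof -
    have "\<exists>y\<in>range I. y < \<beta> + e"
      unfolding \<beta>_def by (rule cInf_lessD) (use e in \<open>auto simp flip: \<beta>_def\<close>)
    then show ?thesis using that by auto
  qed
  have "(\<lambda>n. I m + 2 * c * (real m * (2 * c / real (Suc n)))) \<longlonglongrightarrow> I m + 2 * c * (real m * 0)"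
    by (intro tendsto_intros LIMSEQ_Suc lim_const_over_n)
  then have "\<forall>\<^sub>F n in sequentially. I m + 2 * c * (real m * (2 * c / real (Suc n))) < \<beta> + e"
    using m by (intro order_tendstoD(2)) auto
  then obtain N where N: "\<And>n. n \<ge> N \<Longrightarrow> I n < \<beta> + e"
    unfolding eventually_sequentially using I_le by (meson le_less_trans)
  have i: "integrable M (\<lambda>x. h (avg f p x) (avg f q x))"
    if h: "continuous_on UNIV (\<lambda>(a, b). h a b)" for h :: "real \<Rightarrow> real \<Rightarrow> real" and p q
  proof -
    have "compact ({-c..c} \<times> {-c..c})" by (intro compact_Times) auto
    then have "bounded ((\<lambda>(a, b). h a b) ` ({-c..c} \<times> {-c..c}))"
      by (intro compact_imp_bounded compact_continuous_image continuous_on_subset[OF h]) auto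
    then obtain K where K: "\<And>a b. a \<in> {-c..c} \<Longrightarrow> b \<in> {-c..c} \<Longrightarrow> norm (h a b) \<le> K"
      unfolding bounded_iff by fastforce
    have "\<bar>avg f p x\<bar> \<le> c" "\<bar>avg f q x\<bar> \<le> c" for x by (rule b)+
    then have "norm (h (avg f p x) (avg f q x)) \<le> K" for x by (intro K) (auto simp: abs_le_iff minus_le_iff)
    then show ?thesis
      by (intro integrable_const_bound[of _ K] measurable_pairing[OF h]) auto
  qed
  show ?thesis
  proof (intro exI[of _ N] allI impI)
    fix p q assume pq: "p \<ge> N" "q \<ge> N"
    have ip0: "integrable M (\<lambda>x. (avg f p x)\<^sup>2)"
      by (rule i[of "\<lambda>a b. a\<^sup>2" p q]) (auto simp: case_prod_unfold intro!: continuous_intros)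
    have ip1: "integrable M (\<lambda>x. (avg f q x)\<^sup>2)"
      by (rule i[of "\<lambda>a b. b\<^sup>2" p q]) (auto simp: case_prod_unfold intro!: continuous_intros)
    have ip2: "integrable M (\<lambda>x. ((avg f p x + avg f q x) / 2)\<^sup>2)"
      by (rule i[of "\<lambda>a b. ((a + b) / 2)\<^sup>2" p q]) (auto simp: case_prod_unfold intro!: continuous_intros)
    have ip3: "integrable M (\<lambda>x. (avg f p x - avg f q x)\<^sup>2)"
      by (rule i[of "\<lambda>a b. (a - b)\<^sup>2" p q]) (auto simp: case_prod_unfold intro!: continuous_intros)
    have ip4: "integrable M (\<lambda>x. \<bar>avg f p x - avg f q x\<bar>)"
      by (rule i[of "\<lambda>a b. \<bar>a - b\<bar>" p q]) (auto simp: case_prod_unfold intro!: continuous_intros)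
    note ip = ip0 ip1 ip2 ip3 ip4
    have "(\<integral>x. (avg f p x - avg f q x)\<^sup>2 \<partial>M) =
      (\<integral>x. 2 * (avg f p x)\<^sup>2 + 2 * (avg f q x)\<^sup>2 - 4 * ((avg f p x + avg f q x) / 2)\<^sup>2 \<partial>M)"
      by (intro Bochner_Integration.integral_cong refl) (simp add: power2_eq_square field_simps)
    also have "\<dots> = 2 * I p + 2 * I q - 4 * (\<integral>x. ((avg f p x + avg f q x) / 2)\<^sup>2 \<partial>M)"
      unfolding I_def using ip by simp
    also have "\<dots> \<le> 4 * e" using N[OF pq(1)] N[OF pq(2)] mid[of p q] by linarith
    finally have sq: "(\<integral>x. (avg f p x - avg f q x)\<^sup>2 \<partial>M) \<le> 4 * e" .
    have "(\<integral>x. \<bar>avg f p x - avg f q x\<bar> \<partial>M) \<le> (\<integral>x. \<epsilon> / 4 + (avg f p x - avg f q x)\<^sup>2 / \<epsilon> \<partial>M)"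
    proof (rule integral_mono)
      show "integrable M (\<lambda>x. \<epsilon> / 4 + (avg f p x - avg f q x)\<^sup>2 / \<epsilon>)" using ip by auto
      have "\<bar>y\<bar> \<le> \<epsilon> / 4 + y\<^sup>2 / \<epsilon>" for y :: real
      proof -
        have "0 \<le> (\<bar>y\<bar> - \<epsilon> / 2)\<^sup>2 / \<epsilon>" using \<open>\<epsilon> > 0\<close> by simp
        also have "\<dots> = \<epsilon> / 4 + y\<^sup>2 / \<epsilon> - \<bar>y\<bar>"
          using \<open>\<epsilon> > 0\<close> by (simp add: power2_diff field_simps power2_eq_square)
        finally show ?thesis by simp
      qed
      then show "\<bar>avg f p x - avg f q x\<bar> \<le> \<epsilon> / 4 + (avg f p x - avg f q x)\<^sup>2 / \<epsilon>" for x .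
    qed (use ip in auto)
    also have "\<dots> = \<epsilon> / 4 + (\<integral>x. (avg f p x - avg f q x)\<^sup>2 \<partial>M) / \<epsilon>" using ip by (simp add: prob_space)
    also have "\<dots> \<le> \<epsilon> / 4 + (4 * e) / \<epsilon>" using sq \<open>\<epsilon> > 0\<close> by (intro add_left_mono divide_right_mono) auto
    also have "\<dots> < \<epsilon>" using \<open>\<epsilon> > 0\<close> by (simp add: e_def power2_eq_square field_simps)
    finally show "(\<integral>x. \<bar>avg f p x - avg f q x\<bar> \<partial>M) < \<epsilon>" .
  qed
qed

text \<open>The Cauchy property in L1 gives almost sure convergence along a subsequence; ergodicity
  makes that limit constant, its integral identifies the constant, and the Cauchy property carries
  the conclusion back to the full sequence.\<close>

lemma mean_ergodic_bounded:
  assumes f[measurable]: "f \<in> borel_measurable M" and c: "\<And>x. \<bar>f x\<bar> \<le> c"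
  shows "(\<lambda>n. \<integral>x. \<bar>avg f n x - (\<integral>y. f y \<partial>M)\<bar> \<partial>M) \<longlonglongrightarrow> 0"
proof -
  have c0: "c \<ge> 0" using c[of undefined] by linarith
  define m where "m = (\<integral>y. f y \<partial>M)"
  have f_int: "integrable M f" by (rule integrable_const_bound[of _ c]) (use c in auto)
  have b: "\<bar>avg f n x\<bar> \<le> c" for n x by (rule avg_bounded[of f c, OF c])
  obtain r where r: "strict_mono r" and AE_Cauchy: "AE x in M. Cauchy (\<lambda>i. avg f (r i) x)"
    by (rule cauchy_L1_AE_cauchy_subseq[of M "avg f"])
      (use avg_Cauchy_bounded[OF f c] in \<open>auto intro: integral_avg f_int\<close>)
  define L where "L x = lim (\<lambda>i. avg f (r i) x)" for x
  have [measurable]: "L \<in> borel_measurable M" unfolding L_def by (rule borel_measurable_lim_metric) simp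
  have AE_lim: "AE x in M. (\<lambda>i. avg f (r i) x) \<longlonglongrightarrow> L x"
    using AE_Cauchy by eventually_elim (simp add: L_def Cauchy_convergent_iff convergent_LIMSEQ_iff)
  \<comment> \<open>The invariance has to hold at every point, not just almost everywhere. The
    averages at \<open>x\<close> and at \<open>\<theta> x\<close> have the same limits, so
    \<open>lim\<close> agrees on both, including its default value where the averages
    diverge.\<close>
  have L_\<theta>: "L (\<theta> x) = L x" for x
  proof -
    have "(\<lambda>i. avg f (r i) (\<theta> x) - avg f (r i) x) \<longlonglongrightarrow> 0"
    proof (rule Lim_null_comparison)
      show "\<forall>\<^sub>F i in sequentially. norm (avg f (r i) (\<theta> x) - avg f (r i) x) \<le> 2 * c / real (Suc (r i))"
        using avg_shift[of f c "r _" 1 x, OF c] by (intro always_eventually) simp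
      have "(\<lambda>n. 2 * c / real (Suc n)) \<longlonglongrightarrow> 0" by (intro LIMSEQ_Suc lim_const_over_n)
      from LIMSEQ_subseq_LIMSEQ[OF this r] show "(\<lambda>i. 2 * c / real (Suc (r i))) \<longlonglongrightarrow> 0" by (simp add: o_def)
    qed
    then have "(\<lambda>i. avg f (r i) (\<theta> x)) \<longlonglongrightarrow> l \<longleftrightarrow> (\<lambda>i. avg f (r i) x) \<longlonglongrightarrow> l" for l
      using tendsto_add[of "\<lambda>i. avg f (r i) (\<theta> x) - avg f (r i) x" 0 sequentially "\<lambda>i. avg f (r i) x" l]
        tendsto_diff[of "\<lambda>i. avg f (r i) (\<theta> x)" l sequentially "\<lambda>i. avg f (r i) (\<theta> x) - avg f (r i) x" 0] by auto
    then show ?thesis unfolding L_def lim_def by simp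
  qed
  have "(\<lambda>i. \<integral>x. avg f (r i) x \<partial>M) \<longlonglongrightarrow> (\<integral>x. L x \<partial>M)"
    by (rule integral_dominated_convergence[where w="\<lambda>_. c"]) (use AE_lim b in auto)
  then have L_m: "(\<integral>x. L x \<partial>M) = m"
    unfolding integral_avg(2)[OF f_int] m_def by (rule LIMSEQ_unique[OF _ tendsto_const])
  have L_int: "integrable M L"
    by (rule integrable_dominated_convergence[where w="\<lambda>_. c" and s="\<lambda>i. avg f (r i)"]) (use AE_lim b in auto)
  \<comment> \<open>If \<open>L < m\<close> or \<open>L > m\<close> had probability 1, the mean of
    \<open>L\<close> would differ from \<open>m\<close>; by ergodicity both events then have
    probability 0.\<close>
  have AE_L: "AE x in M. L x = m"
  proof -
    have ev: "{x. P (L x)} \<in> sets M" if "Measurable.pred borel P" for P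
    proof -
      have "{x \<in> space M. P (L x)} \<in> sets M" using that by measurable
      then show ?thesis by (simp add: space_UNIV)
    qed
    have 01: "measure M {x. P (L x)} \<in> {0, 1}" if "Measurable.pred borel P" for P
    proof (rule ergodic)
      show "{x. P (L x)} \<in> sets M" using that by (rule ev)
      show "\<theta> -` {x. P (L x)} = {x. P (L x)}" by (simp add: L_\<theta> vimage_def)
    qed
    have "measure M {x. L x < m} \<noteq> 1"
    proof
      assume "measure M {x. L x < m} = 1"
      then have "AE x in M. L x < m" using prob_Collect_eq_1[of "\<lambda>x. L x < m"] ev[of "\<lambda>y. y < m"] by (simp add: space_UNIV)
      then have "(\<integral>x. L x \<partial>M) < (\<integral>x. m \<partial>M)"
        by (intro integral_less_AE_space L_int) (auto simp: emeasure_space_1)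
      then show False using L_m by (simp add: prob_space)
    qed
    then have "measure M {x. L x < m} = 0" using 01[of "\<lambda>y. y < m"] by simp
    moreover have "measure M {x. L x > m} \<noteq> 1"
    proof
      assume "measure M {x. L x > m} = 1"
      then have "AE x in M. L x > m" using prob_Collect_eq_1[of "\<lambda>x. L x > m"] ev[of "\<lambda>y. y > m"] by (simp add: space_UNIV)
      then have "(\<integral>x. m \<partial>M) < (\<integral>x. L x \<partial>M)"
        by (intro integral_less_AE_space L_int) (auto simp: emeasure_space_1)
      then show False using L_m by (simp add: prob_space)
    qed
    then have "measure M {x. L x > m} = 0" using 01[of "\<lambda>y. y > m"] by simp
    ultimately have "AE x in M. \<not> L x < m" "AE x in M. \<not> L x > m"
      using prob_Collect_eq_0[of "\<lambda>x. L x < m"] prob_Collect_eq_0[of "\<lambda>x. L x > m"]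
        ev[of "\<lambda>y. y < m"] ev[of "\<lambda>y. y > m"] by (simp_all add: space_UNIV)
    then show ?thesis by eventually_elim auto
  qed
  have sub: "(\<lambda>i. \<integral>x. \<bar>avg f (r i) x - m\<bar> \<partial>M) \<longlonglongrightarrow> (\<integral>x. 0 \<partial>M)"
  proof (rule integral_dominated_convergence[where w="\<lambda>_. c + \<bar>m\<bar>"])
    show "AE x in M. (\<lambda>i. \<bar>avg f (r i) x - m\<bar>) \<longlonglongrightarrow> 0"
      using AE_lim AE_L by eventually_elim (auto intro!: tendsto_rabs_zero LIM_zero)
    show "AE x in M. norm \<bar>avg f (r i) x - m\<bar> \<le> c + \<bar>m\<bar>" for i
    proof (rule AE_I2)
      fix x show "norm \<bar>avg f (r i) x - m\<bar> \<le> c + \<bar>m\<bar>" using b[of "r i" x] by simp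
    qed
  qed auto
  show ?thesis
    unfolding m_def[symmetric]
  proof (rule LIMSEQ_I)
    fix \<epsilon> :: real assume "\<epsilon> > 0"
    then have "\<epsilon> / 2 > 0" by simp
    obtain N where N: "\<And>p q. p \<ge> N \<Longrightarrow> q \<ge> N \<Longrightarrow> (\<integral>x. \<bar>avg f p x - avg f q x\<bar> \<partial>M) < \<epsilon> / 2"
      using avg_Cauchy_bounded[OF f c \<open>\<epsilon> / 2 > 0\<close>] by blast
    have "\<forall>\<^sub>F i in sequentially. (\<integral>x. \<bar>avg f (r i) x - m\<bar> \<partial>M) < \<epsilon> / 2"
      by (rule order_tendstoD(2)[OF sub]) (use \<open>\<epsilon> / 2 > 0\<close> in simp)
    moreover have "\<forall>\<^sub>F i in sequentially. r i \<ge> N"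
      using filterlim_subseq[OF r] by (simp add: filterlim_at_top)
    ultimately have "\<forall>\<^sub>F i in sequentially. (\<integral>x. \<bar>avg f (r i) x - m\<bar> \<partial>M) < \<epsilon> / 2 \<and> r i \<ge> N"
      by (rule eventually_conj)
    then obtain i where i: "(\<integral>x. \<bar>avg f (r i) x - m\<bar> \<partial>M) < \<epsilon> / 2" "r i \<ge> N"
      unfolding eventually_sequentially by blast
    show "\<exists>n0. \<forall>n\<ge>n0. norm ((\<integral>x. \<bar>avg f n x - m\<bar> \<partial>M) - 0) < \<epsilon>"
    proof (intro exI[of _ N] allI impI)
      fix n assume n: "n \<ge> N"
      note ai = integral_avg(1)[OF f_int]
      have "(\<integral>x. \<bar>avg f n x - m\<bar> \<partial>M) \<le> (\<integral>x. \<bar>avg f n x - avg f (r i) x\<bar> + \<bar>avg f (r i) x - m\<bar> \<partial>M)"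
        by (rule integral_mono) (use ai in auto)
      also have "\<dots> = (\<integral>x. \<bar>avg f n x - avg f (r i) x\<bar> \<partial>M) + (\<integral>x. \<bar>avg f (r i) x - m\<bar> \<partial>M)"
        by (rule Bochner_Integration.integral_add) (use ai in auto)
      also have "\<dots> < \<epsilon>" using N[OF n i(2)] i(1) by simp
      finally show "norm ((\<integral>x. \<bar>avg f n x - m\<bar> \<partial>M) - 0) < \<epsilon>" by (simp add: integral_nonneg_AE)
    qed
  qed
qed

text \<open>Averaging contracts L1, so the error of truncating \<open>f\<close> at level
  \<open>k\<close> is not increased, and the bounded case applies to the truncation.\<close>

theorem mean_ergodic:
  assumes f: "integrable M f"
  shows "(\<lambda>n. \<integral>x. \<bar>avg f n x - (\<integral>y. f y \<partial>M)\<bar> \<partial>M) \<longlonglongrightarrow> 0"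
proof (rule LIMSEQ_I)
  fix \<epsilon> :: real assume "\<epsilon> > 0"
  have [measurable]: "f \<in> borel_measurable M" using f by auto
  define t where "t k x = max (- real k) (min (real k) (f x))" for k :: nat and x
  have t_meas[measurable]: "t k \<in> borel_measurable M" for k unfolding t_def by measurable
  have t_bd: "\<bar>t k x\<bar> \<le> real k" for k x unfolding t_def by linarith
  have t_int: "integrable M (t k)" for k by (rule integrable_const_bound[of _ "real k"]) (use t_bd in auto)
  have "(\<lambda>k. \<integral>x. \<bar>f x - t k x\<bar> \<partial>M) \<longlonglongrightarrow> (\<integral>x. 0 \<partial>M)"
  proof (rule integral_dominated_convergence[where w="\<lambda>x. 2 * \<bar>f x\<bar>"])
    show "AE x in M. (\<lambda>k. \<bar>f x - t k x\<bar>) \<longlonglongrightarrow> 0"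
    proof (rule AE_I2)
      fix x
      obtain K :: nat where K: "\<bar>f x\<bar> \<le> real K" using real_arch_simple by blast
      have "t k x = f x" if "k \<ge> K" for k
      proof -
        have "\<bar>f x\<bar> \<le> real k" using K that by linarith
        then show ?thesis unfolding t_def by linarith
      qed
      then have "\<forall>k\<ge>K. \<bar>f x - t k x\<bar> = 0" by simp
      then show "(\<lambda>k. \<bar>f x - t k x\<bar>) \<longlonglongrightarrow> 0"
        by (intro tendsto_eventually) (unfold eventually_sequentially, blast)
    qed
    show "AE x in M. norm \<bar>f x - t k x\<bar> \<le> 2 * \<bar>f x\<bar>" for k
    proof (rule AE_I2)
      fix x show "norm \<bar>f x - t k x\<bar> \<le> 2 * \<bar>f x\<bar>" unfolding t_def by (simp add: abs_if max_def min_def)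
    qed
  qed (use f in auto)
  then have "\<forall>\<^sub>F k in sequentially. (\<integral>x. \<bar>f x - t k x\<bar> \<partial>M) < \<epsilon> / 3"
    using \<open>\<epsilon> > 0\<close> by (intro order_tendstoD(2)) auto
  then obtain k where k: "(\<integral>x. \<bar>f x - t k x\<bar> \<partial>M) < \<epsilon> / 3" unfolding eventually_sequentially by blast
  have "\<epsilon> / 3 > 0" using \<open>\<epsilon> > 0\<close> by simp
  from order_tendstoD(2)[OF mean_ergodic_bounded[OF t_meas t_bd] this]
  obtain N where N: "\<And>n. n \<ge> N \<Longrightarrow> (\<integral>x. \<bar>avg (t k) n x - (\<integral>y. t k y \<partial>M)\<bar> \<partial>M) < \<epsilon> / 3"
    unfolding eventually_sequentially by blast
  define d where "d x = \<bar>f x - t k x\<bar>" for x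
  have d_int: "integrable M d" unfolding d_def using f t_int by auto
  show "\<exists>n0. \<forall>n\<ge>n0. norm ((\<integral>x. \<bar>avg f n x - (\<integral>y. f y \<partial>M)\<bar> \<partial>M) - 0) < \<epsilon>"
  proof (intro exI[of _ N] allI impI)
    fix n assume n: "n \<ge> N"
    have m: "\<bar>(\<integral>y. t k y \<partial>M) - (\<integral>y. f y \<partial>M)\<bar> \<le> (\<integral>y. d y \<partial>M)"
    proof -
      have "(\<integral>y. t k y \<partial>M) - (\<integral>y. f y \<partial>M) = (\<integral>y. t k y - f y \<partial>M)" using f t_int by simp
      also have "\<bar>\<dots>\<bar> \<le> (\<integral>y. \<bar>t k y - f y\<bar> \<partial>M)" using integral_norm_bound[of M "\<lambda>y. t k y - f y"] by simp
      finally show ?thesis by (simp add: d_def abs_minus_commute)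
    qed
    have "(\<integral>x. \<bar>avg f n x - (\<integral>y. f y \<partial>M)\<bar> \<partial>M) \<le> (\<integral>x. avg d n x + \<bar>avg (t k) n x - (\<integral>y. t k y \<partial>M)\<bar> + (\<integral>y. d y \<partial>M) \<partial>M)"
    proof (rule integral_mono)
      show "integrable M (\<lambda>x. avg d n x + \<bar>avg (t k) n x - (\<integral>y. t k y \<partial>M)\<bar> + (\<integral>y. d y \<partial>M))"
        using integral_avg(1)[OF d_int, of n] integral_avg(1)[OF t_int, of k n] by auto
      show "\<bar>avg f n x - (\<integral>y. f y \<partial>M)\<bar> \<le> avg d n x + \<bar>avg (t k) n x - (\<integral>y. t k y \<partial>M)\<bar> + (\<integral>y. d y \<partial>M)" for x
        using abs_avg_le[of "\<lambda>x. f x - t k x" n x] m unfolding avg_diff d_def by linarith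
    qed (use integral_avg(1)[OF f, of n] in auto)
    also have "\<dots> = (\<integral>x. avg d n x \<partial>M) + (\<integral>x. \<bar>avg (t k) n x - (\<integral>y. t k y \<partial>M)\<bar> \<partial>M) + (\<integral>y. d y \<partial>M)"
      using integral_avg(1)[OF d_int, of n] integral_avg(1)[OF t_int, of k n] by (simp add: prob_space)
    also have "\<dots> < \<epsilon>" using N[OF n] k integral_avg(2)[OF d_int, of n] by (simp add: d_def)
    finally show "norm ((\<integral>x. \<bar>avg f n x - (\<integral>y. f y \<partial>M)\<bar> \<partial>M) - 0) < \<epsilon>" by (simp add: integral_nonneg_AE)
  qed
qed

end

section \<open>Ergodic averages along the stationary sequence\<close>

context stationary_adapted
begin

definition trajectory :: "'a \<Rightarrow> int \<Rightarrow> 'b" where "trajectory \<omega> = (\<lambda>i. X i \<omega>)"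

lemma trajectory_measurable[measurable]: "trajectory \<in> measurable M (\<Pi>\<^sub>M i\<in>UNIV. borel)"
  unfolding trajectory_def by (rule measurable_PiM_single') (auto simp: PiE_def extensional_def)

text \<open>Ergodicity is known for the sequence, while \<open>T\<close> may have further invariant
  events. The ergodic theorem is therefore applied to the law of the trajectory on the product
  space, with the coordinate shift in the role of \<open>T\<close>, and pulled back.\<close>

lemma mean_ergodic_trajectory:
  assumes erg: "ergodic_process M X"
    and \<phi>[measurable]: "\<phi> \<in> borel_measurable (\<Pi>\<^sub>M i\<in>(UNIV :: int set). (borel :: 'b measure))"
    and int: "integrable M (\<lambda>\<omega>. \<phi> (trajectory \<omega>))"
  shows "(\<lambda>n. \<integral>\<omega>. \<bar>(\<Sum>k<Suc n. \<phi> (trajectory ((T ^^ k) \<omega>))) / real (Suc n) - (\<integral>\<omega>. \<phi> (trajectory \<omega>) \<partial>M)\<bar> \<partial>M) \<longlonglongrightarrow> 0"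
proof -
  define PM where "PM = (\<Pi>\<^sub>M i\<in>(UNIV :: int set). (borel :: 'b measure))"
  define \<mu> where "\<mu> = distr M PM trajectory"
  define \<theta> where "\<theta> = (\<lambda>x :: int \<Rightarrow> 'b. \<lambda>i. x (i + 1))"
  have trajectory_m[measurable]: "trajectory \<in> measurable M PM" unfolding PM_def by measurable
  have \<phi>_m[measurable]: "\<phi> \<in> borel_measurable PM" unfolding PM_def by measurable
  have sp: "space PM = UNIV" by (auto simp: PM_def space_PiM PiE_def)
  have \<theta>_m[measurable]: "\<theta> \<in> measurable PM PM"
    unfolding PM_def \<theta>_def by (rule measurable_PiM_single') (auto simp: PiE_def extensional_def)
  have trajectory_T: "trajectory (T \<omega>) = \<theta> (trajectory \<omega>)" if "\<omega> \<in> space M" for \<omega>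
    using X_T[OF that] by (simp add: trajectory_def \<theta>_def)
  have trajectory_T_funpow: "trajectory ((T ^^ k) \<omega>) = (\<theta> ^^ k) (trajectory \<omega>)" if "\<omega> \<in> space M" for k \<omega>
    by (induction k) (simp_all add: trajectory_T[OF T_funpow_space[OF that]])
  interpret \<mu>: prob_space \<mu> unfolding \<mu>_def by (rule prob_space_distr) measurable
  interpret ergodic_map \<mu> \<theta>
  proof
    show "\<theta> \<in> measurable \<mu> \<mu>" unfolding \<mu>_def using \<theta>_m by simp
    show "space \<mu> = UNIV" by (simp add: \<mu>_def sp)
    have "distr \<mu> \<mu> \<theta> = distr \<mu> PM \<theta>" by (rule distr_cong) (auto simp: \<mu>_def)
    also have "\<dots> = distr M PM (\<theta> \<circ> trajectory)" unfolding \<mu>_def by (rule distr_distr) measurable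
    also have "\<dots> = distr M PM (trajectory \<circ> T)" by (rule distr_cong) (auto simp: trajectory_T)
    also have "\<dots> = distr (distr M M T) PM trajectory" by (rule distr_distr[symmetric]) measurable
    also have "\<dots> = \<mu>" using shift by (simp add: bimeasurable_mp_def \<mu>_def)
    finally show "distr \<mu> \<mu> \<theta> = \<mu>" .
    fix B assume B: "B \<in> sets \<mu>" "\<theta> -` B = B"
    have "measure \<mu> B = measure M (trajectory -` B \<inter> space M)"
      unfolding \<mu>_def by (rule measure_distr) (use B in \<open>auto simp: \<mu>_def\<close>)
    also have "trajectory -` B \<inter> space M = {\<omega> \<in> space M. (\<lambda>i. X i \<omega>) \<in> B}" by (auto simp: trajectory_def)
    also have "measure M \<dots> \<in> {0, 1}"
      using erg B unfolding ergodic_process_def by (simp add: \<mu>_def PM_def \<theta>_def)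
    finally show "measure \<mu> B \<in> {0, 1}" .
  qed
  have i: "integrable \<mu> \<phi>" unfolding \<mu>_def using int by (simp add: integrable_distr_eq)
  have e: "(\<integral>y. \<phi> y \<partial>\<mu>) = (\<integral>\<omega>. \<phi> (trajectory \<omega>) \<partial>M)" unfolding \<mu>_def by (rule integral_distr) measurable
  have [measurable]: "avg \<phi> n \<in> borel_measurable PM" for n
    using avg_measurable[of \<phi> n] by (simp add: \<mu>_def)
  have "(\<integral>x. \<bar>avg \<phi> n x - (\<integral>y. \<phi> y \<partial>\<mu>)\<bar> \<partial>\<mu>) =
    (\<integral>\<omega>. \<bar>(\<Sum>k<Suc n. \<phi> (trajectory ((T ^^ k) \<omega>))) / real (Suc n) - (\<integral>\<omega>. \<phi> (trajectory \<omega>) \<partial>M)\<bar> \<partial>M)" for n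
  proof -
    have "(\<integral>x. \<bar>avg \<phi> n x - (\<integral>y. \<phi> y \<partial>\<mu>)\<bar> \<partial>\<mu>) = (\<integral>\<omega>. \<bar>avg \<phi> n (trajectory \<omega>) - (\<integral>\<omega>. \<phi> (trajectory \<omega>) \<partial>M)\<bar> \<partial>M)"
      unfolding e unfolding \<mu>_def by (rule integral_distr) measurable
    also have "\<dots> = (\<integral>\<omega>. \<bar>(\<Sum>k<Suc n. \<phi> (trajectory ((T ^^ k) \<omega>))) / real (Suc n) - (\<integral>\<omega>. \<phi> (trajectory \<omega>) \<partial>M)\<bar> \<partial>M)"
      by (intro Bochner_Integration.integral_cong refl) (simp only: avg_def trajectory_T_funpow)
    finally show ?thesis .
  qed
  then show ?thesis using mean_ergodic[OF i] by simp
qed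

end

section \<open>Characteristic functions of the normalised sums\<close>

text \<open>The powers \<open>(1 - \<kappa> / n) ^ K\<close> solve the equation without error. An
  error \<open>e\<close> in the equation grows at most to \<open>e * (1 + q) ^ K\<close> with
  \<open>q = \<bar>\<kappa>\<bar> / n\<close>, hence by at most the factor
  \<open>exp \<bar>\<kappa>\<bar>\<close> up to time \<open>n\<close>.\<close>

lemma discrete_gronwall_exp:
  fixes a :: "nat \<Rightarrow> nat \<Rightarrow> complex" and \<kappa> :: real
  assumes "\<And>\<epsilon>. \<epsilon> > 0 \<Longrightarrow>
    \<exists>N. \<forall>n\<ge>N. \<forall>K\<le>n. norm (a n K - 1 + of_real (\<kappa> / real n) * (\<Sum>l<K. a n l)) \<le> \<epsilon>"
  shows "(\<lambda>n. a n n) \<longlonglongrightarrow> of_real (exp (- \<kappa>))"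
proof -
  define b where "b n K = (1 - \<kappa> / real n) ^ K" for n K :: nat
  have b_eq: "b n K - 1 + (\<kappa> / real n) * (\<Sum>l<K. b n l) = 0" for n K
    by (induction K) (auto simp: b_def algebra_simps)
  have "(\<lambda>n. (1 + (- \<kappa>) / real n) ^ n) \<longlonglongrightarrow> exp (- \<kappa>)" by (rule tendsto_exp_limit_sequentially)
  then have b_lim: "(\<lambda>n. complex_of_real (b n n)) \<longlonglongrightarrow> of_real (exp (- \<kappa>))"
    unfolding b_def by (intro tendsto_of_real) simp
  have "(\<lambda>n. a n n - of_real (b n n)) \<longlonglongrightarrow> 0"
  proof (rule LIMSEQ_I)
    fix \<epsilon> :: real assume "\<epsilon> > 0"
    define e where "e = \<epsilon> / (2 * exp \<bar>\<kappa>\<bar>)"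
    have e: "e > 0" using \<open>\<epsilon> > 0\<close> by (simp add: e_def)
    from assms[OF this] obtain N where
      N: "\<And>n K. n \<ge> N \<Longrightarrow> K \<le> n \<Longrightarrow> norm (a n K - 1 + of_real (\<kappa> / real n) * (\<Sum>l<K. a n l)) \<le> e"
      by blast
    have "norm (a n n - of_real (b n n)) < \<epsilon>" if n: "n \<ge> max N 1" for n
    proof -
      define q where "q = \<bar>\<kappa>\<bar> / real n"
      have q: "q \<ge> 0" by (simp add: q_def)
      have geo: "e + q * (\<Sum>l<K. e * (1 + q) ^ l) = e * (1 + q) ^ K" for K
        by (induction K) (auto simp: algebra_simps)
      have d: "norm (a n K - of_real (b n K)) \<le> e * (1 + q) ^ K" if "K \<le> n" for K
        using that
      proof (induction K rule: less_induct)
        case (less K)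
        have "of_real (b n K) - 1 + of_real (\<kappa> / real n) * (\<Sum>l<K. of_real (b n l)) = (0 :: complex)"
          using arg_cong[OF b_eq[of n K], of complex_of_real] by simp
        then have "a n K - of_real (b n K) = (a n K - 1 + of_real (\<kappa> / real n) * (\<Sum>l<K. a n l))
          - of_real (\<kappa> / real n) * (\<Sum>l<K. a n l - of_real (b n l))"
          unfolding sum_subtractf right_diff_distrib by (simp add: algebra_simps)
        also have "norm \<dots> \<le> e + q * norm (\<Sum>l<K. a n l - of_real (b n l))"
        proof (rule order_trans[OF norm_triangle_ineq4], rule add_mono)
          show "norm (a n K - 1 + of_real (\<kappa> / real n) * (\<Sum>l<K. a n l)) \<le> e"
            using N[of n K] n less.prems by simp
          have "norm (complex_of_real (\<kappa> / real n)) = q" unfolding norm_of_real by (simp add: q_def)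
          then show "norm (of_real (\<kappa> / real n) * (\<Sum>l<K. a n l - of_real (b n l))) \<le> q * norm (\<Sum>l<K. a n l - of_real (b n l))"
            unfolding norm_mult by simp
        qed
        also have "\<dots> \<le> e + q * (\<Sum>l<K. e * (1 + q) ^ l)"
          using less by (intro add_left_mono mult_left_mono q order_trans[OF norm_sum sum_mono]) auto
        finally show ?case unfolding geo .
      qed
      have "(1 + q) ^ n \<le> exp q ^ n" using q exp_ge_add_one_self[of q] by (intro power_mono) auto
      also have "\<dots> = exp (real n * q)" by (rule exp_of_nat_mult[symmetric])
      also have "real n * q = \<bar>\<kappa>\<bar>" using n by (simp add: q_def)
      finally have "e * (1 + q) ^ n \<le> e * exp \<bar>\<kappa>\<bar>" using e by simp
      also have "\<dots> < \<epsilon>" using \<open>\<epsilon> > 0\<close> by (simp add: e_def)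
      finally show ?thesis using d[of n] by simp
    qed
    then show "\<exists>n0. \<forall>n\<ge>n0. norm ((a n n - of_real (b n n)) - 0) < \<epsilon>"
      by (intro exI[of _ "max N 1"]) simp
  qed
  from tendsto_add[OF this b_lim] show ?thesis by simp
qed

text \<open>\<open>taylor1\<close> and \<open>taylor2\<close> bound the remainders of the
  exponential after the first and the second order. One branch of each minimum is integrable under
  second moments and serves as dominating function, the other supplies an extra factor
  \<open>1 / sqrt n\<close>; this is how two moments suffice.\<close>

definition taylor1 :: "real \<Rightarrow> real" where "taylor1 y = min (y\<^sup>2) (2 * \<bar>y\<bar>)"

definition taylor2 :: "real \<Rightarrow> real" where "taylor2 y = min (y\<^sup>2) (\<bar>y\<bar> ^ 3)"

lemma taylor_measurable[measurable]: "taylor1 \<in> borel_measurable borel" "taylor2 \<in> borel_measurable borel"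
  unfolding taylor1_def[abs_def] taylor2_def[abs_def] by measurable

lemma iexp_taylor1: "norm (iexp y - 1 - \<i> * of_real y) \<le> taylor1 y"
  using iexp_approx1[of y 1] iexp_approx2[of y 1]
  by (simp add: taylor1_def numeral_2_eq_2[symmetric] algebra_simps)
     (smt (verit) zero_le_power2)

lemma iexp_taylor2: "norm (iexp y - 1 - \<i> * of_real y + of_real (y\<^sup>2 / 2)) \<le> taylor2 y"
proof -
  have "(\<Sum>k\<le>2. (\<i> * of_real y) ^ k / fact k) = 1 + \<i> * of_real y - complex_of_real (y\<^sup>2 / 2)"
    by (simp add: numeral_2_eq_2 power_mult_distrib)
  then have eq: "iexp y - (\<Sum>k\<le>2. (\<i> * of_real y) ^ k / fact k) = iexp y - 1 - \<i> * of_real y + of_real (y\<^sup>2 / 2)"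
    by (simp add: algebra_simps)
  have "\<bar>y\<bar> ^ Suc 2 / fact (Suc 2) \<le> \<bar>y\<bar> ^ Suc 2 / 1" by (intro divide_left_mono fact_ge_1) auto
  then have "\<bar>y\<bar> ^ Suc 2 / fact (Suc 2) \<le> \<bar>y\<bar> ^ 3" by simp
  moreover have "2 * \<bar>y\<bar> ^ 2 / fact 2 = y\<^sup>2" by (simp add: fact_2)
  ultimately show ?thesis
    using iexp_approx1[of y 2] iexp_approx2[of y 2] unfolding eq taylor2_def by simp
qed

lemma norm_iexp_diff_le: "norm (iexp y - 1) \<le> min 2 \<bar>y\<bar>"
  using iexp_approx1[of y 0] norm_triangle_ineq4[of "iexp y" 1] by simp

lemma integrable_bounded_mult:
  fixes W :: "'a \<Rightarrow> complex" and h :: "'a \<Rightarrow> real"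
  assumes [measurable]: "W \<in> borel_measurable M" and W: "\<And>\<omega>. norm (W \<omega>) \<le> C"
    and h: "integrable M h"
  shows "integrable M (\<lambda>\<omega>. W \<omega> * of_real (h \<omega>))"
proof (rule Bochner_Integration.integrable_bound)
  have [measurable]: "h \<in> borel_measurable M" using h by auto
  show "integrable M (\<lambda>\<omega>. C * \<bar>h \<omega>\<bar>)" using h by simp
  show "(\<lambda>\<omega>. W \<omega> * of_real (h \<omega>)) \<in> borel_measurable M" by measurable
  show "AE \<omega> in M. norm (W \<omega> * of_real (h \<omega>)) \<le> norm (C * \<bar>h \<omega>\<bar>)"
  proof (rule AE_I2)
    fix \<omega>
    have "norm (W \<omega>) * \<bar>h \<omega>\<bar> \<le> C * \<bar>h \<omega>\<bar>" using W by (intro mult_right_mono) auto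
    then show "norm (W \<omega> * of_real (h \<omega>)) \<le> norm (C * \<bar>h \<omega>\<bar>)" by (simp add: norm_mult)
  qed
qed

lemma norm_integral_le:
  fixes f :: "'a \<Rightarrow> 'b::{banach, second_countable_topology}"
  assumes "integrable M h" "\<And>\<omega>. \<omega> \<in> space M \<Longrightarrow> norm (f \<omega>) \<le> h \<omega>" "f \<in> borel_measurable M"
  shows "norm (\<integral>\<omega>. f \<omega> \<partial>M) \<le> (\<integral>\<omega>. h \<omega> \<partial>M)"
proof -
  have "integrable M f"
    by (rule Bochner_Integration.integrable_bound[OF assms(1,3)])
      (use assms(2) in \<open>auto intro!: AE_I2 intro: order_trans[OF _ abs_ge_self]\<close>)
  then have "(\<integral>\<omega>. norm (f \<omega>) \<partial>M) \<le> (\<integral>\<omega>. h \<omega> \<partial>M)"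
    using assms by (intro integral_mono) auto
  then show ?thesis using integral_norm_bound[of M f] by linarith
qed

text \<open>The two windows differ in at most \<open>r\<close> terms at either end.\<close>

lemma sum_shift_bound:
  fixes a :: "nat \<Rightarrow> 'b::real_normed_vector"
  assumes "\<And>l. norm (a l) \<le> A"
  shows "norm ((\<Sum>l<K. a l) - (\<Sum>l<K. a (l + r))) \<le> 2 * real r * A"
proof (induction r)
  case (Suc r)
  have "(\<Sum>l<K. a (l + r)) - (\<Sum>l<K. a (l + Suc r)) = - (\<Sum>l<K. a (Suc l + r) - a (l + r))"
    by (simp add: sum_subtractf)
  also have "\<dots> = a r - a (K + r)" by (subst sum_lessThan_telescope) simp
  also have "norm \<dots> \<le> A + A" by (rule order_trans[OF norm_triangle_ineq4 add_mono]) (rule assms)+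
  finally have "norm ((\<Sum>l<K. a (l + r)) - (\<Sum>l<K. a (l + Suc r))) \<le> 2 * A" by simp
  moreover have "(\<Sum>l<K. a l) - (\<Sum>l<K. a (l + Suc r)) =
    ((\<Sum>l<K. a l) - (\<Sum>l<K. a (l + r))) + ((\<Sum>l<K. a (l + r)) - (\<Sum>l<K. a (l + Suc r)))" by simp
  ultimately show ?case
    using Suc norm_triangle_ineq[of "(\<Sum>l<K. a l) - (\<Sum>l<K. a (l + r))" "(\<Sum>l<K. a (l + r)) - (\<Sum>l<K. a (l + Suc r))"]
    by (simp add: algebra_simps)
qed simp

lemma blinfun_apply_measurable[measurable]: "blinfun_apply v \<in> borel_measurable borel"
  by (intro borel_measurable_continuous_onI linear_continuous_on blinfun.bounded_linear_right)

lemma is_bochner_cond_exp_diff: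
  fixes f f' g g' :: "'a \<Rightarrow> 'b::{banach, second_countable_topology}"
  assumes f: "integrable M f" "integrable M f'" and F: "subalgebra M F"
    and g: "is_bochner_cond_exp M F f g" "is_bochner_cond_exp M F f' g'"
  shows "is_bochner_cond_exp M F (\<lambda>\<omega>. f \<omega> - f' \<omega>) (\<lambda>\<omega>. g \<omega> - g' \<omega>)"
proof -
  have A: "A \<in> sets M" if "A \<in> sets F" for A using F that by (auto simp: subalgebra_def)
  have i: "integrable M (\<lambda>\<omega>. indicator A \<omega> *\<^sub>R h \<omega>)" if "A \<in> sets F" "integrable M h" for A and h :: "'a \<Rightarrow> 'b"
    using integrable_mult_indicator[OF A[OF that(1)] that(2)] .
  have g': "g \<in> borel_measurable F" "g' \<in> borel_measurable F" "integrable M g" "integrable M g'"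
    and eq: "B \<in> sets F \<Longrightarrow> set_lebesgue_integral M B g = set_lebesgue_integral M B f"
      "B \<in> sets F \<Longrightarrow> set_lebesgue_integral M B g' = set_lebesgue_integral M B f'" for B
    using g unfolding is_bochner_cond_exp_def by auto
  show ?thesis
    unfolding is_bochner_cond_exp_def
  proof (intro conjI ballI)
    fix B assume B: "B \<in> sets F"
    show "set_lebesgue_integral M B (\<lambda>\<omega>. g \<omega> - g' \<omega>) = set_lebesgue_integral M B (\<lambda>\<omega>. f \<omega> - f' \<omega>)"
      using eq[OF B] unfolding set_lebesgue_integral_def scaleR_diff_right
      by (simp only: Bochner_Integration.integral_diff[OF i[OF B g'(3)] i[OF B g'(4)]]
          Bochner_Integration.integral_diff[OF i[OF B f(1)] i[OF B f(2)]])
  qed (use g' in auto)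
qed

section \<open>Covariances of the sequence and convergence of their series\<close>

locale clt_process = projectively_summable M T X F
  for M :: "'a measure" and T and X :: "int \<Rightarrow> 'a \<Rightarrow> 'b::{banach, second_countable_topology}" and F +
  assumes centered: "\<And>i. (\<integral>\<omega>. X i \<omega> \<partial>M) = 0"
    and erg: "ergodic_process M X"
begin

definition gam :: "('b \<Rightarrow>\<^sub>L real) \<Rightarrow> ('b \<Rightarrow>\<^sub>L real) \<Rightarrow> nat \<Rightarrow> real" where
  "gam u v j = (\<integral>\<omega>. u (X 0 \<omega>) * v (X (int j) \<omega>) \<partial>M)"

lemma functional_sq_integrable:
  fixes v :: "'b \<Rightarrow>\<^sub>L real"
  assumes [measurable]: "h \<in> borel_measurable M" and "integrable M (\<lambda>\<omega>. (norm (h \<omega>))\<^sup>2)"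
  shows "integrable M (\<lambda>\<omega>. (v (h \<omega>))\<^sup>2)"
proof (rule Bochner_Integration.integrable_bound)
  show "integrable M (\<lambda>\<omega>. (norm v)\<^sup>2 * (norm (h \<omega>))\<^sup>2)" using assms by simp
  have "(v b)\<^sup>2 \<le> (norm v)\<^sup>2 * (norm b)\<^sup>2" for b
    using power_mono[OF norm_blinfun[of v b], of 2] by (simp add: power_mult_distrib)
  then show "AE \<omega> in M. norm ((v (h \<omega>))\<^sup>2) \<le> norm ((norm v)\<^sup>2 * (norm (h \<omega>))\<^sup>2)" by simp
qed measurable

lemma functional_mult_integrable:
  fixes u v :: "'b \<Rightarrow>\<^sub>L real"
  assumes "h \<in> borel_measurable M" "integrable M (\<lambda>\<omega>. (norm (h \<omega>))\<^sup>2)"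
    and "h' \<in> borel_measurable M" "integrable M (\<lambda>\<omega>. (norm (h' \<omega>))\<^sup>2)"
  shows "integrable M (\<lambda>\<omega>. u (h \<omega>) * v (h' \<omega>))"
  by (rule integrable_mult_of_squares) (use assms in \<open>auto intro!: functional_sq_integrable\<close>)

lemma XX_integrable:
  fixes u v :: "'b \<Rightarrow>\<^sub>L real"
  shows "integrable M (\<lambda>\<omega>. u (X i \<omega>) * v (X j \<omega>))"
  by (rule functional_mult_integrable[OF X_measurable X_sq_integrable X_measurable X_sq_integrable])

lemma XS_integrable:
  fixes u v :: "'b \<Rightarrow>\<^sub>L real"
  shows "integrable M (\<lambda>\<omega>. u (X i \<omega>) * v (S j \<omega>))"
  by (rule functional_mult_integrable[OF X_measurable X_sq_integrable S_measurable S_sq_integrable])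

lemma S_diff_sq_integrable: "integrable M (\<lambda>\<omega>. (norm (S j \<omega> - S m \<omega>))\<^sup>2)"
  using integrable_norm_sq_add[of "S j" M "\<lambda>\<omega>. - S m \<omega>"] S_sq_integrable by simp

lemma g_diff_cond_exp:
  "is_bochner_cond_exp M (F 0) (\<lambda>\<omega>. S j \<omega> - S m \<omega>) (\<lambda>\<omega>. g j \<omega> - g m \<omega>)"
  by (rule is_bochner_cond_exp_diff[OF S_integrable S_integrable F0.subalg g_cond_exp g_cond_exp])

lemma sum_gam: "(\<Sum>j=1..n. gam u v j) = (\<integral>\<omega>. u (X 0 \<omega>) * v (S n \<omega>) \<partial>M)"
proof (induction n)
  case (Suc n)
  have "(\<integral>\<omega>. u (X 0 \<omega>) * v (S (Suc n) \<omega>) \<partial>M) = (\<integral>\<omega>. u (X 0 \<omega>) * v (S n \<omega>) + u (X 0 \<omega>) * v (X (int (Suc n)) \<omega>) \<partial>M)"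
    by (simp only: S_Suc blinfun.add_right distrib_left)
  also have "\<dots> = (\<integral>\<omega>. u (X 0 \<omega>) * v (S n \<omega>) \<partial>M) + gam u v (Suc n)"
    unfolding gam_def by (rule Bochner_Integration.integral_add[OF XS_integrable XX_integrable])
  finally show ?case using Suc by simp
qed (simp add: S_0 blinfun.zero_right)

text \<open>The increment bound is used at \<open>l = 0\<close> with a bilinear pairing:
  \<open>S 0\<close> vanishes and \<open>S 1\<close> is \<open>X 0\<close> shifted once.\<close>

lemma X0_S_diff_bound:
  fixes u v :: "'b \<Rightarrow>\<^sub>L real"
  assumes int: "integrable M (\<lambda>\<omega>. norm (X 0 \<omega>) * norm (g j \<omega> - g m \<omega>))"
  shows "\<bar>\<integral>\<omega>. u (X 0 \<omega>) * v (S j \<omega> - S m \<omega>) \<partial>M\<bar> \<le>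
    norm u * norm v * (\<integral>\<omega>. norm (X 0 \<omega>) * norm (g j \<omega> - g m \<omega>) \<partial>M)"
proof -
  define \<Phi> where "\<Phi> w b = blinfun_apply u w * blinfun_apply v b" for w b
  have "norm (\<integral>\<omega>. \<Phi> (S (Suc 0) \<omega>) (S j ((T ^^ Suc 0) \<omega>) - S m ((T ^^ Suc 0) \<omega>)) - \<Phi> (S 0 \<omega>) (S j ((T ^^ Suc 0) \<omega>) - S m ((T ^^ Suc 0) \<omega>)) \<partial>M)
    \<le> (norm u * norm v) * (\<integral>\<omega>. norm (X 0 \<omega>) * norm ((\<lambda>b. b) (g j \<omega> - g m \<omega>)) \<partial>M)"
  proof (rule increment_pairing_bound[OF g_diff_cond_exp _ S_diff_sq_integrable])
    show "integrable M (\<lambda>\<omega>. S j \<omega> - S m \<omega>)" using S_integrable by auto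
    show "bounded_linear (\<Phi> w)" for w
      unfolding \<Phi>_def by (intro bounded_linear_mult_right[THEN bounded_linear_compose] blinfun.bounded_linear_right)
    show "continuous_on UNIV (\<lambda>(w, b). \<Phi> w b)"
      unfolding \<Phi>_def case_prod_unfold by (intro continuous_intros)
    show "norm (\<Phi> a b - \<Phi> w b) \<le> (norm u * norm v) * norm (a - w) * norm b" for a w b
    proof -
      have "norm (\<Phi> a b - \<Phi> w b) = norm (u (a - w)) * norm (v b)"
        unfolding \<Phi>_def by (simp add: blinfun.diff_right left_diff_distrib[symmetric] abs_mult)
      also have "\<dots> \<le> (norm u * norm (a - w)) * (norm v * norm b)"
        by (intro mult_mono norm_blinfun) auto
      finally show ?thesis by (simp add: mult_ac)
    qed
  qed (use int in \<open>auto simp: \<Phi>_def blinfun.zero_right\<close>)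
  also have "(\<integral>\<omega>. \<Phi> (S (Suc 0) \<omega>) (S j ((T ^^ Suc 0) \<omega>) - S m ((T ^^ Suc 0) \<omega>)) - \<Phi> (S 0 \<omega>) (S j ((T ^^ Suc 0) \<omega>) - S m ((T ^^ Suc 0) \<omega>)) \<partial>M)
    = (\<integral>\<omega>. (\<lambda>\<omega>. u (X 0 \<omega>) * v (S j \<omega> - S m \<omega>)) ((T ^^ Suc 0) \<omega>) \<partial>M)"
  proof (rule Bochner_Integration.integral_cong[OF refl])
    fix \<omega> assume \<omega>: "\<omega> \<in> space M"
    have "S (Suc 0) \<omega> = X 0 ((T ^^ Suc 0) \<omega>)"
      using X_T_funpow[OF \<omega>, of 0 "Suc 0"] by (simp add: S_Suc S_0)
    then show "\<Phi> (S (Suc 0) \<omega>) (S j ((T ^^ Suc 0) \<omega>) - S m ((T ^^ Suc 0) \<omega>)) - \<Phi> (S 0 \<omega>) (S j ((T ^^ Suc 0) \<omega>) - S m ((T ^^ Suc 0) \<omega>))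
      = (\<lambda>\<omega>. u (X 0 \<omega>) * v (S j \<omega> - S m \<omega>)) ((T ^^ Suc 0) \<omega>)"
      by (simp add: \<Phi>_def S_0 blinfun.zero_right)
  qed
  also have "\<dots> = (\<integral>\<omega>. u (X 0 \<omega>) * v (S j \<omega> - S m \<omega>) \<partial>M)"
    by (rule integral_shift) measurable
  finally show ?thesis by simp
qed

text \<open>The partial sums are the expectations of \<open>u (X 0) * v (S n)\<close>, so the Cauchy
  property in L1 transfers to them as a whole; the individual covariances are not estimated.\<close>

lemma summable_gam: "summable (\<lambda>j. gam u v (Suc j))"
proof -
  have "Cauchy (\<lambda>n. \<Sum>j<n. gam u v (Suc j))"
  proof (rule CauchyI)
    fix \<epsilon> :: real assume "\<epsilon> > 0"
    define e where "e = \<epsilon> / (4 * (norm u * norm v + 1))"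
    have nuv: "norm u * norm v + 1 > 0" by (intro add_nonneg_pos mult_nonneg_nonneg) auto
    have e: "e > 0" unfolding e_def using \<open>\<epsilon> > 0\<close> nuv by simp
    obtain m where "m \<ge> 1" and m: "\<forall>n\<ge>m. integrable M (\<lambda>\<omega>. norm (X 0 \<omega>) * norm (g n \<omega> - g m \<omega>)) \<and>
      (\<integral>\<omega>. norm (X 0 \<omega>) * norm (g n \<omega> - g m \<omega>) \<partial>M) \<le> e"
      using Y_Cauchy[OF e] by (elim exE conjE) (rule that)
    have eq: "(\<Sum>j<n. gam u v (Suc j)) = (\<integral>\<omega>. u (X 0 \<omega>) * v (S n \<omega>) \<partial>M)" for n
      using sum_gam[of u v n] by (simp add: sum.atLeast1_atMost_eq)
    have b: "\<bar>(\<Sum>j<n. gam u v (Suc j)) - (\<Sum>j<m. gam u v (Suc j))\<bar> \<le> \<epsilon> / 4" if "n \<ge> m" for n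
    proof -
      have "(\<Sum>j<n. gam u v (Suc j)) - (\<Sum>j<m. gam u v (Suc j)) = (\<integral>\<omega>. u (X 0 \<omega>) * v (S n \<omega> - S m \<omega>) \<partial>M)"
        unfolding eq using XS_integrable by (simp add: blinfun.diff_right right_diff_distrib)
      also have "\<bar>\<dots>\<bar> \<le> norm u * norm v * (\<integral>\<omega>. norm (X 0 \<omega>) * norm (g n \<omega> - g m \<omega>) \<partial>M)"
        using m that by (intro X0_S_diff_bound) simp
      also have "\<dots> \<le> norm u * norm v * e" using m that by (intro mult_left_mono) auto
      also have "\<dots> \<le> (norm u * norm v + 1) * e" using e by (simp add: distrib_right)
      also have "\<dots> = \<epsilon> / 4"
      proof -
        have "a * (\<epsilon> / (4 * a)) = \<epsilon> / 4" if "a > 0" for a :: real using that by simp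
        from this[OF nuv] show ?thesis unfolding e_def .
      qed
      finally show ?thesis .
    qed
    show "\<exists>M. \<forall>p\<ge>M. \<forall>q\<ge>M. norm ((\<Sum>j<p. gam u v (Suc j)) - (\<Sum>j<q. gam u v (Suc j))) < \<epsilon>"
    proof (intro exI[of _ m] allI impI)
      fix p q assume "p \<ge> m" "q \<ge> m"
      then show "norm ((\<Sum>j<p. gam u v (Suc j)) - (\<Sum>j<q. gam u v (Suc j))) < \<epsilon>"
        using b[of p] b[of q] \<open>\<epsilon> > 0\<close> unfolding real_norm_def by linarith
    qed
  qed
  then show ?thesis by (simp add: summable_iff_convergent Cauchy_convergent_iff)
qed

end

lemma norm_iexp_diff_iexp_le: "norm (iexp x - iexp y) \<le> \<bar>x - y\<bar>"
proof -
  have "iexp x - iexp y = iexp y * (iexp (x - y) - 1)"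
    by (simp add: algebra_simps flip: exp_add)
  then have "norm (iexp x - iexp y) = norm (iexp (x - y) - 1)" by (simp add: norm_mult)
  with norm_iexp_diff_le[of "x - y"] show ?thesis by simp
qed

section \<open>Expansion of the characteristic function along the sums\<close>

context clt_process
begin

definition U :: "('b \<Rightarrow>\<^sub>L real) \<Rightarrow> real \<Rightarrow> nat \<Rightarrow> 'a \<Rightarrow> complex" where
  "U v s l \<omega> = iexp (s * v (S l \<omega>))"

text \<open>Contribution of one step to the exponent: its mean is half the variance series cut at
  lag \<open>m\<close>.\<close>

definition V :: "('b \<Rightarrow>\<^sub>L real) \<Rightarrow> nat \<Rightarrow> 'a \<Rightarrow> real" where
  "V v m \<omega> = (v (X 0 \<omega>))\<^sup>2 / 2 + v (X 0 \<omega>) * v (S m \<omega>)"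

lemma U_measurable[measurable]: "U v s l \<in> borel_measurable M"
  unfolding U_def[abs_def] by measurable

lemma norm_U: "norm (U v s l \<omega>) = 1"
  by (simp add: U_def)

lemma U_0: "U v s 0 \<omega> = 1"
  by (simp add: U_def S_0 blinfun.zero_right)

lemma U_add: "\<omega> \<in> space M \<Longrightarrow> U v s (l + r) \<omega> = U v s l \<omega> * iexp (s * v (S r ((T ^^ l) \<omega>)))"
  unfolding U_def S_T_funpow by (simp add: blinfun.diff_right algebra_simps flip: exp_add)

lemma U_Suc: "U v s (Suc l) \<omega> = U v s l \<omega> * iexp (s * v (X (int (Suc l)) \<omega>))"
  unfolding U_def S_Suc by (simp add: blinfun.add_right distrib_left exp_add)

lemma U_mult_integrable:
  "integrable M h \<Longrightarrow> integrable M (\<lambda>\<omega>. U v s l \<omega> * complex_of_real (h \<omega>))"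
  by (rule integrable_bounded_mult[where C=1]) (simp_all add: norm_U)

lemma norm_integral_U_mult_le:
  assumes "integrable M h"
  shows "norm (\<integral>\<omega>. U v s l \<omega> * complex_of_real (h \<omega>) \<partial>M) \<le> (\<integral>\<omega>. \<bar>h \<omega>\<bar> \<partial>M)"
proof (rule norm_integral_le)
  have [measurable]: "h \<in> borel_measurable M" using assms by auto
  show "(\<lambda>\<omega>. U v s l \<omega> * complex_of_real (h \<omega>)) \<in> borel_measurable M" by measurable
qed (use assms in \<open>auto simp: norm_mult norm_U\<close>)

lemma V_integrable: "integrable M (V v m)"
  unfolding V_def using XX_integrable[of v 0 v 0] XS_integrable[of v 0 v m] by (simp add: power2_eq_square)

lemma X_Suc_T: "\<omega> \<in> space M \<Longrightarrow> X (int (Suc l)) \<omega> = X 0 ((T ^^ Suc l) \<omega>)"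
  by (simp only: X_T_funpow add_0)

text \<open>\<open>g 0\<close> is a version of the conditional expectation of 0, hence 0 only almost surely.\<close>

definition g0 :: "nat \<Rightarrow> 'a \<Rightarrow> 'b" where "g0 j = (if j = 0 then (\<lambda>_. 0) else g j)"

lemma g0_cond_exp: "is_bochner_cond_exp M (F 0) (S j) (g0 j)"
  using g_cond_exp[of j] by (cases j) (auto simp: g0_def is_bochner_cond_exp_def set_lebesgue_integral_def S_0)

lemma g0_integrable: "integrable M (\<lambda>\<omega>. norm (X 0 \<omega>) * norm (g0 j \<omega>))"
  using integrable_X0_R_g[OF bounded_linear_ident, of j] by (cases j) (auto simp: g0_def)

text \<open>The future \<open>S K - S (Suc l)\<close> in the summation by parts is replaced by the
  next \<open>m\<close> variables. It has length at least \<open>m\<close> except for at most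
  \<open>m\<close> final indices \<open>l\<close>; there the two conditional expectations are
  bounded separately, which costs \<open>2 * B\<close> each.\<close>

lemma linear_term_bound:
  assumes s: "s \<ge> 0" and m: "m \<ge> 1" and B: "B \<ge> 0" "\<And>n. n \<ge> 1 \<Longrightarrow> (\<integral>\<omega>. norm (X 0 \<omega>) * norm (g n \<omega>) \<partial>M) \<le> B"
    and \<eta>: "\<forall>n\<ge>m. integrable M (\<lambda>\<omega>. norm (X 0 \<omega>) * norm (g n \<omega> - g m \<omega>)) \<and>
      (\<integral>\<omega>. norm (X 0 \<omega>) * norm (g n \<omega> - g m \<omega>) \<partial>M) \<le> \<eta>" "\<eta> \<ge> 0"
  shows "norm ((\<Sum>k<K. \<integral>\<omega>. U v s k \<omega> * complex_of_real (v (X (int (Suc k)) \<omega>)) \<partial>M)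
      - (\<Sum>l<K. \<integral>\<omega>. (U v s (Suc l) \<omega> - U v s l \<omega>) * complex_of_real (v (S m ((T ^^ Suc l) \<omega>))) \<partial>M))
    \<le> s * (norm v)\<^sup>2 * (real K * \<eta> + 2 * B * real m)"
proof -
  \<comment> \<open>Subtracting 1 makes \<open>\<Phi>\<close> vanish at 0; in the linear terms this
    is invisible after taking expectations, because \<open>X\<close> is centered.\<close>
  define \<Phi> where "\<Phi> w b = (iexp (s * v w) - 1) * complex_of_real (v b)" for w b
  define L where "L = s * (norm v)\<^sup>2"
  have L: "L \<ge> 0" using s by (simp add: L_def)
  have lin: "bounded_linear (\<Phi> w)" for w
    unfolding \<Phi>_def by (intro bounded_linear_mult_right[THEN bounded_linear_compose]
      bounded_linear_of_real[THEN bounded_linear_compose] blinfun.bounded_linear_right)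
  have zero: "\<Phi> 0 b = 0" for b by (simp add: \<Phi>_def blinfun.zero_right)
  have cont: "continuous_on UNIV (\<lambda>(w, b). \<Phi> w b)"
    unfolding \<Phi>_def case_prod_unfold by (intro continuous_intros)
  have lip: "norm (\<Phi> a b - \<Phi> w b) \<le> L * norm (a - w) * norm ((\<lambda>b. b) b)" for a w b
  proof -
    have "norm (\<Phi> a b - \<Phi> w b) = norm (iexp (s * v a) - iexp (s * v w)) * \<bar>v b\<bar>"
      unfolding \<Phi>_def by (simp add: norm_mult flip: left_diff_distrib)
    also have "\<dots> \<le> (s * \<bar>v (a - w)\<bar>) * \<bar>v b\<bar>"
      using norm_iexp_diff_iexp_le[of "s * v a" "s * v w"] s
      by (intro mult_right_mono) (auto simp: blinfun.diff_right abs_mult simp flip: right_diff_distrib)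
    also have "\<dots> \<le> (s * (norm v * norm (a - w))) * (norm v * norm b)"
      using norm_blinfun[of v "a - w"] norm_blinfun[of v b] s by (intro mult_mono mult_left_mono) auto
    finally show ?thesis by (simp add: L_def power2_eq_square mult_ac)
  qed
  have bd: "norm (\<Phi> w b) \<le> L * (norm w * norm b)" for w b using lip[of w b 0] by (simp add: zero mult.assoc)
  have int_\<Phi>: "integrable M (\<lambda>\<omega>. \<Phi> (S k \<omega>) (h \<omega>))"
    if "h \<in> borel_measurable M" "integrable M (\<lambda>\<omega>. (norm (h \<omega>))\<^sup>2)" for k h
    using cont bd S_measurable S_sq_integrable that by (rule integrable_pairing)
  have S_T_sq: "integrable M (\<lambda>\<omega>. (norm (S m ((T ^^ Suc l) \<omega>)))\<^sup>2)" for l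
    using integrable_shift[of "\<lambda>\<omega>. (norm (S m \<omega>))\<^sup>2" "Suc l"] S_sq_integrable by simp
  have S_T_meas: "(\<lambda>\<omega>. S m ((T ^^ Suc l) \<omega>)) \<in> borel_measurable M" for l
    using measurable_compose[OF T_funpow_measurable S_measurable] .
  define near where "near l = (\<integral>\<omega>. \<Phi> (S (Suc l) \<omega>) (S m ((T ^^ Suc l) \<omega>)) - \<Phi> (S l \<omega>) (S m ((T ^^ Suc l) \<omega>)) \<partial>M)" for l
  have near_eq: "near l = (\<integral>\<omega>. (U v s (Suc l) \<omega> - U v s l \<omega>) * complex_of_real (v (S m ((T ^^ Suc l) \<omega>))) \<partial>M)" for l
    unfolding near_def \<Phi>_def U_def by (intro Bochner_Integration.integral_cong refl) (simp add: algebra_simps del: funpow.simps)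
  have X_eq: "(\<integral>\<omega>. U v s k \<omega> * complex_of_real (v (X (int (Suc k)) \<omega>)) \<partial>M) = (\<integral>\<omega>. \<Phi> (S k \<omega>) (X (int (Suc k)) \<omega>) \<partial>M)" for k
  proof -
    have "integrable M (\<lambda>\<omega>. v (X i \<omega>))" for i
      using integrable_bounded_linear[OF blinfun.bounded_linear_right X_integrable] .
    moreover have "(\<integral>\<omega>. v (X i \<omega>) \<partial>M) = 0" for i
      using integral_bounded_linear[OF blinfun.bounded_linear_right X_integrable, of v i] centered[of i]
      by (simp add: blinfun.zero_right)
    ultimately show ?thesis
      using U_mult_integrable[of "\<lambda>\<omega>. v (X (int (Suc k)) \<omega>)" v s k]
      unfolding \<Phi>_def U_def left_diff_distrib mult_1_left
      by (subst Bochner_Integration.integral_diff) (auto simp del: of_nat_Suc)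
  qed
  have d_meas: "(\<lambda>\<omega>. S K \<omega> - S (Suc l) \<omega>) \<in> borel_measurable M" for l by measurable
  have "(\<Sum>k<K. \<integral>\<omega>. \<Phi> (S k \<omega>) (X (int (Suc k)) \<omega>) \<partial>M) = (\<integral>\<omega>. (\<Sum>k<K. \<Phi> (S k \<omega>) (X (int (Suc k)) \<omega>)) \<partial>M)"
    by (intro Bochner_Integration.integral_sum[symmetric] int_\<Phi> X_measurable X_sq_integrable)
  also have "\<dots> = (\<integral>\<omega>. (\<Sum>l<K. \<Phi> (S (Suc l) \<omega>) (S K \<omega> - S (Suc l) \<omega>) - \<Phi> (S l \<omega>) (S K \<omega> - S (Suc l) \<omega>)) \<partial>M)"
  proof (rule Bochner_Integration.integral_cong[OF refl])
    fix \<omega>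
    have "\<Phi> (S 0 \<omega>) b = 0" for b by (simp add: S_0 zero)
    from sum_by_parts_pairing[of \<Phi> "\<lambda>k. S k \<omega>", OF lin this, of K]
    show "(\<Sum>k<K. \<Phi> (S k \<omega>) (X (int (Suc k)) \<omega>)) =
      (\<Sum>l<K. \<Phi> (S (Suc l) \<omega>) (S K \<omega> - S (Suc l) \<omega>) - \<Phi> (S l \<omega>) (S K \<omega> - S (Suc l) \<omega>))"
      by (simp only: S_Suc add_diff_cancel_left')
  qed
  also have "\<dots> = (\<Sum>l<K. \<integral>\<omega>. \<Phi> (S (Suc l) \<omega>) (S K \<omega> - S (Suc l) \<omega>) - \<Phi> (S l \<omega>) (S K \<omega> - S (Suc l) \<omega>) \<partial>M)"
    by (intro Bochner_Integration.integral_sum Bochner_Integration.integrable_diff int_\<Phi> d_meas S_diff_sq_integrable)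
  finally have sum_eq: "(\<Sum>k<K. \<integral>\<omega>. \<Phi> (S k \<omega>) (X (int (Suc k)) \<omega>) \<partial>M) =
    (\<Sum>l<K. \<integral>\<omega>. \<Phi> (S (Suc l) \<omega>) (S K \<omega> - S (Suc l) \<omega>) - \<Phi> (S l \<omega>) (S K \<omega> - S (Suc l) \<omega>) \<partial>M)" .
  have trm: "norm ((\<integral>\<omega>. \<Phi> (S (Suc l) \<omega>) (S K \<omega> - S (Suc l) \<omega>) - \<Phi> (S l \<omega>) (S K \<omega> - S (Suc l) \<omega>) \<partial>M) - near l)
    \<le> L * (\<eta> + (if K - Suc l < m then 2 * B else 0))" if l: "l < K" for l
  proof -
    define j where "j = K - Suc l"
    have j: "Suc l + j = K" using l by (simp add: j_def)
    have "(\<integral>\<omega>. \<Phi> (S (Suc l) \<omega>) (S K \<omega> - S (Suc l) \<omega>) - \<Phi> (S l \<omega>) (S K \<omega> - S (Suc l) \<omega>) \<partial>M) - near l =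
      (\<integral>\<omega>. (\<Phi> (S (Suc l) \<omega>) (S K \<omega> - S (Suc l) \<omega>) - \<Phi> (S l \<omega>) (S K \<omega> - S (Suc l) \<omega>))
        - (\<Phi> (S (Suc l) \<omega>) (S m ((T ^^ Suc l) \<omega>)) - \<Phi> (S l \<omega>) (S m ((T ^^ Suc l) \<omega>))) \<partial>M)"
      unfolding near_def
      by (intro Bochner_Integration.integral_diff[symmetric] Bochner_Integration.integrable_diff int_\<Phi> d_meas S_diff_sq_integrable S_T_meas S_T_sq)
    also have "\<dots> = (\<integral>\<omega>. \<Phi> (S (Suc l) \<omega>) (S j ((T ^^ Suc l) \<omega>) - S m ((T ^^ Suc l) \<omega>)) - \<Phi> (S l \<omega>) (S j ((T ^^ Suc l) \<omega>) - S m ((T ^^ Suc l) \<omega>)) \<partial>M)"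
      by (intro Bochner_Integration.integral_cong refl)
        (simp only: S_T_funpow[of _ j] j linear_simps(2)[OF lin], simp add: algebra_simps)
    finally have eq: "(\<integral>\<omega>. \<Phi> (S (Suc l) \<omega>) (S K \<omega> - S (Suc l) \<omega>) - \<Phi> (S l \<omega>) (S K \<omega> - S (Suc l) \<omega>) \<partial>M) - near l
      = (\<integral>\<omega>. \<Phi> (S (Suc l) \<omega>) (S j ((T ^^ Suc l) \<omega>) - S m ((T ^^ Suc l) \<omega>)) - \<Phi> (S l \<omega>) (S j ((T ^^ Suc l) \<omega>) - S m ((T ^^ Suc l) \<omega>)) \<partial>M)" .
    \<comment> \<open>The remaining length \<open>j\<close> is 0 for the last \<open>l\<close>;
      there \<open>g0\<close> is exactly 0.\<close>
    have ce: "is_bochner_cond_exp M (F 0) (\<lambda>\<omega>. S j \<omega> - S m \<omega>) (\<lambda>\<omega>. g0 j \<omega> - g0 m \<omega>)"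
      by (rule is_bochner_cond_exp_diff[OF S_integrable S_integrable F0.subalg g0_cond_exp g0_cond_exp])
    have ig: "integrable M (\<lambda>\<omega>. norm (X 0 \<omega>) * norm (g0 j \<omega> - g0 m \<omega>))
      \<and> (\<integral>\<omega>. norm (X 0 \<omega>) * norm (g0 j \<omega> - g0 m \<omega>) \<partial>M) \<le> \<eta> + (if j < m then 2 * B else 0)"
    proof (cases "j < m")
      case False
      then have "g0 j = g j" "g0 m = g m" using m by (auto simp: g0_def)
      then show ?thesis using \<eta>(1) False by simp
    next
      case True
      have [measurable]: "g0 i \<in> borel_measurable M" for i
        using g0_cond_exp[of i] unfolding is_bochner_cond_exp_def by auto
      have tri: "norm (X 0 \<omega>) * norm (g0 j \<omega> - g0 m \<omega>) \<le> norm (X 0 \<omega>) * norm (g0 j \<omega>) + norm (X 0 \<omega>) * norm (g0 m \<omega>)" for \<omega>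
        unfolding distrib_left[symmetric] by (intro mult_left_mono norm_triangle_ineq4) auto
      have i: "integrable M (\<lambda>\<omega>. norm (X 0 \<omega>) * norm (g0 j \<omega> - g0 m \<omega>))"
        by (rule Bochner_Integration.integrable_bound[OF Bochner_Integration.integrable_add[OF g0_integrable[of j] g0_integrable[of m]]])
          (use tri in auto)
      have b: "(\<integral>\<omega>. norm (X 0 \<omega>) * norm (g0 i \<omega>) \<partial>M) \<le> B" for i
        using B by (cases i) (auto simp: g0_def)
      have "(\<integral>\<omega>. norm (X 0 \<omega>) * norm (g0 j \<omega> - g0 m \<omega>) \<partial>M) \<le> (\<integral>\<omega>. norm (X 0 \<omega>) * norm (g0 j \<omega>) + norm (X 0 \<omega>) * norm (g0 m \<omega>) \<partial>M)"
        by (rule integral_mono[OF i Bochner_Integration.integrable_add[OF g0_integrable[of j] g0_integrable[of m]] tri])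
      also have "\<dots> \<le> 2 * B"
        using b[of j] b[of m] by (subst Bochner_Integration.integral_add[OF g0_integrable g0_integrable]) simp
      finally show ?thesis using i True \<eta>(2) by simp
    qed
    have "norm (\<integral>\<omega>. \<Phi> (S (Suc l) \<omega>) (S j ((T ^^ Suc l) \<omega>) - S m ((T ^^ Suc l) \<omega>)) - \<Phi> (S l \<omega>) (S j ((T ^^ Suc l) \<omega>) - S m ((T ^^ Suc l) \<omega>)) \<partial>M)
      \<le> L * (\<integral>\<omega>. norm (X 0 \<omega>) * norm ((\<lambda>b. b) (g0 j \<omega> - g0 m \<omega>)) \<partial>M)"
      by (rule increment_pairing_bound[OF ce _ S_diff_sq_integrable _ lin cont zero bounded_linear_ident lip L])
        (use ig S_integrable in auto)
    also have "\<dots> \<le> L * (\<eta> + (if j < m then 2 * B else 0))" using ig L by (intro mult_left_mono) auto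
    finally show ?thesis unfolding eq by (simp add: j_def)
  qed
  have "norm ((\<Sum>k<K. \<integral>\<omega>. \<Phi> (S k \<omega>) (X (int (Suc k)) \<omega>) \<partial>M) - (\<Sum>l<K. near l))
    \<le> (\<Sum>l<K. L * (\<eta> + (if K - Suc l < m then 2 * B else 0)))"
    unfolding sum_eq sum_subtractf[symmetric] by (rule order_trans[OF norm_sum sum_mono]) (use trm in auto)
  also have "\<dots> = L * (real K * \<eta> + (\<Sum>l<K. if K - Suc l < m then 2 * B else 0))"
    by (simp add: sum_distrib_left[symmetric] sum.distrib)
  also have "(\<Sum>l<K. if K - Suc l < m then 2 * B else 0) = (\<Sum>j<K. if j < m then 2 * B else 0)"
    by (rule sum.nat_diff_reindex)
  also have "\<dots> = (\<Sum>j\<in>{..<K} \<inter> {j. j < m}. 2 * B)" by (subst sum.inter_restrict) (auto intro: sum.cong)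
  also have "\<dots> \<le> 2 * B * real m"
  proof -
    have "card ({..<K} \<inter> {j. j < m}) \<le> card {..<m}" by (intro card_mono) auto
    then have "real (card ({..<K} \<inter> {j. j < m})) * (2 * B) \<le> real m * (2 * B)"
      using B(1) by (intro mult_right_mono) auto
    then show ?thesis by (simp add: mult_ac)
  qed
  finally have "norm ((\<Sum>k<K. \<integral>\<omega>. \<Phi> (S k \<omega>) (X (int (Suc k)) \<omega>) \<partial>M) - (\<Sum>l<K. near l))
    \<le> L * (real K * \<eta> + 2 * B * real m)" using L by (simp add: mult_left_mono)
  then show ?thesis unfolding X_eq near_eq L_def .
qed

text \<open>Telescoping \<open>U\<close> and expanding each step to second order gives a linear term
  \<open>\<i> * s * a k\<close> and a quadratic one. Summation by parts rewrites the linear sum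
  through \<open>near\<close>, whose expansion to first order yields a second factor
  \<open>\<i> * s\<close>; both terms are then of order \<open>s^2\<close> and combine to
  \<open>V\<close>. The three errors are the second order remainder, the replacement of the future
  by \<open>m\<close> steps, and the first order remainder.\<close>

lemma main_step:
  assumes s: "s \<ge> 0" and m: "m \<ge> 1" and B: "B \<ge> 0" "\<And>n. n \<ge> 1 \<Longrightarrow> (\<integral>\<omega>. norm (X 0 \<omega>) * norm (g n \<omega>) \<partial>M) \<le> B"
    and \<eta>: "\<forall>n\<ge>m. integrable M (\<lambda>\<omega>. norm (X 0 \<omega>) * norm (g n \<omega> - g m \<omega>)) \<and>
      (\<integral>\<omega>. norm (X 0 \<omega>) * norm (g n \<omega> - g m \<omega>) \<partial>M) \<le> \<eta>" "\<eta> \<ge> 0"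
  shows "norm ((\<integral>\<omega>. U v s K \<omega> \<partial>M) - 1
      + of_real (s\<^sup>2) * (\<Sum>l<K. \<integral>\<omega>. U v s l \<omega> * complex_of_real (V v m ((T ^^ Suc l) \<omega>)) \<partial>M))
    \<le> real K * (\<integral>\<omega>. taylor2 (s * v (X 0 \<omega>)) \<partial>M)
      + s\<^sup>2 * (norm v)\<^sup>2 * (real K * \<eta> + 2 * B * real m)
      + s * real K * (\<integral>\<omega>. taylor1 (s * v (X 0 \<omega>)) * \<bar>v (S m \<omega>)\<bar> \<partial>M)"
proof -
  let ?x = "\<lambda>k \<omega>. v (X (int (Suc k)) \<omega>)"
  have x_int: "integrable M (?x k)" for k
    using integrable_bounded_linear[OF blinfun.bounded_linear_right X_integrable] .
  have x_sq: "integrable M (\<lambda>\<omega>. (v (X i \<omega>))\<^sup>2)" for i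
    using XX_integrable[of v i v i] by (simp add: power2_eq_square)
  define a where "a k = (\<integral>\<omega>. U v s k \<omega> * of_real (?x k \<omega>) \<partial>M)" for k
  define q where "q k = (\<integral>\<omega>. U v s k \<omega> * of_real ((?x k \<omega>)\<^sup>2) \<partial>M)" for k
  define P where "P l = (\<integral>\<omega>. U v s l \<omega> * complex_of_real (?x l \<omega> * v (S m ((T ^^ Suc l) \<omega>))) \<partial>M)" for l
  define near where "near l = (\<integral>\<omega>. (U v s (Suc l) \<omega> - U v s l \<omega>) * complex_of_real (v (S m ((T ^^ Suc l) \<omega>))) \<partial>M)" for l
  define t1 where "t1 = (\<integral>\<omega>. taylor1 (s * v (X 0 \<omega>)) * \<bar>v (S m \<omega>)\<bar> \<partial>M)"
  define t2 where "t2 = (\<integral>\<omega>. taylor2 (s * v (X 0 \<omega>)) \<partial>M)"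
  have T_meas[measurable]: "(\<lambda>\<omega>. h ((T ^^ Suc l) \<omega>)) \<in> borel_measurable M"
    if "h \<in> borel_measurable M" for h :: "'a \<Rightarrow> 'b" and l
    using measurable_compose[OF T_funpow_measurable that] .
  have taylor2_int: "integrable M (\<lambda>\<omega>. taylor2 (s * v (X i \<omega>)))" for i
  proof (rule Bochner_Integration.integrable_bound)
    show "integrable M (\<lambda>\<omega>. s\<^sup>2 * (v (X i \<omega>))\<^sup>2)" using x_sq by simp
    show "AE \<omega> in M. norm (taylor2 (s * v (X i \<omega>))) \<le> norm (s\<^sup>2 * (v (X i \<omega>))\<^sup>2)"
      by (intro AE_I2) (simp add: taylor2_def power_mult_distrib min_def)
  qed measurable
  have xS_T_int: "integrable M (\<lambda>\<omega>. ?x l \<omega> * v (S m ((T ^^ Suc l) \<omega>)))" for l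
  proof -
    have "integrable M (\<lambda>\<omega>. v (X 0 ((T ^^ Suc l) \<omega>)) * v (S m ((T ^^ Suc l) \<omega>)))"
      using integrable_shift[of "\<lambda>\<omega>. v (X 0 \<omega>) * v (S m \<omega>)" "Suc l"] XS_integrable[of v 0 v m] by simp
    also have "?this \<longleftrightarrow> ?thesis" by (intro Bochner_Integration.integrable_cong refl) (simp only: X_Suc_T)
    finally show ?thesis .
  qed
  have t1_int0: "integrable M (\<lambda>\<omega>. taylor1 (s * v (X 0 \<omega>)) * \<bar>v (S m \<omega>)\<bar>)"
  proof (rule Bochner_Integration.integrable_bound)
    show "integrable M (\<lambda>\<omega>. 2 * s * \<bar>v (X 0 \<omega>) * v (S m \<omega>)\<bar>)" using XS_integrable[of v 0 v m] by simp
    show "AE \<omega> in M. norm (taylor1 (s * v (X 0 \<omega>)) * \<bar>v (S m \<omega>)\<bar>) \<le> norm (2 * s * \<bar>v (X 0 \<omega>) * v (S m \<omega>)\<bar>)"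
    proof (rule AE_I2)
      fix \<omega>
      have "\<bar>taylor1 y\<bar> \<le> 2 * \<bar>y\<bar>" for y by (simp add: taylor1_def min_def)
      from mult_right_mono[OF this[of "s * v (X 0 \<omega>)"], of "\<bar>v (S m \<omega>)\<bar>"]
      show "norm (taylor1 (s * v (X 0 \<omega>)) * \<bar>v (S m \<omega>)\<bar>) \<le> norm (2 * s * \<bar>v (X 0 \<omega>) * v (S m \<omega>)\<bar>)"
        using s by (simp add: abs_mult mult_ac)
    qed
  qed measurable
  have t1_shift: "integrable M (\<lambda>\<omega>. taylor1 (s * ?x l \<omega>) * \<bar>v (S m ((T ^^ Suc l) \<omega>))\<bar>) \<and>
    (\<integral>\<omega>. taylor1 (s * ?x l \<omega>) * \<bar>v (S m ((T ^^ Suc l) \<omega>))\<bar> \<partial>M) = t1" for l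
  proof -
    let ?h = "\<lambda>\<omega>. taylor1 (s * v (X 0 \<omega>)) * \<bar>v (S m \<omega>)\<bar>"
    have hm: "?h \<in> borel_measurable M" by measurable
    have "integrable M (\<lambda>\<omega>. taylor1 (s * ?x l \<omega>) * \<bar>v (S m ((T ^^ Suc l) \<omega>))\<bar>) = integrable M (\<lambda>\<omega>. ?h ((T ^^ Suc l) \<omega>))"
      by (intro Bochner_Integration.integrable_cong refl) (simp only: X_Suc_T)
    moreover have "(\<integral>\<omega>. taylor1 (s * ?x l \<omega>) * \<bar>v (S m ((T ^^ Suc l) \<omega>))\<bar> \<partial>M) = (\<integral>\<omega>. ?h ((T ^^ Suc l) \<omega>) \<partial>M)"
      by (intro Bochner_Integration.integral_cong refl) (simp only: X_Suc_T)
    ultimately show ?thesis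
      unfolding integrable_shift[OF hm] integral_shift[OF hm] t1_def using t1_int0 by simp
  qed
  have U_int: "integrable M (U v s k)" for k
    by (rule integrable_const_bound[of _ 1]) (auto simp: norm_U)
  have e2: "norm (near l - \<i> * of_real s * P l) \<le> t1" for l
  proof -
    let ?y = "\<lambda>\<omega>. v (S m ((T ^^ Suc l) \<omega>))"
    have y_int: "integrable M ?y"
      using integrable_shift[of "\<lambda>\<omega>. v (S m \<omega>)" "Suc l"] integrable_bounded_linear[OF blinfun.bounded_linear_right S_integrable] by simp
    have "near l - \<i> * of_real s * P l = (\<integral>\<omega>. (U v s (Suc l) \<omega> - U v s l \<omega>) * of_real (?y \<omega>)
        - \<i> * of_real s * (U v s l \<omega> * of_real (?x l \<omega> * ?y \<omega>)) \<partial>M)"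
      unfolding near_def P_def
      using U_mult_integrable[OF xS_T_int] U_mult_integrable[OF y_int]
      by (subst Bochner_Integration.integral_diff) (auto simp only: left_diff_distrib integral_mult_right_zero
          intro!: Bochner_Integration.integrable_diff integrable_mult_right)
    also have "\<dots> = (\<integral>\<omega>. U v s l \<omega> * (iexp (s * ?x l \<omega>) - 1 - \<i> * of_real (s * ?x l \<omega>)) * of_real (?y \<omega>) \<partial>M)"
      by (intro Bochner_Integration.integral_cong refl) (simp add: U_Suc algebra_simps del: of_nat_Suc funpow.simps)
    also have "norm \<dots> \<le> (\<integral>\<omega>. taylor1 (s * ?x l \<omega>) * \<bar>?y \<omega>\<bar> \<partial>M)"
    proof (rule norm_integral_le)
      show "norm (U v s l \<omega> * (iexp (s * ?x l \<omega>) - 1 - \<i> * of_real (s * ?x l \<omega>)) * of_real (?y \<omega>))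
        \<le> taylor1 (s * ?x l \<omega>) * \<bar>?y \<omega>\<bar>" for \<omega>
        unfolding norm_mult norm_U mult_1_left norm_of_real by (intro mult_right_mono iexp_taylor1) auto
    qed (use t1_shift[of l] in \<open>auto simp del: of_nat_Suc funpow.simps\<close>)
    also have "\<dots> = t1" using t1_shift[of l] by simp
    finally show ?thesis .
  qed
  have e3: "norm ((\<integral>\<omega>. U v s K \<omega> \<partial>M) - 1 - (\<Sum>k<K. \<i> * of_real s * a k - of_real (s\<^sup>2 / 2) * q k)) \<le> real K * t2"
  proof -
    have U_x: "integrable M (\<lambda>\<omega>. U v s k \<omega> * of_real (?x k \<omega>))" "integrable M (\<lambda>\<omega>. U v s k \<omega> * of_real ((?x k \<omega>)\<^sup>2))" for k
      by (intro U_mult_integrable x_int x_sq)+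
    have "(\<integral>\<omega>. U v s K \<omega> \<partial>M) - 1 = (\<integral>\<omega>. U v s K \<omega> - U v s 0 \<omega> \<partial>M)"
      using U_int by (simp add: U_0 prob_space)
    also have "\<dots> = (\<integral>\<omega>. (\<Sum>k<K. U v s (Suc k) \<omega> - U v s k \<omega>) \<partial>M)"
      by (intro Bochner_Integration.integral_cong refl sum_lessThan_telescope[symmetric])
    also have "\<dots> = (\<Sum>k<K. \<integral>\<omega>. U v s (Suc k) \<omega> - U v s k \<omega> \<partial>M)"
      using U_int by (intro Bochner_Integration.integral_sum Bochner_Integration.integrable_diff)
    finally have 1: "(\<integral>\<omega>. U v s K \<omega> \<partial>M) - 1 = (\<Sum>k<K. \<integral>\<omega>. U v s (Suc k) \<omega> - U v s k \<omega> \<partial>M)" .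
    have 2: "norm ((\<integral>\<omega>. U v s (Suc k) \<omega> - U v s k \<omega> \<partial>M) - (\<i> * of_real s * a k - of_real (s\<^sup>2 / 2) * q k)) \<le> t2" for k
    proof -
      have "(\<integral>\<omega>. U v s (Suc k) \<omega> - U v s k \<omega> \<partial>M) - (\<i> * of_real s * a k - of_real (s\<^sup>2 / 2) * q k) =
        (\<integral>\<omega>. (U v s (Suc k) \<omega> - U v s k \<omega>) - (\<i> * of_real s * (U v s k \<omega> * of_real (?x k \<omega>))
          - of_real (s\<^sup>2 / 2) * (U v s k \<omega> * of_real ((?x k \<omega>)\<^sup>2))) \<partial>M)"
        unfolding a_def q_def integral_mult_right_zero[symmetric]
        using U_x[of k] U_int[of k] U_int[of "Suc k"]
        by (simp del: of_nat_Suc integral_mult_right_zero)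
      also have "\<dots> = (\<integral>\<omega>. U v s k \<omega> * (iexp (s * ?x k \<omega>) - 1 - \<i> * of_real (s * ?x k \<omega>) + of_real ((s * ?x k \<omega>)\<^sup>2 / 2)) \<partial>M)"
        by (intro Bochner_Integration.integral_cong refl) (simp add: U_Suc algebra_simps power2_eq_square del: of_nat_Suc)
      also have "norm \<dots> \<le> (\<integral>\<omega>. taylor2 (s * ?x k \<omega>) \<partial>M)"
      proof (rule norm_integral_le)
        show "norm (U v s k \<omega> * (iexp (s * ?x k \<omega>) - 1 - \<i> * of_real (s * ?x k \<omega>) + of_real ((s * ?x k \<omega>)\<^sup>2 / 2))) \<le> taylor2 (s * ?x k \<omega>)" for \<omega>
          unfolding norm_mult norm_U mult_1_left by (rule iexp_taylor2)
      qed (use taylor2_int in \<open>auto simp del: of_nat_Suc\<close>)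
      also have "\<dots> = t2" unfolding t2_def by (rule X_law(1)) measurable
      finally show ?thesis .
    qed
    have "norm ((\<integral>\<omega>. U v s K \<omega> \<partial>M) - 1 - (\<Sum>k<K. \<i> * of_real s * a k - of_real (s\<^sup>2 / 2) * q k)) \<le> (\<Sum>k<K. t2)"
      unfolding 1 sum_subtractf[symmetric, of "\<lambda>k. \<integral>\<omega>. U v s (Suc k) \<omega> - U v s k \<omega> \<partial>M"]
      by (rule order_trans[OF norm_sum sum_mono]) (rule 2)
    then show ?thesis by simp
  qed
  have e1: "norm ((\<Sum>k<K. a k) - (\<Sum>l<K. near l)) \<le> s * (norm v)\<^sup>2 * (real K * \<eta> + 2 * B * real m)"
    unfolding a_def near_def by (rule linear_term_bound[OF s m B \<eta>])
  have V_eq: "(\<integral>\<omega>. U v s l \<omega> * complex_of_real (V v m ((T ^^ Suc l) \<omega>)) \<partial>M) = q l / 2 + P l" for l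
  proof -
    have "(\<integral>\<omega>. U v s l \<omega> * complex_of_real (V v m ((T ^^ Suc l) \<omega>)) \<partial>M)
      = (\<integral>\<omega>. U v s l \<omega> * of_real ((?x l \<omega>)\<^sup>2) / 2 + U v s l \<omega> * of_real (?x l \<omega> * v (S m ((T ^^ Suc l) \<omega>))) \<partial>M)"
      by (intro Bochner_Integration.integral_cong refl)
        (simp only: V_def X_Suc_T, simp add: algebra_simps del: of_nat_Suc funpow.simps)
    also have "\<dots> = q l / 2 + P l"
      unfolding q_def P_def using U_mult_integrable[OF x_sq] U_mult_integrable[OF xS_T_int]
      by (subst Bochner_Integration.integral_add) (auto simp del: of_nat_Suc funpow.simps)
    finally show ?thesis .
  qed
  define A where "A = (\<Sum>k<K. a k)"
  define N where "N = (\<Sum>k<K. near k)"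
  define PP where "PP = (\<Sum>k<K. P k)"
  define QQ where "QQ = (\<Sum>k<K. q k)"
  define E where "E = (\<integral>\<omega>. U v s K \<omega> \<partial>M) - 1"
  have i2: "\<i> * (\<i> * z) = - z" for z by (simp flip: mult.assoc)
  have decomp: "E + of_real (s\<^sup>2) * (QQ / 2 + PP) = (E - (\<i> * of_real s * A - of_real (s\<^sup>2 / 2) * QQ))
    + (\<i> * of_real s * (A - N) + \<i> * of_real s * (N - \<i> * of_real s * PP))"
    by (simp add: algebra_simps power2_eq_square i2)
  have "norm (N - \<i> * of_real s * PP) \<le> (\<Sum>k<K. t1)"
    unfolding N_def PP_def sum_distrib_left sum_subtractf[symmetric]
    by (rule order_trans[OF norm_sum sum_mono]) (rule e2)
  then have n3: "norm (\<i> * of_real s * (N - \<i> * of_real s * PP)) \<le> s * real K * t1"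
    using s by (simp add: norm_mult mult.assoc mult_left_mono)
  have n2: "norm (\<i> * of_real s * (A - N)) \<le> s * (s * (norm v)\<^sup>2 * (real K * \<eta> + 2 * B * real m))"
    using e1 s unfolding A_def N_def norm_mult by (simp add: mult_left_mono)
  have n1: "norm (E - (\<i> * of_real s * A - of_real (s\<^sup>2 / 2) * QQ)) \<le> real K * t2"
    using e3 unfolding E_def A_def QQ_def sum_subtractf sum_distrib_left .
  have "norm (E + of_real (s\<^sup>2) * (QQ / 2 + PP)) \<le> real K * t2 + (s * (s * (norm v)\<^sup>2 * (real K * \<eta> + 2 * B * real m)) + s * real K * t1)"
    unfolding decomp by (intro order_trans[OF norm_triangle_ineq] add_mono n1 n2 n3)
  moreover have "(\<Sum>l<K. \<integral>\<omega>. U v s l \<omega> * complex_of_real (V v m ((T ^^ Suc l) \<omega>)) \<partial>M) = QQ / 2 + PP"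
    unfolding V_eq sum.distrib QQ_def PP_def by (simp add: sum_divide_distrib)
  ultimately show ?thesis
    unfolding E_def t1_def[symmetric] t2_def[symmetric] by (simp add: power2_eq_square mult.assoc)
qed

end

lemma lim_const_over_sqrt: "(\<lambda>n. c / sqrt (real n)) \<longlonglongrightarrow> 0"
  by (intro tendsto_divide_0[OF tendsto_const] filterlim_at_top_imp_at_infinity
      filterlim_compose[OF sqrt_at_top filterlim_real_sequentially])

section \<open>Averaging of the quadratic terms and the limiting exponent\<close>

context clt_process
begin

lemma funpow_T_measurable_compose:
  fixes h :: "'a \<Rightarrow> 'c::topological_space"
  shows "h \<in> borel_measurable M \<Longrightarrow> (\<lambda>\<omega>. h ((T ^^ l) \<omega>)) \<in> borel_measurable M"
  by (rule measurable_compose[OF T_funpow_measurable])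

text \<open>Averaging over \<open>p\<close> consecutive shifts: \<open>U\<close> varies slowly, so it can be frozen while the mean
  ergodic theorem is applied to \<open>h\<close>.\<close>

lemma ergodic_step:
  fixes v :: "'b \<Rightarrow>\<^sub>L real"
  assumes h: "integrable M h"
  shows "real p * norm (\<Sum>l<K. \<integral>\<omega>. U v s l \<omega> * complex_of_real (h ((T ^^ Suc l) \<omega>)) \<partial>M)
    \<le> real K * ((\<integral>\<omega>. \<bar>\<Sum>r<p. h ((T ^^ r) \<omega>)\<bar> \<partial>M)
        + (\<Sum>r<p. \<integral>\<omega>. min 2 \<bar>s * v (S r \<omega>)\<bar> * \<bar>h ((T ^^ Suc r) \<omega>)\<bar> \<partial>M))
      + 2 * (real p)\<^sup>2 * (\<integral>\<omega>. \<bar>h \<omega>\<bar> \<partial>M)"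
proof -
  have h_meas[measurable]: "h \<in> borel_measurable M" using h by auto
  have hT_meas[measurable]: "(\<lambda>\<omega>. h ((T ^^ l) \<omega>)) \<in> borel_measurable M" for l
    by (rule funpow_T_measurable_compose) measurable
  have hT: "integrable M (\<lambda>\<omega>. h ((T ^^ l) \<omega>))" for l
    using integrable_shift[OF h_meas, of l] h by simp
  define A where "A = (\<integral>\<omega>. \<bar>h \<omega>\<bar> \<partial>M)"
  have A: "A \<ge> 0" by (simp add: A_def)
  define a where "a l = (\<integral>\<omega>. U v s l \<omega> * complex_of_real (h ((T ^^ Suc l) \<omega>)) \<partial>M)" for l
  have a_le: "norm (a l) \<le> A" for l
  proof -
    have "norm (a l) \<le> (\<integral>\<omega>. \<bar>h ((T ^^ Suc l) \<omega>)\<bar> \<partial>M)"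
      unfolding a_def by (rule norm_integral_U_mult_le[OF hT])
    also have "\<dots> = A" unfolding A_def by (rule integral_shift[of "\<lambda>\<omega>. \<bar>h \<omega>\<bar>"]) measurable
    finally show ?thesis .
  qed
  define \<alpha> where "\<alpha> = (\<integral>\<omega>. \<bar>\<Sum>r<p. h ((T ^^ r) \<omega>)\<bar> \<partial>M)"
  define \<delta> where "\<delta> r = (\<integral>\<omega>. min 2 \<bar>s * v (S r \<omega>)\<bar> * \<bar>h ((T ^^ Suc r) \<omega>)\<bar> \<partial>M)" for r
  have blk: "norm (\<Sum>r<p. a (l + r)) \<le> \<alpha> + (\<Sum>r<p. \<delta> r)" for l
  proof -
    define c where "c r = (\<integral>\<omega>. U v s l \<omega> * complex_of_real (h ((T ^^ Suc (l + r)) \<omega>)) \<partial>M)" for r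
    have "norm (\<Sum>r<p. c r) \<le> \<alpha>"
    proof -
      have "(\<Sum>r<p. c r) = (\<integral>\<omega>. U v s l \<omega> * complex_of_real (\<Sum>r<p. h ((T ^^ Suc (l + r)) \<omega>)) \<partial>M)"
        unfolding c_def of_real_sum sum_distrib_left
        by (intro Bochner_Integration.integral_sum[symmetric] U_mult_integrable hT)
      also have "norm \<dots> \<le> (\<integral>\<omega>. \<bar>\<Sum>r<p. h ((T ^^ Suc (l + r)) \<omega>)\<bar> \<partial>M)"
        by (rule norm_integral_U_mult_le) (intro Bochner_Integration.integrable_sum hT)
      also have "\<dots> = (\<integral>\<omega>. (\<lambda>\<omega>. \<bar>\<Sum>r<p. h ((T ^^ r) \<omega>)\<bar>) ((T ^^ Suc l) \<omega>) \<partial>M)"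
      proof (rule Bochner_Integration.integral_cong[OF refl])
        fix \<omega>
        have "(T ^^ Suc (l + r)) \<omega> = (T ^^ r) ((T ^^ Suc l) \<omega>)" for r
          using fun_cong[OF funpow_add[of r "Suc l" T], of \<omega>] by (simp add: add.commute del: funpow.simps)
        then show "\<bar>\<Sum>r<p. h ((T ^^ Suc (l + r)) \<omega>)\<bar> = (\<lambda>\<omega>. \<bar>\<Sum>r<p. h ((T ^^ r) \<omega>)\<bar>) ((T ^^ Suc l) \<omega>)"
          by (simp only:)
      qed
      also have "\<dots> = \<alpha>" unfolding \<alpha>_def by (rule integral_shift) measurable
      finally show ?thesis .
    qed
    moreover have "norm (a (l + r) - c r) \<le> \<delta> r" for r
    proof -
      let ?f = "\<lambda>\<omega>. min 2 \<bar>s * v (S r \<omega>)\<bar> * \<bar>h ((T ^^ Suc r) \<omega>)\<bar>"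
      have fm: "?f \<in> borel_measurable M" by measurable
      have f_int: "integrable M ?f"
      proof (rule Bochner_Integration.integrable_bound)
        show "integrable M (\<lambda>\<omega>. 2 * \<bar>h ((T ^^ Suc r) \<omega>)\<bar>)" using hT[of "Suc r"] by (simp del: funpow.simps)
        show "AE \<omega> in M. norm (?f \<omega>) \<le> norm (2 * \<bar>h ((T ^^ Suc r) \<omega>)\<bar>)"
          unfolding real_norm_def abs_mult abs_abs by (intro AE_I2 mult_right_mono) auto
      qed (rule fm)
      have "a (l + r) - c r = (\<integral>\<omega>. (U v s (l + r) \<omega> - U v s l \<omega>) * complex_of_real (h ((T ^^ Suc (l + r)) \<omega>)) \<partial>M)"
        unfolding a_def c_def left_diff_distrib
        by (intro Bochner_Integration.integral_diff[symmetric] U_mult_integrable hT)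
      also have "norm \<dots> \<le> (\<integral>\<omega>. ?f ((T ^^ l) \<omega>) \<partial>M)"
      proof (rule norm_integral_le)
        show "integrable M (\<lambda>\<omega>. ?f ((T ^^ l) \<omega>))" using integrable_shift[OF fm, of l] f_int by simp
        fix \<omega> assume \<omega>: "\<omega> \<in> space M"
        have "(T ^^ Suc (l + r)) \<omega> = (T ^^ Suc r) ((T ^^ l) \<omega>)"
          using fun_cong[OF funpow_add[of "Suc r" l T], of \<omega>] by (simp add: add.commute del: funpow.simps)
        moreover have "norm (U v s (l + r) \<omega> - U v s l \<omega>) \<le> min 2 \<bar>s * v (S r ((T ^^ l) \<omega>))\<bar>"
        proof -
          have "U v s (l + r) \<omega> - U v s l \<omega> = U v s l \<omega> * (iexp (s * v (S r ((T ^^ l) \<omega>))) - 1)"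
            unfolding U_add[OF \<omega>] by (simp add: algebra_simps)
          then show ?thesis using norm_iexp_diff_le[of "s * v (S r ((T ^^ l) \<omega>))"] by (simp only: norm_mult norm_U mult_1_left)
        qed
        ultimately show "norm ((U v s (l + r) \<omega> - U v s l \<omega>) * complex_of_real (h ((T ^^ Suc (l + r)) \<omega>))) \<le> ?f ((T ^^ l) \<omega>)"
          unfolding norm_mult norm_of_real by (simp only:) (intro mult_right_mono, auto)
      qed measurable
      also have "\<dots> = \<delta> r" unfolding \<delta>_def by (rule integral_shift[OF fm])
      finally show ?thesis .
    qed
    then have "norm (\<Sum>r<p. a (l + r) - c r) \<le> (\<Sum>r<p. \<delta> r)"
      by (intro order_trans[OF norm_sum sum_mono])
    moreover have "(\<Sum>r<p. a (l + r)) = (\<Sum>r<p. c r) + (\<Sum>r<p. a (l + r) - c r)" by (simp add: sum_subtractf)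
    ultimately show ?thesis using norm_triangle_ineq[of "\<Sum>r<p. c r" "\<Sum>r<p. a (l + r) - c r"] by simp
  qed
  \<comment> \<open>\<open>p\<close> copies of the sum are replaced by its shifts by
    \<open>0, ..., p - 1\<close>; each replacement affects few boundary terms, and the shifted sums
    regroup into blocks of length \<open>p\<close>.\<close>
  have "of_nat p * (\<Sum>l<K. a l) = (\<Sum>r<p. (\<Sum>l<K. a l) - (\<Sum>l<K. a (l + r))) + (\<Sum>l<K. \<Sum>r<p. a (l + r))"
    unfolding sum.swap[of "\<lambda>l r. a (l + r)" "{..<p}" "{..<K}"] by (simp add: sum_subtractf)
  moreover have "norm (of_nat p * (\<Sum>l<K. a l)) = real p * norm (\<Sum>l<K. a l)" by (simp add: norm_mult)
  moreover have "norm (\<Sum>r<p. (\<Sum>l<K. a l) - (\<Sum>l<K. a (l + r))) \<le> (\<Sum>r<p. 2 * real p * A)"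
  proof (rule order_trans[OF norm_sum sum_mono])
    fix r assume "r \<in> {..<p}"
    then have "2 * real r * A \<le> 2 * real p * A" using A by (intro mult_right_mono) auto
    with sum_shift_bound[of a A K r] a_le show "norm ((\<Sum>l<K. a l) - (\<Sum>l<K. a (l + r))) \<le> 2 * real p * A" by fastforce
  qed
  moreover have "norm (\<Sum>l<K. \<Sum>r<p. a (l + r)) \<le> (\<Sum>l<K. \<alpha> + (\<Sum>r<p. \<delta> r))"
    by (rule order_trans[OF norm_sum sum_mono]) (rule blk)
  ultimately have "real p * norm (\<Sum>l<K. a l) \<le> real p * (2 * real p * A) + real K * (\<alpha> + (\<Sum>r<p. \<delta> r))"
    using norm_triangle_ineq[of "\<Sum>r<p. (\<Sum>l<K. a l) - (\<Sum>l<K. a (l + r))" "\<Sum>l<K. \<Sum>r<p. a (l + r)"] by simp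
  then show ?thesis unfolding a_def A_def \<alpha>_def \<delta>_def by (simp add: power2_eq_square algebra_simps del: funpow.simps)
qed

text \<open>The exponent of the limit: half the sum of the covariances of \<open>v\<close> over all
  integer lags.\<close>

definition kap :: "('b \<Rightarrow>\<^sub>L real) \<Rightarrow> real" where
  "kap v = gam v v 0 / 2 + (\<Sum>j. gam v v (Suc j))"

lemma integral_V:
  fixes v :: "'b \<Rightarrow>\<^sub>L real"
  shows "(\<integral>\<omega>. V v m \<omega> \<partial>M) = gam v v 0 / 2 + (\<Sum>j=1..m. gam v v j)"
proof -
  have "(\<integral>\<omega>. V v m \<omega> \<partial>M) = (\<integral>\<omega>. v (X 0 \<omega>) * v (X 0 \<omega>) / 2 + v (X 0 \<omega>) * v (S m \<omega>) \<partial>M)"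
    by (simp add: V_def power2_eq_square)
  also have "\<dots> = gam v v 0 / 2 + (\<Sum>j=1..m. gam v v j)"
    unfolding sum_gam using XX_integrable[of v 0 v 0] XS_integrable[of v 0 v m]
    by (subst Bochner_Integration.integral_add) (auto simp: gam_def)
  finally show ?thesis .
qed

text \<open>The Cauchy bound holds for every \<open>n \<ge> m\<close> and therefore passes to the
  limit of the series.\<close>

lemma kap_approx:
  fixes v :: "'b \<Rightarrow>\<^sub>L real"
  assumes \<eta>: "\<forall>n\<ge>m. integrable M (\<lambda>\<omega>. norm (X 0 \<omega>) * norm (g n \<omega> - g m \<omega>)) \<and>
      (\<integral>\<omega>. norm (X 0 \<omega>) * norm (g n \<omega> - g m \<omega>) \<partial>M) \<le> \<eta>"
  shows "\<bar>kap v - (\<integral>\<omega>. V v m \<omega> \<partial>M)\<bar> \<le> (norm v)\<^sup>2 * \<eta>"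
proof -
  have eq: "(\<Sum>j<n. gam v v (Suc j)) = (\<integral>\<omega>. v (X 0 \<omega>) * v (S n \<omega>) \<partial>M)" for n
    using sum_gam[of v v n] by (simp add: sum.atLeast1_atMost_eq)
  have "\<bar>(\<Sum>j<n. gam v v (Suc j)) - (\<Sum>j<m. gam v v (Suc j))\<bar> \<le> (norm v)\<^sup>2 * \<eta>" if n: "n \<ge> m" for n
  proof -
    have "(\<Sum>j<n. gam v v (Suc j)) - (\<Sum>j<m. gam v v (Suc j)) = (\<integral>\<omega>. v (X 0 \<omega>) * v (S n \<omega> - S m \<omega>) \<partial>M)"
      unfolding eq using XS_integrable by (simp add: blinfun.diff_right right_diff_distrib)
    also have "\<bar>\<dots>\<bar> \<le> norm v * norm v * (\<integral>\<omega>. norm (X 0 \<omega>) * norm (g n \<omega> - g m \<omega>) \<partial>M)"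
      using \<eta> n by (intro X0_S_diff_bound) simp
    also have "\<dots> \<le> norm v * norm v * \<eta>" using \<eta> n by (intro mult_left_mono) auto
    finally show ?thesis by (simp add: power2_eq_square)
  qed
  then have ev: "\<forall>\<^sub>F n in sequentially. \<bar>(\<Sum>j<n. gam v v (Suc j)) - (\<Sum>j<m. gam v v (Suc j))\<bar> \<le> (norm v)\<^sup>2 * \<eta>"
    unfolding eventually_sequentially by blast
  have "(\<lambda>n. \<bar>(\<Sum>j<n. gam v v (Suc j)) - (\<Sum>j<m. gam v v (Suc j))\<bar>) \<longlonglongrightarrow> \<bar>(\<Sum>j. gam v v (Suc j)) - (\<Sum>j<m. gam v v (Suc j))\<bar>"
    by (intro tendsto_rabs tendsto_diff tendsto_const summable_LIMSEQ summable_gam)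
  from tendsto_upperbound[OF this ev] have "\<bar>(\<Sum>j. gam v v (Suc j)) - (\<Sum>j<m. gam v v (Suc j))\<bar> \<le> (norm v)\<^sup>2 * \<eta>" by simp
  then show ?thesis unfolding integral_V kap_def by (simp add: sum.atLeast1_atMost_eq)
qed

text \<open>At scale \<open>1 / sqrt n\<close> the quadratic branch times \<open>n\<close> equals
  \<open>(v (X 0))^2\<close> for positive \<open>n\<close>, an integrable majorant, while the cubic
  branch leaves a factor \<open>1 / sqrt n\<close>.\<close>

lemma taylor2_limit:
  fixes v :: "'b \<Rightarrow>\<^sub>L real"
  shows "(\<lambda>n. real n * (\<integral>\<omega>. taylor2 (1 / sqrt (real n) * v (X 0 \<omega>)) \<partial>M)) \<longlonglongrightarrow> 0"
proof -
  have x_sq: "integrable M (\<lambda>\<omega>. (v (X 0 \<omega>))\<^sup>2)"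
    using XX_integrable[of v 0 v 0] by (simp add: power2_eq_square)
  have "(\<lambda>n. \<integral>\<omega>. real n * taylor2 (1 / sqrt (real n) * v (X 0 \<omega>)) \<partial>M) \<longlonglongrightarrow> (\<integral>\<omega>. 0 \<partial>M)"
  proof (rule integral_dominated_convergence[OF _ _ x_sq])
    have sq: "real n * taylor2 (1 / sqrt (real n) * y) \<le> y\<^sup>2" for n :: nat and y :: real
    proof (cases "n = 0")
      case False
      have "real n * taylor2 (1 / sqrt (real n) * y) \<le> real n * (1 / sqrt (real n) * y)\<^sup>2"
        by (intro mult_left_mono) (auto simp: taylor2_def)
      also have "\<dots> = y\<^sup>2" using False by (simp add: power_mult_distrib power_divide)
      finally show ?thesis .
    qed simp
    have cu: "real n * taylor2 (1 / sqrt (real n) * y) \<le> \<bar>y\<bar> ^ 3 / sqrt (real n)" for n :: nat and y :: real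
    proof (cases "n = 0")
      case False
      then have n: "real n > 0" by simp
      have "real n * taylor2 (1 / sqrt (real n) * y) \<le> real n * \<bar>1 / sqrt (real n) * y\<bar> ^ 3"
        by (intro mult_left_mono) (auto simp: taylor2_def)
      also have "\<dots> = real n * (\<bar>y\<bar> ^ 3 / (sqrt (real n) ^ 2 * sqrt (real n)))"
        by (simp add: abs_mult power_mult_distrib power_divide eval_nat_numeral)
      also have "\<dots> = \<bar>y\<bar> ^ 3 / sqrt (real n)" using n by simp
      finally show ?thesis .
    qed simp
    have pos: "taylor2 y \<ge> 0" for y by (simp add: taylor2_def)
    show "AE \<omega> in M. norm (real n * taylor2 (1 / sqrt (real n) * v (X 0 \<omega>))) \<le> (v (X 0 \<omega>))\<^sup>2" for n
      using sq pos by (intro AE_I2) (simp add: abs_mult)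
    show "AE \<omega> in M. (\<lambda>n. real n * taylor2 (1 / sqrt (real n) * v (X 0 \<omega>))) \<longlonglongrightarrow> 0"
    proof (rule AE_I2)
      fix \<omega>
      show "(\<lambda>n. real n * taylor2 (1 / sqrt (real n) * v (X 0 \<omega>))) \<longlonglongrightarrow> 0"
      proof (rule Lim_null_comparison)
        show "\<forall>\<^sub>F n in sequentially. norm (real n * taylor2 (1 / sqrt (real n) * v (X 0 \<omega>))) \<le> \<bar>v (X 0 \<omega>)\<bar> ^ 3 / sqrt (real n)"
          using cu pos by (intro always_eventually) (simp add: abs_mult)
        show "(\<lambda>n. \<bar>v (X 0 \<omega>)\<bar> ^ 3 / sqrt (real n)) \<longlonglongrightarrow> 0" by (rule lim_const_over_sqrt)
      qed
    qed
  qed measurable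
  then show ?thesis by simp
qed

text \<open>The weight is \<open>sqrt n\<close> because it comes from \<open>s * K\<close> with
  \<open>s = 1 / sqrt n\<close> and \<open>K \<le> n\<close>.\<close>

lemma taylor1_limit:
  fixes v :: "'b \<Rightarrow>\<^sub>L real"
  shows "(\<lambda>n. sqrt (real n) * (\<integral>\<omega>. taylor1 (1 / sqrt (real n) * v (X 0 \<omega>)) * \<bar>v (S m \<omega>)\<bar> \<partial>M)) \<longlonglongrightarrow> 0"
proof -
  have i: "integrable M (\<lambda>\<omega>. 2 * \<bar>v (X 0 \<omega>) * v (S m \<omega>)\<bar>)" using XS_integrable[of v 0 v m] by simp
  have "(\<lambda>n. \<integral>\<omega>. sqrt (real n) * (taylor1 (1 / sqrt (real n) * v (X 0 \<omega>)) * \<bar>v (S m \<omega>)\<bar>) \<partial>M) \<longlonglongrightarrow> (\<integral>\<omega>. 0 \<partial>M)"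
  proof (rule integral_dominated_convergence[OF _ _ i])
    have li: "sqrt (real n) * taylor1 (1 / sqrt (real n) * y) \<le> 2 * \<bar>y\<bar>" for n :: nat and y :: real
    proof (cases "n = 0")
      case False
      have "sqrt (real n) * taylor1 (1 / sqrt (real n) * y) \<le> sqrt (real n) * (2 * \<bar>1 / sqrt (real n) * y\<bar>)"
        by (intro mult_left_mono) (auto simp: taylor1_def)
      also have "\<dots> = 2 * \<bar>y\<bar>" using False by (simp add: abs_mult)
      finally show ?thesis .
    qed simp
    have sq: "sqrt (real n) * taylor1 (1 / sqrt (real n) * y) \<le> y\<^sup>2 / sqrt (real n)" for n :: nat and y :: real
    proof (cases "n = 0")
      case False
      then have n: "sqrt (real n) > 0" by simp
      have "sqrt (real n) * taylor1 (1 / sqrt (real n) * y) \<le> sqrt (real n) * (1 / sqrt (real n) * y)\<^sup>2"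
        by (intro mult_left_mono) (auto simp: taylor1_def)
      also have "\<dots> = y\<^sup>2 / sqrt (real n)"
      proof -
        have "c * (1 / c * y)\<^sup>2 = y\<^sup>2 / c" if "c > 0" for c :: real
          using that by (simp add: power2_eq_square)
        from this[OF n] show ?thesis .
      qed
      finally show ?thesis .
    qed simp
    have pos: "taylor1 y \<ge> 0" for y by (simp add: taylor1_def)
    have nrm: "norm (sqrt (real n) * (taylor1 (1 / sqrt (real n) * y) * \<bar>z\<bar>)) = (sqrt (real n) * taylor1 (1 / sqrt (real n) * y)) * \<bar>z\<bar>"
      for n :: nat and y z :: real
      using pos[of "1 / sqrt (real n) * y"] by (simp add: abs_mult mult.assoc)
    show "AE \<omega> in M. norm (sqrt (real n) * (taylor1 (1 / sqrt (real n) * v (X 0 \<omega>)) * \<bar>v (S m \<omega>)\<bar>)) \<le> 2 * \<bar>v (X 0 \<omega>) * v (S m \<omega>)\<bar>" for n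
      unfolding nrm abs_mult mult.assoc[of 2, symmetric] by (intro AE_I2 mult_right_mono li) auto
    show "AE \<omega> in M. (\<lambda>n. sqrt (real n) * (taylor1 (1 / sqrt (real n) * v (X 0 \<omega>)) * \<bar>v (S m \<omega>)\<bar>)) \<longlonglongrightarrow> 0"
    proof (rule AE_I2)
      fix \<omega>
      show "(\<lambda>n. sqrt (real n) * (taylor1 (1 / sqrt (real n) * v (X 0 \<omega>)) * \<bar>v (S m \<omega>)\<bar>)) \<longlonglongrightarrow> 0"
      proof (rule Lim_null_comparison)
        show "\<forall>\<^sub>F n in sequentially. norm (sqrt (real n) * (taylor1 (1 / sqrt (real n) * v (X 0 \<omega>)) * \<bar>v (S m \<omega>)\<bar>)) \<le> (v (X 0 \<omega>))\<^sup>2 / sqrt (real n) * \<bar>v (S m \<omega>)\<bar>"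
          unfolding nrm by (intro always_eventually allI mult_right_mono sq) auto
        show "(\<lambda>n. (v (X 0 \<omega>))\<^sup>2 / sqrt (real n) * \<bar>v (S m \<omega>)\<bar>) \<longlonglongrightarrow> 0"
          by (rule tendsto_mult_left_zero[OF lim_const_over_sqrt])
      qed
    qed
  qed measurable
  then show ?thesis by simp
qed

text \<open>The cut at 2 provides the dominating function, the factor \<open>1 / sqrt n\<close> the
  pointwise limit 0.\<close>

lemma freeze_limit:
  fixes v :: "'b \<Rightarrow>\<^sub>L real"
  assumes h: "integrable M h"
  shows "(\<lambda>n. \<integral>\<omega>. min 2 \<bar>1 / sqrt (real n) * v (S r \<omega>)\<bar> * \<bar>h ((T ^^ Suc r) \<omega>)\<bar> \<partial>M) \<longlonglongrightarrow> 0"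
proof -
  have h_meas[measurable]: "h \<in> borel_measurable M" using h by auto
  have hT_meas[measurable]: "(\<lambda>\<omega>. h ((T ^^ l) \<omega>)) \<in> borel_measurable M" for l
    by (rule funpow_T_measurable_compose) measurable
  have hT: "integrable M (\<lambda>\<omega>. h ((T ^^ l) \<omega>))" for l
    using integrable_shift[OF h_meas, of l] h by simp
  have "(\<lambda>n. \<integral>\<omega>. min 2 \<bar>1 / sqrt (real n) * v (S r \<omega>)\<bar> * \<bar>h ((T ^^ Suc r) \<omega>)\<bar> \<partial>M) \<longlonglongrightarrow> (\<integral>\<omega>. 0 \<partial>M)"
  proof (rule integral_dominated_convergence)
    show "integrable M (\<lambda>\<omega>. 2 * \<bar>h ((T ^^ Suc r) \<omega>)\<bar>)" using hT[of "Suc r"] by (simp del: funpow.simps)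
    show "AE \<omega> in M. norm (min 2 \<bar>1 / sqrt (real n) * v (S r \<omega>)\<bar> * \<bar>h ((T ^^ Suc r) \<omega>)\<bar>) \<le> 2 * \<bar>h ((T ^^ Suc r) \<omega>)\<bar>" for n
      unfolding real_norm_def abs_mult abs_abs by (intro AE_I2 mult_right_mono) auto
    show "AE \<omega> in M. (\<lambda>n. min 2 \<bar>1 / sqrt (real n) * v (S r \<omega>)\<bar> * \<bar>h ((T ^^ Suc r) \<omega>)\<bar>) \<longlonglongrightarrow> 0"
    proof (rule AE_I2)
      fix \<omega>
      have l: "(\<lambda>n. 1 / sqrt (real n)) \<longlonglongrightarrow> 0" by (rule lim_const_over_sqrt)
      have "(\<lambda>n. min 2 \<bar>1 / sqrt (real n) * v (S r \<omega>)\<bar> * \<bar>h ((T ^^ Suc r) \<omega>)\<bar>) \<longlonglongrightarrow> min 2 \<bar>0 * v (S r \<omega>)\<bar> * \<bar>h ((T ^^ Suc r) \<omega>)\<bar>"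
        by (intro tendsto_mult tendsto_min tendsto_rabs l tendsto_const)
      then show "(\<lambda>n. min 2 \<bar>1 / sqrt (real n) * v (S r \<omega>)\<bar> * \<bar>h ((T ^^ Suc r) \<omega>)\<bar>) \<longlonglongrightarrow> 0" by (simp del: funpow.simps)
    qed
  qed measurable
  then show ?thesis by simp
qed

lemma V_ergodic:
  fixes v :: "'b \<Rightarrow>\<^sub>L real"
  shows "(\<lambda>n. \<integral>\<omega>. \<bar>(\<Sum>k<Suc n. V v m ((T ^^ k) \<omega>)) / real (Suc n) - (\<integral>\<omega>. V v m \<omega> \<partial>M)\<bar> \<partial>M) \<longlonglongrightarrow> 0"
proof -
  define \<phi> where "\<phi> x = (v (x 0))\<^sup>2 / 2 + v (x 0) * v (\<Sum>k=1..m. x (int k))" for x :: "int \<Rightarrow> 'b"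
  have [measurable]: "\<phi> \<in> borel_measurable (\<Pi>\<^sub>M i\<in>(UNIV :: int set). (borel :: 'b measure))"
    unfolding \<phi>_def by measurable
  have eq: "\<phi> (trajectory \<omega>) = V v m \<omega>" for \<omega> by (simp add: \<phi>_def trajectory_def V_def partial_sum_def)
  have "integrable M (\<lambda>\<omega>. \<phi> (trajectory \<omega>))" unfolding eq by (rule V_integrable)
  from mean_ergodic_trajectory[OF erg _ this] show ?thesis unfolding eq by simp
qed

text \<open>The order of the choices matters: \<open>\<eta>\<close> fixes the number
  \<open>m\<close> of lags, \<open>m\<close> fixes the block length \<open>p\<close> through the
  ergodic theorem, and only then is \<open>n\<close> taken large. The error bounds grow with
  \<open>K\<close>, so their values at \<open>K = n\<close> give uniformity over
  \<open>K \<le> n\<close>.\<close>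

lemma char_fun_estimate:
  fixes v :: "'b \<Rightarrow>\<^sub>L real"
  assumes "\<epsilon> > 0"
  shows "\<exists>N. \<forall>n\<ge>N. \<forall>K\<le>n. norm ((\<integral>\<omega>. U v (1 / sqrt (real n)) K \<omega> \<partial>M) - 1
    + of_real (kap v / real n) * (\<Sum>l<K. \<integral>\<omega>. U v (1 / sqrt (real n)) l \<omega> \<partial>M)) \<le> \<epsilon>"
proof -
  obtain B where B: "B \<ge> 0" "\<And>n. n \<ge> 1 \<Longrightarrow> (\<integral>\<omega>. norm (X 0 \<omega>) * norm (g n \<omega>) \<partial>M) \<le> B"
    using X0_g_bounded by metis
  \<comment> \<open>Makes \<open>(norm v)^2 * \<eta>\<close> at most \<open>\<epsilon> / 8\<close>,
    also for \<open>v = 0\<close>.\<close>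
  define \<eta> where "\<eta> = \<epsilon> / (8 * ((norm v)\<^sup>2 + 1))"
  have nv: "(norm v)\<^sup>2 + 1 > 0" by (intro add_nonneg_pos) auto
  have \<eta>: "\<eta> > 0" unfolding \<eta>_def using assms nv by simp
  have v\<eta>: "(norm v)\<^sup>2 * \<eta> \<le> \<epsilon> / 8"
  proof -
    have "a * (\<epsilon> / (8 * (a + 1))) \<le> \<epsilon> / 8" if "a \<ge> 0" for a :: real
      using that assms by (simp add: field_simps)
    then show ?thesis unfolding \<eta>_def by simp
  qed
  obtain m where m: "m \<ge> 1" and mc: "\<forall>n\<ge>m. integrable M (\<lambda>\<omega>. norm (X 0 \<omega>) * norm (g n \<omega> - g m \<omega>)) \<and>
      (\<integral>\<omega>. norm (X 0 \<omega>) * norm (g n \<omega> - g m \<omega>) \<partial>M) \<le> \<eta>"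
    using Y_Cauchy[OF \<eta>] by (elim exE conjE) (rule that)
  define vm where "vm = (\<integral>\<omega>. V v m \<omega> \<partial>M)"
  have kap: "\<bar>kap v - vm\<bar> \<le> \<epsilon> / 8" using kap_approx[OF mc, of v] v\<eta> by (simp add: vm_def)
  define h where "h \<omega> = V v m \<omega> - vm" for \<omega>
  have h: "integrable M h" unfolding h_def using V_integrable[of v m] by simp
  have "\<forall>\<^sub>F q in sequentially. (\<integral>\<omega>. \<bar>(\<Sum>k<Suc q. V v m ((T ^^ k) \<omega>)) / real (Suc q) - vm\<bar> \<partial>M) < \<epsilon> / 8"
    unfolding vm_def using assms by (intro order_tendstoD(2)[OF V_ergodic]) simp
  then obtain q where q: "(\<integral>\<omega>. \<bar>(\<Sum>k<Suc q. V v m ((T ^^ k) \<omega>)) / real (Suc q) - vm\<bar> \<partial>M) < \<epsilon> / 8"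
    unfolding eventually_sequentially by blast
  define p where "p = Suc q"
  have p: "p > 0" by (simp add: p_def)
  have \<alpha>: "(\<integral>\<omega>. \<bar>\<Sum>r<p. h ((T ^^ r) \<omega>)\<bar> \<partial>M) \<le> real p * (\<epsilon> / 8)"
  proof -
    have "(\<integral>\<omega>. \<bar>\<Sum>r<p. h ((T ^^ r) \<omega>)\<bar> \<partial>M) = (\<integral>\<omega>. real p * \<bar>(\<Sum>k<Suc q. V v m ((T ^^ k) \<omega>)) / real (Suc q) - vm\<bar> \<partial>M)"
    proof (rule Bochner_Integration.integral_cong[OF refl])
      fix \<omega>
      have "(\<Sum>r<p. h ((T ^^ r) \<omega>)) = real p * ((\<Sum>k<Suc q. V v m ((T ^^ k) \<omega>)) / real (Suc q) - vm)"
        unfolding h_def sum_subtractf p_def by (simp add: right_diff_distrib del: sum.lessThan_Suc funpow.simps of_nat_Suc)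
      then show "\<bar>\<Sum>r<p. h ((T ^^ r) \<omega>)\<bar> = real p * \<bar>(\<Sum>k<Suc q. V v m ((T ^^ k) \<omega>)) / real (Suc q) - vm\<bar>"
        by (simp add: abs_mult)
    qed
    also have "\<dots> = real p * (\<integral>\<omega>. \<bar>(\<Sum>k<Suc q. V v m ((T ^^ k) \<omega>)) / real (Suc q) - vm\<bar> \<partial>M)" by simp
    also have "\<dots> \<le> real p * (\<epsilon> / 8)" using q by (intro mult_left_mono) auto
    finally show ?thesis .
  qed
  define A where "A = (\<integral>\<omega>. \<bar>h \<omega>\<bar> \<partial>M)"
  have A: "A \<ge> 0" by (simp add: A_def)
  define t2 where "t2 n = (\<integral>\<omega>. taylor2 (1 / sqrt (real n) * v (X 0 \<omega>)) \<partial>M)" for n :: nat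
  define t1 where "t1 n = (\<integral>\<omega>. taylor1 (1 / sqrt (real n) * v (X 0 \<omega>)) * \<bar>v (S m \<omega>)\<bar> \<partial>M)" for n :: nat
  define \<delta> where "\<delta> n = (\<Sum>r<p. \<integral>\<omega>. min 2 \<bar>1 / sqrt (real n) * v (S r \<omega>)\<bar> * \<bar>h ((T ^^ Suc r) \<omega>)\<bar> \<partial>M)" for n :: nat
  have t2_pos: "t2 n \<ge> 0" for n unfolding t2_def by (intro Bochner_Integration.integral_nonneg) (simp add: taylor2_def)
  have t1_pos: "t1 n \<ge> 0" for n unfolding t1_def by (intro Bochner_Integration.integral_nonneg mult_nonneg_nonneg) (simp_all add: taylor1_def)
  have \<delta>_pos: "\<delta> n \<ge> 0" for n unfolding \<delta>_def by (intro sum_nonneg Bochner_Integration.integral_nonneg mult_nonneg_nonneg) auto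
  \<comment> \<open>Collects every error that vanishes as \<open>n\<close> grows with
    \<open>m\<close> and \<open>p\<close> fixed. Together with the three errors
    \<open>\<epsilon> / 8\<close> from \<open>\<eta>\<close>, from the block average and from
    \<open>kap\<close> the total is at most \<open>\<epsilon> / 2\<close>.\<close>
  define Z where "Z n = real n * t2 n + (norm v)\<^sup>2 * (2 * B * real m) / real n + sqrt (real n) * t1 n + \<delta> n + 2 * real p * A / real n" for n
  have "Z \<longlonglongrightarrow> 0 + 0 + 0 + (\<Sum>r<p. 0) + 0"
    unfolding Z_def t2_def t1_def \<delta>_def
    by (intro tendsto_add tendsto_sum taylor2_limit taylor1_limit freeze_limit[OF h] lim_const_over_n)
  then have "\<forall>\<^sub>F n in sequentially. Z n < \<epsilon> / 8" using assms by (intro order_tendstoD(2)) auto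
  then obtain N where N: "\<And>n. n \<ge> N \<Longrightarrow> Z n < \<epsilon> / 8" unfolding eventually_sequentially by blast
  show ?thesis
  proof (intro exI[of _ "max N 1"] allI impI)
    fix n K assume n: "n \<ge> max N 1" and K: "K \<le> n"
    define s where "s = 1 / sqrt (real n)"
    have n0: "real n > 0" using n by simp
    have s: "s \<ge> 0" "s\<^sup>2 = 1 / real n" using n0 by (auto simp: s_def power_divide)
    have sK: "s * real K \<le> sqrt (real n)"
    proof -
      have "s * real K \<le> s * real n" using K s by (intro mult_left_mono) auto
      also have "\<dots> = sqrt (real n)" using n0 by (simp add: s_def real_div_sqrt)
      finally show ?thesis .
    qed
    define E where "E l = (\<integral>\<omega>. U v s l \<omega> \<partial>M)" for l
    define a where "a l = (\<integral>\<omega>. U v s l \<omega> * complex_of_real (h ((T ^^ Suc l) \<omega>)) \<partial>M)" for l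
    define SV where "SV = (\<Sum>l<K. \<integral>\<omega>. U v s l \<omega> * complex_of_real (V v m ((T ^^ Suc l) \<omega>)) \<partial>M)"
    have U_int: "integrable M (U v s k)" for k
      by (rule integrable_const_bound[of _ 1]) (auto simp: norm_U)
    \<comment> \<open>\<open>V\<close> splits into its fluctuation \<open>h\<close> and its mean
      \<open>vm\<close>: the first is removed by averaging over blocks, the second is exchanged for
      \<open>kap v\<close>.\<close>
    have SV: "SV = (\<Sum>l<K. a l) + of_real vm * (\<Sum>l<K. E l)"
    proof -
      have "integrable M (\<lambda>\<omega>. h ((T ^^ Suc l) \<omega>))" for l
        using integrable_shift[of h "Suc l"] h by simp
      from U_mult_integrable[OF this] have i: "integrable M (\<lambda>\<omega>. U v s l \<omega> * complex_of_real (h ((T ^^ Suc l) \<omega>)))" for l .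
      have "(\<integral>\<omega>. U v s l \<omega> * complex_of_real (V v m ((T ^^ Suc l) \<omega>)) \<partial>M) = a l + of_real vm * E l" for l
      proof -
        have "(\<integral>\<omega>. U v s l \<omega> * complex_of_real (V v m ((T ^^ Suc l) \<omega>)) \<partial>M)
          = (\<integral>\<omega>. U v s l \<omega> * complex_of_real (h ((T ^^ Suc l) \<omega>)) + of_real vm * U v s l \<omega> \<partial>M)"
          by (intro Bochner_Integration.integral_cong refl) (simp add: h_def algebra_simps del: funpow.simps)
        also have "\<dots> = a l + of_real vm * E l"
          unfolding a_def E_def using i[of l] U_int[of l] by (subst Bochner_Integration.integral_add) auto
        finally show ?thesis .
      qed
      then show ?thesis unfolding SV_def by (simp add: sum.distrib sum_distrib_left)
    qed
    have main: "norm (E K - 1 + of_real (s\<^sup>2) * SV) \<le> real n * t2 n + \<epsilon> / 8 + (norm v)\<^sup>2 * (2 * B * real m) / real n + sqrt (real n) * t1 n"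
    proof -
      have "norm (E K - 1 + of_real (s\<^sup>2) * SV) \<le> real K * t2 n + s\<^sup>2 * (norm v)\<^sup>2 * (real K * \<eta> + 2 * B * real m) + s * real K * t1 n"
        unfolding E_def SV_def t2_def t1_def s_def[symmetric]
        by (rule main_step[OF s(1) m B mc]) (use \<eta> in auto)
      moreover have "real K * t2 n \<le> real n * t2 n" using K t2_pos by (intro mult_right_mono) auto
      moreover have "s * real K * t1 n \<le> sqrt (real n) * t1 n" using sK t1_pos by (intro mult_right_mono) auto
      moreover have "s\<^sup>2 * (norm v)\<^sup>2 * (real K * \<eta> + 2 * B * real m) \<le> \<epsilon> / 8 + (norm v)\<^sup>2 * (2 * B * real m) / real n"
      proof -
        have "s\<^sup>2 * (norm v)\<^sup>2 * (real K * \<eta> + 2 * B * real m) \<le> s\<^sup>2 * (norm v)\<^sup>2 * (real n * \<eta> + 2 * B * real m)"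
          using K \<eta> by (intro mult_left_mono add_right_mono mult_right_mono) auto
        also have "\<dots> = (norm v)\<^sup>2 * \<eta> + (norm v)\<^sup>2 * (2 * B * real m) / real n"
          using n0 unfolding s(2) by (simp add: field_simps)
        finally show ?thesis using v\<eta> by simp
      qed
      ultimately show ?thesis by linarith
    qed
    have ergo: "norm (of_real (s\<^sup>2) * (\<Sum>l<K. a l)) \<le> \<epsilon> / 8 + \<delta> n + 2 * real p * A / real n"
    proof -
      have "real p * norm (\<Sum>l<K. a l) \<le> real K * (real p * (\<epsilon> / 8) + \<delta> n) + 2 * (real p)\<^sup>2 * A"
      proof (rule order_trans[OF ergodic_step[OF h, where p=p and K=K and v=v and s=s, folded a_def A_def]])
        show "real K * ((\<integral>\<omega>. \<bar>\<Sum>r<p. h ((T ^^ r) \<omega>)\<bar> \<partial>M) + (\<Sum>r<p. \<integral>\<omega>. min 2 \<bar>s * v (S r \<omega>)\<bar> * \<bar>h ((T ^^ Suc r) \<omega>)\<bar> \<partial>M)) + 2 * (real p)\<^sup>2 * A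
          \<le> real K * (real p * (\<epsilon> / 8) + \<delta> n) + 2 * (real p)\<^sup>2 * A"
          unfolding \<delta>_def s_def[symmetric] using \<alpha> by (intro add_right_mono mult_left_mono) auto
      qed
      also have "\<dots> \<le> real n * (real p * (\<epsilon> / 8) + real p * \<delta> n) + 2 * (real p)\<^sup>2 * A"
      proof (intro add_right_mono mult_mono add_left_mono)
        \<comment> \<open>A crude factor \<open>p \<ge> 1\<close>, inserted so that \<open>p\<close>
          cancels from both sides.\<close>
        show "\<delta> n \<le> real p * \<delta> n" using mult_right_mono[of 1 "real p" "\<delta> n"] p \<delta>_pos[of n] by simp
      qed (use K assms \<delta>_pos in auto)
      also have "\<dots> = real p * (real n * (\<epsilon> / 8 + \<delta> n) + 2 * real p * A)" by (simp add: power2_eq_square algebra_simps)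
      finally have "norm (\<Sum>l<K. a l) \<le> real n * (\<epsilon> / 8 + \<delta> n) + 2 * real p * A" using p by simp
      then have "(1 / real n) * norm (\<Sum>l<K. a l) \<le> (1 / real n) * (real n * (\<epsilon> / 8 + \<delta> n) + 2 * real p * A)"
        using n0 by (intro mult_left_mono) auto
      also have "\<dots> = \<epsilon> / 8 + \<delta> n + 2 * real p * A / real n" using n0 by (simp add: field_simps)
      finally show ?thesis unfolding norm_mult norm_of_real s(2) using n0 by simp
    qed
    have kp: "norm (of_real ((kap v - vm) / real n) * (\<Sum>l<K. E l)) \<le> \<epsilon> / 8"
    proof -
      have "norm (\<Sum>l<K. E l) \<le> (\<Sum>l<K. 1)"
      proof (rule order_trans[OF norm_sum sum_mono])
        fix l
        have "norm (E l) \<le> (\<integral>\<omega>. 1 \<partial>M)" unfolding E_def by (rule norm_integral_le) (auto simp: norm_U)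
        then show "norm (E l) \<le> 1" by (simp add: prob_space)
      qed
      then have "norm (\<Sum>l<K. E l) \<le> real n" using K by simp
      then have "\<bar>kap v - vm\<bar> * norm (\<Sum>l<K. E l) \<le> (\<epsilon> / 8) * real n" using kap assms by (intro mult_mono) auto
      then show ?thesis using n0 unfolding norm_mult norm_of_real abs_divide by (simp add: field_simps)
    qed
    have "E K - 1 + of_real (kap v / real n) * (\<Sum>l<K. E l) = (E K - 1 + of_real (s\<^sup>2) * SV) - of_real (s\<^sup>2) * (\<Sum>l<K. a l)
      + of_real ((kap v - vm) / real n) * (\<Sum>l<K. E l)"
      unfolding SV s(2) by (simp add: diff_divide_distrib algebra_simps)
    also have "norm \<dots> \<le> (real n * t2 n + \<epsilon> / 8 + (norm v)\<^sup>2 * (2 * B * real m) / real n + sqrt (real n) * t1 n)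
      + (\<epsilon> / 8 + \<delta> n + 2 * real p * A / real n) + \<epsilon> / 8"
      by (intro order_trans[OF norm_triangle_ineq] add_mono order_trans[OF norm_triangle_ineq4] main ergo kp)
    also have "\<dots> = Z n + 3 * (\<epsilon> / 8)" by (simp add: Z_def)
    also have "\<dots> \<le> \<epsilon>" using N[of n] n assms by simp
    finally show "norm ((\<integral>\<omega>. U v (1 / sqrt (real n)) K \<omega> \<partial>M) - 1
      + of_real (kap v / real n) * (\<Sum>l<K. \<integral>\<omega>. U v (1 / sqrt (real n)) l \<omega> \<partial>M)) \<le> \<epsilon>"
      unfolding E_def s_def .
  qed
qed

theorem char_fun_limit:
  fixes v :: "'b \<Rightarrow>\<^sub>L real"
  shows "(\<lambda>n. \<integral>\<omega>. iexp (v ((1 / sqrt (real n)) *\<^sub>R S n \<omega>)) \<partial>M) \<longlonglongrightarrow> of_real (exp (- kap v))"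
  using discrete_gronwall_exp[of "\<lambda>n K. \<integral>\<omega>. U v (1 / sqrt (real n)) K \<omega> \<partial>M" "kap v", OF char_fun_estimate]
  by (simp add: U_def blinfun.scaleR_right)

end

section \<open>Weak convergence of finite-dimensional projections\<close>

text \<open>Trigonometric polynomials in \<open>d\<close> variables, generated as a linear span.
  Expectations of the generators are real and imaginary parts of characteristic functions, so
  convergence of the latter extends to the span; the product formulas for sine and cosine make it an
  algebra.\<close>

inductive_set trig :: "nat \<Rightarrow> ((nat \<Rightarrow> real) \<Rightarrow> real) set" for d where
  cos: "(\<lambda>t. cos (\<Sum>i<d. b i * t i)) \<in> trig d"
| sin: "(\<lambda>t. sin (\<Sum>i<d. b i * t i)) \<in> trig d"
| add: "p \<in> trig d \<Longrightarrow> q \<in> trig d \<Longrightarrow> (\<lambda>t. p t + q t) \<in> trig d"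
| scale: "p \<in> trig d \<Longrightarrow> (\<lambda>t. c * p t) \<in> trig d"

lemma trig_const: "(\<lambda>t. c) \<in> trig d"
  using trig.scale[OF trig.cos[of "\<lambda>_. 0" d], of c] by simp

lemma trig_mult_basic:
  "(\<lambda>t. cos (\<Sum>i<d. a i * t i) * cos (\<Sum>i<d. b i * t i)) \<in> trig d"
  "(\<lambda>t. sin (\<Sum>i<d. a i * t i) * cos (\<Sum>i<d. b i * t i)) \<in> trig d"
  "(\<lambda>t. sin (\<Sum>i<d. a i * t i) * sin (\<Sum>i<d. b i * t i)) \<in> trig d"
proof -
  have m: "(\<Sum>i<d. (a i - b i) * t i) = (\<Sum>i<d. a i * t i) - (\<Sum>i<d. b i * t i)"
    and p: "(\<Sum>i<d. (a i + b i) * t i) = (\<Sum>i<d. a i * t i) + (\<Sum>i<d. b i * t i)" for t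
    by (simp_all add: algebra_simps sum.distrib sum_subtractf)
  show "(\<lambda>t. cos (\<Sum>i<d. a i * t i) * cos (\<Sum>i<d. b i * t i)) \<in> trig d"
    using trig.scale[OF trig.add[OF trig.cos[of "\<lambda>i. a i - b i" d] trig.cos[of "\<lambda>i. a i + b i" d]], of "1/2"]
    unfolding m p by (simp add: cos_times_cos)
  show "(\<lambda>t. sin (\<Sum>i<d. a i * t i) * cos (\<Sum>i<d. b i * t i)) \<in> trig d"
    using trig.scale[OF trig.add[OF trig.sin[of "\<lambda>i. a i + b i" d] trig.sin[of "\<lambda>i. a i - b i" d]], of "1/2"]
    unfolding m p by (simp add: sin_times_cos)
  show "(\<lambda>t. sin (\<Sum>i<d. a i * t i) * sin (\<Sum>i<d. b i * t i)) \<in> trig d"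
    using trig.scale[OF trig.add[OF trig.cos[of "\<lambda>i. a i - b i" d] trig.scale[OF trig.cos[of "\<lambda>i. a i + b i" d], of "-1"]], of "1/2"]
    unfolding m p by (simp add: sin_times_sin)
qed

lemma trig_mult:
  assumes "p \<in> trig d" "q \<in> trig d"
  shows "(\<lambda>t. p t * q t) \<in> trig d"
  using assms(1)
proof induction
  case (cos a)
  show ?case using assms(2)
  proof induction
    case (sin b)
    then show ?case using trig_mult_basic(2)[of b d a] by (simp add: mult.commute)
  next
    case (add p q)
    then show ?case using trig.add by (simp add: distrib_left)
  next
    case (scale p c)
    then show ?case using trig.scale[of _ d c] by (simp add: mult.left_commute)
  qed (rule trig_mult_basic)
next
  case (sin a)
  show ?case using assms(2)
  proof induction
    case (add p q)
    then show ?case using trig.add by (simp add: distrib_left)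
  next
    case (scale p c)
    then show ?case using trig.scale[of _ d c] by (simp add: mult.left_commute)
  qed (rule trig_mult_basic)+
next
  case (add p p')
  then show ?case using trig.add by (simp add: distrib_right)
next
  case (scale p c)
  then show ?case using trig.scale[of _ d c] by (simp add: mult.assoc)
qed

lemma trig_measurable:
  assumes "p \<in> trig d" and [measurable]: "\<And>i. i < d \<Longrightarrow> (\<lambda>\<omega>. y \<omega> i) \<in> borel_measurable M"
  shows "(\<lambda>\<omega>. p (y \<omega>)) \<in> borel_measurable M"
  using assms(1)
proof induction
  case (cos b)
  have "(\<lambda>\<omega>. \<Sum>i<d. b i * y \<omega> i) \<in> borel_measurable M" by (intro borel_measurable_sum borel_measurable_times assms(2)) auto
  then show ?case by measurable
next
  case (sin b)
  have "(\<lambda>\<omega>. \<Sum>i<d. b i * y \<omega> i) \<in> borel_measurable M" by (intro borel_measurable_sum borel_measurable_times assms(2)) auto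
  then show ?case by measurable
next
  case (scale p c)
  then show ?case by (intro borel_measurable_times borel_measurable_const)
qed measurable

lemma trig_bounded: "p \<in> trig d \<Longrightarrow> \<exists>K. \<forall>t. \<bar>p t\<bar> \<le> K"
proof (induction rule: trig.induct)
  case (add p q)
  then obtain K L where "\<And>t. \<bar>p t\<bar> \<le> K" "\<And>t. \<bar>q t\<bar> \<le> L" by auto
  then have "\<bar>p t + q t\<bar> \<le> K + L" for t by (meson abs_triangle_ineq add_mono order_trans)
  then show ?case by blast
next
  case (scale p c)
  then obtain K where "\<And>t. \<bar>p t\<bar> \<le> K" by auto
  then have "\<bar>c * p t\<bar> \<le> \<bar>c\<bar> * K" for t by (simp add: abs_mult mult_left_mono)
  then show ?case by blast
qed (intro exI[of _ 1], simp)+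

lemma (in prob_space) trig_integrable:
  assumes "p \<in> trig d" and "\<And>i. i < d \<Longrightarrow> (\<lambda>\<omega>. y \<omega> i) \<in> borel_measurable M"
  shows "integrable M (\<lambda>\<omega>. p (y \<omega>))"
proof -
  obtain K where "\<And>t. \<bar>p t\<bar> \<le> K" using trig_bounded[OF assms(1)] by auto
  then show ?thesis by (intro integrable_const_bound[of _ K] trig_measurable[OF assms]) auto
qed

lemma (in prob_space) integral_iexp:
  assumes [measurable]: "h \<in> borel_measurable M"
  shows "(\<integral>\<omega>. iexp (h \<omega>) \<partial>M) = Complex (\<integral>\<omega>. cos (h \<omega>) \<partial>M) (\<integral>\<omega>. sin (h \<omega>) \<partial>M)"
proof -
  have i: "integrable M (\<lambda>\<omega>. cos (h \<omega>))" "integrable M (\<lambda>\<omega>. sin (h \<omega>))"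
    by (auto intro!: integrable_const_bound[of _ 1])
  have "(\<integral>\<omega>. iexp (h \<omega>) \<partial>M) = (\<integral>\<omega>. of_real (cos (h \<omega>)) + \<i> * of_real (sin (h \<omega>)) \<partial>M)"
    by (intro Bochner_Integration.integral_cong refl) (simp add: cis_conv_exp[symmetric] complex_eq_iff)
  also have "\<dots> = of_real (\<integral>\<omega>. cos (h \<omega>) \<partial>M) + \<i> * of_real (\<integral>\<omega>. sin (h \<omega>) \<partial>M)"
    using i by (subst Bochner_Integration.integral_add) (auto intro!: integrable_mult_right)
  finally show ?thesis by (simp add: complex_eq_iff)
qed

lemma trig_integral_tendsto:
  fixes y :: "nat \<Rightarrow> 'a \<Rightarrow> nat \<Rightarrow> real" and z :: "'c \<Rightarrow> nat \<Rightarrow> real"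
  assumes M: "prob_space M" and N: "prob_space N"
    and y: "\<And>n i. i < d \<Longrightarrow> (\<lambda>\<omega>. y n \<omega> i) \<in> borel_measurable M"
    and z: "\<And>i. i < d \<Longrightarrow> (\<lambda>\<omega>. z \<omega> i) \<in> borel_measurable N"
    and char: "\<And>b. (\<lambda>n. \<integral>\<omega>. iexp (\<Sum>i<d. b i * y n \<omega> i) \<partial>M) \<longlonglongrightarrow> (\<integral>\<omega>. iexp (\<Sum>i<d. b i * z \<omega> i) \<partial>N)"
    and p: "p \<in> trig d"
  shows "(\<lambda>n. \<integral>\<omega>. p (y n \<omega>) \<partial>M) \<longlonglongrightarrow> (\<integral>\<omega>. p (z \<omega>) \<partial>N)"
proof -
  interpret M: prob_space M by (rule M)
  interpret N: prob_space N by (rule N)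
  have my: "(\<lambda>\<omega>. \<Sum>i<d. b i * y n \<omega> i) \<in> borel_measurable M" for b n
    by (intro borel_measurable_sum borel_measurable_times y) auto
  have mz: "(\<lambda>\<omega>. \<Sum>i<d. b i * z \<omega> i) \<in> borel_measurable N" for b
    by (intro borel_measurable_sum borel_measurable_times z) auto
  note iy = M.trig_integrable[of _ d "y _", OF _ y]
  note iz = N.trig_integrable[of _ d z, OF _ z]
  show ?thesis using p
  proof induction
    case (cos b)
    show ?case using tendsto_Re[OF char[of b]] unfolding M.integral_iexp[OF my] N.integral_iexp[OF mz] by simp
  next
    case (sin b)
    show ?case using tendsto_Im[OF char[of b]] unfolding M.integral_iexp[OF my] N.integral_iexp[OF mz] by simp
  next
    case (add p q)
    then show ?case
      using tendsto_add[OF add.IH] iy iz by simp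
  next
    case (scale p c)
    then show ?case using tendsto_mult_left[of _ _ _ c] by simp
  qed
qed

text \<open>Points are functions on all of \<open>nat\<close>, so the cube has infinitely many
  coordinates and its compactness is Tychonoff's theorem.\<close>

lemma compact_cube: "compact {t :: nat \<Rightarrow> real. \<forall>i. t i \<in> {-1..1}}"
proof -
  have "compactin (product_topology (\<lambda>_. euclidean) UNIV) (PiE UNIV (\<lambda>_ :: nat. {-1..1 :: real}))"
    by (subst compactin_PiE) auto
  then have "compact (PiE UNIV (\<lambda>_ :: nat. {-1..1 :: real}))" by (simp add: euclidean_product_topology)
  moreover have "PiE UNIV (\<lambda>_ :: nat. {-1..1 :: real}) = {t. \<forall>i. t i \<in> {-1..1}}" by auto
  ultimately show ?thesis by simp
qed

text \<open>The substitution \<open>t i = sin (a * x i)\<close>, with \<open>a\<close> small, turns trigonometric polynomials in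
  \<open>x\<close> into polynomials on a cube, where the Stone-Weierstrass theorem gives an approximation that
  remains bounded on the whole space.\<close>

lemma trig_approximation:
  fixes f :: "'b::real_normed_vector \<Rightarrow> real" and e :: "nat \<Rightarrow> 'b"
  assumes f: "continuous_on UNIV f" and c: "\<And>x. \<bar>f x\<bar> \<le> c" and "\<epsilon> > 0" "L > 0"
  shows "\<exists>p\<in>trig d. \<forall>t. \<bar>f (\<Sum>i<d. t i *\<^sub>R e i) - p t\<bar> \<le> \<epsilon> + 2 * c * (\<Sum>i<d. (t i)\<^sup>2 / L\<^sup>2)"
proof -
  \<comment> \<open>With this scale \<open>a * x\<close> stays between \<open>-pi / 2\<close> and
    \<open>pi / 2\<close> for \<open>\<bar>x\<bar> \<le> L\<close>, where \<open>arcsin\<close>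
    inverts \<open>sin\<close>.\<close>
  define a where "a = pi / (2 * L)"
  have a: "a > 0" using \<open>L > 0\<close> by (simp add: a_def)
  define Q where "Q = {t :: nat \<Rightarrow> real. \<forall>i. t i \<in> {-1..1}}"
  \<comment> \<open>Coordinates from \<open>d\<close> on are set to 0 so that every coordinate
    function of the cube becomes a trigonometric polynomial.\<close>
  define sn where "sn t = (\<lambda>i. if i < d then sin (a * t i) else 0)" for t :: "nat \<Rightarrow> real"
  define R where "R = {p :: (nat \<Rightarrow> real) \<Rightarrow> real. continuous_on Q p \<and> (\<lambda>t. p (sn t)) \<in> trig d}"
  define F where "F t = f (\<Sum>i<d. (arcsin (t i) / a) *\<^sub>R e i)" for t :: "nat \<Rightarrow> real"
  have coord: "(\<lambda>t. t i) \<in> R" for i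
  proof -
    have "(\<lambda>t. sn t i) \<in> trig d"
    proof (cases "i < d")
      case True
      have "(\<Sum>k<d. (if k = i then a else 0) * t k) = (\<Sum>k<d. if k = i then a * t k else 0)" for t
        by (rule sum.cong) auto
      also have "\<dots> t = a * t i" for t using True by simp
      finally have "(\<lambda>t. sn t i) = (\<lambda>t. sin (\<Sum>k<d. (if k = i then a else 0) * t k))" using True by (simp add: sn_def)
      then show ?thesis using trig.sin[of "\<lambda>k. if k = i then a else 0" d] by simp
    next
      case False
      then show ?thesis using trig_const[of 0 d] by (simp add: sn_def)
    qed
    then show ?thesis unfolding R_def by (auto intro: continuous_on_subset[OF continuous_on_product_coordinates])
  qed
  interpret function_ring_on R Q
  proof
    show "compact Q" unfolding Q_def by (rule compact_cube)
    show "\<exists>p\<in>R. p x \<noteq> p y" if "x \<noteq> y" for x y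
    proof -
      obtain i where "x i \<noteq> y i" using \<open>x \<noteq> y\<close> by (auto simp: fun_eq_iff)
      then show ?thesis by (intro bexI[of _ "\<lambda>t. t i"] coord)
    qed
  qed (auto simp: R_def intro!: continuous_intros trig.add trig_mult trig_const)
  have "continuous_on Q F"
    unfolding F_def
  proof (rule continuous_on_compose2[OF f])
    have "continuous_on Q (\<lambda>t. t i)" for i by (rule continuous_on_subset[OF continuous_on_product_coordinates]) auto
    then show "continuous_on Q (\<lambda>t. \<Sum>i<d. (arcsin (t i) / a) *\<^sub>R e i)"
      using a by (intro continuous_intros) (auto simp: Q_def)
  qed auto
  from Stone_Weierstrass_basic[OF this \<open>\<epsilon> > 0\<close>]
  obtain p where p: "p \<in> R" "\<And>t. t \<in> Q \<Longrightarrow> \<bar>F t - p t\<bar> < \<epsilon>" by blast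
  show ?thesis
  proof (intro bexI[of _ "\<lambda>t. p (sn t)"] allI)
    show "(\<lambda>t. p (sn t)) \<in> trig d" using p(1) by (simp add: R_def)
    fix t
    have snQ: "sn t \<in> Q" by (auto simp: sn_def Q_def)
    \<comment> \<open>Inside the box the substitution is exact. Outside it some
      \<open>(t i)^2 / L^2\<close> is at least 1, and the sum absorbs the trivial bound
      \<open>2 * c\<close>.\<close>
    have "\<bar>f (\<Sum>i<d. t i *\<^sub>R e i) - F (sn t)\<bar> \<le> 2 * c * (\<Sum>i<d. (t i)\<^sup>2 / L\<^sup>2)"
    proof (cases "\<forall>i<d. \<bar>t i\<bar> \<le> L")
      case True
      have "arcsin (sn t i) / a = t i" if "i < d" for i
      proof -
        have "\<bar>a * t i\<bar> \<le> a * L" using True that a by (simp add: abs_mult)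
        also have "a * L = pi / 2" using \<open>L > 0\<close> by (simp add: a_def)
        finally have "arcsin (sin (a * t i)) = a * t i" by (intro arcsin_sin) (auto simp: abs_le_iff)
        then show ?thesis using that a by (simp add: sn_def)
      qed
      then have "F (sn t) = f (\<Sum>i<d. t i *\<^sub>R e i)" unfolding F_def by (intro arg_cong[of _ _ f] sum.cong) auto
      moreover have "c \<ge> 0" using c[of 0] by linarith
      ultimately show ?thesis by (simp add: sum_nonneg)
    next
      case False
      then obtain i where i: "i < d" "\<bar>t i\<bar> > L" by auto
      have "c \<ge> 0" using c[of 0] by linarith
      have "L\<^sup>2 \<le> (t i)\<^sup>2" using i \<open>L > 0\<close> by (intro abs_le_square_iff[THEN iffD1]) auto
      then have "1 \<le> (t i)\<^sup>2 / L\<^sup>2" using \<open>L > 0\<close> by simp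
      also have "\<dots> \<le> (\<Sum>i<d. (t i)\<^sup>2 / L\<^sup>2)" using i by (intro member_le_sum) auto
      finally have "2 * c * 1 \<le> 2 * c * (\<Sum>i<d. (t i)\<^sup>2 / L\<^sup>2)" using \<open>c \<ge> 0\<close> by (intro mult_left_mono) auto
      moreover have "\<bar>f (\<Sum>i<d. t i *\<^sub>R e i) - F (sn t)\<bar> \<le> c + c"
        unfolding F_def using c by (intro order_trans[OF abs_triangle_ineq4] add_mono)
      ultimately show ?thesis by linarith
    qed
    with p(2)[OF snQ] show "\<bar>f (\<Sum>i<d. t i *\<^sub>R e i) - p (sn t)\<bar> \<le> \<epsilon> + 2 * c * (\<Sum>i<d. (t i)\<^sup>2 / L\<^sup>2)"
      by linarith
  qed
qed

text \<open>The error of the trigonometric approximation outside a box is controlled by second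
  moments, as in Chebyshev's inequality; their bound, uniform in \<open>n\<close>, takes the place
  of tightness.\<close>

lemma finite_dim_weak_conv:
  fixes y :: "nat \<Rightarrow> 'a \<Rightarrow> nat \<Rightarrow> real" and z :: "'c \<Rightarrow> nat \<Rightarrow> real"
    and f :: "'b::{real_normed_vector, second_countable_topology} \<Rightarrow> real" and e :: "nat \<Rightarrow> 'b"
  assumes M: "prob_space M" and N: "prob_space N"
    and y: "\<And>n i. i < d \<Longrightarrow> (\<lambda>\<omega>. y n \<omega> i) \<in> borel_measurable M"
    and z: "\<And>i. i < d \<Longrightarrow> (\<lambda>\<omega>. z \<omega> i) \<in> borel_measurable N"
    and char: "\<And>b. (\<lambda>n. \<integral>\<omega>. iexp (\<Sum>i<d. b i * y n \<omega> i) \<partial>M) \<longlonglongrightarrow> (\<integral>\<omega>. iexp (\<Sum>i<d. b i * z \<omega> i) \<partial>N)"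
    and y_sq: "\<And>n i. i < d \<Longrightarrow> integrable M (\<lambda>\<omega>. (y n \<omega> i)\<^sup>2)" "\<And>n i. i < d \<Longrightarrow> (\<integral>\<omega>. (y n \<omega> i)\<^sup>2 \<partial>M) \<le> C"
    and z_sq: "\<And>i. i < d \<Longrightarrow> integrable N (\<lambda>\<omega>. (z \<omega> i)\<^sup>2)"
    and f: "continuous_on UNIV f" and c: "\<And>x. \<bar>f x\<bar> \<le> c"
  shows "(\<lambda>n. \<integral>\<omega>. f (\<Sum>i<d. y n \<omega> i *\<^sub>R e i) \<partial>M) \<longlonglongrightarrow> (\<integral>\<omega>. f (\<Sum>i<d. z \<omega> i *\<^sub>R e i) \<partial>N)"
proof (rule LIMSEQ_I)
  fix \<epsilon> :: real assume "\<epsilon> > 0"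
  interpret M: prob_space M by (rule M)
  interpret N: prob_space N by (rule N)
  have c0: "c \<ge> 0" using c[of 0] by linarith
  define D where "D = real d * \<bar>C\<bar> + (\<Sum>i<d. \<integral>\<omega>. (z \<omega> i)\<^sup>2 \<partial>N) + 1"
  have z_nn: "(\<Sum>i<d. \<integral>\<omega>. (z \<omega> i)\<^sup>2 \<partial>N) \<ge> 0" by (intro sum_nonneg Bochner_Integration.integral_nonneg) auto
  then have D: "D > 0" by (simp add: D_def add_nonneg_pos)
  \<comment> \<open>Large enough that \<open>2 * c * D / L^2 \<le> \<epsilon> / 8\<close>, where
    \<open>D\<close> majorises the second moments of both the sequence and the limit.\<close>
  define L where "L = sqrt (16 * (c + 1) * D / \<epsilon>)"
  have L2: "L\<^sup>2 = 16 * (c + 1) * D / \<epsilon>" unfolding L_def using c0 D \<open>\<epsilon> > 0\<close> by simp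
  have L: "L > 0" unfolding L_def using c0 D \<open>\<epsilon> > 0\<close> by simp
  have cD: "2 * c * (D / L\<^sup>2) \<le> \<epsilon> / 8"
  proof -
    have k: "D / (16 * k * D / \<epsilon>) = \<epsilon> / (16 * k)" if "k > 0" for k
      using that D \<open>\<epsilon> > 0\<close> by (simp add: field_simps)
    have "D / L\<^sup>2 = \<epsilon> / (16 * (c + 1))" unfolding L2 by (rule k) (use c0 in simp)
    moreover have "2 * c * (\<epsilon> / (16 * k)) = (\<epsilon> / 8) * (c / k)" for k :: real by simp
    ultimately have "2 * c * (D / L\<^sup>2) = (\<epsilon> / 8) * (c / (c + 1))" by metis
    also have "\<dots> \<le> (\<epsilon> / 8) * 1" using c0 \<open>\<epsilon> > 0\<close> by (intro mult_left_mono) auto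
    finally show ?thesis by simp
  qed
  have "\<epsilon> / 8 > 0" using \<open>\<epsilon> > 0\<close> by simp
  from trig_approximation[OF f c this L, of d e]
  obtain p where p: "p \<in> trig d" "\<And>t. \<bar>f (\<Sum>i<d. t i *\<^sub>R e i) - p t\<bar> \<le> \<epsilon> / 8 + 2 * c * (\<Sum>i<d. (t i)\<^sup>2 / L\<^sup>2)"
    by auto
  have f_meas: "f \<in> borel_measurable borel" by (rule borel_measurable_continuous_onI[OF f])
  have est: "\<bar>(\<integral>\<omega>. f (\<Sum>i<d. x \<omega> i *\<^sub>R e i) \<partial>K) - (\<integral>\<omega>. p (x \<omega>) \<partial>K)\<bar> \<le> \<epsilon> / 4"
    if K: "prob_space K" and x: "\<And>i. i < d \<Longrightarrow> (\<lambda>\<omega>. x \<omega> i) \<in> borel_measurable K"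
      and x_sq: "\<And>i. i < d \<Longrightarrow> integrable K (\<lambda>\<omega>. (x \<omega> i)\<^sup>2)"
      and x_le: "(\<Sum>i<d. \<integral>\<omega>. (x \<omega> i)\<^sup>2 \<partial>K) \<le> D" for K :: "'z measure" and x
  proof -
    interpret K: prob_space K by (rule K)
    have "(\<lambda>\<omega>. \<Sum>i<d. x \<omega> i *\<^sub>R e i) \<in> borel_measurable K"
      by (intro borel_measurable_sum borel_measurable_scaleR x) auto
    then have fm: "(\<lambda>\<omega>. f (\<Sum>i<d. x \<omega> i *\<^sub>R e i)) \<in> borel_measurable K" using f_meas by (rule measurable_compose)
    have fi: "integrable K (\<lambda>\<omega>. f (\<Sum>i<d. x \<omega> i *\<^sub>R e i))"
      by (rule K.integrable_const_bound[of _ c, OF _ fm]) (use c in auto)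
    have pi: "integrable K (\<lambda>\<omega>. p (x \<omega>))" by (rule K.trig_integrable[OF p(1) x])
    have "(\<integral>\<omega>. f (\<Sum>i<d. x \<omega> i *\<^sub>R e i) \<partial>K) - (\<integral>\<omega>. p (x \<omega>) \<partial>K) = (\<integral>\<omega>. f (\<Sum>i<d. x \<omega> i *\<^sub>R e i) - p (x \<omega>) \<partial>K)"
      using fi pi by simp
    also have "\<bar>\<dots>\<bar> \<le> (\<integral>\<omega>. \<epsilon> / 8 + 2 * c * (\<Sum>i<d. (x \<omega> i)\<^sup>2 / L\<^sup>2) \<partial>K)"
      unfolding real_norm_def[symmetric]
    proof (rule norm_integral_le)
      show "integrable K (\<lambda>\<omega>. \<epsilon> / 8 + 2 * c * (\<Sum>i<d. (x \<omega> i)\<^sup>2 / L\<^sup>2))"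
        by (intro Bochner_Integration.integrable_add integrable_mult_right Bochner_Integration.integrable_sum
            integrable_divide K.integrable_const x_sq) auto
      show "norm (f (\<Sum>i<d. x \<omega> i *\<^sub>R e i) - p (x \<omega>)) \<le> \<epsilon> / 8 + 2 * c * (\<Sum>i<d. (x \<omega> i)\<^sup>2 / L\<^sup>2)" for \<omega>
        using p(2)[of "x \<omega>"] by simp
      show "(\<lambda>\<omega>. f (\<Sum>i<d. x \<omega> i *\<^sub>R e i) - p (x \<omega>)) \<in> borel_measurable K" using fi pi by auto
    qed
    also have "\<dots> = \<epsilon> / 8 + 2 * c * ((\<Sum>i<d. \<integral>\<omega>. (x \<omega> i)\<^sup>2 \<partial>K) / L\<^sup>2)"
    proof -
      have i: "integrable K (\<lambda>\<omega>. (x \<omega> i)\<^sup>2 / L\<^sup>2)" if "i \<in> {..<d}" for i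
        using x_sq that by simp
      have "(\<integral>\<omega>. (\<Sum>i<d. (x \<omega> i)\<^sup>2 / L\<^sup>2) \<partial>K) = (\<Sum>i<d. \<integral>\<omega>. (x \<omega> i)\<^sup>2 / L\<^sup>2 \<partial>K)"
        by (rule Bochner_Integration.integral_sum[OF i])
      moreover have "(\<integral>\<omega>. \<epsilon> / 8 + 2 * c * (\<Sum>i<d. (x \<omega> i)\<^sup>2 / L\<^sup>2) \<partial>K) = \<epsilon> / 8 + 2 * c * (\<integral>\<omega>. (\<Sum>i<d. (x \<omega> i)\<^sup>2 / L\<^sup>2) \<partial>K)"
        by (subst Bochner_Integration.integral_add[OF K.integrable_const integrable_mult_right[OF Bochner_Integration.integrable_sum[OF i]]])
          (simp_all add: K.prob_space)
      ultimately show ?thesis by (simp add: sum_divide_distrib)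
    qed
    also have "\<dots> \<le> \<epsilon> / 8 + 2 * c * (D / L\<^sup>2)"
      using x_le c0 by (intro add_left_mono mult_left_mono divide_right_mono) auto
    also have "\<dots> \<le> \<epsilon> / 4" using cD by simp
    finally show ?thesis .
  qed
  have yD: "(\<Sum>i<d. \<integral>\<omega>. (y n \<omega> i)\<^sup>2 \<partial>M) \<le> D" for n
  proof -
    have "(\<Sum>i<d. \<integral>\<omega>. (y n \<omega> i)\<^sup>2 \<partial>M) \<le> (\<Sum>i<d. \<bar>C\<bar>)"
      using y_sq(2) by (intro sum_mono) (auto intro: order_trans[OF _ abs_ge_self])
    then show ?thesis using z_nn by (simp add: D_def)
  qed
  have zD: "(\<Sum>i<d. \<integral>\<omega>. (z \<omega> i)\<^sup>2 \<partial>N) \<le> D" by (simp add: D_def)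
  have "\<forall>\<^sub>F n in sequentially. dist (\<integral>\<omega>. p (y n \<omega>) \<partial>M) (\<integral>\<omega>. p (z \<omega>) \<partial>N) < \<epsilon> / 4"
    by (rule tendstoD[OF trig_integral_tendsto[OF M N y z char p(1)]]) (use \<open>\<epsilon> > 0\<close> in auto)
  then obtain n0 where n0: "\<And>n. n \<ge> n0 \<Longrightarrow> \<bar>(\<integral>\<omega>. p (y n \<omega>) \<partial>M) - (\<integral>\<omega>. p (z \<omega>) \<partial>N)\<bar> < \<epsilon> / 4"
    unfolding eventually_sequentially dist_real_def by blast
  show "\<exists>n0. \<forall>n\<ge>n0. norm ((\<integral>\<omega>. f (\<Sum>i<d. y n \<omega> i *\<^sub>R e i) \<partial>M) - (\<integral>\<omega>. f (\<Sum>i<d. z \<omega> i *\<^sub>R e i) \<partial>N)) < \<epsilon>"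
  proof (intro exI[of _ n0] allI impI)
    fix n assume "n \<ge> n0"
    then show "norm ((\<integral>\<omega>. f (\<Sum>i<d. y n \<omega> i *\<^sub>R e i) \<partial>M) - (\<integral>\<omega>. f (\<Sum>i<d. z \<omega> i *\<^sub>R e i) \<partial>N)) < \<epsilon>"
      using n0[of n] est[OF M y y_sq(1) yD, of n] est[OF N z z_sq zD] unfolding real_norm_def by linarith
  qed
qed

section \<open>Gaussian sequences\<close>

text \<open>Orthogonalisation without normalisation, for a form that may be degenerate: division by
  \<open>K w w = 0\<close> yields 0, which drops exactly those directions \<open>w\<close> that
  \<open>K_degenerate\<close> shows to be orthogonal to everything.\<close>

fun gram_schmidt :: "('v::real_vector \<Rightarrow> 'v \<Rightarrow> real) \<Rightarrow> (nat \<Rightarrow> 'v) \<Rightarrow> nat \<Rightarrow> 'v" where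
  "gram_schmidt K u i = u i - (\<Sum>j<i. (K (u i) (gram_schmidt K u j) / K (gram_schmidt K u j) (gram_schmidt K u j))
     *\<^sub>R gram_schmidt K u j)"

declare gram_schmidt.simps[simp del]

locale covariance_form =
  fixes K :: "'v::real_vector \<Rightarrow> 'v \<Rightarrow> real"
  assumes K_add: "K (a + b) c = K a c + K b c"
    and K_scale: "K (r *\<^sub>R a) b = r * K a b"
    and K_sym: "K a b = K b a"
    and K_pos: "K a a \<ge> 0"
begin

lemma K_add_right: "K c (a + b) = K c a + K c b"
  using K_add[of a b c] by (simp add: K_sym)

lemma K_scale_right: "K b (r *\<^sub>R a) = r * K b a"
  using K_scale[of r a b] by (simp add: K_sym)

lemma K_zero: "K 0 b = 0"
  using K_scale[of 0 0 b] by simp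

lemma K_diff: "K (a - b) c = K a c - K b c"
  using K_add[of "a - b" b c] by simp

lemma K_sum: "K (\<Sum>i\<in>I. f i) c = (\<Sum>i\<in>I. K (f i) c)"
  by (induction I rule: infinite_finite_induct) (simp_all add: K_zero K_add)

lemma K_sum_right: "K c (\<Sum>i\<in>I. f i) = (\<Sum>i\<in>I. K c (f i))"
  using K_sum[of f I c] by (simp add: K_sym)

lemma K_degenerate:
  assumes "K b b = 0"
  shows "K a b = 0"
proof (rule ccontr)
  assume "K a b \<noteq> 0"
  \<comment> \<open>Chosen so that the linear term equals \<open>- (K a a + 1)\<close>, which would
    make the form negative.\<close>
  define t where "t = - (K a a + 1) / (2 * K a b)"
  have "K (a + t *\<^sub>R b) (a + t *\<^sub>R b) = K a a + 2 * t * K a b + t * t * K b b"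
    by (simp add: K_add K_add_right K_scale K_scale_right K_sym[of b a] algebra_simps)
  also have "\<dots> = - 1" using assms \<open>K a b \<noteq> 0\<close> by (simp add: t_def) (simp add: field_simps)
  finally show False using K_pos[of "a + t *\<^sub>R b"] by simp
qed

lemma gram_schmidt_orthogonal_less:
  "j < i \<Longrightarrow> K (gram_schmidt K u i) (gram_schmidt K u j) = 0"
proof (induction i arbitrary: j rule: less_induct)
  case (less i)
  let ?w = "gram_schmidt K u"
  have z: "K (?w l) (?w j) = 0" if "l < i" "l \<noteq> j" for l
  proof (cases "j < l")
    case True
    then show ?thesis using less.IH[OF \<open>l < i\<close>] by simp
  next
    case False
    then show ?thesis using less.IH[OF \<open>j < i\<close>, of l] that by (simp add: K_sym)
  qed
  have "K (?w i) (?w j) = K (u i) (?w j) - (\<Sum>l<i. (K (u i) (?w l) / K (?w l) (?w l)) * K (?w l) (?w j))"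
    by (subst gram_schmidt.simps) (simp add: K_diff K_sum K_scale)
  also have "(\<Sum>l<i. (K (u i) (?w l) / K (?w l) (?w l)) * K (?w l) (?w j)) = (\<Sum>l<i. if l = j then (K (u i) (?w j) / K (?w j) (?w j)) * K (?w j) (?w j) else 0)"
    using z by (intro sum.cong) auto
  also have "\<dots> = (K (u i) (?w j) / K (?w j) (?w j)) * K (?w j) (?w j)" using less.prems by simp
  also have "K (u i) (?w j) - \<dots> = 0" using K_degenerate[of "?w j" "u i"] by (cases "K (?w j) (?w j) = 0") auto
  finally show ?case .
qed

lemma gram_schmidt_orthogonal: "i \<noteq> j \<Longrightarrow> K (gram_schmidt K u i) (gram_schmidt K u j) = 0"
  using gram_schmidt_orthogonal_less[of i j u] gram_schmidt_orthogonal_less[of j i u] by (cases "i < j") (auto simp: K_sym)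

definition gs_coeff :: "(nat \<Rightarrow> 'v) \<Rightarrow> nat \<Rightarrow> nat \<Rightarrow> real" where
  "gs_coeff u i j = (if j = i then 1 else if j < i then K (u i) (gram_schmidt K u j) / K (gram_schmidt K u j) (gram_schmidt K u j) else 0)"

lemma gs_expand:
  assumes "i < d"
  shows "u i = (\<Sum>j<d. gs_coeff u i j *\<^sub>R gram_schmidt K u j)"
proof -
  have "(\<Sum>j<d. gs_coeff u i j *\<^sub>R gram_schmidt K u j) = (\<Sum>j<Suc i. gs_coeff u i j *\<^sub>R gram_schmidt K u j)"
    using assms by (intro sum.mono_neutral_right) (auto simp: gs_coeff_def)
  also have "\<dots> = (\<Sum>j<i. gs_coeff u i j *\<^sub>R gram_schmidt K u j) + gram_schmidt K u i"
    by (simp add: gs_coeff_def)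
  also have "(\<Sum>j<i. gs_coeff u i j *\<^sub>R gram_schmidt K u j) = (\<Sum>j<i. (K (u i) (gram_schmidt K u j) / K (gram_schmidt K u j) (gram_schmidt K u j)) *\<^sub>R gram_schmidt K u j)"
    by (intro sum.cong) (auto simp: gs_coeff_def)
  finally show ?thesis by (simp add: gram_schmidt.simps[of K u i])
qed

text \<open>With \<open>w\<close> the \<open>j\<close>-th orthogonalised vector,
  \<open>gs_coeff u i j * sqrt (K w w)\<close> is a Cholesky factor of the Gram matrix of
  \<open>u\<close>. This identity is what turns independent normals into a sequence of covariance
  \<open>K\<close>.\<close>

lemma K_combination:
  "K (\<Sum>i<d. b i *\<^sub>R u i) (\<Sum>i<d. b i *\<^sub>R u i) =
    (\<Sum>j<d. (\<Sum>i<d. b i * (gs_coeff u i j * sqrt (K (gram_schmidt K u j) (gram_schmidt K u j))))\<^sup>2)"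
proof -
  let ?w = "gram_schmidt K u"
  define \<beta> where "\<beta> j = (\<Sum>i<d. b i * gs_coeff u i j)" for j
  have "(\<Sum>i<d. b i *\<^sub>R u i) = (\<Sum>i<d. \<Sum>j<d. (b i * gs_coeff u i j) *\<^sub>R ?w j)"
    by (intro sum.cong refl) (subst (1) gs_expand[of _ d u], auto simp: scaleR_sum_right)
  also have "\<dots> = (\<Sum>j<d. \<beta> j *\<^sub>R ?w j)"
    unfolding \<beta>_def by (subst sum.swap) (simp add: scaleR_sum_left)
  finally have eq: "(\<Sum>i<d. b i *\<^sub>R u i) = (\<Sum>j<d. \<beta> j *\<^sub>R ?w j)" .
  have "K (\<Sum>j<d. \<beta> j *\<^sub>R ?w j) (\<Sum>j<d. \<beta> j *\<^sub>R ?w j) = (\<Sum>j<d. \<Sum>l<d. \<beta> j * (\<beta> l * K (?w j) (?w l)))"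
    by (simp add: K_sum K_sum_right K_scale K_scale_right sum_distrib_left) (simp add: K_sym)
  also have "\<dots> = (\<Sum>j<d. \<Sum>l<d. if l = j then \<beta> j * (\<beta> j * K (?w j) (?w j)) else 0)"
    by (intro sum.cong refl) (auto simp: gram_schmidt_orthogonal)
  also have "\<dots> = (\<Sum>j<d. (\<beta> j * sqrt (K (?w j) (?w j)))\<^sup>2)"
    by (intro sum.cong refl) (simp add: power_mult_distrib K_pos power2_eq_square)
  also have "\<dots> = (\<Sum>j<d. (\<Sum>i<d. b i * (gs_coeff u i j * sqrt (K (?w j) (?w j))))\<^sup>2)"
    by (simp add: \<beta>_def sum_distrib_right mult.assoc)
  finally show ?thesis unfolding eq .
qed

end

section \<open>Gaussian sequences of prescribed covariance from independent normals\<close>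

definition white_noise :: "(nat \<Rightarrow> real) measure" where
  "white_noise = (\<Pi>\<^sub>M i\<in>UNIV. std_normal_distribution)"

interpretation std_normal: real_distribution std_normal_distribution
  by (rule real_dist_normal_dist)

lemma prob_space_white_noise: "prob_space white_noise"
  unfolding white_noise_def by (intro prob_space_PiM std_normal.prob_space_axioms)

interpretation white_noise: prob_space white_noise
  by (rule prob_space_white_noise)

lemma white_noise_coordinate_measurable[measurable]: "(\<lambda>\<omega>. \<omega> i) \<in> borel_measurable white_noise"
proof -
  have "(\<lambda>\<omega>. \<omega> i) \<in> measurable white_noise std_normal_distribution"
    unfolding white_noise_def by (rule measurable_component_singleton) simp
  then show ?thesis by simp
qed

lemma white_noise_coordinate: "distr white_noise borel (\<lambda>\<omega>. \<omega> i) = std_normal_distribution"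
proof -
  have "distr white_noise borel (\<lambda>\<omega>. \<omega> i) = distr white_noise std_normal_distribution (\<lambda>\<omega>. \<omega> i)"
    by (rule distr_cong) auto
  also have "\<dots> = std_normal_distribution"
    unfolding white_noise_def by (rule distr_PiM_component) (auto intro: std_normal.prob_space_axioms)
  finally show ?thesis .
qed

lemma white_noise_indep: "white_noise.indep_vars (\<lambda>_. borel) (\<lambda>i \<omega>. \<omega> i) UNIV"
proof (subst white_noise.indep_vars_iff_distr_eq_PiM')
  have s: "sets white_noise = sets (\<Pi>\<^sub>M i\<in>UNIV. borel)"
    unfolding white_noise_def by (rule sets_PiM_cong) auto
  have "distr white_noise (\<Pi>\<^sub>M i\<in>UNIV. borel) (\<lambda>x. \<lambda>i\<in>UNIV. x i) = distr white_noise white_noise (\<lambda>x. x)"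
    by (rule distr_cong) (auto simp: s)
  also have "\<dots> = white_noise" by (rule distr_id)
  also have "\<dots> = (\<Pi>\<^sub>M i\<in>UNIV. distr white_noise borel (\<lambda>\<omega>. \<omega> i))"
    unfolding white_noise_coordinate by (rule white_noise_def)
  finally show "distr white_noise (\<Pi>\<^sub>M i\<in>UNIV. borel) (\<lambda>x. \<lambda>i\<in>UNIV. x i) = (\<Pi>\<^sub>M i\<in>UNIV. distr white_noise borel (\<lambda>\<omega>. \<omega> i))" .
qed auto

lemma white_noise_sq_integrable: "integrable white_noise (\<lambda>\<omega>. (\<omega> i)\<^sup>2)"
proof -
  have "integrable (distr white_noise borel (\<lambda>\<omega>. \<omega> i)) (\<lambda>x. x\<^sup>2)"
    unfolding white_noise_coordinate by (rule integrable_std_normal_distribution_moment)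
  then show ?thesis by (subst (asm) integrable_distr_eq) auto
qed

lemma white_noise_char:
  "(\<integral>\<omega>. iexp (\<Sum>j<d. \<beta> j * \<omega> j) \<partial>white_noise) = of_real (exp (- (\<Sum>j<d. (\<beta> j)\<^sup>2) / 2))"
proof -
  have "white_noise.indep_vars (\<lambda>_. borel) (\<lambda>i. (\<lambda>x. \<beta> i * x) \<circ> (\<lambda>\<omega>. \<omega> i)) UNIV"
    by (rule white_noise.indep_vars_compose[OF white_noise_indep]) simp
  from white_noise.indep_vars_subset[OF this subset_UNIV[of "{..<d}"]]
  have ind: "white_noise.indep_vars (\<lambda>_. borel) (\<lambda>i \<omega>. \<beta> i * \<omega> i) {..<d}"
    unfolding o_def .
  have one: "char (distr white_noise borel (\<lambda>\<omega>. \<beta> i * \<omega> i)) 1 = of_real (exp (- (\<beta> i)\<^sup>2 / 2))" for i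
  proof -
    have "char (distr white_noise borel (\<lambda>\<omega>. \<beta> i * \<omega> i)) 1 = (\<integral>\<omega>. iexp (\<beta> i * \<omega> i) \<partial>white_noise)"
      unfolding char_def by (subst integral_distr) auto
    also have "\<dots> = char (distr white_noise borel (\<lambda>\<omega>. \<omega> i)) (\<beta> i)"
      unfolding char_def by (subst integral_distr) auto
    also have "\<dots> = of_real (exp (- (\<beta> i)\<^sup>2 / 2))"
      unfolding white_noise_coordinate char_std_normal_distribution by simp
    finally show ?thesis .
  qed
  have "(\<integral>\<omega>. iexp (\<Sum>j<d. \<beta> j * \<omega> j) \<partial>white_noise) = char (distr white_noise borel (\<lambda>\<omega>. \<Sum>j<d. \<beta> j * \<omega> j)) 1"
    unfolding char_def by (subst integral_distr) auto
  also have "\<dots> = (\<Prod>j<d. of_real (exp (- (\<beta> j)\<^sup>2 / 2)))"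
    unfolding white_noise.char_distr_sum[OF ind] one ..
  also have "\<dots> = of_real (exp (\<Sum>j<d. - (\<beta> j)\<^sup>2 / 2))"
    by (simp only: exp_sum finite_lessThan of_real_prod)
  also have "(\<Sum>j<d. - (\<beta> j)\<^sup>2 / 2) = - (\<Sum>j<d. (\<beta> j)\<^sup>2) / 2"
    by (simp add: sum_negf sum_divide_distrib)
  finally show ?thesis .
qed

text \<open>Row \<open>i\<close> of the Cholesky factor applied to the white noise. The row ends at
  \<open>i\<close>, so that one sequence serves for every finite number \<open>d\<close> of
  coordinates.\<close>

definition (in covariance_form) gaussian_seq :: "(nat \<Rightarrow> 'v) \<Rightarrow> nat \<Rightarrow> (nat \<Rightarrow> real) \<Rightarrow> real" where
  "gaussian_seq u i \<omega> = (\<Sum>j<Suc i. gs_coeff u i j * sqrt (K (gram_schmidt K u j) (gram_schmidt K u j)) * \<omega> j)"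

context covariance_form
begin

lemma gaussian_seq_measurable[measurable]: "gaussian_seq u i \<in> borel_measurable white_noise"
  unfolding gaussian_seq_def[abs_def] by measurable

lemma gaussian_seq_sq_integrable: "integrable white_noise (\<lambda>\<omega>. (gaussian_seq u i \<omega>)\<^sup>2)"
proof (rule Bochner_Integration.integrable_bound)
  let ?a = "\<lambda>j. gs_coeff u i j * sqrt (K (gram_schmidt K u j) (gram_schmidt K u j))"
  show "integrable white_noise (\<lambda>\<omega>. (\<Sum>j<Suc i. (?a j)\<^sup>2 * (\<omega> j)\<^sup>2) * real (Suc i))"
    by (intro integrable_mult_left Bochner_Integration.integrable_sum integrable_mult_right white_noise_sq_integrable)
  show "AE \<omega> in white_noise. norm ((gaussian_seq u i \<omega>)\<^sup>2) \<le> norm ((\<Sum>j<Suc i. (?a j)\<^sup>2 * (\<omega> j)\<^sup>2) * real (Suc i))"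
  proof (rule AE_I2)
    fix \<omega>
    have "(gaussian_seq u i \<omega>)\<^sup>2 \<le> (\<Sum>j<Suc i. (?a j * \<omega> j)\<^sup>2) * real (card {..<Suc i})"
      unfolding gaussian_seq_def by (rule sum_squared_le_sum_of_squares)
    then show "norm ((gaussian_seq u i \<omega>)\<^sup>2) \<le> norm ((\<Sum>j<Suc i. (?a j)\<^sup>2 * (\<omega> j)\<^sup>2) * real (Suc i))"
      unfolding real_norm_def card_lessThan power_mult_distrib by (simp only: abs_of_nonneg zero_le_power2)
  qed
qed measurable

text \<open>Triangularity extends every row by zeros to length \<open>d\<close>; the exponent is
  then evaluated by \<open>K_combination\<close>.\<close>

lemma gaussian_seq_char:
  "(\<integral>\<omega>. iexp (\<Sum>i<d. b i * gaussian_seq u i \<omega>) \<partial>white_noise) =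
    of_real (exp (- K (\<Sum>i<d. b i *\<^sub>R u i) (\<Sum>i<d. b i *\<^sub>R u i) / 2))"
proof -
  define L where "L i j = gs_coeff u i j * sqrt (K (gram_schmidt K u j) (gram_schmidt K u j))" for i j
  have "(\<Sum>i<d. b i * gaussian_seq u i \<omega>) = (\<Sum>j<d. (\<Sum>i<d. b i * L i j) * \<omega> j)" for \<omega>
  proof -
    have "(\<Sum>i<d. b i * gaussian_seq u i \<omega>) = (\<Sum>i<d. \<Sum>j<d. b i * L i j * \<omega> j)"
    proof (rule sum.cong[OF refl])
      fix i assume "i \<in> {..<d}"
      then have "gaussian_seq u i \<omega> = (\<Sum>j<d. L i j * \<omega> j)"
        unfolding gaussian_seq_def L_def by (intro sum.mono_neutral_left) (auto simp: gs_coeff_def)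
      then show "b i * gaussian_seq u i \<omega> = (\<Sum>j<d. b i * L i j * \<omega> j)"
        by (simp add: sum_distrib_left mult.assoc)
    qed
    also have "\<dots> = (\<Sum>j<d. (\<Sum>i<d. b i * L i j) * \<omega> j)"
      by (subst sum.swap) (simp add: sum_distrib_right)
    finally show ?thesis .
  qed
  then have "(\<integral>\<omega>. iexp (\<Sum>i<d. b i * gaussian_seq u i \<omega>) \<partial>white_noise) = (\<integral>\<omega>. iexp (\<Sum>j<d. (\<Sum>i<d. b i * L i j) * \<omega> j) \<partial>white_noise)"
    by (simp only:)
  also have "\<dots> = of_real (exp (- (\<Sum>j<d. (\<Sum>i<d. b i * L i j)\<^sup>2) / 2))" by (rule white_noise_char)
  also have "(\<Sum>j<d. (\<Sum>i<d. b i * L i j)\<^sup>2) = K (\<Sum>i<d. b i *\<^sub>R u i) (\<Sum>i<d. b i *\<^sub>R u i)"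
    unfolding L_def by (rule K_combination[symmetric])
  finally show ?thesis .
qed

end

text \<open>As a measurability rule this matches every function application.\<close>

declare white_noise_coordinate_measurable[measurable del]

section \<open>Weak convergence and covariances\<close>

text \<open>The inf-convolution of \<open>f\<close> with a multiple of the distance (Pasch-Hausdorff
  envelope): the largest \<open>k\<close>-Lipschitz minorant of a bounded \<open>f\<close>.\<close>

definition lip_envelope :: "('b::metric_space \<Rightarrow> real) \<Rightarrow> nat \<Rightarrow> 'b \<Rightarrow> real" where
  "lip_envelope f k x = (INF y. f y + real k * dist x y)"

context
  fixes f :: "'b::metric_space \<Rightarrow> real" and c :: real
  assumes c: "\<And>x. \<bar>f x\<bar> \<le> c"
begin

lemma lip_envelope_bdd: "bdd_below (range (\<lambda>y. f y + real k * dist x y))"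
proof (rule bdd_belowI[of _ "- c"])
  fix z assume "z \<in> range (\<lambda>y. f y + real k * dist x y)"
  then obtain y where "z = f y + real k * dist x y" by auto
  moreover have "real k * dist x y \<ge> 0" by simp
  ultimately show "- c \<le> z" using c[of y] by linarith
qed

lemma lip_envelope_le: "lip_envelope f k x \<le> f y + real k * dist x y"
  unfolding lip_envelope_def by (rule cINF_lower[OF lip_envelope_bdd]) simp

lemma lip_envelope_bounded: "\<bar>lip_envelope f k x\<bar> \<le> c"
proof -
  have "- c \<le> lip_envelope f k x"
    unfolding lip_envelope_def
  proof (rule cINF_greatest)
    fix y
    have "real k * dist x y \<ge> 0" by simp
    then show "- c \<le> f y + real k * dist x y" using c[of y] by linarith
  qed simp
  then show ?thesis using lip_envelope_le[of k x x] c[of x] by simp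
qed

lemma lip_envelope_lipschitz: "\<bar>lip_envelope f k x - lip_envelope f k x'\<bar> \<le> real k * dist x x'"
proof -
  have "lip_envelope f k x - real k * dist x x' \<le> lip_envelope f k x'" for x x'
    unfolding lip_envelope_def[of f k x']
  proof (rule cINF_greatest)
    fix y
    have "real k * dist x y \<le> real k * (dist x x' + dist x' y)"
      by (intro mult_left_mono dist_triangle) auto
    then show "lip_envelope f k x - real k * dist x x' \<le> f y + real k * dist x' y"
      using lip_envelope_le[of k x y] by (simp add: distrib_left)
  qed simp
  from this[of x x'] this[of x' x] show ?thesis by (simp add: dist_commute abs_le_iff)
qed

lemma lip_envelope_tendsto:
  assumes f: "continuous_on UNIV f"
  shows "(\<lambda>k. lip_envelope f k x) \<longlonglongrightarrow> f x"
proof (rule LIMSEQ_I)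
  fix \<epsilon> :: real assume "\<epsilon> > 0"
  then obtain \<delta> where \<delta>: "\<delta> > 0" "\<And>y. dist y x < \<delta> \<Longrightarrow> dist (f y) (f x) < \<epsilon> / 2"
    using f unfolding continuous_on_iff by (metis UNIV_I half_gt_zero)
  \<comment> \<open>From \<open>k0\<close> on, a point at distance at least \<open>\<delta>\<close>
    costs \<open>2 * c\<close> and cannot undercut \<open>f x\<close>; nearer points are handled by
    continuity.\<close>
  obtain k0 :: nat where k0: "2 * c / \<delta> \<le> real k0" using real_arch_simple by blast
  show "\<exists>k0. \<forall>k\<ge>k0. norm (lip_envelope f k x - f x) < \<epsilon>"
  proof (intro exI[of _ k0] allI impI)
    fix k assume k: "k \<ge> k0"
    have "f x - \<epsilon> / 2 \<le> lip_envelope f k x"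
      unfolding lip_envelope_def
    proof (rule cINF_greatest)
      fix y
      show "f x - \<epsilon> / 2 \<le> f y + real k * dist x y"
      proof (cases "dist y x < \<delta>")
        case True
        then have "\<bar>f y - f x\<bar> < \<epsilon> / 2" using \<delta>(2) by (simp add: dist_real_def)
        moreover have "real k * dist x y \<ge> 0" by simp
        ultimately show ?thesis by linarith
      next
        case False
        have "2 * c \<le> real k0 * \<delta>" using k0 \<delta>(1) by (simp add: field_simps)
        also have "\<dots> \<le> real k * dist x y" using k False \<delta>(1) by (intro mult_mono) (auto simp: dist_commute)
        finally show ?thesis using c[of x] c[of y] \<open>\<epsilon> > 0\<close> by linarith
      qed
    qed simp
    moreover have "lip_envelope f k x \<le> f x" using lip_envelope_le[of k x x] by simp
    ultimately show "norm (lip_envelope f k x - f x) < \<epsilon>" using \<open>\<epsilon> > 0\<close> by simp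
  qed
qed

end

text \<open>Bounded Lipschitz functions that converge pointwise to \<open>f\<close> from below bound
  the lower limit of the expectations; the same for \<open>- f\<close> bounds the upper
  limit.\<close>

lemma weak_conv_if_lipschitz:
  fixes Y :: "nat \<Rightarrow> 'a \<Rightarrow> 'b::{metric_space, second_countable_topology}" and G :: "'c \<Rightarrow> 'b"
  assumes M: "prob_space M" and N: "prob_space N"
    and Y: "\<And>n. Y n \<in> borel_measurable M" and G: "G \<in> borel_measurable N"
    and lip: "\<And>(h :: 'b \<Rightarrow> real) c L. (\<And>x. \<bar>h x\<bar> \<le> c) \<Longrightarrow> (\<And>x x'. \<bar>h x - h x'\<bar> \<le> L * dist x x') \<Longrightarrow> L \<ge> 0 \<Longrightarrow>
      (\<lambda>n. \<integral>\<omega>. h (Y n \<omega>) \<partial>M) \<longlonglongrightarrow> (\<integral>\<omega>. h (G \<omega>) \<partial>N)"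
    and f: "continuous_on UNIV f" and c: "\<And>x. \<bar>f x\<bar> \<le> (c :: real)"
  shows "(\<lambda>n. \<integral>\<omega>. f (Y n \<omega>) \<partial>M) \<longlonglongrightarrow> (\<integral>\<omega>. f (G \<omega>) \<partial>N)"
proof -
  interpret M: prob_space M by (rule M)
  interpret N: prob_space N by (rule N)
  have lower: "\<forall>\<^sub>F n in sequentially. (\<integral>\<omega>. f (G \<omega>) \<partial>N) - \<epsilon> < (\<integral>\<omega>. f (Y n \<omega>) \<partial>M)"
    if f: "continuous_on UNIV f" and c: "\<And>x. \<bar>f x\<bar> \<le> c" and "\<epsilon> > 0" for f :: "'b \<Rightarrow> real" and \<epsilon>
  proof -
    let ?l = "lip_envelope f"
    have l_cont: "continuous_on UNIV (?l k)" for k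
    proof (rule continuous_onI)
      fix x :: 'b and e :: real assume "e > 0"
      show "\<exists>d>0. \<forall>x'\<in>UNIV. dist x' x < d \<longrightarrow> dist (?l k x') (?l k x) \<le> e"
      proof (intro exI[of _ "e / (real k + 1)"] conjI ballI impI)
        show "e / (real k + 1) > 0" using \<open>e > 0\<close> by simp
        fix x' assume "dist x' x < e / (real k + 1)"
        then have "(real k + 1) * dist x' x < e" by (simp add: field_simps)
        moreover have "real k * dist x' x \<le> (real k + 1) * dist x' x" by (intro mult_right_mono) auto
        ultimately show "dist (?l k x') (?l k x) \<le> e"
          using lip_envelope_lipschitz[of f c k x' x, OF c] unfolding dist_real_def by linarith
      qed
    qed
    have f_m: "f \<in> borel_measurable borel" and l_m: "?l k \<in> borel_measurable borel" for k
      by (intro borel_measurable_continuous_onI f l_cont)+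
    have fi: "integrable M (\<lambda>\<omega>. f (Y n \<omega>))" for n
      by (rule M.integrable_const_bound[of _ c]) (use c measurable_compose[OF Y f_m] in auto)
    have li: "integrable M (\<lambda>\<omega>. ?l k (Y n \<omega>))" for k n
      by (rule M.integrable_const_bound[of _ c]) (use lip_envelope_bounded[of f c, OF c] measurable_compose[OF Y l_m] in auto)
    have "(\<lambda>k. \<integral>\<omega>. ?l k (G \<omega>) \<partial>N) \<longlonglongrightarrow> (\<integral>\<omega>. f (G \<omega>) \<partial>N)"
    proof (rule integral_dominated_convergence[where w="\<lambda>_. c"])
      show "AE \<omega> in N. (\<lambda>k. ?l k (G \<omega>)) \<longlonglongrightarrow> f (G \<omega>)"
        using lip_envelope_tendsto[of f c, OF c f] by (intro AE_I2)
      show "AE \<omega> in N. norm (?l k (G \<omega>)) \<le> c" for k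
        using lip_envelope_bounded[of f c, OF c] by (intro AE_I2) simp
    qed (use measurable_compose[OF G f_m] measurable_compose[OF G l_m] in auto)
    from order_tendstoD(1)[OF this, of "(\<integral>\<omega>. f (G \<omega>) \<partial>N) - \<epsilon>"] \<open>\<epsilon> > 0\<close>
    obtain k where k: "(\<integral>\<omega>. f (G \<omega>) \<partial>N) - \<epsilon> < (\<integral>\<omega>. ?l k (G \<omega>) \<partial>N)"
      unfolding eventually_sequentially by auto
    have "(\<lambda>n. \<integral>\<omega>. ?l k (Y n \<omega>) \<partial>M) \<longlonglongrightarrow> (\<integral>\<omega>. ?l k (G \<omega>) \<partial>N)"
      by (rule lip[of _ c "real k"]) (use lip_envelope_bounded[of f c, OF c] lip_envelope_lipschitz[of f c, OF c] in auto)
    from order_tendstoD(1)[OF this k] show ?thesis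
    proof eventually_elim
      case (elim n)
      also have "(\<integral>\<omega>. ?l k (Y n \<omega>) \<partial>M) \<le> (\<integral>\<omega>. f (Y n \<omega>) \<partial>M)"
      proof (rule integral_mono[OF li fi])
        show "?l k (Y n \<omega>) \<le> f (Y n \<omega>)" for \<omega>
          using lip_envelope_le[of f c k "Y n \<omega>" "Y n \<omega>", OF c] by simp
      qed
      finally show ?case .
    qed
  qed
  show ?thesis
  proof (rule LIMSEQ_I)
    fix \<epsilon> :: real assume "\<epsilon> > 0"
    have "\<forall>\<^sub>F n in sequentially. (\<integral>\<omega>. f (G \<omega>) \<partial>N) - \<epsilon> < (\<integral>\<omega>. f (Y n \<omega>) \<partial>M)"
      by (rule lower[OF f c \<open>\<epsilon> > 0\<close>])
    moreover have "\<forall>\<^sub>F n in sequentially. (\<integral>\<omega>. - f (G \<omega>) \<partial>N) - \<epsilon> < (\<integral>\<omega>. - f (Y n \<omega>) \<partial>M)"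
      by (rule lower[OF continuous_on_minus[OF f] _ \<open>\<epsilon> > 0\<close>]) (use c in simp)
    ultimately have "\<forall>\<^sub>F n in sequentially. norm ((\<integral>\<omega>. f (Y n \<omega>) \<partial>M) - (\<integral>\<omega>. f (G \<omega>) \<partial>N)) < \<epsilon>"
      by eventually_elim (simp add: abs_less_iff)
    then show "\<exists>n0. \<forall>n\<ge>n0. norm ((\<integral>\<omega>. f (Y n \<omega>) \<partial>M) - (\<integral>\<omega>. f (G \<omega>) \<partial>N)) < \<epsilon>"
      unfolding eventually_sequentially .
  qed
qed

section \<open>The limiting covariance form\<close>

context clt_process
begin

lemma functional_centered: "(\<integral>\<omega>. blinfun_apply v (X i \<omega>) \<partial>M) = 0"
  using integral_bounded_linear[OF blinfun.bounded_linear_right X_integrable, of v i] centered[of i]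
  by (simp add: blinfun.zero_right)

lemma gam_add: "gam (u + u') v j = gam u v j + gam u' v j"
  unfolding gam_def using XX_integrable[of u 0 v "int j"] XX_integrable[of u' 0 v "int j"]
  by (simp add: blinfun.add_left distrib_right)

lemma gam_add_right: "gam v (u + u') j = gam v u j + gam v u' j"
  unfolding gam_def using XX_integrable[of v 0 u "int j"] XX_integrable[of v 0 u' "int j"]
  by (simp add: blinfun.add_left distrib_left)

lemma gam_scale: "gam (r *\<^sub>R u) v j = r * gam u v j"
  unfolding gam_def by (simp add: blinfun.scaleR_left mult.assoc)

lemma gam_scale_right: "gam v (r *\<^sub>R u) j = r * gam v u j"
  unfolding gam_def by (simp add: blinfun.scaleR_left mult.left_commute)

text \<open>The two series belong to the positive and the negative lags; exchanging \<open>u\<close>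
  and \<open>v\<close> in the second makes the form symmetric.\<close>

definition cov_form :: "('b \<Rightarrow>\<^sub>L real) \<Rightarrow> ('b \<Rightarrow>\<^sub>L real) \<Rightarrow> real" where
  "cov_form u v = gam u v 0 + (\<Sum>j. gam u v (Suc j)) + (\<Sum>j. gam v u (Suc j))"

lemma kap_cov_form: "kap v = cov_form v v / 2"
  by (simp add: kap_def cov_form_def)

text \<open>Characteristic functions have modulus at most 1, hence so does their limit
  \<open>exp (- kap v)\<close>.\<close>

lemma kap_nonneg:
  fixes v :: "'b \<Rightarrow>\<^sub>L real"
  shows "kap v \<ge> 0"
proof -
  have "norm (\<integral>\<omega>. iexp (v ((1 / sqrt (real n)) *\<^sub>R S n \<omega>)) \<partial>M) \<le> 1" for n
  proof -
    have "norm (\<integral>\<omega>. iexp (v ((1 / sqrt (real n)) *\<^sub>R S n \<omega>)) \<partial>M) \<le> (\<integral>\<omega>. 1 \<partial>M)"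
      by (rule norm_integral_le) auto
    then show ?thesis by (simp add: prob_space)
  qed
  then have "norm (complex_of_real (exp (- kap v))) \<le> 1"
    by (intro LIMSEQ_le_const2[OF tendsto_norm[OF char_fun_limit[of v]]]) auto
  then show ?thesis by simp
qed

lemma covariance_form_cov_form: "covariance_form cov_form"
proof
  show "cov_form (a + b) c = cov_form a c + cov_form b c" for a b c
    unfolding cov_form_def gam_add gam_add_right
    by (simp add: suminf_add[OF summable_gam summable_gam, symmetric])
  show "cov_form (r *\<^sub>R a) b = r * cov_form a b" for r a b
    unfolding cov_form_def gam_scale gam_scale_right
    by (simp add: suminf_mult[OF summable_gam] distrib_left)
  have "gam a b 0 = gam b a 0" for a b by (simp add: gam_def mult.commute)
  then show "cov_form a b = cov_form b a" for a b by (simp add: cov_form_def)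
  show "cov_form a a \<ge> 0" for a using kap_nonneg[of a] by (simp add: kap_cov_form)
qed

text \<open>A negative lag becomes a positive one after a shift, with the roles of \<open>x\<close>
  and \<open>y\<close> exchanged; lag 0 belongs to the nonnegative side.\<close>

lemma int_sums_covariance:
  fixes x y :: "'b \<Rightarrow>\<^sub>L real"
  shows "int_sums (\<lambda>k. covariance M (\<lambda>\<omega>. x (X 0 \<omega>)) (\<lambda>\<omega>. y (X k \<omega>))) (cov_form x y)"
proof -
  have c: "covariance M (\<lambda>\<omega>. x (X 0 \<omega>)) (\<lambda>\<omega>. y (X k \<omega>)) = (\<integral>\<omega>. x (X 0 \<omega>) * y (X k \<omega>) \<partial>M)" for k
    by (simp add: covariance_def functional_centered)
  have neg: "(\<integral>\<omega>. x (X 0 \<omega>) * y (X (- int (Suc n)) \<omega>) \<partial>M) = gam y x (Suc n)" for n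
  proof -
    let ?h = "\<lambda>\<omega>. x (X 0 \<omega>) * y (X (- int (Suc n)) \<omega>)"
    have "(\<integral>\<omega>. ?h \<omega> \<partial>M) = (\<integral>\<omega>. ?h ((T ^^ Suc n) \<omega>) \<partial>M)"
      by (rule integral_shift[symmetric]) measurable
    also have "\<dots> = gam y x (Suc n)"
      unfolding gam_def
    proof (rule Bochner_Integration.integral_cong[OF refl])
      fix \<omega> assume \<omega>: "\<omega> \<in> space M"
      have "X 0 ((T ^^ Suc n) \<omega>) = X (int (Suc n)) \<omega>" "X (- int (Suc n)) ((T ^^ Suc n) \<omega>) = X 0 \<omega>"
        unfolding X_T_funpow[OF \<omega>] by simp_all
      then show "?h ((T ^^ Suc n) \<omega>) = y (X 0 \<omega>) * x (X (int (Suc n)) \<omega>)" by (simp only: mult.commute)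
    qed
    finally show ?thesis .
  qed
  show ?thesis
    unfolding int_sums_def
  proof (intro exI conjI)
    show "(\<lambda>n. covariance M (\<lambda>\<omega>. x (X 0 \<omega>)) (\<lambda>\<omega>. y (X (int n) \<omega>))) sums ((\<Sum>j. gam x y (Suc j)) + gam x y 0)"
      unfolding c gam_def[symmetric] by (rule sums_Suc[OF summable_sums[OF summable_gam]])
    show "(\<lambda>n. covariance M (\<lambda>\<omega>. x (X 0 \<omega>)) (\<lambda>\<omega>. y (X (- int (Suc n)) \<omega>))) sums (\<Sum>j. gam y x (Suc j))"
      unfolding c neg by (rule summable_sums[OF summable_gam])
    show "cov_form x y = (\<Sum>j. gam x y (Suc j)) + gam x y 0 + (\<Sum>j. gam y x (Suc j))"
      by (simp add: cov_form_def)
  qed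
qed

end

section \<open>The central limit theorem\<close>

text \<open>Young's inequality \<open>a \<le> \<eta> / 2 + a^2 / (2 * \<eta>)\<close>, an equality
  at \<open>a = \<eta>\<close>, is integrated.\<close>

lemma (in prob_space) integral_norm_le_if_sq_le:
  fixes h :: "'a \<Rightarrow> 'b::{banach, second_countable_topology}"
  assumes [measurable]: "h \<in> borel_measurable M" and sq: "integrable M (\<lambda>\<omega>. (norm (h \<omega>))\<^sup>2)"
    and le: "(\<integral>\<omega>. (norm (h \<omega>))\<^sup>2 \<partial>M) \<le> \<eta>\<^sup>2" and "\<eta> > 0"
  shows "(\<integral>\<omega>. norm (h \<omega>) \<partial>M) \<le> \<eta>"
proof -
  have i: "integrable M h" by (rule integrable_if_norm_sq_integrable[OF _ sq]) simp
  have "(\<integral>\<omega>. norm (h \<omega>) \<partial>M) \<le> (\<integral>\<omega>. \<eta> / 2 + (norm (h \<omega>))\<^sup>2 / (2 * \<eta>) \<partial>M)"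
  proof (rule integral_mono)
    show "integrable M (\<lambda>\<omega>. \<eta> / 2 + (norm (h \<omega>))\<^sup>2 / (2 * \<eta>))" using sq by auto
    have "a \<le> \<eta> / 2 + a\<^sup>2 / (2 * \<eta>)" for a :: real
    proof -
      have "0 \<le> (a - \<eta>)\<^sup>2 / (2 * \<eta>)" using \<open>\<eta> > 0\<close> by simp
      also have "\<dots> = \<eta> / 2 + a\<^sup>2 / (2 * \<eta>) - a"
        using \<open>\<eta> > 0\<close> by (simp add: power2_diff field_simps power2_eq_square)
      finally show ?thesis by simp
    qed
    then show "norm (h \<omega>) \<le> \<eta> / 2 + (norm (h \<omega>))\<^sup>2 / (2 * \<eta>)" for \<omega> .
  qed (use i in auto)
  also have "\<dots> = \<eta> / 2 + (\<integral>\<omega>. (norm (h \<omega>))\<^sup>2 \<partial>M) / (2 * \<eta>)" using sq by (simp add: prob_space)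
  also have "\<dots> \<le> \<eta> / 2 + \<eta>\<^sup>2 / (2 * \<eta>)" using le \<open>\<eta> > 0\<close> by (intro add_left_mono divide_right_mono) auto
  also have "\<dots> = \<eta>" using \<open>\<eta> > 0\<close> by (simp add: power2_eq_square)
  finally show ?thesis .
qed

context clt_process
begin

definition Y :: "nat \<Rightarrow> 'a \<Rightarrow> 'b" where
  "Y n \<omega> = (1 / sqrt (real (Suc n))) *\<^sub>R S (Suc n) \<omega>"

lemma Y_measurable[measurable]: "Y n \<in> borel_measurable M"
  unfolding Y_def[abs_def] by measurable

lemma norm_bounded_linear_Y_sq:
  assumes "bounded_linear Q"
  shows "(norm (Q (Y n \<omega>)))\<^sup>2 = (norm (Q (S (Suc n) \<omega>)))\<^sup>2 / real (Suc n)"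
  unfolding Y_def linear_simps(5)[OF assms] by (simp add: power_mult_distrib power_divide del: of_nat_Suc)

lemma Y_sq_integrable: "integrable M (\<lambda>\<omega>. (norm (Y n \<omega>))\<^sup>2)"
  unfolding norm_bounded_linear_Y_sq[OF bounded_linear_ident] using S_sq_integrable by simp

lemma Y_char: "(\<lambda>n. \<integral>\<omega>. iexp (blinfun_apply v (Y n \<omega>)) \<partial>M) \<longlonglongrightarrow> of_real (exp (- cov_form v v / 2))"
  using LIMSEQ_Suc[OF char_fun_limit[of v]] unfolding Y_def kap_cov_form by simp

text \<open>Weak convergence is obtained for every projection \<open>P N\<close>, while the
  remainders \<open>Q N\<close> of \<open>Y n\<close> are uniformly small in L1. The corresponding
  smallness on the Gaussian side is inherited through the weak limits, in place of an estimate of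
  Gaussian norms in the Banach space.\<close>

theorem weak_limit_exists:
  assumes smooth: "two_smooth TYPE('b)" and basis: "schauder_basis (e :: nat \<Rightarrow> 'b)"
  shows "\<exists>G \<in> borel_measurable white_noise. \<forall>(f :: 'b \<Rightarrow> real) c. continuous_on UNIV f \<longrightarrow> (\<forall>x. \<bar>f x\<bar> \<le> c) \<longrightarrow>
    (\<lambda>n. \<integral>\<omega>. f (Y n \<omega>) \<partial>M) \<longlonglongrightarrow> (\<integral>\<omega>. f (G \<omega>) \<partial>white_noise)"
proof -
  interpret covariance_form cov_form by (rule covariance_form_cov_form)
  obtain u :: "nat \<Rightarrow> 'b \<Rightarrow>\<^sub>L real" and C where C: "C > 0"
    and u_sums: "\<And>x. (\<lambda>n. u n x *\<^sub>R e n) sums x"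
    and u_bd: "\<And>N x. norm (\<Sum>i<N. u i x *\<^sub>R e i) \<le> C * norm x"
    using schauder_basis_coefficients_bounded[OF basis] by metis
  define P where "P N x = (\<Sum>i<N. u i x *\<^sub>R e i)" for N x
  define Q where "Q N x = x - P N x" for N x
  have P_bl: "bounded_linear (P N)" for N
    unfolding P_def by (intro bounded_linear_sum bounded_linear_scaleR_left[THEN bounded_linear_compose] blinfun.bounded_linear_right)
  have Q_bl: "bounded_linear (Q N)" for N
    unfolding Q_def by (intro bounded_linear_sub bounded_linear_ident P_bl)
  have [measurable]: "Q N \<in> borel_measurable borel" "P N \<in> borel_measurable borel" for N
    by (intro borel_measurable_continuous_onI linear_continuous_on Q_bl P_bl)+
  have Q_bd: "norm (Q N x) \<le> (1 + C) * norm x" for N x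
  proof -
    have "norm (P N x) \<le> C * norm x" unfolding P_def by (rule u_bd)
    then show ?thesis using norm_triangle_ineq4[of x "P N x"] by (simp add: Q_def distrib_right)
  qed
  have Q_lim: "(\<lambda>N. Q N x) \<longlonglongrightarrow> 0" for x
  proof -
    have "(\<lambda>N. x - P N x) \<longlonglongrightarrow> x - x" using u_sums[of x] unfolding P_def sums_def by (intro tendsto_diff tendsto_const)
    then show ?thesis by (simp add: Q_def)
  qed
  have Q_sq: "integrable M (\<lambda>\<omega>. (norm (Q N (Y n \<omega>)))\<^sup>2)" for N n
  proof (rule Bochner_Integration.integrable_bound)
    show "integrable M (\<lambda>\<omega>. (1 + C)\<^sup>2 * (norm (Y n \<omega>))\<^sup>2)" using Y_sq_integrable by simp
    have "(norm (Q N x))\<^sup>2 \<le> (1 + C)\<^sup>2 * (norm x)\<^sup>2" for x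
      using power_mono[OF Q_bd[of N x], of 2] by (simp add: power_mult_distrib)
    then show "AE \<omega> in M. norm ((norm (Q N (Y n \<omega>)))\<^sup>2) \<le> norm ((1 + C)\<^sup>2 * (norm (Y n \<omega>))\<^sup>2)" by simp
  qed measurable
  have QY_int: "integrable M (\<lambda>\<omega>. Q N (Y n \<omega>))" for N n
    by (rule integrable_if_norm_sq_integrable[OF _ Q_sq]) measurable
  have small: "\<exists>N0. \<forall>N\<ge>N0. \<forall>n. (\<integral>\<omega>. norm (Q N (Y n \<omega>)) \<partial>M) \<le> \<eta>" if "\<eta> > 0" for \<eta>
  proof -
    have "1 + C \<ge> 0" "\<eta>\<^sup>2 > 0" using C that by auto
    from norm_Q_S_sq_small[OF smooth Q_bl this(1) Q_bd Q_lim this(2)]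
    obtain N0 where N0: "\<And>N n. N \<ge> N0 \<Longrightarrow> (\<integral>\<omega>. (norm (Q N (S n \<omega>)))\<^sup>2 \<partial>M) \<le> real n * \<eta>\<^sup>2" by metis
    have "(\<integral>\<omega>. norm (Q N (Y n \<omega>)) \<partial>M) \<le> \<eta>" if N: "N \<ge> N0" for N n
    proof (rule integral_norm_le_if_sq_le[OF _ Q_sq _ \<open>\<eta> > 0\<close>])
      have "(\<integral>\<omega>. (norm (Q N (Y n \<omega>)))\<^sup>2 \<partial>M) = (\<integral>\<omega>. (norm (Q N (S (Suc n) \<omega>)))\<^sup>2 \<partial>M) / real (Suc n)"
        unfolding norm_bounded_linear_Y_sq[OF Q_bl] by simp
      also have "\<dots> \<le> (real (Suc n) * \<eta>\<^sup>2) / real (Suc n)" by (intro divide_right_mono N0[OF N]) auto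
      finally show "(\<integral>\<omega>. (norm (Q N (Y n \<omega>)))\<^sup>2 \<partial>M) \<le> \<eta>\<^sup>2" by simp
    qed measurable
    then show ?thesis by blast
  qed
  obtain B where B: "B \<ge> 0" "\<And>n. (\<integral>\<omega>. (norm (S n \<omega>))\<^sup>2 \<partial>M) \<le> real n * B"
    using norm_S_sq_linear_growth[OF smooth] by metis
  have Y_B: "(\<integral>\<omega>. (norm (Y n \<omega>))\<^sup>2 \<partial>M) \<le> B" for n
  proof -
    have "(\<integral>\<omega>. (norm (Y n \<omega>))\<^sup>2 \<partial>M) = (\<integral>\<omega>. (norm (S (Suc n) \<omega>))\<^sup>2 \<partial>M) / real (Suc n)"
      unfolding norm_bounded_linear_Y_sq[OF bounded_linear_ident] by simp
    also have "\<dots> \<le> (real (Suc n) * B) / real (Suc n)" by (intro divide_right_mono B(2)) auto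
    finally show ?thesis by simp
  qed
  define \<gamma> where "\<gamma> = gaussian_seq u"
  have \<gamma>_meas[measurable]: "\<gamma> i \<in> borel_measurable white_noise" for i unfolding \<gamma>_def by measurable
  have \<gamma>_sq: "integrable white_noise (\<lambda>\<omega>. (\<gamma> i \<omega>)\<^sup>2)" for i unfolding \<gamma>_def by (rule gaussian_seq_sq_integrable)
  have \<gamma>_int: "integrable white_noise (\<gamma> i)" for i
    by (rule white_noise.integrable_if_norm_sq_integrable) (use \<gamma>_sq in auto)
  \<comment> \<open>The characteristic functions of the coordinates of \<open>Y n\<close> converge
    because a linear combination of the \<open>u i\<close> is again a functional. The vectors
    \<open>e'\<close> are left free so that differences of two projections are covered.\<close>
  have fd: "(\<lambda>n. \<integral>\<omega>. f (\<Sum>i<d. u i (Y n \<omega>) *\<^sub>R e' i) \<partial>M) \<longlonglongrightarrow> (\<integral>\<omega>. f (\<Sum>i<d. \<gamma> i \<omega> *\<^sub>R e' i) \<partial>white_noise)"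
    if f: "continuous_on UNIV f" "\<And>x. \<bar>f x\<bar> \<le> c" for f :: "'b \<Rightarrow> real" and c d and e' :: "nat \<Rightarrow> 'b"
  proof (rule finite_dim_weak_conv[OF prob_space_axioms prob_space_white_noise, where y="\<lambda>n \<omega> i. u i (Y n \<omega>)" and z="\<lambda>\<omega> i. \<gamma> i \<omega>" and C="\<Sum>i<d. (norm (u i))\<^sup>2 * B", OF _ _ _ _ _ _ f])
    fix b :: "nat \<Rightarrow> real"
    define v where "v = (\<Sum>i<d. b i *\<^sub>R u i)"
    have "v x = (\<Sum>i<d. b i * u i x)" for x by (simp add: v_def blinfun.sum_left blinfun.scaleR_left)
    then show "(\<lambda>n. \<integral>\<omega>. iexp (\<Sum>i<d. b i * u i (Y n \<omega>)) \<partial>M) \<longlonglongrightarrow> (\<integral>\<omega>. iexp (\<Sum>i<d. b i * \<gamma> i \<omega>) \<partial>white_noise)"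
      using Y_char[of v] unfolding \<gamma>_def gaussian_seq_char v_def[symmetric] by simp
  next
    fix n i assume i: "i < d"
    show "integrable M (\<lambda>\<omega>. (u i (Y n \<omega>))\<^sup>2)" by (rule functional_sq_integrable[OF _ Y_sq_integrable]) measurable
    then have "(\<integral>\<omega>. (u i (Y n \<omega>))\<^sup>2 \<partial>M) \<le> (\<integral>\<omega>. (norm (u i))\<^sup>2 * (norm (Y n \<omega>))\<^sup>2 \<partial>M)"
    proof (rule integral_mono)
      show "(u i (Y n \<omega>))\<^sup>2 \<le> (norm (u i))\<^sup>2 * (norm (Y n \<omega>))\<^sup>2" for \<omega>
        using power_mono[OF norm_blinfun[of "u i" "Y n \<omega>"], of 2] by (simp add: power_mult_distrib)
    qed (use Y_sq_integrable in simp)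
    also have "\<dots> \<le> (norm (u i))\<^sup>2 * B" using Y_B[of n] by (simp add: mult_left_mono)
    also have "\<dots> \<le> (\<Sum>i<d. (norm (u i))\<^sup>2 * B)" using i B(1) by (intro member_le_sum) auto
    finally show "(\<integral>\<omega>. (u i (Y n \<omega>))\<^sup>2 \<partial>M) \<le> (\<Sum>i<d. (norm (u i))\<^sup>2 * B)" .
  qed (use \<gamma>_sq in auto)
  define \<Gamma> where "\<Gamma> N \<omega> = (\<Sum>i<N. \<gamma> i \<omega> *\<^sub>R e i)" for N \<omega>
  have \<Gamma>_meas[measurable]: "\<Gamma> N \<in> borel_measurable white_noise" for N unfolding \<Gamma>_def[abs_def] by measurable
  have \<Gamma>_int: "integrable white_noise (\<Gamma> N)" for N
    unfolding \<Gamma>_def[abs_def] using \<gamma>_int by (intro Bochner_Integration.integrable_sum integrable_scaleR_left) auto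
  have \<Gamma>_diff: "(\<integral>\<omega>. norm (\<Gamma> p \<omega> - \<Gamma> q \<omega>) \<partial>white_noise) \<le> 2 * \<eta>"
    if pq: "\<And>n. (\<integral>\<omega>. norm (Q p (Y n \<omega>)) \<partial>M) \<le> \<eta>" "\<And>n. (\<integral>\<omega>. norm (Q q (Y n \<omega>)) \<partial>M) \<le> \<eta>" for p q \<eta>
  proof -
    define d where "d = max p q"
    define e' where "e' i = (if i < p then e i else 0) - (if i < q then e i else 0)" for i
    have comb: "(\<Sum>i<d. a i *\<^sub>R e' i) = (\<Sum>i<p. a i *\<^sub>R e i) - (\<Sum>i<q. a i *\<^sub>R e i)" for a :: "nat \<Rightarrow> real"
    proof -
      have "(\<Sum>i<d. a i *\<^sub>R (if i < r then e i else 0)) = (\<Sum>i<r. a i *\<^sub>R e i)" if "r \<le> d" for r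
      proof -
        have "(\<Sum>i<r. a i *\<^sub>R e i) = (\<Sum>i<r. a i *\<^sub>R (if i < r then e i else 0))" by (intro sum.cong) auto
        also have "\<dots> = (\<Sum>i<d. a i *\<^sub>R (if i < r then e i else 0))" using that by (intro sum.mono_neutral_left) auto
        finally show ?thesis ..
      qed
      from this[of p] this[of q] show ?thesis
        unfolding e'_def scaleR_diff_right sum_subtractf by (simp add: d_def)
    qed
    \<comment> \<open>Weak convergence speaks about bounded functions, hence the norm cut at
      \<open>k\<close>; the bound does not depend on \<open>k\<close>, which is then sent to
      infinity.\<close>
    have trunc: "(\<integral>\<omega>. min (norm (\<Gamma> p \<omega> - \<Gamma> q \<omega>)) (real k) \<partial>white_noise) \<le> 2 * \<eta>" for k :: nat
    proof -
      let ?f = "\<lambda>x :: 'b. min (norm x) (real k)"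
      have fc: "continuous_on UNIV ?f" by (intro continuous_intros)
      have fb: "\<bar>?f x\<bar> \<le> real k" for x by simp
      have lim: "(\<lambda>n. \<integral>\<omega>. ?f (\<Sum>i<d. u i (Y n \<omega>) *\<^sub>R e' i) \<partial>M) \<longlonglongrightarrow> (\<integral>\<omega>. ?f (\<Sum>i<d. \<gamma> i \<omega> *\<^sub>R e' i) \<partial>white_noise)"
        by (rule fd[OF fc fb])
      have "(\<integral>\<omega>. ?f (\<Sum>i<d. u i (Y n \<omega>) *\<^sub>R e' i) \<partial>M) \<le> 2 * \<eta>" for n
      proof -
        have eq: "(\<Sum>i<d. u i (Y n \<omega>) *\<^sub>R e' i) = Q q (Y n \<omega>) - Q p (Y n \<omega>)" for \<omega>
          unfolding comb by (simp add: Q_def P_def)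
        have "(\<integral>\<omega>. ?f (\<Sum>i<d. u i (Y n \<omega>) *\<^sub>R e' i) \<partial>M) \<le> (\<integral>\<omega>. norm (Q q (Y n \<omega>)) + norm (Q p (Y n \<omega>)) \<partial>M)"
        proof (rule integral_mono)
          show "integrable M (\<lambda>\<omega>. ?f (\<Sum>i<d. u i (Y n \<omega>) *\<^sub>R e' i))"
            by (rule integrable_const_bound[of _ "real k"]) (auto simp: fb)
          show "?f (\<Sum>i<d. u i (Y n \<omega>) *\<^sub>R e' i) \<le> norm (Q q (Y n \<omega>)) + norm (Q p (Y n \<omega>))" for \<omega>
            unfolding eq using norm_triangle_ineq4[of "Q q (Y n \<omega>)" "Q p (Y n \<omega>)"] by simp
        qed (use QY_int in auto)
        also have "\<dots> \<le> 2 * \<eta>" using pq[of n] QY_int by simp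
        finally show ?thesis .
      qed
      then have "(\<integral>\<omega>. ?f (\<Sum>i<d. \<gamma> i \<omega> *\<^sub>R e' i) \<partial>white_noise) \<le> 2 * \<eta>"
        by (intro LIMSEQ_le_const2[OF lim]) auto
      then show ?thesis unfolding comb \<Gamma>_def .
    qed
    have "(\<lambda>k. \<integral>\<omega>. min (norm (\<Gamma> p \<omega> - \<Gamma> q \<omega>)) (real k) \<partial>white_noise) \<longlonglongrightarrow> (\<integral>\<omega>. norm (\<Gamma> p \<omega> - \<Gamma> q \<omega>) \<partial>white_noise)"
    proof (rule integral_dominated_convergence[where w="\<lambda>\<omega>. norm (\<Gamma> p \<omega> - \<Gamma> q \<omega>)"])
      show "integrable white_noise (\<lambda>\<omega>. norm (\<Gamma> p \<omega> - \<Gamma> q \<omega>))" using \<Gamma>_int by auto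
      show "AE \<omega> in white_noise. (\<lambda>k. min (norm (\<Gamma> p \<omega> - \<Gamma> q \<omega>)) (real k)) \<longlonglongrightarrow> norm (\<Gamma> p \<omega> - \<Gamma> q \<omega>)"
      proof (rule AE_I2)
        fix \<omega>
        obtain K :: nat where K: "norm (\<Gamma> p \<omega> - \<Gamma> q \<omega>) \<le> real K" using real_arch_simple by blast
        have "\<forall>k\<ge>K. min (norm (\<Gamma> p \<omega> - \<Gamma> q \<omega>)) (real k) = norm (\<Gamma> p \<omega> - \<Gamma> q \<omega>)" using K by (auto simp: min_def)
        then show "(\<lambda>k. min (norm (\<Gamma> p \<omega> - \<Gamma> q \<omega>)) (real k)) \<longlonglongrightarrow> norm (\<Gamma> p \<omega> - \<Gamma> q \<omega>)"
          by (intro tendsto_eventually) (unfold eventually_sequentially, blast)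
      qed
    qed auto
    then show ?thesis by (rule LIMSEQ_le_const2) (use trunc in auto)
  qed
  have \<Gamma>_Cauchy: "\<exists>N. \<forall>p\<ge>N. \<forall>q\<ge>N. (\<integral>\<omega>. norm (\<Gamma> p \<omega> - \<Gamma> q \<omega>) \<partial>white_noise) < \<epsilon>" if "\<epsilon> > 0" for \<epsilon>
  proof -
    have "\<epsilon> / 3 > 0" using that by simp
    from small[OF this] obtain N0 where "\<And>N n. N \<ge> N0 \<Longrightarrow> (\<integral>\<omega>. norm (Q N (Y n \<omega>)) \<partial>M) \<le> \<epsilon> / 3" by blast
    then have "(\<integral>\<omega>. norm (\<Gamma> p \<omega> - \<Gamma> q \<omega>) \<partial>white_noise) \<le> 2 * (\<epsilon> / 3)" if "p \<ge> N0" "q \<ge> N0" for p q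
      using that by (intro \<Gamma>_diff) auto
    then have "\<forall>p\<ge>N0. \<forall>q\<ge>N0. (\<integral>\<omega>. norm (\<Gamma> p \<omega> - \<Gamma> q \<omega>) \<partial>white_noise) < \<epsilon>"
      using \<open>\<epsilon> > 0\<close> by fastforce
    then show ?thesis ..
  qed
  \<comment> \<open>The Cauchy property in L1 yields almost sure convergence along a subsequence,
    which is enough to define \<open>G\<close> and to approximate its law.\<close>
  obtain r where r: "strict_mono r" and AE_Cauchy: "AE \<omega> in white_noise. Cauchy (\<lambda>k. \<Gamma> (r k) \<omega>)"
    by (rule cauchy_L1_AE_cauchy_subseq[OF \<Gamma>_int \<Gamma>_Cauchy])
  define G where "G \<omega> = lim (\<lambda>k. \<Gamma> (r k) \<omega>)" for \<omega>
  have G_meas[measurable]: "G \<in> borel_measurable white_noise"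
    unfolding G_def[abs_def] by (rule borel_measurable_lim_metric) measurable
  have AE_lim: "AE \<omega> in white_noise. (\<lambda>k. \<Gamma> (r k) \<omega>) \<longlonglongrightarrow> G \<omega>"
    using AE_Cauchy by eventually_elim (simp add: G_def Cauchy_convergent_iff convergent_LIMSEQ_iff)
  have lip: "(\<lambda>n. \<integral>\<omega>. h (Y n \<omega>) \<partial>M) \<longlonglongrightarrow> (\<integral>\<omega>. h (G \<omega>) \<partial>white_noise)"
    if hb: "\<And>x. \<bar>h x\<bar> \<le> c" and hl: "\<And>x x'. \<bar>h x - h x'\<bar> \<le> L * dist x x'" and L: "L \<ge> 0" for h :: "'b \<Rightarrow> real" and c L
  proof (rule LIMSEQ_I)
    fix \<epsilon> :: real assume "\<epsilon> > 0"
    have hc: "continuous_on UNIV h"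
    proof (rule continuous_onI)
      fix x :: 'b and \<delta> :: real assume "\<delta> > 0"
      show "\<exists>d>0. \<forall>x'\<in>UNIV. dist x' x < d \<longrightarrow> dist (h x') (h x) \<le> \<delta>"
      proof (intro exI[of _ "\<delta> / (L + 1)"] conjI ballI impI)
        show "\<delta> / (L + 1) > 0" using \<open>\<delta> > 0\<close> L by simp
        fix x' assume "dist x' x < \<delta> / (L + 1)"
        then have "(L + 1) * dist x' x < \<delta>" using L by (simp add: field_simps)
        moreover have "L * dist x' x \<le> (L + 1) * dist x' x" by (intro mult_right_mono) auto
        ultimately show "dist (h x') (h x) \<le> \<delta>" using hl[of x' x] unfolding dist_real_def by linarith
      qed
    qed
    have hm[measurable]: "h \<in> borel_measurable borel" by (rule borel_measurable_continuous_onI[OF hc])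
    have "(\<lambda>k. \<integral>\<omega>. h (\<Gamma> (r k) \<omega>) \<partial>white_noise) \<longlonglongrightarrow> (\<integral>\<omega>. h (G \<omega>) \<partial>white_noise)"
    proof (rule integral_dominated_convergence[where w="\<lambda>_. c"])
      show "AE \<omega> in white_noise. (\<lambda>k. h (\<Gamma> (r k) \<omega>)) \<longlonglongrightarrow> h (G \<omega>)"
        using AE_lim by eventually_elim (rule continuous_on_tendsto_compose[OF hc], auto)
    qed (use hb in auto)
    from tendstoD[OF this, of "\<epsilon> / 3"] \<open>\<epsilon> > 0\<close>
    have ev1: "\<forall>\<^sub>F k in sequentially. dist (\<integral>\<omega>. h (\<Gamma> (r k) \<omega>) \<partial>white_noise) (\<integral>\<omega>. h (G \<omega>) \<partial>white_noise) < \<epsilon> / 3" by simp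
    \<comment> \<open>Of three errors \<open>\<epsilon> / 3\<close>, this covers the passage from
      \<open>Y n\<close> to its projection, at most \<open>L * \<eta>\<close>; the others are the
      weak limit of the projection and the passage from \<open>\<Gamma> N\<close> to
      \<open>G\<close>. The denominator contains \<open>L + 1\<close> so that \<open>L = 0\<close>
      is included.\<close>
    define \<eta> where "\<eta> = \<epsilon> / (3 * (L + 1))"
    have \<eta>: "\<eta> > 0" using \<open>\<epsilon> > 0\<close> L by (simp add: \<eta>_def)
    obtain N0 where N0: "\<And>N n. N \<ge> N0 \<Longrightarrow> (\<integral>\<omega>. norm (Q N (Y n \<omega>)) \<partial>M) \<le> \<eta>" using small[OF \<eta>] by blast
    have ev2: "\<forall>\<^sub>F k in sequentially. r k \<ge> N0" using filterlim_subseq[OF r] by (simp add: filterlim_at_top)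
    obtain k where k: "dist (\<integral>\<omega>. h (\<Gamma> (r k) \<omega>) \<partial>white_noise) (\<integral>\<omega>. h (G \<omega>) \<partial>white_noise) < \<epsilon> / 3" "r k \<ge> N0"
      using eventually_conj[OF ev1 ev2] unfolding eventually_sequentially by blast
    define N where "N = r k"
    have "(\<lambda>n. \<integral>\<omega>. h (P N (Y n \<omega>)) \<partial>M) \<longlonglongrightarrow> (\<integral>\<omega>. h (\<Gamma> N \<omega>) \<partial>white_noise)"
      unfolding P_def \<Gamma>_def by (rule fd[OF hc hb])
    from tendstoD[OF this, of "\<epsilon> / 3"] \<open>\<epsilon> > 0\<close>
    obtain n0 where n0: "\<And>n. n \<ge> n0 \<Longrightarrow> dist (\<integral>\<omega>. h (P N (Y n \<omega>)) \<partial>M) (\<integral>\<omega>. h (\<Gamma> N \<omega>) \<partial>white_noise) < \<epsilon> / 3"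
      unfolding eventually_sequentially by auto
    have near: "\<bar>(\<integral>\<omega>. h (Y n \<omega>) \<partial>M) - (\<integral>\<omega>. h (P N (Y n \<omega>)) \<partial>M)\<bar> \<le> \<epsilon> / 3" for n
    proof -
      have i: "integrable M (\<lambda>\<omega>. h (Y n \<omega>))" "integrable M (\<lambda>\<omega>. h (P N (Y n \<omega>)))"
        by (auto intro!: integrable_const_bound[of _ c] simp: hb)
      have "(\<integral>\<omega>. h (Y n \<omega>) \<partial>M) - (\<integral>\<omega>. h (P N (Y n \<omega>)) \<partial>M) = (\<integral>\<omega>. h (Y n \<omega>) - h (P N (Y n \<omega>)) \<partial>M)" using i by simp
      also have "\<bar>\<dots>\<bar> \<le> (\<integral>\<omega>. L * norm (Q N (Y n \<omega>)) \<partial>M)"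
        unfolding real_norm_def[symmetric]
      proof (rule norm_integral_le)
        show "norm (h (Y n \<omega>) - h (P N (Y n \<omega>))) \<le> L * norm (Q N (Y n \<omega>))" for \<omega>
          using hl[of "Y n \<omega>" "P N (Y n \<omega>)"] by (simp add: Q_def dist_norm)
      qed (use QY_int in auto)
      also have "\<dots> \<le> L * \<eta>" using N0[of N n] k(2) L by (simp add: N_def mult_left_mono)
      also have "\<dots> \<le> (L + 1) * \<eta>" using \<eta> by (intro mult_right_mono) auto
      also have "\<dots> = \<epsilon> / 3"
      proof -
        have "a * (\<epsilon> / (3 * a)) = \<epsilon> / 3" if "a > 0" for a using that by simp
        from this[of "L + 1"] show ?thesis using L by (simp add: \<eta>_def)
      qed
      finally show ?thesis .
    qed
    show "\<exists>n0. \<forall>n\<ge>n0. norm ((\<integral>\<omega>. h (Y n \<omega>) \<partial>M) - (\<integral>\<omega>. h (G \<omega>) \<partial>white_noise)) < \<epsilon>"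
    proof (intro exI[of _ n0] allI impI)
      fix n assume "n \<ge> n0"
      then show "norm ((\<integral>\<omega>. h (Y n \<omega>) \<partial>M) - (\<integral>\<omega>. h (G \<omega>) \<partial>white_noise)) < \<epsilon>"
        using n0[of n] near[of n] k(1) unfolding N_def dist_real_def real_norm_def by linarith
    qed
  qed
  show ?thesis
  proof (intro bexI[of _ G] allI impI)
    fix f :: "'b \<Rightarrow> real" and c assume f: "continuous_on UNIV f" "\<forall>x. \<bar>f x\<bar> \<le> c"
    show "(\<lambda>n. \<integral>\<omega>. f (Y n \<omega>) \<partial>M) \<longlonglongrightarrow> (\<integral>\<omega>. f (G \<omega>) \<partial>white_noise)"
    proof (rule weak_conv_if_lipschitz[OF prob_space_axioms prob_space_white_noise Y_measurable G_meas])
      fix h :: "'b \<Rightarrow> real" and c' L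
      assume "\<And>x. \<bar>h x\<bar> \<le> c'" "\<And>x x'. \<bar>h x - h x'\<bar> \<le> L * dist x x'" "L \<ge> 0"
      then show "(\<lambda>n. \<integral>\<omega>. h (Y n \<omega>) \<partial>M) \<longlonglongrightarrow> (\<integral>\<omega>. h (G \<omega>) \<partial>white_noise)" by (rule lip)
    qed (use f in auto)
  qed (rule G_meas)
qed

end

section \<open>One-dimensional Gaussian laws, point masses included\<close>

lemma std_normal_scaled_char:
  "char (distr std_normal_distribution borel (\<lambda>x. \<sigma> * x)) t = of_real (exp (- (\<sigma> * t)\<^sup>2 / 2))"
proof -
  have "char (distr std_normal_distribution borel (\<lambda>x. \<sigma> * x)) t = char std_normal_distribution (\<sigma> * t)"
    unfolding char_def by (subst integral_distr) (auto simp: mult_ac)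
  then show ?thesis by (simp add: char_std_normal_distribution)
qed

lemma std_normal_moments:
  "integrable std_normal_distribution (\<lambda>x. x\<^sup>2)" "(\<integral>x. x\<^sup>2 \<partial>std_normal_distribution) = 1"
  "(\<integral>x. x \<partial>std_normal_distribution) = 0"
proof -
  show "integrable std_normal_distribution (\<lambda>x. x\<^sup>2)" by (rule integrable_std_normal_distribution_moment)
  show "(\<integral>x. x\<^sup>2 \<partial>std_normal_distribution) = 1"
    using std_normal_distribution_even_moments(1)[of 1] by (simp add: fact_2)
  show "(\<integral>x. x \<partial>std_normal_distribution) = 0"
    using integral_std_normal_distribution_moment_odd[of 1] by simp
qed

text \<open>Writing the law as that of \<open>sqrt s\<close> times a standard normal treats the
  point mass at \<open>s = 0\<close> together with the nondegenerate laws.\<close>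

lemma (in prob_space) gaussian_law_if_char:
  assumes h[measurable]: "h \<in> borel_measurable M" and "s \<ge> 0"
    and char: "\<And>t. (\<integral>\<omega>. iexp (t * h \<omega>) \<partial>M) = of_real (exp (- t\<^sup>2 * s / 2))"
  shows "distr M borel h = distr std_normal_distribution borel (\<lambda>x. sqrt s * x)"
proof (rule Levy_uniqueness)
  show "real_distribution (distr M borel h)" by (rule real_distribution_distr) measurable
  show "real_distribution (distr std_normal_distribution borel (\<lambda>x. sqrt s * x))"
    by (rule std_normal.real_distribution_distr) simp
  show "char (distr M borel h) = char (distr std_normal_distribution borel (\<lambda>x. sqrt s * x))"
  proof
    fix t
    have "char (distr M borel h) t = (\<integral>\<omega>. iexp (t * h \<omega>) \<partial>M)"
      unfolding char_def by (subst integral_distr) auto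
    also have "\<dots> = char (distr std_normal_distribution borel (\<lambda>x. sqrt s * x)) t"
      unfolding char std_normal_scaled_char using \<open>s \<ge> 0\<close> by (simp add: power_mult_distrib mult.commute)
    finally show "char (distr M borel h) t = char (distr std_normal_distribution borel (\<lambda>x. sqrt s * x)) t" .
  qed
qed

lemma gaussian_law_moments:
  assumes h[measurable]: "h \<in> borel_measurable M" and "s \<ge> 0"
    and law: "distr M borel h = distr std_normal_distribution borel (\<lambda>x. sqrt s * x)"
  shows "integrable M (\<lambda>\<omega>. (h \<omega>)\<^sup>2)" "(\<integral>\<omega>. (h \<omega>)\<^sup>2 \<partial>M) = s" "(\<integral>\<omega>. h \<omega> \<partial>M) = 0"
proof -
  have "integrable std_normal_distribution (\<lambda>x. (sqrt s * x)\<^sup>2)"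
    using std_normal_moments(1) by (simp add: power_mult_distrib)
  then have "integrable (distr std_normal_distribution borel (\<lambda>x. sqrt s * x)) (\<lambda>x. x\<^sup>2)"
    using integrable_distr_eq[of "\<lambda>x. sqrt s * x" std_normal_distribution borel "\<lambda>x. x\<^sup>2"] by simp
  then show "integrable M (\<lambda>\<omega>. (h \<omega>)\<^sup>2)"
    using integrable_distr_eq[OF h, of "\<lambda>x. x\<^sup>2"] unfolding law by simp
  have "(\<integral>\<omega>. (h \<omega>)\<^sup>2 \<partial>M) = (\<integral>x. x\<^sup>2 \<partial>distr M borel h)" by (rule integral_distr[symmetric]) measurable
  also have "\<dots> = (\<integral>x. (sqrt s * x)\<^sup>2 \<partial>std_normal_distribution)" unfolding law by (rule integral_distr) measurable
  also have "\<dots> = s" using std_normal_moments(2) \<open>s \<ge> 0\<close> by (simp add: power_mult_distrib)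
  finally show "(\<integral>\<omega>. (h \<omega>)\<^sup>2 \<partial>M) = s" .
  have "(\<integral>\<omega>. h \<omega> \<partial>M) = (\<integral>x. x \<partial>distr M borel h)" by (rule integral_distr[symmetric]) measurable
  also have "\<dots> = (\<integral>x. sqrt s * x \<partial>std_normal_distribution)" unfolding law by (rule integral_distr) measurable
  also have "\<dots> = 0" using std_normal_moments(3) by simp
  finally show "(\<integral>\<omega>. h \<omega> \<partial>M) = 0" .
qed

lemma gaussian_law_normal:
  assumes h[measurable]: "h \<in> borel_measurable M" and "s \<ge> 0"
    and law: "distr M borel h = distr std_normal_distribution borel (\<lambda>x. sqrt s * x)"
  shows "(AE \<omega> in M. h \<omega> = 0) \<or> (\<exists>\<sigma>>0. distributed M lborel h (\<lambda>t. ennreal (normal_density 0 \<sigma> t)))"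
proof (cases "s = 0")
  case True
  have "AE x in distr std_normal_distribution borel (\<lambda>x. sqrt s * x). x = 0"
    by (subst AE_distr_iff) (auto simp: True)
  then have "AE \<omega> in M. h \<omega> = 0" unfolding law[symmetric] by (subst (asm) AE_distr_iff) auto
  then show ?thesis ..
next
  case False
  then have s: "sqrt s > 0" using \<open>s \<ge> 0\<close> by simp
  have "distributed std_normal_distribution lborel (\<lambda>x. x) std_normal_density"
    unfolding distributed_def by (auto simp: distr_id2)
  from std_normal.normal_density_affine[OF this _ less_imp_neq[OF s, symmetric], of 0]
  have "distributed std_normal_distribution lborel (\<lambda>x. sqrt s * x) (\<lambda>x. ennreal (normal_density 0 (sqrt s) x))"
    using s by simp
  then have "distr std_normal_distribution lborel (\<lambda>x. sqrt s * x) = density lborel (\<lambda>x. ennreal (normal_density 0 (sqrt s) x))"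
    by (simp add: distributed_def)
  moreover have "distr M lborel h = distr M borel h" by (rule distr_cong) auto
  moreover have "distr std_normal_distribution lborel (\<lambda>x. sqrt s * x) = distr std_normal_distribution borel (\<lambda>x. sqrt s * x)"
    by (rule distr_cong) auto
  ultimately have "distr M lborel h = density lborel (\<lambda>x. ennreal (normal_density 0 (sqrt s) x))"
    by (simp only: law)
  then have "distributed M lborel h (\<lambda>t. ennreal (normal_density 0 (sqrt s) t))" unfolding distributed_def by auto
  with s show ?thesis by blast
qed

context clt_process
begin

theorem clt:
  assumes smooth: "two_smooth TYPE('b)" and basis: "\<exists>e :: nat \<Rightarrow> 'b. schauder_basis e"
  shows "\<exists>(N :: 'b measure) (G :: 'b \<Rightarrow> 'b).
    prob_space N \<and> centered_gaussian N G \<and>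
    (\<forall>x y :: 'b \<Rightarrow>\<^sub>L real.
       int_sums
         (\<lambda>k. covariance M (\<lambda>\<omega>. blinfun_apply x (X 0 \<omega>)) (\<lambda>\<omega>. blinfun_apply y (X k \<omega>)))
         (cov_operator N G x y)) \<and>
    converges_in_distribution M
      (\<lambda>n \<omega>. (1 / sqrt (real (Suc n))) *\<^sub>R partial_sum X (Suc n) \<omega>) N G"
proof -
  interpret covariance_form cov_form by (rule covariance_form_cov_form)
  obtain e :: "nat \<Rightarrow> 'b" where e: "schauder_basis e" using basis by blast
  obtain G where G[measurable]: "G \<in> borel_measurable white_noise"
    and weak: "\<And>(f :: 'b \<Rightarrow> real) c. continuous_on UNIV f \<Longrightarrow> (\<And>x. \<bar>f x\<bar> \<le> c) \<Longrightarrow>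
      (\<lambda>n. \<integral>\<omega>. f (Y n \<omega>) \<partial>M) \<longlonglongrightarrow> (\<integral>\<omega>. f (G \<omega>) \<partial>white_noise)"
    using weak_limit_exists[OF smooth e] by blast
  \<comment> \<open>The limit is realised on the Banach space itself, by its law together with the
    identity as random variable.\<close>
  define N where "N = distr white_noise borel G"
  have sN: "sets N = sets borel" by (simp add: N_def)
  interpret N: prob_space N unfolding N_def by (rule white_noise.prob_space_distr) measurable
  have meas_N: "h \<in> borel_measurable N \<longleftrightarrow> h \<in> borel_measurable borel" for h :: "'b \<Rightarrow> 'z::topological_space"
    by (simp add: N_def)
  have weak_N: "(\<lambda>n. \<integral>\<omega>. f (Y n \<omega>) \<partial>M) \<longlonglongrightarrow> (\<integral>x. f x \<partial>N)"
    if "continuous_on UNIV f" "\<And>x. \<bar>f x\<bar> \<le> c" for f :: "'b \<Rightarrow> real" and c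
    using weak[OF that] borel_measurable_continuous_onI[OF that(1)] unfolding N_def by (simp add: integral_distr)
  have v_m[measurable]: "blinfun_apply v \<in> borel_measurable N" for v :: "'b \<Rightarrow>\<^sub>L real" by (simp add: meas_N)
  have char: "(\<integral>x. iexp (v x) \<partial>N) = of_real (exp (- cov_form v v / 2))" for v :: "'b \<Rightarrow>\<^sub>L real"
  proof (rule LIMSEQ_unique[OF _ Y_char])
    have cos: "(\<lambda>n. \<integral>\<omega>. cos (v (Y n \<omega>)) \<partial>M) \<longlonglongrightarrow> (\<integral>x. cos (v x) \<partial>N)"
      by (rule weak_N[of _ 1]) (auto intro!: continuous_intros)
    have sin: "(\<lambda>n. \<integral>\<omega>. sin (v (Y n \<omega>)) \<partial>M) \<longlonglongrightarrow> (\<integral>x. sin (v x) \<partial>N)"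
      by (rule weak_N[of _ 1]) (auto intro!: continuous_intros)
    have "(\<lambda>\<omega>. v (Y n \<omega>)) \<in> borel_measurable M" for n by measurable
    then show "(\<lambda>n. \<integral>\<omega>. iexp (v (Y n \<omega>)) \<partial>M) \<longlonglongrightarrow> (\<integral>x. iexp (v x) \<partial>N)"
      unfolding N.integral_iexp[OF v_m] using tendsto_Complex[OF cos sin] by (simp add: integral_iexp)
  qed
  \<comment> \<open>Evaluating \<open>char\<close> at the multiples of \<open>v\<close> gives the
    characteristic function of a centered normal variable with variance \<open>cov_form v v\<close>,
    and uniqueness gives the law.\<close>
  have law: "distr N borel (blinfun_apply v) = distr std_normal_distribution borel (\<lambda>x. sqrt (cov_form v v) * x)" for v :: "'b \<Rightarrow>\<^sub>L real"
  proof (rule N.gaussian_law_if_char[OF v_m K_pos])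
    fix t
    have "(\<integral>x. iexp (t * v x) \<partial>N) = (\<integral>x. iexp ((t *\<^sub>R v) x) \<partial>N)" by (simp add: blinfun.scaleR_left)
    also have "\<dots> = of_real (exp (- t\<^sup>2 * cov_form v v / 2))"
      unfolding char K_scale K_scale_right by (simp add: power2_eq_square mult.assoc)
    finally show "(\<integral>x. iexp (t * v x) \<partial>N) = of_real (exp (- t\<^sup>2 * cov_form v v / 2))" .
  qed
  note mom = gaussian_law_moments[OF v_m K_pos law]
  have cov: "cov_operator N (\<lambda>x. x) x y = cov_form x y" for x y :: "'b \<Rightarrow>\<^sub>L real"
  proof -
    have "cov_operator N (\<lambda>x. x) x y = (\<integral>b. x b * y b \<partial>N)"
      by (simp add: cov_operator_def covariance_def mom(3))
    \<comment> \<open>Polarisation: the variances of \<open>x\<close>, \<open>y\<close> and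
      \<open>x + y\<close>, all known from one-dimensional laws, determine the covariance.\<close>
    also have "\<dots> = (\<integral>b. (((x + y) b)\<^sup>2 - (x b)\<^sup>2 - (y b)\<^sup>2) / 2 \<partial>N)"
      by (intro Bochner_Integration.integral_cong refl) (simp add: blinfun.add_left power2_eq_square algebra_simps)
    also have "\<dots> = (cov_form (x + y) (x + y) - cov_form x x - cov_form y y) / 2"
      using mom(1)[of "x + y"] mom(1)[of x] mom(1)[of y] mom(2)[of "x + y"] mom(2)[of x] mom(2)[of y] by simp
    also have "\<dots> = cov_form x y" by (simp add: K_add K_add_right K_sym[of y x])
    finally show ?thesis .
  qed
  show ?thesis
  proof (intro exI conjI allI)
    show "prob_space N" by (rule N.prob_space_axioms)
    show "centered_gaussian N (\<lambda>x. x)"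
      unfolding centered_gaussian_def
      using gaussian_law_normal[OF v_m K_pos law] by (simp add: meas_N)
    show "int_sums (\<lambda>k. covariance M (\<lambda>\<omega>. x (X 0 \<omega>)) (\<lambda>\<omega>. y (X k \<omega>))) (cov_operator N (\<lambda>x. x) x y)" for x y :: "'b \<Rightarrow>\<^sub>L real"
      unfolding cov by (rule int_sums_covariance)
    show "converges_in_distribution M (\<lambda>n \<omega>. (1 / sqrt (real (Suc n))) *\<^sub>R partial_sum X (Suc n) \<omega>) N (\<lambda>x. x)"
      unfolding converges_in_distribution_def Y_def[symmetric]
    proof (intro conjI allI impI)
      show "Y n \<in> borel_measurable M" for n by measurable
      show "(\<lambda>x. x) \<in> borel_measurable N" by (simp add: meas_N)
      fix f :: "'b \<Rightarrow> real" assume f: "continuous_on UNIV f \<and> bounded (range f)"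
      then obtain c where "\<And>x. \<bar>f x\<bar> \<le> c" unfolding bounded_iff by auto
      with f show "(\<lambda>n. \<integral>\<omega>. f (Y n \<omega>) \<partial>M) \<longlonglongrightarrow> (\<integral>x. f x \<partial>N)" by (intro weak_N) auto
    qed
  qed
qed

end

theorem theorem1p4:
  fixes M :: "'a measure"
    and T :: "'a \<Rightarrow> 'a"
    and X :: "int \<Rightarrow> 'a \<Rightarrow> 'b::{banach, second_countable_topology}"
    and F :: "int \<Rightarrow> 'a measure"
  assumes smooth: "two_smooth TYPE('b)"
    and basis: "\<exists>e :: nat \<Rightarrow> 'b. schauder_basis e"
    and prob: "prob_space M"
    and shift: "bimeasurable_mp M T"
    and stat_X: "stationary_process M T X"
    and stat_F: "stationary_filtration M T F"
    and adapted: "X 0 \<in> borel_measurable (F 0)"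
    and ergodic: "ergodic_process M X"
    and sq_int: "integrable M (\<lambda>\<omega>. (norm (X 0 \<omega>))\<^sup>2)"
    and centered: "\<And>i. (\<integral>\<omega>. X i \<omega> \<partial>M) = 0"
    and conv: "converges_in_L1 M
      (\<lambda>n \<omega>. norm (X 0 \<omega>) *\<^sub>R bochner_cond_exp M (F 0) (partial_sum X (Suc n)) \<omega>)"
  shows "\<exists>(N :: 'b measure) (G :: 'b \<Rightarrow> 'b).
    prob_space N \<and> centered_gaussian N G \<and>
    (\<forall>x y :: 'b \<Rightarrow>\<^sub>L real.
       int_sums
         (\<lambda>k. covariance M (\<lambda>\<omega>. blinfun_apply x (X 0 \<omega>)) (\<lambda>\<omega>. blinfun_apply y (X k \<omega>)))
         (cov_operator N G x y)) \<and>
    converges_in_distribution M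
      (\<lambda>n \<omega>. (1 / sqrt (real (Suc n))) *\<^sub>R partial_sum X (Suc n) \<omega>) N G"
proof -
  interpret prob_space M by (rule prob)
  interpret clt_process M T X F
    by unfold_locales (fact shift stat_X stat_F adapted sq_int conv centered ergodic)+
  show ?thesis by (rule clt[OF smooth basis])
qed

end
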